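(* Let $\vartheta$ be a primitive, geometrically compatible and recognisable random substitution, and for $n\in\mathbb N_0$ let $Q_n=Q(\mathbf P^{n,1})$ be the $n$-productivity geometric substitution matrix. Then there is a unique uniformity measure $\mu_{\mathrm u}$ if and only if the sequence $(Q_n)_{n\in\mathbb N_0}$ is ergodic in inverse time. In this case $(Y_\vartheta,T)$ is intrinsically ergodic and its unique measure of maximal entropy is the lift $\widetilde{\mu_{\mathrm u}}$.
   Context: Standing assumptions: $\mathcal A$ finite alphabet; $\vartheta$ a random substitution (letters to non-empty finite sets of non-empty words, extended to words by concatenation), $\vartheta^n$ its $n$-fold composition, $X_\vartheta$ its subshift with shift $S$. Primitive: some marginal (choice $\theta(a)\in\vartheta(a)$) of some $\vartheta^n$ has primitive substitution matrix $M_{ab}=|\theta(b)|_a$. Geometrically compatible: some $\lambda>1$ and positive row vector $L$ with $LM=\lambda L$ for the substitution matrix of every marginal; $L(w)=\sum_aL_a|w|_a$. Recognisable: every $y\in X_\vartheta$ has a unique decomposition $S^{-k}y=\cdots v_{-1}.v_0v_1\cdots$ with $x\in X_\vartheta$, $v_i\in\vartheta(x_i)$, $0\le k<|v_0|$ (then every $\vartheta^n$ is recognisable). $\mathcal M$: shift-invariant Borel probability measures on $X_\vartheta$. The geometric hull $(Y_\vartheta,T)$ is the suspension flow over $(X_\vartheta,S)$ with roof $x\mapsto L_{x_0}$; $\widetilde\mu=(\mu\times\mathrm{Leb})|_{Y_\vartheta}$ normalised is the lift of $\mu\in\mathcal M$. Uniformity measure: for $(y,s)\in Y_\vartheta$ and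 $n\in\mathbb N$, its level-$n$ recognisability data is the unique $(x,t,(v_i))$ with $v_i\in\vartheta^n(x_i)$, $0\le t<L(v_0)$, $(y,s)=T_t(\cdots v_{-1}.v_0v_1\cdots,0)$; for a permutation $\alpha$ of $\vartheta^n(a)$ the shuffle $f_\alpha(y,s)=T_t(\cdots w_{-1}.w_0\cdots,0)$ with $w_i=\alpha(v_i)$ if $x_i=a$, $w_i=v_i$ otherwise; $\mu\in\mathcal M$ is a uniformity measure if $\widetilde\mu\circ f_\alpha=\widetilde\mu$ for all such $n,a,\alpha$. The $n$-productivity distribution is the probability choice $\mathbf P^{n,1}_{v,a}=\#\vartheta^n(v)/\#\vartheta^{n+1}(a)$ for $v\in\vartheta(a)$. For a probability choice $\mathbf P$, $M(\mathbf P)_{ab}=\sum_{v\in\vartheta(b)}\mathbf P_{v,b}|v|_a$ and $Q(\mathbf P)_{ab}=L_aM(\mathbf P)_{ab}/(\lambda L_b)$. A sequence of column-stochastic matrices $(P_n)$ is ergodic in inverse time if for each $n$ there is a probability vector $\pi^n$ with $\lim_{k\to\infty}P_nP_{n+1}\cdots P_{n+k}=\pi^n\mathbf 1^T$. Intrinsically ergodic means there is a unique measure of maximal entropy. *)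

theory Defs
  imports "HOL-Probability.Probability"
begin

type_synonym 'a rsubst = "'a \<Rightarrow> 'a list set"

definition valid_rsubst :: "('a::finite) rsubst \<Rightarrow> bool" where
  "valid_rsubst \<sigma> \<longleftrightarrow> (\<forall>a. finite (\<sigma> a) \<and> \<sigma> a \<noteq> {} \<and> [] \<notin> \<sigma> a)"

definition rs_word :: "'a rsubst \<Rightarrow> 'a list \<Rightarrow> 'a list set" where
  "rs_word \<sigma> w = {concat vs | vs. list_all2 (\<lambda>v c. v \<in> \<sigma> c) vs w}"

fun rs_pow :: "'a rsubst \<Rightarrow> nat \<Rightarrow> 'a rsubst" where
  "rs_pow \<sigma> 0 a = {[a]}"
| "rs_pow \<sigma> (Suc n) a = \<Union> (rs_word \<sigma> ` rs_pow \<sigma> n a)"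

definition mmult :: "('a::finite \<Rightarrow> 'a \<Rightarrow> real) \<Rightarrow> ('a \<Rightarrow> 'a \<Rightarrow> real) \<Rightarrow> 'a \<Rightarrow> 'a \<Rightarrow> real" where
  "mmult A B i j = (\<Sum>k\<in>UNIV. A i k * B k j)"

fun mpow :: "('a::finite \<Rightarrow> 'a \<Rightarrow> real) \<Rightarrow> nat \<Rightarrow> 'a \<Rightarrow> 'a \<Rightarrow> real" where
  "mpow M 0 = (\<lambda>i j. if i = j then 1 else 0)"
| "mpow M (Suc k) = mmult M (mpow M k)"

definition primitive_matrix :: "('a::finite \<Rightarrow> 'a \<Rightarrow> real) \<Rightarrow> bool" where
  "primitive_matrix M \<longleftrightarrow> (\<forall>a b. 0 \<le> M a b) \<and> (\<exists>k. \<forall>a b. 0 < mpow M k a b)"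

definition subst_matrix :: "('a \<Rightarrow> 'a list) \<Rightarrow> 'a \<Rightarrow> 'a \<Rightarrow> real" where
  "subst_matrix \<theta> a b = real (count_list (\<theta> b) a)"

definition primitive_rs :: "('a::finite) rsubst \<Rightarrow> bool" where
  "primitive_rs \<sigma> \<longleftrightarrow> (\<exists>n \<theta>. 0 < n \<and> (\<forall>a. \<theta> a \<in> rs_pow \<sigma> n a) \<and> primitive_matrix (subst_matrix \<theta>))"

definition geom_compatible :: "('a::finite) rsubst \<Rightarrow> real \<Rightarrow> ('a \<Rightarrow> real) \<Rightarrow> bool" where
  "geom_compatible \<sigma> lam L \<longleftrightarrow> 1 < lam \<and> (\<forall>a. 0 < L a) \<and>
     (\<forall>\<theta>. (\<forall>a. \<theta> a \<in> \<sigma> a) \<longrightarrow> (\<forall>b. (\<Sum>a\<in>UNIV. L a * subst_matrix \<theta> a b) = lam * L b))"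

definition Lword :: "('a \<Rightarrow> real) \<Rightarrow> 'a list \<Rightarrow> real" where
  "Lword L w = (\<Sum>c\<leftarrow>w. L c)"

definition legal :: "'a rsubst \<Rightarrow> 'a list \<Rightarrow> bool" where
  "legal \<sigma> w \<longleftrightarrow> (\<exists>n a u v. u @ w @ v \<in> rs_pow \<sigma> n a)"

definition subshift :: "'a rsubst \<Rightarrow> (int \<Rightarrow> 'a) set" where
  "subshift \<sigma> = {x. \<forall>i j. i \<le> j \<longrightarrow> legal \<sigma> (map x [i..j])}"

definition shift :: "(int \<Rightarrow> 'a) \<Rightarrow> int \<Rightarrow> 'a" where
  "shift x = (\<lambda>i. x (i + 1))"

definition shiftn :: "int \<Rightarrow> (int \<Rightarrow> 'a) \<Rightarrow> int \<Rightarrow> 'a" where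
  "shiftn n x = (\<lambda>i. x (i + n))"

text \<open>Bi-infinite concatenation ... v_(-1) . v_0 v_1 ...: word v_i starts at position wpos v i.\<close>
definition wpos :: "(int \<Rightarrow> 'a list) \<Rightarrow> int \<Rightarrow> int" where
  "wpos v i = (if 0 \<le> i then (\<Sum>j\<in>{0..<i}. int (length (v j)))
               else - (\<Sum>j\<in>{i..<0}. int (length (v j))))"

definition biconcat :: "(int \<Rightarrow> 'a list) \<Rightarrow> int \<Rightarrow> 'a" where
  "biconcat v = (\<lambda>p. THE c. \<exists>i k. k < length (v i) \<and> p = wpos v i + int k \<and> c = v i ! k)"

definition recognisable :: "('a::finite) rsubst \<Rightarrow> bool" where
  "recognisable \<sigma> \<longleftrightarrow> (\<forall>y\<in>subshift \<sigma>. \<exists>!(x, k, v).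
      x \<in> subshift \<sigma> \<and> (\<forall>i. v i \<in> \<sigma> (x i)) \<and> 0 \<le> k \<and> k < int (length (v 0)) \<and>
      y = shiftn k (biconcat v))"

text \<open>Measurable structure on the full shift (product sigma-algebra = Borel sigma-algebra).\<close>
definition MX :: "(int \<Rightarrow> 'a) measure" where
  "MX = PiM UNIV (\<lambda>_. count_space UNIV)"

definition shift_inv_measure :: "('a::finite) rsubst \<Rightarrow> (int \<Rightarrow> 'a) measure \<Rightarrow> bool" where
  "shift_inv_measure \<sigma> \<mu> \<longleftrightarrow> sets \<mu> = sets MX \<and> prob_space \<mu> \<and> emeasure \<mu> (subshift \<sigma>) = 1 \<and>
     (\<forall>A\<in>sets MX. emeasure \<mu> (shift -` A) = emeasure \<mu> A)"

section \<open>Geometric geo_hull (suspension flow with roof x \<mapsto> L (x 0))\<close>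

definition MY :: "((int \<Rightarrow> 'a) \<times> real) measure" where
  "MY = MX \<Otimes>\<^sub>M lborel"

definition geo_hull :: "'a rsubst \<Rightarrow> ('a \<Rightarrow> real) \<Rightarrow> ((int \<Rightarrow> 'a) \<times> real) set" where
  "geo_hull \<sigma> L = {(x, s). x \<in> subshift \<sigma> \<and> 0 \<le> s \<and> s < L (x 0)}"

definition roofsum :: "('a \<Rightarrow> real) \<Rightarrow> (int \<Rightarrow> 'a) \<Rightarrow> int \<Rightarrow> real" where
  "roofsum L x n = (if 0 \<le> n then (\<Sum>i\<in>{0..<n}. L (x i)) else - (\<Sum>i\<in>{n..<0}. L (x i)))"

definition flow :: "('a \<Rightarrow> real) \<Rightarrow> real \<Rightarrow> (int \<Rightarrow> 'a) \<times> real \<Rightarrow> (int \<Rightarrow> 'a) \<times> real" where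
  "flow L t = (\<lambda>(x, s). let n = (THE n. roofsum L x n \<le> s + t \<and> s + t < roofsum L x (n + 1))
                        in (shiftn n x, s + t - roofsum L x n))"

definition lift :: "'a rsubst \<Rightarrow> ('a \<Rightarrow> real) \<Rightarrow> (int \<Rightarrow> 'a) measure \<Rightarrow> ((int \<Rightarrow> 'a) \<times> real) measure" where
  "lift \<sigma> L \<mu> = density (\<mu> \<Otimes>\<^sub>M lborel)
      (\<lambda>z. ennreal (indicator (geo_hull \<sigma> L) z / (\<integral>x. L (x 0) \<partial>\<mu>)))"

definition rec_data_pred :: "'a rsubst \<Rightarrow> ('a \<Rightarrow> real) \<Rightarrow> nat \<Rightarrow> (int \<Rightarrow> 'a) \<times> real
      \<Rightarrow> (int \<Rightarrow> 'a) \<Rightarrow> real \<Rightarrow> (int \<Rightarrow> 'a list) \<Rightarrow> bool" where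
  "rec_data_pred \<sigma> L n p x t v \<longleftrightarrow> x \<in> subshift \<sigma> \<and> (\<forall>i. v i \<in> rs_pow \<sigma> n (x i)) \<and>
      0 \<le> t \<and> t < Lword L (v 0) \<and> p = flow L t (biconcat v, 0)"

definition rec_data :: "'a rsubst \<Rightarrow> ('a \<Rightarrow> real) \<Rightarrow> nat \<Rightarrow> (int \<Rightarrow> 'a) \<times> real
      \<Rightarrow> (int \<Rightarrow> 'a) \<times> real \<times> (int \<Rightarrow> 'a list)" where
  "rec_data \<sigma> L n p = (THE (x, t, v). rec_data_pred \<sigma> L n p x t v)"

definition shuffle :: "'a rsubst \<Rightarrow> ('a \<Rightarrow> real) \<Rightarrow> nat \<Rightarrow> 'a \<Rightarrow> ('a list \<Rightarrow> 'a list)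
      \<Rightarrow> (int \<Rightarrow> 'a) \<times> real \<Rightarrow> (int \<Rightarrow> 'a) \<times> real" where
  "shuffle \<sigma> L n a \<alpha> p = (if p \<in> geo_hull \<sigma> L then
      (case rec_data \<sigma> L n p of (x, t, v) \<Rightarrow>
         flow L t (biconcat (\<lambda>i. if x i = a then \<alpha> (v i) else v i), 0))
    else p)"

definition uniformity_measure :: "('a::finite) rsubst \<Rightarrow> ('a \<Rightarrow> real) \<Rightarrow> (int \<Rightarrow> 'a) measure \<Rightarrow> bool" where
  "uniformity_measure \<sigma> L \<mu> \<longleftrightarrow> shift_inv_measure \<sigma> \<mu> \<and>
     (\<forall>n a \<alpha>. bij_betw \<alpha> (rs_pow \<sigma> n a) (rs_pow \<sigma> n a) \<longrightarrow>
        (\<forall>A\<in>sets MY. emeasure (lift \<sigma> L \<mu>) (shuffle \<sigma> L n a \<alpha> -` A \<inter> space MY)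
                      = emeasure (lift \<sigma> L \<mu>) A))"

definition productivity_dist :: "'a rsubst \<Rightarrow> nat \<Rightarrow> 'a list \<Rightarrow> 'a \<Rightarrow> real" where
  "productivity_dist \<sigma> n v a = real (card (rs_word (rs_pow \<sigma> n) v)) / real (card (rs_pow \<sigma> (Suc n) a))"

definition M_of :: "'a rsubst \<Rightarrow> ('a list \<Rightarrow> 'a \<Rightarrow> real) \<Rightarrow> 'a \<Rightarrow> 'a \<Rightarrow> real" where
  "M_of \<sigma> P a b = (\<Sum>v\<in>\<sigma> b. P v b * real (count_list v a))"

definition Q_of :: "'a rsubst \<Rightarrow> real \<Rightarrow> ('a \<Rightarrow> real) \<Rightarrow> ('a list \<Rightarrow> 'a \<Rightarrow> real) \<Rightarrow> 'a \<Rightarrow> 'a \<Rightarrow> real" where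
  "Q_of \<sigma> lam L P a b = L a * M_of \<sigma> P a b / (lam * L b)"

definition column_stochastic :: "('a::finite \<Rightarrow> 'a \<Rightarrow> real) \<Rightarrow> bool" where
  "column_stochastic M \<longleftrightarrow> (\<forall>a b. 0 \<le> M a b) \<and> (\<forall>b. (\<Sum>a\<in>UNIV. M a b) = 1)"

fun mprod :: "(nat \<Rightarrow> 'a::finite \<Rightarrow> 'a \<Rightarrow> real) \<Rightarrow> nat \<Rightarrow> nat \<Rightarrow> 'a \<Rightarrow> 'a \<Rightarrow> real" where
  "mprod P n 0 = P n"
| "mprod P n (Suc k) = mmult (mprod P n k) (P (n + Suc k))"

definition ergodic_inverse_time :: "(nat \<Rightarrow> 'a::finite \<Rightarrow> 'a \<Rightarrow> real) \<Rightarrow> bool" where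
  "ergodic_inverse_time P \<longleftrightarrow> (\<forall>n. column_stochastic (P n)) \<and>
     (\<forall>n. \<exists>\<pi>. (\<forall>a. 0 \<le> \<pi> a) \<and> (\<Sum>a\<in>UNIV. \<pi> a) = 1 \<and>
        (\<forall>a b. (\<lambda>k. mprod P n k a b) \<longlonglongrightarrow> \<pi> a))"

definition fin_partition :: "'b measure \<Rightarrow> 'b set set \<Rightarrow> bool" where
  "fin_partition m P \<longleftrightarrow> finite P \<and> P \<subseteq> sets m \<and> disjoint P \<and> \<Union>P = space m"

definition part_entropy :: "'b measure \<Rightarrow> 'b set set \<Rightarrow> real" where
  "part_entropy m P = - (\<Sum>A\<in>P. measure m A * ln (measure m A))"

definition refine :: "'b measure \<Rightarrow> ('b \<Rightarrow> 'b) \<Rightarrow> 'b set set \<Rightarrow> nat \<Rightarrow> 'b set set" where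
  "refine m f P n = {space m \<inter> (\<Inter>i\<in>{..<n}. (f ^^ i) -` c i) | c. \<forall>i<n. c i \<in> P}"

definition ks_entropy :: "'b measure \<Rightarrow> ('b \<Rightarrow> 'b) \<Rightarrow> ereal" where
  "ks_entropy m f = (SUP P\<in>{P. fin_partition m P}.
      liminf (\<lambda>n. ereal (part_entropy m (refine m f P (Suc n)) / real (Suc n))))"

definition flow_inv_measure :: "'a rsubst \<Rightarrow> ('a \<Rightarrow> real) \<Rightarrow> ((int \<Rightarrow> 'a) \<times> real) measure \<Rightarrow> bool" where
  "flow_inv_measure \<sigma> L \<nu> \<longleftrightarrow> sets \<nu> = sets MY \<and> prob_space \<nu> \<and> emeasure \<nu> (geo_hull \<sigma> L) = 1 \<and>
     (\<forall>t. \<forall>A\<in>sets MY. emeasure \<nu> (flow L t -` A \<inter> space \<nu>) = emeasure \<nu> A)"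

text \<open>Entropy of the flow = entropy of its time-one map.\<close>
definition max_entropy_measure :: "'a rsubst \<Rightarrow> ('a \<Rightarrow> real) \<Rightarrow> ((int \<Rightarrow> 'a) \<times> real) measure \<Rightarrow> bool" where
  "max_entropy_measure \<sigma> L \<nu> \<longleftrightarrow> flow_inv_measure \<sigma> L \<nu> \<and>
     (\<forall>\<nu>'. flow_inv_measure \<sigma> L \<nu>' \<longrightarrow> ks_entropy \<nu>' (flow L 1) \<le> ks_entropy \<nu> (flow L 1))"

definition intrinsically_ergodic :: "'a rsubst \<Rightarrow> ('a \<Rightarrow> real) \<Rightarrow> bool" where
  "intrinsically_ergodic \<sigma> L \<longleftrightarrow> (\<exists>!\<nu>. max_entropy_measure \<sigma> L \<nu>)"

end

(*
Recognisability of all powers of the substitution splits every point of the subshift into level-n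
cells: pairs (a, w) with w in the n-th image of a.  By Kac's formula, a shift-invariant measure is
determined by the densities of its cells, and every family of densities that is consistent under
subdivision comes from a measure.  A measure is a uniformity measure iff the density of (a, w) depends
on a only.  Consistency then says that the spatial frequencies p_n of the letters at level n satisfy
p_n = Q_n p_(n+1), and such a sequence of probability vectors is unique iff the products of the Q_n
converge to rank one matrices.

For the entropy, put q_n(a) = ln (number of level-n words of a) / (lam^n L_a).  By primitivity
max q_n - min q_n tends to 0, so all q_n(a) have the same limit h.  Coding an orbit by its level-N cells
and comparing with weights p that make the cells independent, Gibbs' inequality bounds the entropy of
every invariant measure by h minus the relative entropy of its cell densities with respect to uniform
weights; this gain does not change when p is extended to higher levels, and for a measure that is not
uniform it is positive at some level.  Conversely, Gibbs' inequality for the uniform distribution on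
the level-M words, cut into pieces of length n, bounds the entropy of a uniformity measure below by h.
Hence the measures of maximal entropy are exactly the lifts of the uniformity measures.
*)

theory Submission
  imports Defs "HOL-Library.Diagonal_Subsequence"
begin

section \<open>Two-sided sums and concatenations\<close>

text \<open>The unit steps of the time-one map do not in general fit the cell lengths lam^n L_a, and
  entropy is a supremum over all finite measurable partitions. Both bounds therefore use codes of
  orbit segments with explicit sub-probability weights. What the cells leave open (phase, letter
  below each unit step, comparisons with finitely many heights) takes polynomially many values and
  costs O(ln n); an arbitrary partition agrees, off a set of small measure, with labels that read
  finitely many letters and thresholds. Geometric compatibility makes all level-n words of a letter
  equally long. Hence shuffles keep cell boundaries and commute with the flow, and q_(m+n)(b) is at
  least the length-weighted mean of q_n over the letters of any level-m word of b; a word with all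
  letters contracts the oscillation, while max q_n grows by O(lam^-n) per level. Measures are
  handled through one estimate: level-n cuts have density O(lam^-n), so windows that meet a cut are
  negligible, summably in n. This gives both uniqueness and existence of a measure with given
  densities.\<close>

definition isum :: "(int \<Rightarrow> 'b::ab_group_add) \<Rightarrow> int \<Rightarrow> 'b" where
  "isum f n = (if 0 \<le> n then sum f {0..<n} else - sum f {n..<0})"

lemma isum_0 [simp]: "isum f 0 = 0"
  by (simp add: isum_def)

lemma isum_Suc: "isum f (n + 1) = isum f n + f n"
proof (cases "0 \<le> n")
  case True
  then have "{0..<n + 1} = insert n {0..<n}" by auto
  then show ?thesis using True by (simp add: isum_def add.commute)
next
  case False
  then have "{n..<0} = insert n {n + 1..<0}" by auto
  then show ?thesis using False by (cases "n = -1") (simp_all add: isum_def)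
qed

lemma isum_1 [simp]: "isum f 1 = f 0"
  using isum_Suc[of f 0] by simp

lemma isum_add: "isum f (m + n) = isum f m + isum (\<lambda>i. f (i + m)) n"
proof (induction n rule: int_induct[where k = 0])
  case base
  then show ?case by simp
next
  case (step1 i)
  then show ?case
    using isum_Suc[of f "m + i"] isum_Suc[of "\<lambda>i. f (i + m)" i] by (simp add: algebra_simps)
next
  case (step2 i)
  then show ?case
    using isum_Suc[of f "m + (i - 1)"] isum_Suc[of "\<lambda>i. f (i + m)" "i - 1"]
    by (simp add: algebra_simps)
qed

lemma isum_hom:
  assumes "\<And>a b. h (a + b) = h a + h b"
  shows "isum (\<lambda>i. h (f i)) n = h (isum f n)"
proof (induction n rule: int_induct[where k = 0])
  case base
  have "h (0 + 0) = h 0 + h 0" using assms by blast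
  then show ?case by simp
next
  case (step1 i)
  then show ?case using assms by (simp add: isum_Suc)
next
  case (step2 i)
  have "isum (\<lambda>i. h (f i)) (i - 1) + h (f (i - 1)) = h (isum f (i - 1)) + h (f (i - 1))"
    using step2 isum_Suc[of f "i - 1"] isum_Suc[of "\<lambda>i. h (f i)" "i - 1"] assms by simp
  then show ?case by simp
qed

lemma isum_lower:
  fixes f :: "int \<Rightarrow> real"
  assumes "\<And>i. e \<le> f i" and "m \<le> n"
  shows "isum f m + e * of_int (n - m) \<le> isum f n"
proof -
  have "isum f m + e * real k \<le> isum f (m + int k)" for k
  proof (induction k)
    case (Suc k)
    then show ?case
      using isum_Suc[of f "m + int k"] assms(1)[of "m + int k"] by (simp add: algebra_simps)
  qed simp
  from this[of "nat (n - m)"] show ?thesis using assms(2) by simp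
qed

lemma isum_strict_mono:
  fixes f :: "int \<Rightarrow> real"
  assumes "\<And>i. e \<le> f i" and "0 < e" and "m < n"
  shows "isum f m < isum f n"
proof -
  have "0 < e * of_int (n - m)" using assms by simp
  moreover have "isum f m + e * of_int (n - m) \<le> isum f n"
    by (rule isum_lower) (use assms in auto)
  ultimately show ?thesis by linarith
qed

lemma isum_le_iff:
  fixes f :: "int \<Rightarrow> real"
  assumes "\<And>i. e \<le> f i" and "0 < e"
  shows "isum f m \<le> isum f n \<longleftrightarrow> m \<le> n"
  using isum_strict_mono[of e f m n, OF assms] isum_strict_mono[of e f n m, OF assms]
  by (cases m n rule: linorder_cases) auto

lemma isum_less_iff:
  fixes f :: "int \<Rightarrow> real"
  assumes "\<And>i. e \<le> f i" and "0 < e"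
  shows "isum f m < isum f n \<longleftrightarrow> m < n"
  using isum_le_iff[of e f n m, OF assms] by linarith

text \<open>Terms of at least \<open>e > 0\<close> drive the sums to both infinities, so the
  half-open intervals between consecutive sums tile the line. Used with word lengths to find the
  word over a position, with \<open>L\<close> for the letter over a height, and with
  \<open>lam ^ n * L\<close> for the level-n cell.\<close>

lemma isum_bracket:
  fixes f :: "int \<Rightarrow> real"
  assumes e: "\<And>i. e \<le> f i" and "0 < e"
  shows "\<exists>n. isum f n \<le> t \<and> t < isum f (n + 1)"
proof -
  obtain K :: nat where K: "\<bar>t\<bar> < e * real K"
    using ex_less_of_nat_mult[of e "\<bar>t\<bar>"] \<open>0 < e\<close> by (auto simp: mult.commute)
  have low: "isum f (- int K) \<le> t"
    using isum_lower[of e f "- int K" 0, OF e] K by (simp add: algebra_simps)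
  have up: "t < isum f (- int K + int (2 * K))"
    using isum_lower[of e f 0 "int K", OF e] K by (simp add: algebra_simps)
  \<comment> \<open>The search starts at \<open>- K\<close>, where the sum is still at most
    \<open>t\<close>; the least index at which it exceeds \<open>t\<close> therefore has a
    predecessor.\<close>
  define k where "k = (LEAST k. t < isum f (- int K + int k))"
  have k: "t < isum f (- int K + int k)" unfolding k_def by (rule LeastI[where P = "\<lambda>k. t < isum f (- int K + int k)", OF up])
  then obtain j where j: "k = Suc j" using low by (cases k) auto
  have "\<not> t < isum f (- int K + int j)"
    using not_less_Least[of j "\<lambda>k. t < isum f (- int K + int k)"] j k_def by simp
  then show ?thesis using k j by (intro exI[of _ "- int K + int j"]) (simp add: algebra_simps)
qed

lemma wpos_isum: "wpos v i = isum (\<lambda>j. int (length (v j))) i"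
  by (simp add: wpos_def isum_def)

lemma roofsum_isum: "roofsum L x n = isum (\<lambda>i. L (x i)) n"
  by (simp add: roofsum_def isum_def)

lemma wpos_0 [simp]: "wpos v 0 = 0" and wpos_1 [simp]: "wpos v 1 = int (length (v 0))"
  by (simp_all add: wpos_isum)

lemma wpos_Suc: "wpos v (i + 1) = wpos v i + int (length (v i))"
  by (simp add: wpos_isum isum_Suc)

lemma wpos_shiftn: "wpos (shiftn j v) i = wpos v (i + j) - wpos v j"
  using isum_add[of "\<lambda>j. int (length (v j))" j i] by (simp add: wpos_isum shiftn_def add.commute)

lemma of_int_wpos: "real_of_int (wpos v i) = isum (\<lambda>j. real (length (v j))) i"
  using isum_hom[of real_of_int "\<lambda>j. int (length (v j))" i] by (simp add: wpos_isum)

section \<open>Windows and shifts of two-sided sequences\<close>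

definition win :: "(int \<Rightarrow> 'b) \<Rightarrow> int \<Rightarrow> nat \<Rightarrow> 'b list" where
  "win y p n = map (\<lambda>i. y (p + int i)) [0..<n]"

lemma length_win [simp]: "length (win y p n) = n"
  by (simp add: win_def)

lemma nth_win [simp]: "i < n \<Longrightarrow> win y p n ! i = y (p + int i)"
  by (simp add: win_def)

lemma win_0 [simp]: "win y p 0 = []"
  by (simp add: win_def)

lemma win_Suc: "win y p (Suc n) = win y p n @ [y (p + int n)]"
  by (simp add: win_def)

lemma win_add: "win y p (m + n) = win y p m @ win y (p + int m) n"
  by (rule nth_equalityI) (auto simp: nth_append)

lemma win_shiftn: "win (shiftn j y) p n = win y (p + j) n"
  by (simp add: win_def shiftn_def algebra_simps)

lemma win_eq_iff: "win y p n = win y' p' n \<longleftrightarrow> (\<forall>i<n. y (p + int i) = y' (p' + int i))"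
  by (auto simp: list_eq_iff_nth_eq)

lemma take_win: "m \<le> n \<Longrightarrow> take m (win y p n) = win y p m"
  by (rule nth_equalityI) auto

lemma shiftn_shiftn [simp]: "shiftn i (shiftn j y) = shiftn (i + j) y"
  by (simp add: shiftn_def algebra_simps fun_eq_iff)

lemma shiftn_0 [simp]: "shiftn 0 y = y"
  by (simp add: shiftn_def)

lemma shift_shiftn: "shift = shiftn 1"
  by (simp add: shiftn_def shift_def fun_eq_iff)

lemma shiftn_apply: "shiftn j y i = y (i + j)"
  by (simp add: shiftn_def)

section \<open>Concatenation of non-empty words\<close>

abbreviation NE :: "(int \<Rightarrow> 'b list) \<Rightarrow> bool" where
  "NE v \<equiv> \<forall>i. v i \<noteq> []"

lemma NE_len: "NE v \<Longrightarrow> 1 \<le> real (length (v i))"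
  by (simp add: Suc_leI)

lemma wpos_less_iff: "NE v \<Longrightarrow> wpos v i < wpos v j \<longleftrightarrow> i < j"
  using isum_less_iff[of 1 "\<lambda>j. real (length (v j))" i j] NE_len[of v]
  by (simp flip: of_int_wpos)

lemma wpos_le_iff: "NE v \<Longrightarrow> wpos v i \<le> wpos v j \<longleftrightarrow> i \<le> j"
  by (metis linorder_not_less wpos_less_iff)

lemma wpos_bracket: "NE v \<Longrightarrow> \<exists>i. wpos v i \<le> p \<and> p < wpos v (i + 1)"
  using isum_bracket[of 1 "\<lambda>j. real (length (v j))" "of_int p"] NE_len[of v]
  by (simp flip: of_int_wpos)

lemma wpos_bracket_unique:
  "\<lbrakk>NE v; wpos v i \<le> p; p < wpos v (i + 1); wpos v j \<le> p; p < wpos v (j + 1)\<rbrakk> \<Longrightarrow> i = j"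
  by (smt (verit) wpos_less_iff)

lemma wpos_ge: "NE v \<Longrightarrow> 0 \<le> i \<Longrightarrow> i \<le> wpos v i"
  using isum_lower[of 1 "\<lambda>j. real (length (v j))" 0 i] NE_len[of v]
  by (simp flip: of_int_wpos)

lemma wpos_le_neg: "NE v \<Longrightarrow> i \<le> 0 \<Longrightarrow> wpos v i \<le> i"
  using isum_lower[of 1 "\<lambda>j. real (length (v j))" i 0] NE_len[of v]
  by (simp flip: of_int_wpos)

text \<open>Non-empty words put every position into exactly one word, so the \<open>THE\<close> in
  \<open>biconcat\<close> has a unique witness.\<close>

lemma biconcat_at:
  assumes "NE v" "k < length (v i)"
  shows "biconcat v (wpos v i + int k) = v i ! k"
proof -
  have u: "i' = i \<and> k' = k" if "k' < length (v i')" "wpos v i + int k = wpos v i' + int k'" for i' k'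
  proof -
    have "i' = i"
      by (rule wpos_bracket_unique[OF assms(1), of i' "wpos v i + int k" i])
        (use that assms(2) wpos_Suc[of v i] wpos_Suc[of v i'] in linarith)+
    then show ?thesis using that by simp
  qed
  show ?thesis
    unfolding biconcat_def
  proof (rule the_equality)
    show "\<exists>i' k'. k' < length (v i') \<and> wpos v i + int k = wpos v i' + int k' \<and> v i ! k = v i' ! k'"
      using assms(2) by blast
  qed (use u in blast)
qed

lemma biconcat_eqI:
  assumes "NE v" "\<And>i k. k < length (v i) \<Longrightarrow> y (wpos v i + int k) = v i ! k"
  shows "biconcat v = y"
proof
  fix p
  obtain i where i: "wpos v i \<le> p" "p < wpos v (i + 1)" using wpos_bracket[OF assms(1)] by blast
  define k where "k = nat (p - wpos v i)"
  have "k < length (v i)" "p = wpos v i + int k" using i wpos_Suc[of v i] by (auto simp: k_def)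
  then show "biconcat v p = y p" using assms biconcat_at by metis
qed

lemma biconcat_shiftn:
  assumes "NE v"
  shows "biconcat (shiftn j v) = shiftn (wpos v j) (biconcat v)"
  by (rule biconcat_eqI) (use assms biconcat_at[OF assms] in \<open>auto simp: wpos_shiftn shiftn_apply algebra_simps\<close>)

lemma win_biconcat:
  assumes "NE v"
  shows "win (biconcat v) (wpos v i) (length (concat (win v i m))) = concat (win v i m)"
    and "wpos v (i + int m) = wpos v i + int (length (concat (win v i m)))"
proof (induction m)
  case (Suc m)
  {
    case 1
    have "win (biconcat v) (wpos v (i + int m)) (length (v (i + int m))) = v (i + int m)"
      by (rule nth_equalityI) (use biconcat_at[OF assms] in auto)
    then show ?case using Suc by (simp add: win_Suc win_add)
  next
    case 2
    then show ?case using Suc wpos_Suc[of v "i + int m"] by (simp add: win_Suc algebra_simps)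
  }
qed auto

lemma win_biconcat_one:
  assumes "NE v"
  shows "win (biconcat v) (wpos v i) (length (v i)) = v i"
  using win_biconcat(1)[OF assms, of i 1] by (simp add: win_def)

text \<open>Concatenation happens twice here: \<open>biconcat vs\<close> is a sequence of fine
  words, whose own concatenation is a sequence of letters. The inner \<open>wpos\<close> counts fine
  words, the outer ones count letters.\<close>

lemma wpos_concat:
  assumes "NE vs" "\<And>i w. w \<in> set (vs i) \<Longrightarrow> w \<noteq> []"
  shows "wpos (biconcat vs) (wpos vs i) = wpos (\<lambda>i. concat (vs i)) i"
proof -
  have step: "wpos (biconcat vs) (wpos vs (i + 1)) = wpos (biconcat vs) (wpos vs i) + int (length (concat (vs i)))" for i
  proof -
    have ne: "NE (biconcat vs)"
    proof
      fix p
      obtain i where i: "wpos vs i \<le> p" "p < wpos vs (i + 1)" using wpos_bracket[OF assms(1)] by blast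
      define k where "k = nat (p - wpos vs i)"
      have "k < length (vs i)" "p = wpos vs i + int k" using i wpos_Suc[of vs i] by (auto simp: k_def)
      then have "biconcat vs p \<in> set (vs i)" using biconcat_at[OF assms(1)] by simp
      then show "biconcat vs p \<noteq> []" using assms(2) by blast
    qed
    show ?thesis
      using win_biconcat(2)[OF ne, of "wpos vs i" "length (vs i)"] win_biconcat_one[OF assms(1), of i]
      by (simp add: wpos_Suc)
  qed
  show ?thesis
  proof (induction i rule: int_induct[where k = 0])
    case (step1 i)
    then show ?case using step[of i] wpos_Suc[of "\<lambda>i. concat (vs i)" i] by simp
  next
    case (step2 i)
    then show ?case using step[of "i - 1"] wpos_Suc[of "\<lambda>i. concat (vs i)" "i - 1"] by simp
  qed simp
qed

lemma biconcat_all: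
  assumes "NE vs" "\<And>i w. w \<in> set (vs i) \<Longrightarrow> P w"
  shows "P (biconcat vs p)"
proof -
  obtain i where i: "wpos vs i \<le> p" "p < wpos vs (i + 1)" using wpos_bracket[OF assms(1)] by blast
  define k where "k = nat (p - wpos vs i)"
  have "k < length (vs i)" "p = wpos vs i + int k" using i wpos_Suc[of vs i] by (auto simp: k_def)
  then have "biconcat vs p \<in> set (vs i)" using biconcat_at[OF assms(1)] by simp
  then show ?thesis using assms(2) by blast
qed

text \<open>Associativity of the two-level concatenation; it lets decompositions of one point at two
  levels be compared.\<close>

lemma biconcat_concat:
  assumes "NE vs" "\<And>i w. w \<in> set (vs i) \<Longrightarrow> w \<noteq> []"
  shows "biconcat (\<lambda>i. concat (vs i)) = biconcat (biconcat vs)"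
proof (rule biconcat_eqI)
  show "NE (\<lambda>i. concat (vs i))" using assms by (metis concat_eq_Nil_conv list.set_sel(1))
next
  fix i k assume k: "k < length (concat (vs i))"
  have ne: "NE (biconcat vs)" using biconcat_all[of vs "\<lambda>w. w \<noteq> []"] assms by blast
  have "win (biconcat (biconcat vs)) (wpos (biconcat vs) (wpos vs i)) (length (concat (vs i))) = concat (vs i)"
    using win_biconcat(1)[OF ne, of "wpos vs i" "length (vs i)"] win_biconcat_one[OF assms(1), of i] by simp
  then show "biconcat (biconcat vs) (wpos (\<lambda>i. concat (vs i)) i + int k) = concat (vs i) ! k"
    using k wpos_concat[of vs i] assms by (metis nth_win)
qed

lemma biconcat_all2:
  assumes "NE vs" "\<And>i. list_all2 P (vs i) (us i)"
  shows "P (biconcat vs p) (biconcat us p)" and "wpos us i = wpos vs i"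
proof -
  have len: "length (us i) = length (vs i)" for i using assms(2) list_all2_lengthD by metis
  then show w: "wpos us i = wpos vs i" for i by (simp add: wpos_isum)
  have ne: "NE us" using assms(1) len by (metis length_0_conv)
  obtain i where i: "wpos vs i \<le> p" "p < wpos vs (i + 1)" using wpos_bracket[OF assms(1)] by blast
  define k where "k = nat (p - wpos vs i)"
  have k: "k < length (vs i)" "p = wpos vs i + int k" using i wpos_Suc[of vs i] by (auto simp: k_def)
  have "biconcat vs p = vs i ! k" "biconcat us p = us i ! k"
    using biconcat_at[OF assms(1)] biconcat_at[OF ne] k len w by (metis)+
  then show "P (biconcat vs p) (biconcat us p)" using assms(2)[of i] k by (simp add: list_all2_nthD)
qed

text \<open>Equal lengths force equal cutting points, and the words are then read off from the
  common sequence.\<close>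

lemma biconcat_inj_lengths:
  assumes "NE vs" "\<And>i. length (vs i) = length (us i)" "biconcat vs = biconcat us"
  shows "vs = us"
proof
  fix i
  have "NE us" using assms(1,2) by (metis length_0_conv)
  moreover have "wpos vs i = wpos us i" using assms(2) by (simp add: wpos_isum)
  ultimately show "vs i = us i"
    using win_biconcat_one[of vs i] win_biconcat_one[of us i] assms by metis
qed

section \<open>Random substitutions and recognisability of their powers\<close>

lemma rs_word_iff: "w \<in> rs_word \<tau> u \<longleftrightarrow> (\<exists>vs. list_all2 (\<lambda>v c. v \<in> \<tau> c) vs u \<and> w = concat vs)"
  by (auto simp: rs_word_def)

lemma rs_word_Nil [simp]: "rs_word \<tau> [] = {[]}"
  by (auto simp: rs_word_def)

lemma rs_word_Cons: "rs_word \<tau> (c # u) = (\<lambda>(v, w). v @ w) ` (\<tau> c \<times> rs_word \<tau> u)"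
proof (intro equalityI subsetI)
  fix x assume "x \<in> rs_word \<tau> (c # u)"
  then obtain vs where vs: "list_all2 (\<lambda>v c. v \<in> \<tau> c) vs (c # u)" "x = concat vs"
    by (auto simp: rs_word_iff)
  then obtain v vs' where "vs = v # vs'" "v \<in> \<tau> c" "list_all2 (\<lambda>v c. v \<in> \<tau> c) vs' u"
    by (auto simp: list_all2_Cons2)
  then show "x \<in> (\<lambda>(v, w). v @ w) ` (\<tau> c \<times> rs_word \<tau> u)"
    using vs by (auto simp: rs_word_iff intro!: image_eqI[of _ _ "(v, concat vs')"])
next
  fix x assume "x \<in> (\<lambda>(v, w). v @ w) ` (\<tau> c \<times> rs_word \<tau> u)"
  then obtain v vs' where "v \<in> \<tau> c" "list_all2 (\<lambda>v c. v \<in> \<tau> c) vs' u" "x = v @ concat vs'"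
    by (auto simp: rs_word_iff)
  then show "x \<in> rs_word \<tau> (c # u)"
    by (auto simp: rs_word_iff intro!: exI[of _ "v # vs'"])
qed

lemma rs_word_Cons_iff: "x \<in> rs_word \<tau> (c # u) \<longleftrightarrow> (\<exists>v\<in>\<tau> c. \<exists>w\<in>rs_word \<tau> u. x = v @ w)"
  by (auto simp: rs_word_Cons)

lemma rs_word_append_iff:
  "x \<in> rs_word \<tau> (u @ u') \<longleftrightarrow> (\<exists>v\<in>rs_word \<tau> u. \<exists>w\<in>rs_word \<tau> u'. x = v @ w)"
proof (induction u arbitrary: x)
  case (Cons c u)
  have "x \<in> rs_word \<tau> ((c # u) @ u') \<longleftrightarrow> (\<exists>v\<in>\<tau> c. \<exists>w\<in>rs_word \<tau> u. \<exists>w'\<in>rs_word \<tau> u'. x = v @ w @ w')"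
  proof safe
    assume "x \<in> rs_word \<tau> ((c # u) @ u')"
    then obtain v z where "v \<in> \<tau> c" "z \<in> rs_word \<tau> (u @ u')" "x = v @ z"
      by (auto simp: rs_word_Cons_iff)
    moreover from this(2) obtain w w' where "w \<in> rs_word \<tau> u" "w' \<in> rs_word \<tau> u'" "z = w @ w'"
      using Cons.IH by blast
    ultimately show "\<exists>v\<in>\<tau> c. \<exists>w\<in>rs_word \<tau> u. \<exists>w'\<in>rs_word \<tau> u'. x = v @ w @ w'"
      by (intro bexI[of _ v] bexI[of _ w] bexI[of _ w']) auto
  next
    fix v w w' assume a: "v \<in> \<tau> c" "w \<in> rs_word \<tau> u" "w' \<in> rs_word \<tau> u'"
    then have "w @ w' \<in> rs_word \<tau> (u @ u')" using Cons.IH by blast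
    then show "v @ w @ w' \<in> rs_word \<tau> ((c # u) @ u')"
      using a(1) by (auto simp: rs_word_Cons)
  qed
  also have "\<dots> \<longleftrightarrow> (\<exists>v\<in>rs_word \<tau> (c # u). \<exists>w\<in>rs_word \<tau> u'. x = v @ w)"
  proof safe
    fix v w w' assume a: "v \<in> \<tau> c" "w \<in> rs_word \<tau> u" "w' \<in> rs_word \<tau> u'"
    then have "v @ w \<in> rs_word \<tau> (c # u)" by (auto simp: rs_word_Cons)
    then show "\<exists>va\<in>rs_word \<tau> (c # u). \<exists>wa\<in>rs_word \<tau> u'. v @ w @ w' = va @ wa"
      using a(3) by (intro bexI[of _ "v @ w"] bexI[of _ w']) auto
  next
    fix v w' assume a: "v \<in> rs_word \<tau> (c # u)" "w' \<in> rs_word \<tau> u'"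
    then obtain v' w where "v' \<in> \<tau> c" "w \<in> rs_word \<tau> u" "v = v' @ w" by (auto simp: rs_word_Cons)
    then show "\<exists>va\<in>\<tau> c. \<exists>w\<in>rs_word \<tau> u. \<exists>w'a\<in>rs_word \<tau> u'. v @ w' = va @ w @ w'a"
      using a(2) by (intro bexI[of _ v'] bexI[of _ w] bexI[of _ w']) auto
  qed
  finally show ?case .
qed simp

lemma rs_word_append: "rs_word \<tau> (u @ u') = (\<lambda>(v, w). v @ w) ` (rs_word \<tau> u \<times> rs_word \<tau> u')"
  unfolding set_eq_iff by (simp add: rs_word_append_iff image_iff split_beta)

lemma rs_word_appendI: "v \<in> rs_word \<tau> u \<Longrightarrow> w \<in> rs_word \<tau> u' \<Longrightarrow> v @ w \<in> rs_word \<tau> (u @ u')"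
  unfolding rs_word_append_iff by blast

lemma rs_word_comp: "\<Union> (rs_word \<tau> ` rs_word \<rho> u) = rs_word (\<lambda>a. \<Union> (rs_word \<tau> ` \<rho> a)) u"
proof (induction u)
  case (Cons c u)
  have "\<Union> (rs_word \<tau> ` rs_word \<rho> (c # u)) = (\<Union>p\<in>\<rho> c \<times> rs_word \<rho> u. rs_word \<tau> (fst p @ snd p))"
    by (auto simp: rs_word_Cons image_image split_beta)
  also have "\<dots> = (\<lambda>(v, w). v @ w) ` (\<Union> (rs_word \<tau> ` \<rho> c) \<times> \<Union> (rs_word \<tau> ` rs_word \<rho> u))"
    by (fastforce simp: rs_word_append)
  finally show ?case using Cons by (simp add: rs_word_Cons)
qed simp

text \<open>The recursion of \<open>rs_pow\<close> inflates by \<sigma> last, so induction on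
  \<open>n\<close> peels off that step and \<open>rs_word_comp\<close> regroups. Every multi-level
  argument splits a word here: first a level-m word, then a level-n word for each of its
  letters.\<close>

lemma rs_pow_add: "rs_pow \<sigma> (m + n) a = \<Union> (rs_word (rs_pow \<sigma> n) ` rs_pow \<sigma> m a)"
proof (induction n)
  case 0
  have "rs_word (\<lambda>a. {[a]}) u = {u}" for u :: "'a list"
    by (induction u) (auto simp: rs_word_Cons)
  moreover have "rs_pow \<sigma> 0 = (\<lambda>a. {[a]})" by (rule ext) simp
  ultimately show ?case by simp
next
  case (Suc n)
  have "rs_pow \<sigma> (m + Suc n) a = (\<Union>u\<in>rs_pow \<sigma> m a. \<Union> (rs_word \<sigma> ` rs_word (rs_pow \<sigma> n) u))"
    using Suc by simp
  also have "\<dots> = (\<Union>u\<in>rs_pow \<sigma> m a. rs_word (rs_pow \<sigma> (Suc n)) u)"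
  proof -
    have "rs_pow \<sigma> (Suc n) = (\<lambda>a. \<Union> (rs_word \<sigma> ` rs_pow \<sigma> n a))" by (rule ext) simp
    then show ?thesis using rs_word_comp[of \<sigma> "rs_pow \<sigma> n"] by simp
  qed
  finally show ?case .
qed

lemma rs_pow_1 [simp]: "rs_pow \<sigma> (Suc 0) = \<sigma>"
  by (rule ext) (force simp: rs_word_Cons)

lemma Lword_Nil [simp]: "Lword L [] = 0"
  and Lword_Cons [simp]: "Lword L (c # w) = L c + Lword L w"
  and Lword_append [simp]: "Lword L (v @ w) = Lword L v + Lword L w"
  by (simp_all add: Lword_def)

lemma Lword_count:
  fixes L :: "'a::finite \<Rightarrow> real"
  shows "(\<Sum>a\<in>UNIV. L a * real (count_list w a)) = Lword L w"
proof (induction w)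
  case (Cons c w)
  have "(\<Sum>a\<in>UNIV. L a * real (count_list (c # w) a))
      = (\<Sum>a\<in>UNIV. (if a = c then L a else 0) + L a * real (count_list w a))"
    by (rule sum.cong) (auto simp: algebra_simps)
  then show ?case using Cons by (simp add: sum.distrib)
qed simp

section \<open>Legal words, the subshift and decompositions at a given level\<close>

lemma legal_sub: "legal \<sigma> (u @ w @ v) \<Longrightarrow> legal \<sigma> w"
  unfolding legal_def by (metis append.assoc)

lemma map_upto_win: "i \<le> j \<Longrightarrow> map x [i..j] = win x i (nat (j - i + 1))"
  by (rule nth_equalityI) auto

lemma subshift_iff: "x \<in> subshift \<sigma> \<longleftrightarrow> (\<forall>p n. legal \<sigma> (win x p n))"
proof
  assume x: "x \<in> subshift \<sigma>"
  show "\<forall>p n. legal \<sigma> (win x p n)"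
  proof (intro allI)
    fix p n
    show "legal \<sigma> (win x p n)"
    proof (cases n)
      case 0
      then show ?thesis unfolding legal_def
        by (intro exI[of _ 0] exI[of _ undefined] exI[of _ "[]"] exI[of _ "[undefined]"]) simp
    next
      case (Suc m)
      have "legal \<sigma> (map x [p..p + int m])" using x by (simp add: subshift_def)
      then show ?thesis using Suc by (simp add: map_upto_win nat_add_distrib)
    qed
  qed
qed (simp add: subshift_def map_upto_win)

lemma subshift_shiftn: "x \<in> subshift \<sigma> \<Longrightarrow> shiftn j x \<in> subshift \<sigma>"
  by (simp add: subshift_iff win_shiftn)

lemma subshift_shiftn_iff [simp]: "shiftn j x \<in> subshift \<sigma> \<longleftrightarrow> x \<in> subshift \<sigma>"
  using subshift_shiftn[of "shiftn j x" \<sigma> "- j"] subshift_shiftn by auto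

lemma list_all2_win:
  "(\<And>i. P (v i) (x i)) \<Longrightarrow> list_all2 P (win v p n) (win x p n)"
  by (simp add: list_all2_conv_all_nth)

text \<open>The letter of y at 0 is the letter number k of the word v 0, and y is the concatenation of the v i.\<close>
definition level_data :: "'a rsubst \<Rightarrow> nat \<Rightarrow> (int \<Rightarrow> 'a) \<Rightarrow> (int \<Rightarrow> 'a) \<Rightarrow> int \<Rightarrow> (int \<Rightarrow> 'a list) \<Rightarrow> bool" where
  "level_data \<sigma> n y x k v \<longleftrightarrow> x \<in> subshift \<sigma> \<and> (\<forall>i. v i \<in> rs_pow \<sigma> n (x i)) \<and> 0 \<le> k \<and>
     k < int (length (v 0)) \<and> y = shiftn k (biconcat v)"

locale recog_subst =
  fixes \<sigma> :: "('a::finite) rsubst" and lam :: real and L :: "'a \<Rightarrow> real"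
  assumes valid: "valid_rsubst \<sigma>" and prim: "primitive_rs \<sigma>"
    and geom: "geom_compatible \<sigma> lam L" and recog: "recognisable \<sigma>"
begin

abbreviation X where "X \<equiv> subshift \<sigma>"
abbreviation pw where "pw \<equiv> rs_pow \<sigma>"
abbreviation ldata where "ldata \<equiv> level_data \<sigma>"
abbreviation Lmin where "Lmin \<equiv> Min (range L)"
abbreviation Lmax where "Lmax \<equiv> Max (range L)"
abbreviation lifted where "lifted \<equiv> lift \<sigma> L"
abbreviation HY where "HY \<equiv> geo_hull \<sigma> L"

lemma lam_gt_1: "1 < lam" and L_pos [simp]: "0 < L a"
  using geom by (auto simp: geom_compatible_def)

lemma L_nonneg [simp]: "0 \<le> L a"
  using L_pos[of a] by linarith

lemma finite_rs_word: "(\<And>a. finite (\<tau> a)) \<Longrightarrow> finite (rs_word \<tau> u)"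
  by (induction u) (auto simp: rs_word_Cons)

lemma pw_valid: "finite (pw n a)" "pw n a \<noteq> {}" "[] \<notin> pw n a"
proof (induction n arbitrary: a)
  case (Suc n)
  have s: "finite (\<sigma> a)" "\<sigma> a \<noteq> {}" "[] \<notin> \<sigma> a" for a using valid by (auto simp: valid_rsubst_def)
  have ne: "rs_word \<sigma> u \<noteq> {}" for u by (induction u) (auto simp: rs_word_Cons s)
  have nn: "u \<noteq> [] \<Longrightarrow> [] \<notin> rs_word \<sigma> u" for u using s(3) by (cases u) (auto simp: rs_word_Cons)
  { case 1 show ?case using Suc finite_rs_word[of \<sigma>, OF s(1)] by auto }
  { case 2 show ?case using Suc(2)[of a] ne by auto }
  { case 3 show ?case using Suc(3)[of a] nn by (metis UN_E rs_pow.simps(2)) }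
qed auto

text \<open>Geometric compatibility speaks of marginals; a single word \<open>v\<close> of
  \<open>b\<close> is put into one by choosing arbitrary words for the other letters.\<close>

lemma Lword_one: "v \<in> \<sigma> b \<Longrightarrow> Lword L v = lam * L b"
proof -
  assume v: "v \<in> \<sigma> b"
  define \<theta> where "\<theta> a = (if a = b then v else (SOME w. w \<in> \<sigma> a))" for a
  have "\<sigma> a \<noteq> {}" for a using valid by (auto simp: valid_rsubst_def)
  then have "\<forall>a. \<theta> a \<in> \<sigma> a" using v by (auto simp: \<theta>_def some_in_eq)
  then have "(\<Sum>a\<in>UNIV. L a * subst_matrix \<theta> a b) = lam * L b"
    using geom by (simp add: geom_compatible_def)
  then show ?thesis using Lword_count[of L v] by (simp add: subst_matrix_def \<theta>_def)
qed

lemma Lword_rs_word: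
  assumes "\<And>c v. v \<in> \<tau> c \<Longrightarrow> Lword L v = r * L c" "w \<in> rs_word \<tau> u"
  shows "Lword L w = r * Lword L u"
  using assms(2) by (induction u arbitrary: w) (auto simp: rs_word_Cons assms(1) algebra_simps)

lemma Lword_pw: "w \<in> pw n a \<Longrightarrow> Lword L w = lam ^ n * L a"
proof (induction n arbitrary: w)
  case (Suc n)
  then obtain u where u: "u \<in> pw n a" "w \<in> rs_word \<sigma> u" by auto
  show ?case using Lword_rs_word[OF Lword_one u(2)] Suc.IH[OF u(1)] by simp
qed simp

text \<open>A window of the concatenation lies in the image of a window of \<open>x\<close>. The
  latter is legal inside some longer word, and inflating the two remaining pieces of that word as
  well shows the image to be legal.\<close>

lemma inflate_in_X:
  assumes "x \<in> X" "\<And>i. v i \<in> pw n (x i)"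
  shows "biconcat v \<in> X"
  unfolding subshift_iff
proof (intro allI)
  fix p :: int and m :: nat
  have ne: "NE v" using assms(2) pw_valid by metis
  \<comment> \<open>As words are non-empty, word number \<open>- \<bar>p\<bar>\<close> starts at or
    before \<open>p\<close>, and word number \<open>\<bar>p\<bar> + m\<close> at or after
    \<open>p + m\<close>; the words in between cover the window.\<close>
  define i where "i = - \<bar>p\<bar>"
  define M where "M = nat (2 * \<bar>p\<bar> + int m)"
  have i: "wpos v i \<le> p" using wpos_le_neg[OF ne, of i] by (simp add: i_def)
  have iM: "p + int m \<le> wpos v (i + int M)" using wpos_ge[OF ne, of "i + int M"] by (simp add: i_def M_def)
  define W where "W = concat (win v i M)"
  have "W \<in> rs_word (pw n) (win x i M)"
    unfolding rs_word_iff W_def using list_all2_win[of "\<lambda>v c. v \<in> pw n c" v x i M] assms(2) by blast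
  moreover obtain k a s t where "s @ win x i M @ t \<in> pw k a"
    using assms(1) unfolding subshift_iff legal_def by blast
  moreover have ne2: "rs_word (pw n) u \<noteq> {}" for u by (induction u) (auto simp: rs_word_Cons pw_valid)
  moreover obtain s' t' where "s' \<in> rs_word (pw n) s" "t' \<in> rs_word (pw n) t"
    using ne2 by blast
  ultimately have "s' @ W @ t' \<in> rs_word (pw n) (s @ win x i M @ t)"
    by (intro rs_word_appendI)
  then have "legal \<sigma> W" unfolding legal_def
    using \<open>s @ win x i M @ t \<in> pw k a\<close> rs_pow_add[of \<sigma> k n a] by blast
  moreover have "W = win (biconcat v) (wpos v i) (length W)"
    using win_biconcat(1)[OF ne, of i M] by (simp add: W_def)
  moreover have "length W = nat (p - wpos v i) + (m + nat (wpos v (i + int M) - (p + int m)))"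
    using win_biconcat(2)[OF ne, of i M] i iM by (simp add: W_def)
  moreover have "win (biconcat v) (wpos v i) (nat (p - wpos v i) + (m + c))
    = win (biconcat v) (wpos v i) (nat (p - wpos v i)) @ win (biconcat v) p m @ win (biconcat v) (p + int m) c" for c
    using i by (simp add: win_add)
  ultimately show "legal \<sigma> (win (biconcat v) p m)" using legal_sub by metis
qed

lemma level_data_shiftn:
  assumes "ldata n y x k v" "wpos v j \<le> k + m" "k + m < wpos v (j + 1)"
  shows "ldata n (shiftn m y) (shiftn j x) (k + m - wpos v j) (shiftn j v)"
proof -
  have ne: "NE v" using assms(1) pw_valid unfolding level_data_def by metis
  show ?thesis using assms ne biconcat_shiftn[OF ne, of j] wpos_Suc[of v j]
    by (auto simp: level_data_def shiftn_apply algebra_simps)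
qed

lemma level_data_NE: "ldata n y x k v \<Longrightarrow> NE v"
  using pw_valid unfolding level_data_def by metis

lemma level_data_compose:
  assumes d1: "ldata n y x1 k1 v1" and d2: "ldata m x1 x2 k2 v2"
  shows "\<exists>k v. ldata (m + n) y x2 k v"
proof -
  \<comment> \<open>Undoes the shift in \<open>x1 = shiftn k2 (biconcat v2)\<close>, so that
    \<open>w j\<close> is the fine word of the letter at position \<open>j\<close> of
    \<open>biconcat v2\<close>; \<open>vs i\<close> then groups the fine words by the coarse word
    \<open>v2 i\<close>.\<close>
  define w where "w = shiftn (- k2) v1"
  define vs where "vs i = win w (wpos v2 i) (length (v2 i))" for i
  have ne2: "NE v2" and ne1: "NE v1" using d1 d2 level_data_NE by blast+
  then have new: "NE w" by (simp add: w_def shiftn_apply)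
  have x1: "x1 = shiftn k2 (biconcat v2)" using d2 by (simp add: level_data_def)
  have w_in: "w j \<in> pw n (biconcat v2 j)" for j
  proof -
    have "v1 (j - k2) \<in> pw n (x1 (j - k2))" using d1 by (simp add: level_data_def)
    then show ?thesis by (simp add: w_def shiftn_apply x1)
  qed
  have nevs: "NE vs" using ne2 by (simp add: vs_def win_def)
  have wposvs: "wpos vs i = wpos v2 i" for i by (simp add: vs_def wpos_isum)
  have bvs: "biconcat vs = w"
    by (rule biconcat_eqI[OF nevs]) (simp add: wposvs, simp add: vs_def)
  have nevs2: "u \<noteq> []" if "u \<in> set (vs i)" for i u
    using that new by (auto simp: vs_def win_def)
  have wposc: "wpos (biconcat vs) (wpos vs 1) = wpos (\<lambda>i. concat (vs i)) 1"
    by (rule wpos_concat[OF nevs]) (use nevs2 in blast)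
  have bconc: "biconcat (\<lambda>i. concat (vs i)) = biconcat (biconcat vs)"
    by (rule biconcat_concat[OF nevs]) (use nevs2 in blast)
  have all2: "list_all2 (\<lambda>u c. u \<in> pw n c) (vs i) (v2 i)" for i
  proof -
    have "v2 i = win (biconcat v2) (wpos v2 i) (length (v2 i))" using win_biconcat_one[OF ne2] by simp
    then show ?thesis unfolding vs_def
      using list_all2_win[of "\<lambda>u c. u \<in> pw n c" w "biconcat v2"] w_in by metis
  qed
  have inpw: "concat (vs i) \<in> pw (m + n) (x2 i)" for i
    unfolding rs_pow_add using all2[of i] d2 by (auto simp: level_data_def rs_word_iff)
  have bb: "biconcat (\<lambda>i. concat (vs i)) = biconcat w"
    using bconc bvs by simp
  have "biconcat v1 = shiftn (wpos w k2) (biconcat w)"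
    using biconcat_shiftn[OF new, of k2] by (simp add: w_def)
  then have y: "y = shiftn (k1 + wpos w k2) (biconcat (\<lambda>i. concat (vs i)))"
    using d1 bb by (simp add: level_data_def)
  have k2: "0 \<le> k2" "k2 < int (length (v2 0))" and k1: "0 \<le> k1" "k1 < int (length (w k2))"
    using d1 d2 by (auto simp: level_data_def w_def shiftn_apply)
  have "wpos w (int (length (v2 0))) = int (length (concat (vs 0)))"
    using wposc bvs wposvs[of 1] by simp
  moreover have "wpos w (k2 + 1) \<le> wpos w (int (length (v2 0)))" using k2 by (simp add: wpos_le_iff[OF new])
  moreover have "0 \<le> wpos w k2" using wpos_ge[OF new, of k2] k2 by simp
  ultimately have "0 \<le> k1 + wpos w k2" "k1 + wpos w k2 < int (length (concat (vs 0)))"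
    using k1 wpos_Suc[of w k2] by linarith+
  then have "ldata (m + n) y x2 (k1 + wpos w k2) (\<lambda>i. concat (vs i))"
    using y inpw d2 by (simp add: level_data_def)
  then show ?thesis by blast
qed

text \<open>Converse of \<open>level_data_compose\<close>. \<open>u i\<close> is the level-m word of
  \<open>x i\<close> and \<open>vs i\<close> lists the level-n words of its letters;
  \<open>j\<close> numbers the level-n word over the origin, so \<open>shiftn j (biconcat u)\<close>
  is the point at the intermediate level.\<close>

lemma level_data_decompose:
  assumes d: "ldata (m + n) y x k v"
  obtains u vs j where "\<And>i. u i \<in> pw m (x i)" "\<And>i. list_all2 (\<lambda>w c. w \<in> pw n c) (vs i) (u i)"
    "\<And>i. v i = concat (vs i)" "NE vs" "NE u" "\<And>i w. w \<in> set (vs i) \<Longrightarrow> w \<noteq> []"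
    "0 \<le> j" "j < int (length (u 0))"
    "wpos (biconcat vs) j \<le> k" "k < wpos (biconcat vs) (j + 1)"
    "ldata n y (shiftn j (biconcat u)) (k - wpos (biconcat vs) j) (shiftn j (biconcat vs))"
proof -
  have "\<exists>u vs. u \<in> pw m (x i) \<and> list_all2 (\<lambda>w c. w \<in> pw n c) vs u \<and> v i = concat vs" for i
  proof -
    have "v i \<in> pw (m + n) (x i)" using d by (simp add: level_data_def)
    then show ?thesis unfolding rs_pow_add by (auto simp: rs_word_iff)
  qed
  then obtain u vs where u: "\<And>i. u i \<in> pw m (x i)"
    and vs: "\<And>i. list_all2 (\<lambda>w c. w \<in> pw n c) (vs i) (u i)" and v: "\<And>i. v i = concat (vs i)" by metis
  have neu: "NE u" using u pw_valid by metis
  have nevs: "NE vs" using vs neu by (metis list_all2_Nil)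
  have nevs2: "w \<noteq> []" if w: "w \<in> set (vs i)" for i w
  proof -
    obtain q where "q < length (vs i)" "w = vs i ! q" using w by (auto simp: in_set_conv_nth)
    then have "w \<in> pw n (u i ! q)" using list_all2_nthD[OF vs[of i]] by simp
    then show ?thesis using pw_valid by metis
  qed
  have wposc: "wpos (biconcat vs) (wpos vs 1) = wpos (\<lambda>i. concat (vs i)) 1"
    by (rule wpos_concat[OF nevs]) (use nevs2 in blast)
  have bconc: "biconcat (\<lambda>i. concat (vs i)) = biconcat (biconcat vs)"
    by (rule biconcat_concat[OF nevs]) (use nevs2 in blast)
  have neb: "NE (biconcat vs)" using biconcat_all[of vs "\<lambda>w. w \<noteq> []"] nevs nevs2 by blast
  obtain j where j: "wpos (biconcat vs) j \<le> k" "k < wpos (biconcat vs) (j + 1)"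
    using wpos_bracket[OF neb] by blast
  have len: "length (vs 0) = length (u 0)" using vs list_all2_lengthD by blast
  have up: "wpos (biconcat vs) (int (length (u 0))) = int (length (v 0))"
    using wposc len by (simp add: v)
  have k: "0 \<le> k" "k < int (length (v 0))" using d by (auto simp: level_data_def)
  have "wpos (biconcat vs) 0 < wpos (biconcat vs) (j + 1)" using j k by simp
  then have j0: "0 \<le> j" using wpos_less_iff[OF neb] by (metis zless_add1_eq order_le_less)
  have "wpos (biconcat vs) j < wpos (biconcat vs) (int (length (u 0)))" using j k up by simp
  then have j1: "j < int (length (u 0))" using wpos_less_iff[OF neb] by blast
  have xu: "biconcat u \<in> X" using inflate_in_X[of x u m] u d by (simp add: level_data_def)
  have inb: "biconcat vs p \<in> pw n (biconcat u p)" for p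
    by (rule biconcat_all2(1)[OF nevs vs])
  have "y = shiftn k (biconcat (biconcat vs))"
    using d bconc ext[of v, OF v] by (simp add: level_data_def)
  then have ld: "ldata n y (shiftn j (biconcat u)) (k - wpos (biconcat vs) j) (shiftn j (biconcat vs))"
    using j inb xu wpos_Suc[of "biconcat vs" j] biconcat_shiftn[OF neb, of j]
    by (auto simp: level_data_def shiftn_apply)
  show ?thesis by (rule that[of u vs j]) (fact u vs v nevs neu nevs2 j0 j1 j ld)+
qed

lemma wpos_ones:
  assumes "\<And>i. length (v i) = 1"
  shows "wpos v i = i"
proof (induction i rule: int_induct[where k = 0])
  case (step2 i)
  then show ?case using wpos_Suc[of v "i - 1"] assms by simp
qed (simp_all add: wpos_Suc assms)

lemma level_data_ex: "y \<in> X \<Longrightarrow> \<exists>x k v. ldata n y x k v"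
proof (induction n arbitrary: y)
  case 0
  have b: "biconcat (\<lambda>i. [y i]) = y"
  proof (rule biconcat_eqI)
    have "wpos (\<lambda>i. [y i]) i = i" for i by (rule wpos_ones) simp
    then show "y (wpos (\<lambda>i. [y i]) i + int k) = [y i] ! k" if "k < length [y i]" for i k
      using that by simp
  qed simp
  show ?case
    by (rule exI[of _ y], rule exI[of _ 0], rule exI[of _ "\<lambda>i. [y i]"]) (simp add: level_data_def b 0)
next
  case (Suc n)
  have "\<exists>!(x, k, v). x \<in> X \<and> (\<forall>i. v i \<in> \<sigma> (x i)) \<and> 0 \<le> k \<and> k < int (length (v 0)) \<and> y = shiftn k (biconcat v)"
    using Suc.prems recog unfolding recognisable_def by blast
  then have "\<exists>x k v. ldata 1 y x k v"
    by (auto simp: level_data_def dest!: ex1_implies_ex)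
  then obtain x1 k1 v1 where d1: "ldata 1 y x1 k1 v1" by blast
  then have "x1 \<in> X" by (simp add: level_data_def)
  then obtain x2 k2 v2 where "ldata n x1 x2 k2 v2" using Suc.IH by blast
  from level_data_compose[OF d1 this] show ?case by auto
qed

lemma level_data_in_X: "ldata n y x k v \<Longrightarrow> y \<in> X"
  using inflate_in_X[of x v n] by (simp add: level_data_def)

lemma level_data_unique_1:
  assumes "ldata 1 y x k v" "ldata 1 y x' k' v'"
  shows "x = x' \<and> k = k' \<and> v = v'"
proof -
  define P where "P = (\<lambda>(x, k, v). x \<in> X \<and> (\<forall>i. v i \<in> \<sigma> (x i)) \<and> 0 \<le> k \<and>
    k < int (length (v 0)) \<and> y = shiftn k (biconcat v))"
  have "\<exists>!p. P p"
    using recog level_data_in_X[OF assms(1)] unfolding recognisable_def P_def by blast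
  moreover have "P (x, k, v)" "P (x', k', v')"
    using assms by (simp_all add: P_def level_data_def)
  ultimately have "(x, k, v) = (x', k', v')" by blast
  then show ?thesis by simp
qed

text \<open>Recognisability is used at the finest step: it determines the intermediate point, to
  which the induction hypothesis applies. The lengths of the groups \<open>vs i\<close> are then
  those of the words \<open>u i\<close>, which fixes the grouping of the finest words.\<close>

lemma level_data_unique:
  assumes "ldata n y x k v" "ldata n y x' k' v'"
  shows "x = x' \<and> k = k' \<and> v = v'"
  using assms
proof (induction n arbitrary: y x k v x' k' v')
  case 0
  have "x = y \<and> k = 0 \<and> v = (\<lambda>i. [y i])" if "ldata 0 y x k v" for x k v
  proof -
    have v: "v i = [x i]" for i using that by (simp add: level_data_def)
    then have "k = 0" using that by (simp add: level_data_def)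
    have w: "wpos v i = i" for i by (rule wpos_ones) (simp add: v)
    have "biconcat v = x" by (rule biconcat_eqI) (use v w in auto)
    then show ?thesis using that v \<open>k = 0\<close> by (auto simp: level_data_def)
  qed
  then show ?case using 0 by metis
next
  case (Suc n)
  have d: "ldata (n + 1) y x k v" "ldata (n + 1) y x' k' v'" using Suc.prems by auto
  obtain u vs j where a: "\<And>i. u i \<in> pw n (x i)" "\<And>i. list_all2 (\<lambda>w c. w \<in> pw 1 c) (vs i) (u i)"
    "\<And>i. v i = concat (vs i)" "NE vs" "NE u" "\<And>i w. w \<in> set (vs i) \<Longrightarrow> w \<noteq> []"
    "0 \<le> j" "j < int (length (u 0))"
    "wpos (biconcat vs) j \<le> k" "k < wpos (biconcat vs) (j + 1)"
    "ldata 1 y (shiftn j (biconcat u)) (k - wpos (biconcat vs) j) (shiftn j (biconcat vs))"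
    using level_data_decompose[OF d(1)] by blast
  obtain u' vs' j' where b: "\<And>i. u' i \<in> pw n (x' i)" "\<And>i. list_all2 (\<lambda>w c. w \<in> pw 1 c) (vs' i) (u' i)"
    "\<And>i. v' i = concat (vs' i)" "NE vs'" "NE u'" "\<And>i w. w \<in> set (vs' i) \<Longrightarrow> w \<noteq> []"
    "0 \<le> j'" "j' < int (length (u' 0))"
    "wpos (biconcat vs') j' \<le> k'" "k' < wpos (biconcat vs') (j' + 1)"
    "ldata 1 y (shiftn j' (biconcat u')) (k' - wpos (biconcat vs') j') (shiftn j' (biconcat vs'))"
    using level_data_decompose[OF d(2)] by blast
  from level_data_unique_1[OF a(11) b(11)]
  have e: "shiftn j (biconcat u) = shiftn j' (biconcat u')" "shiftn j (biconcat vs) = shiftn j' (biconcat vs')"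
    "k - wpos (biconcat vs) j = k' - wpos (biconcat vs') j'" by auto
  have "ldata n (shiftn j (biconcat u)) x j u"
    using a(1,7,8) d(1) by (simp add: level_data_def)
  moreover have "ldata n (shiftn j (biconcat u)) x' j' u'"
    unfolding e(1) using b(1,7,8) d(2) by (simp add: level_data_def)
  ultimately have f: "x = x'" "j = j'" "u = u'" using Suc.IH by blast+
  then have "biconcat vs = biconcat vs'" using e(2) by (metis shiftn_shiftn shiftn_0 add.left_inverse)
  moreover have "length (vs i) = length (vs' i)" for i
    using a(2)[of i] b(2)[of i] f by (metis list_all2_lengthD)
  ultimately have "vs = vs'" using biconcat_inj_lengths a(4) by blast
  then have "v = v'" using a(3) b(3) by (intro ext) simp
  moreover have "k = k'" using e(3) \<open>vs = vs'\<close> f by simp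
  ultimately show ?case using f by blast
qed

end

section \<open>Compactness and cells\<close>

text \<open>Sequential compactness of a countable product of finite sets, phrased by eventual
  constancy of each coordinate.\<close>

lemma diagonal_limit:
  fixes f :: "nat \<Rightarrow> 'i::countable \<Rightarrow> 'b"
  assumes fin: "\<And>i. finite (F i)" and f: "\<And>m i. f m i \<in> F i"
  obtains r g where "strict_mono r" "\<And>i. \<forall>\<^sub>F m in sequentially. f (r m) i = g i"
proof -
  define P where "P n s \<longleftrightarrow> (\<exists>c. \<forall>\<^sub>F m in sequentially. \<forall>i. to_nat i = n \<longrightarrow> f (s m) i = c)" for n and s :: "nat \<Rightarrow> nat"
  interpret subseqs P
  proof
    fix n and s :: "nat \<Rightarrow> nat"
    show "\<exists>r'. strict_mono r' \<and> P n (s \<circ> r')"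
    proof (cases "\<exists>i::'i. to_nat i = n")
      case True
      then obtain i :: 'i where i: "to_nat i = n" by blast
      have "finite (range (\<lambda>m. f (s m) i))" by (rule finite_subset[OF _ fin[of i]]) (use f in auto)
      then obtain c where "infinite {m \<in> UNIV. f (s m) i = c}"
        using pigeonhole_infinite[of UNIV "\<lambda>m. f (s m) i"] by (auto simp: eq_commute)
      then have inf: "infinite {m. f (s m) i = c}" by simp
      define r' where "r' = enumerate {m. f (s m) i = c}"
      have "strict_mono r'" unfolding r'_def by (rule strict_mono_enumerate[OF inf])
      moreover have "f (s (r' m)) i = c" for m
        using enumerate_in_set[OF inf, of m] by (simp add: r'_def)
      then have "P n (s \<circ> r')" unfolding P_def using i
        by (intro exI[of _ c] always_eventually) (auto)
      ultimately show ?thesis by blast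
    next
      case False
      then show ?thesis by (intro exI[of _ id]) (auto simp: P_def strict_mono_def)
    qed
  qed
  have ev: "\<exists>c. \<forall>\<^sub>F m in sequentially. f (diagseq m) i = c" for i
  proof -
    have "P (to_nat i) (diagseq \<circ> (+) (Suc (to_nat i)))"
    proof (rule diagseq_holds)
      fix r s n assume r: "strict_mono (r :: nat \<Rightarrow> nat)" and "P n s"
      then obtain c where "\<forall>\<^sub>F m in sequentially. \<forall>i. to_nat i = n \<longrightarrow> f (s m) i = c" by (auto simp: P_def)
      then have "\<forall>\<^sub>F m in sequentially. \<forall>i. to_nat i = n \<longrightarrow> f (s (r m)) i = c"
        using filterlim_subseq[OF r] unfolding filterlim_iff by blast
      then show "P n (s \<circ> r)" unfolding P_def by auto
    qed
    then obtain c where "\<forall>\<^sub>F m in sequentially. f (diagseq (Suc (to_nat i) + m)) i = c"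
      by (auto simp: P_def elim: eventually_mono)
    then have "\<forall>\<^sub>F m in sequentially. f (diagseq (m + Suc (to_nat i))) i = c"
      by (simp only: add.commute)
    then have "\<forall>\<^sub>F m in sequentially. f (diagseq m) i = c"
      by (rule eventually_sequentially_seg[THEN iffD1])
    then show ?thesis by blast
  qed
  show ?thesis
    by (rule that[OF subseq_diagseq, of "\<lambda>i. SOME c. \<forall>\<^sub>F m in sequentially. f (diagseq m) i = c"])
      (rule someI_ex[OF ev])
qed

text \<open>Each non-empty word advances the position by at least one. Hence a value of
  \<open>biconcat\<close> near the origin depends only on words of small index.\<close>

lemma bracket_index_bound:
  assumes "NE v" "wpos v i \<le> p" "p < wpos v (i + 1)"
  shows "\<bar>i\<bar> \<le> \<bar>p\<bar>"
proof (cases "0 \<le> i")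
  case True
  then show ?thesis using wpos_ge[OF assms(1), of i] assms by simp
next
  case False
  then have "wpos v (i + 1) \<le> i + 1" using wpos_le_neg[OF assms(1), of "i + 1"] by simp
  then show ?thesis using False assms by simp
qed

lemma wpos_cong:
  assumes "\<And>j. \<bar>j\<bar> \<le> \<bar>i\<bar> \<Longrightarrow> v j = v' j"
  shows "wpos v i = wpos v' i"
  using assms by (auto simp: wpos_def intro!: sum.cong)

lemma biconcat_cong:
  assumes "NE v" "NE v'" "\<And>j. \<bar>j\<bar> \<le> \<bar>p\<bar> \<Longrightarrow> v j = v' j"
  shows "biconcat v p = biconcat v' p"
proof -
  obtain i where i: "wpos v i \<le> p" "p < wpos v (i + 1)" using wpos_bracket[OF assms(1)] by blast
  define k where "k = nat (p - wpos v i)"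
  have k: "k < length (v i)" "p = wpos v i + int k" using i wpos_Suc[of v i] by (auto simp: k_def)
  have b: "\<bar>i\<bar> \<le> \<bar>p\<bar>" by (rule bracket_index_bound[OF assms(1) i])
  have "wpos v i = wpos v' i" by (rule wpos_cong) (use assms(3) b in auto)
  moreover have "v i = v' i" using assms(3) b by blast
  ultimately show ?thesis
    using biconcat_at[OF assms(1), of k i] biconcat_at[OF assms(2), of k i] k by metis
qed

lemma eventually_agree:
  fixes x :: "nat \<Rightarrow> int \<Rightarrow> 'b"
  assumes "\<And>i. \<forall>\<^sub>F m in sequentially. x m i = y i" "finite I"
  shows "\<forall>\<^sub>F m in sequentially. \<forall>i\<in>I. x m i = y i"
  using assms by (simp add: eventually_ball_finite_distrib)

lemma subshift_limit:
  assumes "\<And>p n. \<forall>\<^sub>F m in sequentially. legal \<sigma> (win (x m) p n)" "\<And>i. \<forall>\<^sub>F m in sequentially. x m i = y i"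
  shows "y \<in> subshift \<sigma>"
  unfolding subshift_iff
proof (intro allI)
  fix p n
  have "\<forall>\<^sub>F m in sequentially. \<forall>i\<in>{p..<p + int n}. x m i = y i"
    using eventually_agree[of x y] assms(2) by blast
  then have "\<forall>\<^sub>F m in sequentially. legal \<sigma> (win y p n)"
    using assms(1)[of p n]
  proof eventually_elim
    case (elim m)
    have "win (x m) p n = win y p n" using elim(1) by (simp add: win_eq_iff)
    then show ?case using elim(2) by simp
  qed
  then show "legal \<sigma> (win y p n)" by simp
qed

lemma sum_lessThan_add:
  fixes f :: "nat \<Rightarrow> 'd::comm_monoid_add"
  shows "sum f {..<a + b} = sum f {..<a} + (\<Sum>i<b. f (a + i))"
  by (induction b) (simp_all add: add.assoc)

context recog_subst
begin

definition maxlen :: "nat \<Rightarrow> nat" where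
  "maxlen n = Max (length ` (\<Union>a. pw n a))"

lemma length_le_maxlen: "v \<in> pw n a \<Longrightarrow> length v \<le> maxlen n"
  unfolding maxlen_def by (rule Max_ge) (use pw_valid in auto)

text \<open>Level data form a closed relation: each of the defining conditions involves only
  finitely many coordinates at a time.\<close>

lemma level_data_limit:
  assumes "\<And>m. ldata n (y m) (x m) (k m) (v m)"
    and "\<And>i. \<forall>\<^sub>F m in sequentially. y m i = y' i" "\<And>i. \<forall>\<^sub>F m in sequentially. x m i = x' i"
    and "\<And>i. \<forall>\<^sub>F m in sequentially. v m i = v' i" "\<forall>\<^sub>F m in sequentially. k m = k'"
  shows "ldata n y' x' k' v'"
proof -
  have A: "v m i \<in> pw n (x m i)" "0 \<le> k m" "k m < int (length (v m 0))" for m i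
    using assms(1)[of m] by (auto simp: level_data_def)
  show ?thesis unfolding level_data_def
proof (intro conjI allI)
  show "x' \<in> X"
    by (rule subshift_limit[OF _ assms(3)]) (use assms(1) in \<open>auto simp: level_data_def subshift_iff\<close>)
  show in_pw: "v' i \<in> pw n (x' i)" for i
  proof -
    have "\<forall>\<^sub>F m in sequentially. v' i \<in> pw n (x' i)"
      using assms(3)[of i] assms(4)[of i] by eventually_elim (use A in metis)
    then show ?thesis by simp
  qed
  have "\<forall>\<^sub>F m in sequentially. 0 \<le> k' \<and> k' < int (length (v' 0))"
    using assms(4)[of 0] assms(5) by eventually_elim (use A in metis)
  then show "0 \<le> k'" "k' < int (length (v' 0))" by auto
  have ne': "NE v'" using in_pw pw_valid by metis
  show "y' = shiftn k' (biconcat v')"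
  proof
    fix p
    have "\<forall>\<^sub>F m in sequentially. \<forall>j\<in>{-\<bar>p + k'\<bar>..\<bar>p + k'\<bar>}. v m j = v' j"
      using eventually_agree[of v v'] assms(4) by blast
    then have "\<forall>\<^sub>F m in sequentially. y' p = biconcat v' (p + k')"
      using assms(2)[of p] assms(5)
    proof eventually_elim
      case (elim m)
      have "biconcat (v m) (p + k') = biconcat v' (p + k')"
        by (rule biconcat_cong[OF level_data_NE[OF assms(1)] ne']) (use elim(1) in force)
      moreover have "y m p = biconcat (v m) (p + k m)" using assms(1)[of m] by (simp add: level_data_def shiftn_apply)
      ultimately show ?case using elim by simp
    qed
    then show "y' p = shiftn k' (biconcat v') p" by (simp add: shiftn_apply)
  qed
qed
qed

text \<open>On \<open>X\<close> this choice is the only one, by \<open>level_data_unique\<close>;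
  outside \<open>X\<close> it is arbitrary, hence the guards \<open>y \<in> X\<close> in later
  definitions.\<close>

definition ldat :: "nat \<Rightarrow> (int \<Rightarrow> 'a) \<Rightarrow> (int \<Rightarrow> 'a) \<times> int \<times> (int \<Rightarrow> 'a list)" where
  "ldat n y = (SOME p. ldata n y (fst p) (fst (snd p)) (snd (snd p)))"

definition cx where "cx n y = fst (ldat n y)"
definition ck where "ck n y = fst (snd (ldat n y))"
definition cv where "cv n y = snd (snd (ldat n y))"

lemma level_data_c: "y \<in> X \<Longrightarrow> ldata n y (cx n y) (ck n y) (cv n y)"
  using someI_ex[of "\<lambda>p. ldata n y (fst p) (fst (snd p)) (snd (snd p))"] level_data_ex[of y n]
  by (simp add: cx_def ck_def cv_def ldat_def)

lemma level_data_cD: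
  assumes "ldata n y x k v"
  shows "cx n y = x" "ck n y = k" "cv n y = v"
  using level_data_unique[OF level_data_c assms] level_data_in_X[OF assms] by auto

lemma level_data_finite:
  assumes "ldata n y x k v"
  shows "v i \<in> (\<Union>a. pw n a)" "k \<in> {0..int (maxlen n)}"
  using assms length_le_maxlen[of "v 0" n "x 0"] by (auto simp: level_data_def)

text \<open>Continuity on the compact space \<open>X\<close> of a function with discrete values, in
  its uniform form.\<close>

definition loc :: "((int \<Rightarrow> 'a) \<Rightarrow> 'c) \<Rightarrow> bool" where
  "loc f \<longleftrightarrow> (\<exists>R\<ge>0. \<forall>y\<in>X. \<forall>y'\<in>X. (\<forall>i. \<bar>i\<bar> \<le> R \<longrightarrow> y i = y' i) \<longrightarrow> f y = f y')"

text \<open>Compactness turns uniqueness into locality. Otherwise there are pairs of points that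
  agree on growing windows but have different data; along a subsequence both points tend to the same
  limit, which inherits two different level data.\<close>

lemma loc_data: "loc (\<lambda>y. (cx n y j, ck n y, cv n y j))"
proof (rule ccontr)
  assume "\<not> ?thesis"
  then have "\<exists>y y'. y \<in> X \<and> y' \<in> X \<and> (\<forall>i. \<bar>i\<bar> \<le> int R \<longrightarrow> y i = y' i) \<and>
     (cx n y j, ck n y, cv n y j) \<noteq> (cx n y' j, ck n y', cv n y' j)" for R
    unfolding loc_def using of_nat_0_le_iff[of R] by blast
  then obtain y y' where yX: "\<And>R. y R \<in> X" "\<And>R. y' R \<in> X"
    and agree: "\<And>R i. \<bar>i\<bar> \<le> int R \<Longrightarrow> y R i = y' R i"
    and ne: "\<And>R. (cx n (y R) j, ck n (y R), cv n (y R) j) \<noteq> (cx n (y' R) j, ck n (y' R), cv n (y' R) j)"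
    by metis
  \<comment> \<open>Points and data are packed into one family over the integers, with the offsets
    repeated at every index, so that a single diagonal subsequence makes everything
    converge.\<close>
  define f where "f R i = (y R i, y' R i, (cx n (y R) i, cv n (y R) i, ck n (y R)),
     (cx n (y' R) i, cv n (y' R) i, ck n (y' R)))" for R i
  define F where "F = (UNIV :: 'a set) \<times> (UNIV :: 'a set) \<times> ((UNIV :: 'a set) \<times> (\<Union>a. pw n a) \<times> {0..int (maxlen n)})
    \<times> ((UNIV :: 'a set) \<times> (\<Union>a. pw n a) \<times> {0..int (maxlen n)})"
  have "finite F" unfolding F_def using pw_valid by (intro finite_cartesian_product) auto
  moreover have "f m i \<in> F" for m i
    unfolding f_def F_def using level_data_finite[OF level_data_c[OF yX(1)]] level_data_finite[OF level_data_c[OF yX(2)]]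
    by auto
  ultimately obtain r g where r: "strict_mono r" and g: "\<And>i. \<forall>\<^sub>F m in sequentially. f (r m) i = g i"
    using diagonal_limit[of "\<lambda>_. F" f] by blast
  define a where "a i = fst (g i)" for i
  define b where "b i = fst (snd (snd (g i)))" for i
  define c where "c i = snd (snd (snd (g i)))" for i
  have ev: "\<forall>\<^sub>F m in sequentially. y (r m) i = a i"
     "\<forall>\<^sub>F m in sequentially. cx n (y (r m)) i = fst (b i)"
     "\<forall>\<^sub>F m in sequentially. cv n (y (r m)) i = fst (snd (b i))"
     "\<forall>\<^sub>F m in sequentially. ck n (y (r m)) = snd (snd (b i))"
     "\<forall>\<^sub>F m in sequentially. cx n (y' (r m)) i = fst (c i)"
     "\<forall>\<^sub>F m in sequentially. cv n (y' (r m)) i = fst (snd (c i))"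
     "\<forall>\<^sub>F m in sequentially. ck n (y' (r m)) = snd (snd (c i))" for i
  proof -
    have "\<forall>\<^sub>F m in sequentially. g i = f (r m) i" using g[of i] by (simp add: eq_commute)
    then show "\<forall>\<^sub>F m in sequentially. y (r m) i = a i"
     "\<forall>\<^sub>F m in sequentially. cx n (y (r m)) i = fst (b i)"
     "\<forall>\<^sub>F m in sequentially. cv n (y (r m)) i = fst (snd (b i))"
     "\<forall>\<^sub>F m in sequentially. ck n (y (r m)) = snd (snd (b i))"
     "\<forall>\<^sub>F m in sequentially. cx n (y' (r m)) i = fst (c i)"
     "\<forall>\<^sub>F m in sequentially. cv n (y' (r m)) i = fst (snd (c i))"
     "\<forall>\<^sub>F m in sequentially. ck n (y' (r m)) = snd (snd (c i))"
      by (auto elim!: eventually_mono simp: f_def a_def b_def c_def)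
  qed
  have ev': "\<forall>\<^sub>F m in sequentially. y' (r m) i = a i" for i
    using ev(1)[of i] eventually_ge_at_top[of "nat \<bar>i\<bar>"]
  proof eventually_elim
    case (elim m)
    have "m \<le> r m" using r by (rule seq_suble)
    then show ?case using agree[of i "r m"] elim by simp
  qed
  have "ldata n a (\<lambda>i. fst (b i)) (snd (snd (b 0))) (\<lambda>i. fst (snd (b i)))"
    by (rule level_data_limit[of n "\<lambda>m. y (r m)" "\<lambda>m. cx n (y (r m))" "\<lambda>m. ck n (y (r m))" "\<lambda>m. cv n (y (r m))"])
      (rule level_data_c[OF yX(1)] ev)+
  moreover have "ldata n a (\<lambda>i. fst (c i)) (snd (snd (c 0))) (\<lambda>i. fst (snd (c i)))"
    by (rule level_data_limit[of n "\<lambda>m. y' (r m)" "\<lambda>m. cx n (y' (r m))" "\<lambda>m. ck n (y' (r m))" "\<lambda>m. cv n (y' (r m))"])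
      (rule level_data_c[OF yX(2)] ev ev')+
  ultimately have u: "(\<lambda>i. fst (b i)) = (\<lambda>i. fst (c i))" "snd (snd (b 0)) = snd (snd (c 0))"
     "(\<lambda>i. fst (snd (b i))) = (\<lambda>i. fst (snd (c i)))"
    using level_data_unique by blast+
  have "\<forall>\<^sub>F m in sequentially. False"
    using ev(2)[of j] ev(3)[of j] ev(4)[of 0] ev(5)[of j] ev(6)[of j] ev(7)[of 0]
  proof eventually_elim
    case (elim m)
    then show ?case using ne[of "r m"] fun_cong[OF u(1), of j] fun_cong[OF u(3), of j] u(2) by simp
  qed
  then show False by simp
qed

lemma loc_comp: "loc f \<Longrightarrow> loc (\<lambda>y. h (f y))"
  unfolding loc_def by (metis (no_types, lifting))

lemma loc_const [simp]: "loc (\<lambda>y. c)"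
  by (auto simp: loc_def)

lemma loc_Pair:
  assumes "loc f" "loc g"
  shows "loc (\<lambda>y. (f y, g y))"
proof -
  obtain R where R: "0 \<le> R" "\<And>y y'. y \<in> X \<Longrightarrow> y' \<in> X \<Longrightarrow> (\<And>i. \<bar>i\<bar> \<le> R \<Longrightarrow> y i = y' i) \<Longrightarrow> f y = f y'"
    using assms(1) unfolding loc_def by metis
  obtain R' where R': "0 \<le> R'" "\<And>y y'. y \<in> X \<Longrightarrow> y' \<in> X \<Longrightarrow> (\<And>i. \<bar>i\<bar> \<le> R' \<Longrightarrow> y i = y' i) \<Longrightarrow> g y = g y'"
    using assms(2) unfolding loc_def by metis
  show ?thesis unfolding loc_def
  proof (intro exI[of _ "max R R'"] conjI ballI impI)
    fix y y' assume a: "y \<in> X" "y' \<in> X" "\<forall>i. \<bar>i\<bar> \<le> max R R' \<longrightarrow> y i = y' i"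
    then show "(f y, g y) = (f y', g y')" using R(2)[of y y'] R'(2)[of y y'] by auto
  qed (use R in auto)
qed

lemma loc_comp2: "loc f \<Longrightarrow> loc g \<Longrightarrow> loc (\<lambda>y. h (f y) (g y))"
  using loc_comp[OF loc_Pair, of f g "\<lambda>(a, b). h a b"] by simp

lemma loc_win: "(\<And>i. loc (\<lambda>y. g y i)) \<Longrightarrow> loc (\<lambda>y. win (g y) p n)"
proof (induction n)
  case (Suc n)
  then show ?case unfolding win_Suc by (intro loc_comp2[of _ _ "\<lambda>a b. a @ [b]"]) auto
qed simp

lemma loc_ck: "loc (ck n)" and loc_cx: "loc (\<lambda>y. cx n y j)" and loc_cv: "loc (\<lambda>y. cv n y j)"
  using loc_comp[OF loc_data[of n 0], of "\<lambda>(a, b, c). b"] loc_comp[OF loc_data[of n j], of "\<lambda>(a, b, c). a"]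
    loc_comp[OF loc_data[of n j], of "\<lambda>(a, b, c). c"] by simp_all

text \<open>A level-n cell (a, w) occurs at y if the decomposition of y into level-n words cuts at the origin, and
  w is the word that begins there.\<close>
definition cell :: "nat \<Rightarrow> (int \<Rightarrow> 'a) \<Rightarrow> ('a \<times> 'a list) option" where
  "cell n y = (if y \<in> X \<and> ck n y = 0 then Some (cx n y 0, cv n y 0) else None)"

lemma loc_cell: "loc (cell n)"
proof -
  have "loc (\<lambda>y. (\<lambda>(a, b, c). if b = 0 then Some (a, c) else None) (cx n y 0, ck n y, cv n y 0))"
    by (rule loc_comp[OF loc_data])
  then show ?thesis unfolding loc_def by (auto simp: cell_def)
qed

lemma cell_SomeE:
  assumes "cell n y = Some (a, w)"
  obtains x v where "ldata n y x 0 v" "x 0 = a" "v 0 = w" "y \<in> X" "w \<in> pw n a"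
proof -
  have a: "y \<in> X" "ck n y = 0" "cx n y 0 = a" "cv n y 0 = w"
    using assms by (auto simp: cell_def split: if_splits)
  then have d: "ldata n y (cx n y) 0 (cv n y)" using level_data_c[of y n] by simp
  then have "w \<in> pw n a" using a by (auto simp: level_data_def)
  then show ?thesis using that d a by blast
qed

lemma cell_level_data: "ldata n y x 0 v \<Longrightarrow> cell n y = Some (x 0, v 0)"
  using level_data_cD[of n y x 0 v] level_data_in_X by (simp add: cell_def)

lemma level_data_inside:
  assumes "ldata n y x 0 v" "wpos v j \<le> i" "i < wpos v (j + 1)"
  shows "ldata n (shiftn i y) (shiftn j x) (i - wpos v j) (shiftn j v)"
  using level_data_shiftn[OF assms(1), of j i] assms by simp

lemma cell_inside:
  assumes "ldata n y x 0 v" "wpos v j \<le> i" "i < wpos v (j + 1)"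
  shows "cell n (shiftn i y) = (if i = wpos v j then Some (x j, v j) else None)"
  using level_data_cD[OF level_data_inside[OF assms]] level_data_in_X[OF assms(1)]
  by (auto simp: cell_def shiftn_apply)

text \<open>Positions at which no cell begins count as 0, so a sum over positions becomes a sum over
  cells.\<close>

definition oval :: "('c \<Rightarrow> 'd::zero) \<Rightarrow> 'c option \<Rightarrow> 'd" where
  "oval g z = (case z of None \<Rightarrow> 0 | Some c \<Rightarrow> g c)"

lemma oval_simps [simp]: "oval g None = 0" "oval g (Some c) = g c"
  by (simp_all add: oval_def)

text \<open>Inside a word only its first position carries a cell, so each block of positions
  contributes a single term.\<close>

lemma cell_sum_win:
  fixes g :: "_ \<Rightarrow> 'd::comm_monoid_add"
  assumes d: "ldata n y x 0 v"
  shows "(\<Sum>i<nat (wpos v (int M)). oval g (cell n (shiftn (int i) y))) = (\<Sum>j<M. g (x (int j), v (int j)))"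
proof (induction M)
  case (Suc M)
  let ?f = "\<lambda>i. oval g (cell n (shiftn (int i) y))"
  have ne: "NE v" using level_data_NE[OF d] .
  define A where "A = nat (wpos v (int M))"
  have "int M \<le> wpos v (int M)" using wpos_ge[OF ne] by simp
  then have A: "int A = wpos v (int M)" by (simp add: A_def)
  have B: "nat (wpos v (int (Suc M))) = A + length (v (int M))"
    using wpos_Suc[of v "int M"] A by (simp add: add.commute)
  have "?f (A + i) = (if i = 0 then g (x (int M), v (int M)) else 0)" if "i < length (v (int M))" for i
    using cell_inside[OF d, of "int M" "int (A + i)"] A wpos_Suc[of v "int M"] that by simp
  then have "(\<Sum>i<length (v (int M)). ?f (A + i)) = (\<Sum>i<length (v (int M)). if i = 0 then g (x (int M), v (int M)) else 0)"
    by (intro sum.cong) auto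
  also have "\<dots> = g (x (int M), v (int M))" using ne by (simp add: sum.delta)
  finally have "(\<Sum>i<length (v (int M)). ?f (A + i)) = g (x (int M), v (int M))" .
  moreover have "(\<Sum>i<A + length (v (int M)). ?f i) = (\<Sum>i<A. ?f i) + (\<Sum>i<length (v (int M)). ?f (A + i))"
    by (rule sum_lessThan_add)
  ultimately show ?case unfolding B using Suc A_def by simp
qed simp

text \<open>\<open>u\<close> is the level-m word behind \<open>W\<close>, and \<open>ws\<close> cuts
  \<open>W\<close> into the level-n words of the letters of \<open>u\<close>. Recognisability makes
  both unique, see \<open>parse_unique\<close>.\<close>

definition parse :: "nat \<Rightarrow> nat \<Rightarrow> 'a \<Rightarrow> 'a list \<Rightarrow> 'a list \<Rightarrow> 'a list list \<Rightarrow> bool" where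
  "parse m n b W u ws \<longleftrightarrow> u \<in> pw m b \<and> list_all2 (\<lambda>w c. w \<in> pw n c) ws u \<and> W = concat ws"

lemma parse_ex: "W \<in> pw (m + n) b \<Longrightarrow> \<exists>u ws. parse m n b W u ws"
  by (auto simp: rs_pow_add rs_word_iff parse_def)

lemma parse_pw: "parse m n b W u ws \<Longrightarrow> W \<in> pw (m + n) b"
  by (auto simp: rs_pow_add rs_word_iff parse_def)

end

section \<open>Primitivity and sample points\<close>

lemma count_list_concat_map:
  fixes w :: "'a::finite list"
  shows "real (count_list (concat (map \<theta> w)) a) = (\<Sum>c\<in>UNIV. real (count_list (\<theta> c) a) * real (count_list w c))"
proof (induction w)
  case (Cons b w)
  have "(\<Sum>c\<in>UNIV. real (count_list (\<theta> c) a) * real (count_list (b # w) c))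
      = (\<Sum>c\<in>UNIV. (if c = b then real (count_list (\<theta> c) a) else 0) + real (count_list (\<theta> c) a) * real (count_list w c))"
    by (rule sum.cong) (auto simp: algebra_simps)
  then show ?case using Cons by (simp add: sum.distrib)
qed simp

context recog_subst
begin

lemma concat_map_rs_word: "(\<And>c. \<theta> c \<in> \<tau> c) \<Longrightarrow> concat (map \<theta> u) \<in> rs_word \<tau> u"
  by (induction u) (auto simp: rs_word_Cons_iff)

text \<open>Iterating one marginal counts letters by the powers of its matrix, so a positive power
  yields words with all letters, at the same level for every \<open>b\<close>.\<close>

lemma all_letters:
  obtains m where "\<And>b. \<exists>w\<in>pw m b. set w = UNIV"
proof -
  obtain n \<theta> where t: "\<And>a. \<theta> a \<in> pw n a" and P: "primitive_matrix (subst_matrix \<theta>)"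
    using prim unfolding primitive_rs_def by blast
  then obtain k where k: "\<And>a b. 0 < mpow (subst_matrix \<theta>) k a b"
    unfolding primitive_matrix_def by blast
  have "\<exists>w\<in>pw (k * n) b. \<forall>a. real (count_list w a) = mpow (subst_matrix \<theta>) k a b" for b
  proof (induction k)
    case 0
    then show ?case by simp
  next
    case (Suc k)
    then obtain w where w: "w \<in> pw (k * n) b" "\<And>a. real (count_list w a) = mpow (subst_matrix \<theta>) k a b" by blast
    have "concat (map \<theta> w) \<in> pw (k * n + n) b"
      unfolding rs_pow_add using concat_map_rs_word[of \<theta> "pw n" w] t w(1) by blast
    moreover have "real (count_list (concat (map \<theta> w)) a) = mpow (subst_matrix \<theta>) (Suc k) a b" for a
      unfolding count_list_concat_map by (simp add: mmult_def subst_matrix_def w(2))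
    ultimately show ?case by (auto simp: add.commute)
  qed
  then have "\<exists>w\<in>pw (k * n) b. set w = UNIV" for b
    using k by (metis (no_types, lifting) count_list_0_iff of_nat_0 less_irrefl UNIV_eq_I)
  then show ?thesis using that by blast
qed

lemma Lword_length: "Lword L w \<le> Lmax * length w"
proof (induction w)
  case (Cons c w)
  have "L c \<le> Lmax" by (rule Max_ge) auto
  then have "L c + Lword L w \<le> Lmax + Lmax * length w" using Cons by linarith
  then show ?case by (simp add: algebra_simps)
qed simp

lemma Lword_length_ge: "Lmin * length w \<le> Lword L w"
proof (induction w)
  case (Cons c w)
  have "Lmin \<le> L c" by (rule Min_le) auto
  then have "Lmin + Lmin * length w \<le> L c + Lword L w" using Cons by linarith
  then show ?case by (simp add: algebra_simps)
qed simp

lemma Lmin_pos: "0 < Lmin" and Lmin_le: "Lmin \<le> L a" and Lmax_ge: "L a \<le> Lmax"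
  by (auto simp: Min_gr_iff)

text \<open>A level-n word has geometric length at least \<open>lam ^ n * Lmin\<close>, and a letter
  takes up at most \<open>Lmax\<close> of it.\<close>

definition lgrow :: real where "lgrow = Lmin / Lmax"

lemma lgrow_pos: "0 < lgrow"
  using Lmin_pos Lmax_ge[of undefined] L_pos[of undefined] unfolding lgrow_def by (intro divide_pos_pos) linarith+

lemma length_pw_ge:
  assumes "w \<in> pw n a"
  shows "lgrow * lam ^ n \<le> length w"
proof -
  have M: "0 < Lmax" using Lmax_ge[of undefined] L_pos[of undefined] by linarith
  have "Lmin * lam ^ n \<le> lam ^ n * L a"
    using Lmin_le[of a] lam_gt_1 by simp
  also have "\<dots> \<le> Lmax * length w" using Lword_length[of w] Lword_pw[OF assms] by simp
  finally show ?thesis using M by (simp add: lgrow_def field_simps)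
qed

lemma concat_map_single: "concat (map \<theta> [c]) = \<theta> c"
  by simp

lemma ex_long_word: "\<exists>n a w. w \<in> pw n a \<and> R \<le> length w"
proof -
  obtain n where n: "real R / lgrow < lam ^ n" using real_arch_pow[OF lam_gt_1] by blast
  obtain w where w: "w \<in> pw n undefined" using pw_valid by blast
  have "real R < lgrow * lam ^ n" using n lgrow_pos by (simp add: field_simps)
  then show ?thesis using length_pw_ge[OF w] w by (intro exI[of _ n] exI[of _ undefined] exI[of _ w]) simp
qed

text \<open>The letter at position \<open>R\<close> of a long word is inflated to a word containing
  all letters, in particular \<open>a\<close>; inflating the rest does not shorten the two
  sides.\<close>

lemma legal_around: "\<exists>s t. legal \<sigma> (s @ [a] @ t) \<and> R \<le> length s \<and> R \<le> length t"
proof -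
  obtain m where m: "\<And>b. \<exists>w\<in>pw m b. set w = UNIV" using all_letters by blast
  obtain n b w where w: "w \<in> pw n b" "2 * R + 1 \<le> length w" using ex_long_word by blast
  obtain \<theta> where t: "\<And>c. \<theta> c \<in> pw m c" "\<And>c. set (\<theta> c) = UNIV" using m by metis
  have ne: "\<theta> c \<noteq> []" for c using t(2)[of c] by auto
  have len: "length u \<le> length (concat (map \<theta> u))" for u
  proof (induction u)
    case (Cons c u)
    then show ?case using ne[of c] by (cases "\<theta> c") auto
  qed simp
  have "concat (map \<theta> w) \<in> pw (n + m) b"
    unfolding rs_pow_add using concat_map_rs_word[of \<theta> "pw m" w] t w(1) by blast
  moreover have "w = take R w @ [w ! R] @ drop (Suc R) w"
    using w(2) id_take_nth_drop[of R w] by simp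
  then have "concat (map \<theta> w) = concat (map \<theta> (take R w)) @ \<theta> (w ! R) @ concat (map \<theta> (drop (Suc R) w))"
    by (metis (no_types) concat_append map_append concat_map_single)
  moreover obtain p q where "\<theta> (w ! R) = p @ a # q" using t(2)[of "w ! R"] by (metis UNIV_I split_list)
  ultimately have "(concat (map \<theta> (take R w)) @ p) @ [a] @ (q @ concat (map \<theta> (drop (Suc R) w))) \<in> pw (n + m) b"
    by simp
  then have "legal \<sigma> ((concat (map \<theta> (take R w)) @ p) @ [a] @ (q @ concat (map \<theta> (drop (Suc R) w))))"
    unfolding legal_def by (intro exI[of _ "n + m"] exI[of _ b] exI[of _ "[]"]) simp
  moreover have "R \<le> length (concat (map \<theta> (take R w)) @ p)"
    using len[of "take R w"] w(2) by simp
  moreover have "R \<le> length (q @ concat (map \<theta> (drop (Suc R) w)))"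
    using len[of "drop (Suc R) w"] w(2) by simp
  ultimately show ?thesis by blast
qed

lemma ex_letter: "\<exists>x\<in>X. x 0 = a"
proof -
  obtain s t where st: "\<And>R. legal \<sigma> (s R @ [a] @ t R)" "\<And>R. R \<le> length (s R)" "\<And>R. R \<le> length (t R)"
    using legal_around[of a] by metis
  \<comment> \<open>The words are centred at \<open>a\<close> and padded by \<open>a\<close>
    outside. The padding leaves every fixed window as \<open>R\<close> grows, so it does not affect
    legality in the limit.\<close>
  define f where "f R i = (if 0 \<le> int (length (s R)) + i \<and> int (length (s R)) + i < int (length (s R @ [a] @ t R))
    then (s R @ [a] @ t R) ! nat (int (length (s R)) + i) else a)" for R i
  obtain r g where r: "strict_mono r" and g: "\<And>i. \<forall>\<^sub>F m in sequentially. f (r m) i = g i"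
    by (rule diagonal_limit[of "\<lambda>_. UNIV" f]) (simp, simp, blast)
  have leg: "legal \<sigma> (win (f R) p n)" if "\<bar>p\<bar> + int n \<le> int R" for R p n
  proof -
    define W where "W = s R @ [a] @ t R"
    define j where "j = nat (int (length (s R)) + p)"
    have j: "int j = int (length (s R)) + p" "j + n \<le> length W" using that st(2)[of R] st(3)[of R] by (auto simp: j_def W_def)
    have "win (f R) p n = take n (drop j W)"
    proof (rule nth_equalityI)
      show "length (win (f R) p n) = length (take n (drop j W))" using j(2) by simp
      fix i assume "i < length (win (f R) p n)"
      then have i: "i < n" by simp
      have e: "int (length (s R)) + (p + int i) = int (j + i)" using j(1) by simp
      have "f R (p + int i) = W ! nat (int (j + i))"
        unfolding f_def e using j(2) i by (simp add: W_def)
      then have "f R (p + int i) = W ! (j + i)" by (simp only: nat_int)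
      then show "win (f R) p n ! i = take n (drop j W) ! i" using i j(2) by simp
    qed
    moreover have "W = take j W @ take n (drop j W) @ drop n (drop j W)" by (metis append_take_drop_id)
    ultimately show ?thesis using st(1)[of R] legal_sub unfolding W_def by metis
  qed
  have "g \<in> X"
  proof (rule subshift_limit[OF _ g])
    fix p n
    show "\<forall>\<^sub>F m in sequentially. legal \<sigma> (win (f (r m)) p n)"
      using eventually_ge_at_top[of "nat (\<bar>p\<bar> + int n)"]
    proof eventually_elim
      case (elim m)
      have "m \<le> r m" using r by (rule seq_suble)
      then show ?case using elim by (intro leg) simp
    qed
  qed
  moreover have "f R 0 = a" for R by (simp add: f_def)
  then have "g 0 = a" using g[of 0] by simp
  ultimately show ?thesis by blast
qed

section \<open>Sample points of cells and uniqueness of parsing\<close>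

text \<open>Inflates a point with the letter \<open>a\<close> at the origin, using \<open>w\<close>
  there. That every cell occurs at some point transfers recognisability from points to finite
  words.\<close>

lemma ex_cell:
  assumes "w \<in> pw n a"
  shows "\<exists>y. cell n y = Some (a, w)"
proof -
  obtain x where x: "x \<in> X" "x 0 = a" using ex_letter by blast
  obtain v0 where v0: "\<And>b. v0 b \<in> pw n b" using that[of "\<lambda>b. SOME w. w \<in> pw n b"] pw_valid(2) by (simp add: some_in_eq)
  define v where "v i = (if i = 0 then w else v0 (x i))" for i :: int
  have "\<And>i. v i \<in> pw n (x i)" using assms x v0 by (auto simp: v_def)
  moreover have "v 0 \<noteq> []" using pw_valid assms unfolding v_def by metis
  ultimately have "ldata n (biconcat v) x 0 v" using x by (simp add: level_data_def)
  from cell_level_data[OF this] show ?thesis using x by (auto simp: v_def)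
qed

definition cells :: "nat \<Rightarrow> ('a \<times> 'a list) set" where
  "cells n = (SIGMA a:UNIV. pw n a)"

lemma finite_cells [simp]: "finite (cells n)"
  using pw_valid by (auto simp: cells_def)

lemma cell_in_cells: "cell n y = Some c \<Longrightarrow> c \<in> cells n"
  by (cases c) (auto simp: cells_def elim: cell_SomeE)

text \<open>One reference point per cell. Counts inside a cell are made along it; another point with
  the same cell differs only by edge effects.\<close>

definition samp :: "nat \<Rightarrow> 'a \<times> 'a list \<Rightarrow> int \<Rightarrow> 'a" where
  "samp n c = (SOME y. cell n y = Some c)"

lemma cell_samp: "c \<in> cells n \<Longrightarrow> cell n (samp n c) = Some c"
  unfolding samp_def using ex_cell by (intro someI_ex[of "\<lambda>y. cell n y = Some c"]) (auto simp: cells_def)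

text \<open>Parsing every word of a decomposition that is cut at the origin gives a finer
  decomposition of the same point, again cut at the origin.\<close>

lemma parse_family:
  assumes x: "x \<in> X" and US: "\<And>i. parse m n (x i) (V i) (U i) (S i)"
  shows "ldata (m + n) (biconcat V) x 0 V" "ldata n (biconcat V) (biconcat U) 0 (biconcat S)"
    "NE S" "length (U i) = length (S i)" "wpos (biconcat S) (wpos S 1) = wpos V 1"
proof -
  have neU: "NE U" using US pw_valid(3) unfolding parse_def by metis
  have all2: "\<And>i. list_all2 (\<lambda>w c. w \<in> pw n c) (S i) (U i)" using US by (simp add: parse_def)
  then have len: "length (S i) = length (U i)" for i using list_all2_lengthD by blast
  show neS: "NE S" using neU len by (metis length_0_conv)
  show "length (U i) = length (S i)" using len by simp
  have neS2: "w \<noteq> []" if w: "w \<in> set (S i)" for i w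
  proof -
    obtain q where "q < length (S i)" "w = S i ! q" using w by (auto simp: in_set_conv_nth)
    then have "w \<in> pw n (U i ! q)" using list_all2_nthD[OF all2[of i]] by simp
    then show ?thesis using pw_valid by metis
  qed
  have V: "V = (\<lambda>i. concat (S i))" using US by (auto simp: parse_def fun_eq_iff)
  have bc: "biconcat V = biconcat (biconcat S)"
    unfolding V by (rule biconcat_concat[OF neS]) (use neS2 in blast)
  show "wpos (biconcat S) (wpos S 1) = wpos V 1"
    unfolding V by (rule wpos_concat[OF neS]) (use neS2 in blast)
  have neb: "NE (biconcat S)" using biconcat_all[of S "\<lambda>w. w \<noteq> []"] neS neS2 by blast
  have inb: "biconcat S q \<in> pw n (biconcat U q)" for q by (rule biconcat_all2(1)[OF neS all2])
  have "biconcat U \<in> X" using inflate_in_X[of x U m] US x by (auto simp: parse_def)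
  then show "ldata n (biconcat V) (biconcat U) 0 (biconcat S)"
    using inb neb bc by (simp add: level_data_def)
  have "V i \<in> pw (m + n) (x i)" for i by (rule parse_pw[OF US])
  moreover from this have "V 0 \<noteq> []" using pw_valid by metis
  ultimately show "ldata (m + n) (biconcat V) x 0 V" using x by (simp add: level_data_def)
qed

lemma parse_level_data:
  assumes c: "cell (m + n) y = Some (b, W)" and p: "parse m n b W u ws"
  obtains x v where "ldata n y x 0 v" "win x 0 (length u) = u" "win v 0 (length u) = ws"
    "wpos v (int (length u)) = int (length W)"
proof -
  obtain x V where d: "ldata (m + n) y x 0 V" "x 0 = b" "V 0 = W" using c by (rule cell_SomeE)
  have "\<exists>u' ws'. parse m n (x i) (V i) u' ws'" for i
    using d(1) by (intro parse_ex) (simp add: level_data_def)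
  then obtain U0 S0 where US0: "\<And>i. parse m n (x i) (V i) (U0 i) (S0 i)" by metis
  \<comment> \<open>Index 0 receives the given parse and every other index an arbitrary one, so any
    parse of \<open>W\<close> is realised inside data of \<open>y\<close>.\<close>
  define U where "U i = (if i = 0 then u else U0 i)" for i
  define S where "S i = (if i = 0 then ws else S0 i)" for i
  have US: "parse m n (x i) (V i) (U i) (S i)" for i using US0[of i] p d by (auto simp: U_def S_def)
  have "x \<in> X" "y = biconcat V" using d(1) by (auto simp: level_data_def)
  note f = parse_family[OF this(1) US, folded this(2)]
  have neU: "NE U" using f(3,4) by (metis length_0_conv)
  note f(2)
  moreover have "win (biconcat U) 0 (length u) = u"
    using win_biconcat_one[OF neU, of 0] by (metis U_def wpos_0)
  moreover have "win (biconcat S) 0 (length u) = ws"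
    using win_biconcat_one[OF f(3), of 0] f(4)[of 0] by (metis U_def S_def wpos_0)
  moreover have "wpos (biconcat S) (int (length u)) = int (length W)"
    using f(5) f(4)[of 0] d(3) by (simp add: U_def)
  ultimately show ?thesis by (rule that)
qed

text \<open>Both parses are realised at one point, whose level-n data are unique. \<open>u\<close>
  and \<open>u'\<close> have equal length because both must end exactly \<open>length W\<close>
  letters to the right of the origin.\<close>

lemma parse_unique:
  assumes "parse m n b W u ws" "parse m n b W u' ws'"
  shows "u = u' \<and> ws = ws'"
proof -
  obtain y where y: "cell (m + n) y = Some (b, W)" using ex_cell parse_pw[OF assms(1)] by blast
  obtain x v where 1: "ldata n y x 0 v" "win x 0 (length u) = u" "win v 0 (length u) = ws"
    "wpos v (int (length u)) = int (length W)" using parse_level_data[OF y assms(1)] by metis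
  obtain x' v' where 2: "ldata n y x' 0 v'" "win x' 0 (length u') = u'" "win v' 0 (length u') = ws'"
    "wpos v' (int (length u')) = int (length W)" using parse_level_data[OF y assms(2)] by metis
  have e: "x = x'" "v = v'" using level_data_unique[OF 1(1) 2(1)] by auto
  have "\<not> int (length u) < int (length u')" "\<not> int (length u') < int (length u)"
    using wpos_less_iff[OF level_data_NE[OF 1(1)]] 1(4) 2(4) e by (metis less_irrefl)+
  then have "length u = length u'" by linarith
  then show ?thesis using 1 2 e by metis
qed

text \<open>The right-hand side is free of \<open>y\<close>: the level-n cells inside a coarser cell
  are determined by that cell alone.\<close>

lemma nested_sum:
  fixes g :: "_ \<Rightarrow> 'd::comm_monoid_add"
  assumes "cell (m + n) y = Some (b, W)" "parse m n b W u ws"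
  shows "(\<Sum>i<length W. oval g (cell n (shiftn (int i) y))) = (\<Sum>j<length u. g (u ! j, ws ! j))"
proof -
  obtain x v where 1: "ldata n y x 0 v" "win x 0 (length u) = u" "win v 0 (length u) = ws"
    "wpos v (int (length u)) = int (length W)" using parse_level_data[OF assms] by metis
  have "x (int j) = u ! j \<and> v (int j) = ws ! j" if "j < length u" for j
    using 1(2,3) that nth_win[of j "length u" x 0] nth_win[of j "length u" v 0] by simp
  then show ?thesis using cell_sum_win[OF 1(1), of g "length u"] 1(4) by simp
qed

lemma sum_wpos:
  fixes h :: "nat \<Rightarrow> 'd::comm_monoid_add"
  shows "(\<Sum>i<nat (wpos v (int M)). h i) = (\<Sum>j<M. \<Sum>i<length (v (int j)). h (nat (wpos v (int j)) + i))"
proof (induction M)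
  case (Suc M)
  have "0 \<le> wpos v (int M)" by (simp add: wpos_def sum_nonneg)
  then have "nat (wpos v (int (Suc M))) = nat (wpos v (int M)) + length (v (int M))"
    using wpos_Suc[of v "int M"] by (simp add: add.commute nat_add_distrib)
  then show ?case using Suc by (simp add: sum_lessThan_add)
qed simp

lemma cell_word:
  assumes "cell n y = Some (a, w)" "i < length w"
  shows "y (int i) = w ! i"
proof -
  obtain x v where d: "ldata n y x 0 v" "x 0 = a" "v 0 = w" using assms(1) by (rule cell_SomeE)
  have "NE v" using level_data_NE[OF d(1)] .
  then show ?thesis using d biconcat_at[of v i 0] assms(2) by (simp add: level_data_def)
qed

end

section \<open>Shift-invariant measures and Kac's formula\<close>

lemma space_MX [simp]: "space MX = UNIV"
  by (simp add: MX_def space_PiM)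

lemma measurable_coord: "(\<lambda>y. y i) \<in> measurable MX (count_space UNIV)"
  unfolding MX_def by (rule measurable_component_singleton) simp

lemma measurable_win: "(\<lambda>y :: int \<Rightarrow> 'a::finite. win y p n) \<in> measurable MX (count_space UNIV)"
proof (subst measurable_count_space_eq2_countable)
  show "(\<lambda>y. win y p n) \<in> space MX \<rightarrow> UNIV \<and> (\<forall>w\<in>UNIV. (\<lambda>y :: int \<Rightarrow> 'a. win y p n) -` {w} \<inter> space MX \<in> sets MX)"
  proof safe
    fix w :: "'a list"
    have "{y \<in> space MX. y (p + int i) = w ! i} \<in> sets MX" for i
      using measurable_sets[OF measurable_coord, of "{w ! i}" "p + int i"] by (simp add: vimage_def)
    then have "{y \<in> space MX. \<forall>i\<in>{..<n}. y (p + int i) = w ! i} \<in> sets MX"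
      by (intro sets.sets_Collect_finite_All) auto
    moreover have "(\<lambda>y. win y p n) -` {w} \<inter> space MX
      = (if length w = n then {y \<in> space MX. \<forall>i\<in>{..<n}. y (p + int i) = w ! i} else {})"
      by (auto simp: list_eq_iff_nth_eq)
    ultimately show "(\<lambda>y. win y p n) -` {w} \<inter> space MX \<in> sets MX" by simp
  qed auto
qed

lemma sets_win: "{y :: int \<Rightarrow> 'a::finite. P (win y p n)} \<in> sets MX"
  using measurable_sets[OF measurable_win, of "Collect P" p n] by (simp add: vimage_def)

lemma measurable_shiftn [measurable]: "shiftn j \<in> measurable MX MX"
  unfolding MX_def shiftn_def
  by (rule measurable_PiM_single') (auto intro!: measurable_component_singleton simp: space_PiM)

text \<open>Cylinder sets, graded by the radius of the window that decides membership.\<close>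

definition windowed :: "nat \<Rightarrow> (int \<Rightarrow> 'a) set \<Rightarrow> bool" where
  "windowed R A \<longleftrightarrow> (\<forall>y y'. (\<forall>i. \<bar>i\<bar> \<le> int R \<longrightarrow> y i = y' i) \<longrightarrow> (y \<in> A \<longleftrightarrow> y' \<in> A))"

lemma windowed_iff: "windowed R A \<longleftrightarrow> (\<exists>W. A = {y. win y (- int R) (2 * R + 1) \<in> W})"
proof
  have eq: "win y (- int R) (2 * R + 1) = win y' (- int R) (2 * R + 1) \<longleftrightarrow> (\<forall>i. \<bar>i\<bar> \<le> int R \<longrightarrow> y i = y' i)" for y y' :: "int \<Rightarrow> 'a"
  proof
    assume *: "win y (- int R) (2 * R + 1) = win y' (- int R) (2 * R + 1)"
    show "\<forall>i. \<bar>i\<bar> \<le> int R \<longrightarrow> y i = y' i"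
    proof safe
      fix i :: int assume "\<bar>i\<bar> \<le> int R"
      then have "nat (i + int R) < 2 * R + 1" "- int R + int (nat (i + int R)) = i" by auto
      then show "y i = y' i" using * unfolding win_eq_iff by metis
    qed
  qed (auto simp: win_eq_iff)
  show "windowed R A \<Longrightarrow> \<exists>W. A = {y. win y (- int R) (2 * R + 1) \<in> W}"
    unfolding windowed_def eq[symmetric]
    by (intro exI[of _ "(\<lambda>y. win y (- int R) (2 * R + 1)) ` A"]) blast
  show "\<exists>W. A = {y. win y (- int R) (2 * R + 1) \<in> W} \<Longrightarrow> windowed R A"
    unfolding windowed_def eq[symmetric] by auto
qed

lemma windowed_sets: "windowed R (A :: (int \<Rightarrow> 'a::finite) set) \<Longrightarrow> A \<in> sets MX"
  unfolding windowed_iff using sets_win by auto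

lemma windowed_mono: "windowed R A \<Longrightarrow> R \<le> R' \<Longrightarrow> windowed R' A"
  unfolding windowed_def by (meson of_nat_le_iff order_trans)

lemma windowed_Compl: "windowed R A \<Longrightarrow> windowed R (- A)"
  unfolding windowed_def by auto

lemma windowed_Un: "windowed R A \<Longrightarrow> windowed R B \<Longrightarrow> windowed R (A \<union> B)"
  unfolding windowed_def by blast

lemma windowed_Int: "windowed R A \<Longrightarrow> windowed R B \<Longrightarrow> windowed R (A \<inter> B)"
  unfolding windowed_def by blast

definition cylalg :: "(int \<Rightarrow> 'a) set set" where
  "cylalg = {A. \<exists>R. windowed R A}"

lemma cylalg_algebra: "algebra UNIV (cylalg :: (int \<Rightarrow> 'a) set set)"
  unfolding algebra_iff_Un
proof (intro conjI ballI)
  show "{} \<in> cylalg" by (auto simp: cylalg_def windowed_def)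
  fix A :: "(int \<Rightarrow> 'a) set" assume "A \<in> cylalg"
  then show "UNIV - A \<in> cylalg" using windowed_Compl by (auto simp: cylalg_def Compl_eq_Diff_UNIV)
next
  fix A B :: "(int \<Rightarrow> 'a) set" assume "A \<in> cylalg" "B \<in> cylalg"
  then obtain R R' where "windowed R A" "windowed R' B" by (auto simp: cylalg_def)
  then have "windowed (max R R') (A \<union> B)" by (intro windowed_Un) (auto elim: windowed_mono)
  then show "A \<union> B \<in> cylalg" by (auto simp: cylalg_def)
qed auto

lemma sets_MX_cylalg: "sets (MX :: (int \<Rightarrow> 'a::finite) measure) = sigma_sets UNIV cylalg"
proof
  show "sigma_sets UNIV cylalg \<subseteq> sets (MX :: (int \<Rightarrow> 'a) measure)"
    using sets.sigma_sets_subset[of cylalg "MX :: (int \<Rightarrow> 'a) measure"] windowed_sets by (auto simp: cylalg_def)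
  have "sets (MX :: (int \<Rightarrow> 'a) measure) = sigma_sets UNIV {{f. f i \<in> A} | i A. True}"
    unfolding MX_def sets_PiM_single by (simp add: PiE_UNIV_domain Pi_def)
  also have "\<dots> \<subseteq> sigma_sets UNIV cylalg"
  proof (rule sigma_sets_subseteq)
    show "{{f. f i \<in> A} | i A. True} \<subseteq> (cylalg :: (int \<Rightarrow> 'a) set set)"
    proof safe
      fix A :: "'a set" and i :: int
      have "windowed (nat \<bar>i\<bar>) {f. f i \<in> A}" by (auto simp: windowed_def)
      then show "{f. f i \<in> A} \<in> cylalg" by (auto simp: cylalg_def)
    qed
  qed
  finally show "sets (MX :: (int \<Rightarrow> 'a) measure) \<subseteq> sigma_sets UNIV cylalg" .
qed

context recog_subst
begin

abbreviation siv where "siv \<equiv> shift_inv_measure \<sigma>"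

lemma X_sets [measurable]: "X \<in> sets MX"
proof -
  have "X = (\<Inter>p. \<Inter>n. {y. legal \<sigma> (win y p n)})" by (auto simp: subshift_iff)
  also have "\<dots> \<in> sets MX" by (intro sets.countable_INT') (auto simp: sets_win)
  finally show ?thesis .
qed

text \<open>\<open>loc\<close> controls \<open>f\<close> on \<open>X\<close> only, so a level set of
  \<open>f\<close> is the trace of a cylinder; the radius depends on \<open>f\<close> and not on the
  level set.\<close>

lemma loc_window:
  assumes "loc f"
  obtains R where "\<And>P. \<exists>A. windowed R A \<and> {y \<in> X. P (f y)} = X \<inter> A"
proof -
  obtain r where r: "0 \<le> r" "\<And>y y'. y \<in> X \<Longrightarrow> y' \<in> X \<Longrightarrow> (\<And>i. \<bar>i\<bar> \<le> r \<Longrightarrow> y i = y' i) \<Longrightarrow> f y = f y'"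
    using assms unfolding loc_def by metis
  show ?thesis
  proof (rule that[of "nat r"])
    fix P
    define A where "A = {y. \<exists>y'\<in>X. P (f y') \<and> (\<forall>i. \<bar>i\<bar> \<le> r \<longrightarrow> y i = y' i)}"
    have "windowed (nat r) A" unfolding windowed_def
    proof (intro allI impI)
      fix y y' :: "int \<Rightarrow> 'a" assume "\<forall>i. \<bar>i\<bar> \<le> int (nat r) \<longrightarrow> y i = y' i"
      then have "\<And>i. \<bar>i\<bar> \<le> r \<Longrightarrow> y i = y' i" using r(1) by simp
      then show "y \<in> A \<longleftrightarrow> y' \<in> A" unfolding A_def by auto
    qed
    moreover have "{y \<in> X. P (f y)} = X \<inter> A"
    proof safe
      fix y assume "y \<in> X" "y \<in> A"
      then obtain y' where "y' \<in> X" "P (f y')" "\<forall>i. \<bar>i\<bar> \<le> r \<longrightarrow> y i = y' i" unfolding A_def by blast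
      then show "P (f y)" using r(2)[of y y'] \<open>y \<in> X\<close> by auto
    qed (auto simp: A_def)
    ultimately show "\<exists>A. windowed (nat r) A \<and> {y \<in> X. P (f y)} = X \<inter> A" by blast
  qed
qed

lemma loc_sets: "loc f \<Longrightarrow> {y \<in> X. P (f y)} \<in> sets MX"
  by (erule loc_window[of f]) (metis X_sets windowed_sets sets.Int)

lemma cell_sets [measurable]: "{y. cell n y = Some c} \<in> sets MX"
proof -
  have "{y. cell n y = Some c} = {y \<in> X. cell n y = Some c}" by (auto simp: cell_def)
  then show ?thesis using loc_sets[OF loc_cell, of "\<lambda>z. z = Some c" n] by simp
qed

lemma siv_sets: "siv \<mu> \<Longrightarrow> sets \<mu> = sets MX"
  and siv_prob: "siv \<mu> \<Longrightarrow> prob_space \<mu>"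
  by (auto simp: shift_inv_measure_def)

lemma siv_space: "siv \<mu> \<Longrightarrow> space \<mu> = UNIV"
  using sets_eq_imp_space_eq[OF siv_sets] by simp

lemma siv_AE: "siv \<mu> \<Longrightarrow> AE y in \<mu>. y \<in> X"
  by (rule prob_space.AE_prob_1[OF siv_prob])
    (auto simp: shift_inv_measure_def measure_def)

lemma siv_emeasure_shiftn:
  assumes "siv \<mu>" "A \<in> sets MX"
  shows "emeasure \<mu> (shiftn j -` A) = emeasure \<mu> A"
  using assms(2)
proof (induction j arbitrary: A rule: int_induct[where k = 0])
  case base
  then show ?case by (simp add: vimage_def)
next
  case (step1 i)
  have m: "shiftn i -` A \<in> sets MX" using measurable_sets[OF measurable_shiftn step1.prems] by simp
  have "shiftn (i + 1) -` A = shift -` (shiftn i -` A)" by (auto simp: shift_shiftn)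
  then show ?case using step1 m assms(1) by (simp add: shift_inv_measure_def)
next
  case (step2 i)
  have m: "shiftn (i - 1) -` A \<in> sets MX" using measurable_sets[OF measurable_shiftn step2.prems] by simp
  have "shiftn i -` A = shift -` (shiftn (i - 1) -` A)" by (auto simp: shift_shiftn)
  then have "emeasure \<mu> (shiftn i -` A) = emeasure \<mu> (shiftn (i - 1) -` A)"
    using m assms(1) by (simp add: shift_inv_measure_def)
  then show ?case using step2.IH[OF step2.prems] by metis
qed

lemma siv_distr:
  assumes "siv \<mu>"
  shows "distr \<mu> MX (shiftn j) = \<mu>"
proof (rule measure_eqI)
  fix A assume "A \<in> sets (distr \<mu> MX (shiftn j))"
  then have A: "A \<in> sets MX" by simp
  have "shiftn j \<in> measurable \<mu> MX" using measurable_shiftn measurable_cong_sets[OF siv_sets[OF assms] refl] by blast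
  then show "emeasure (distr \<mu> MX (shiftn j)) A = emeasure \<mu> A"
    using siv_emeasure_shiftn[OF assms A] A by (simp add: emeasure_distr siv_space[OF assms])
qed (simp add: siv_sets[OF assms])

lemma siv_nn_integral_shiftn:
  assumes "siv \<mu>" "F \<in> borel_measurable MX"
  shows "(\<integral>\<^sup>+y. F (shiftn j y) \<partial>\<mu>) = (\<integral>\<^sup>+y. F y \<partial>\<mu>)"
proof -
  have m: "shiftn j \<in> measurable \<mu> MX"
    using measurable_shiftn measurable_cong_sets[OF siv_sets[OF assms(1)] refl] by blast
  have "(\<integral>\<^sup>+y. F y \<partial>distr \<mu> MX (shiftn j)) = (\<integral>\<^sup>+y. F (shiftn j y) \<partial>\<mu>)"
    by (rule nn_integral_distr[OF m]) (simp add: assms(2))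
  then show ?thesis by (simp only: siv_distr[OF assms(1)])
qed

lemma siv_measurable: "siv \<mu> \<Longrightarrow> f \<in> measurable MX N \<Longrightarrow> f \<in> measurable \<mu> N"
  using measurable_cong_sets[OF siv_sets refl] by blast

section \<open>Kac's formula and cell densities\<close>

lemma cell_shift_back:
  assumes "y \<in> X" "i < length (snd c)"
  shows "cell n (shiftn (- int i) y) = Some c \<longleftrightarrow> c = (cx n y 0, cv n y 0) \<and> int i = ck n y"
proof
  assume *: "cell n (shiftn (- int i) y) = Some c"
  obtain a w where c: "c = (a, w)" by fastforce
  obtain x v where d: "ldata n (shiftn (- int i) y) x 0 v" "x 0 = a" "v 0 = w"
    using *[unfolded c] by (rule cell_SomeE)
  from level_data_inside[OF d(1), of 0 "int i"] assms(2) d c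
  have "ldata n y x (int i) v" by simp
  from level_data_cD[OF this] show "c = (cx n y 0, cv n y 0) \<and> int i = ck n y" using d c by simp
next
  assume *: "c = (cx n y 0, cv n y 0) \<and> int i = ck n y"
  have d: "ldata n y (cx n y) (ck n y) (cv n y)" using level_data_c assms(1) .
  then have "cv n y 0 \<noteq> []" using level_data_NE by blast
  then have "ldata n (shiftn (- int i) y) (cx n y) 0 (cv n y)"
    using level_data_shiftn[OF d, of 0 "- int i"] * by simp
  then show "cell n (shiftn (- int i) y) = Some c" using cell_level_data * by simp
qed

text \<open>The positions inside the cells form Rokhlin towers that partition \<open>X\<close>;
  shift invariance moves every floor back to the base of its tower.\<close>

lemma kac:
  assumes "siv \<mu>" "F \<in> borel_measurable MX"
  shows "(\<integral>\<^sup>+y. F y \<partial>\<mu>) = (\<Sum>c\<in>cells n. \<integral>\<^sup>+y. (\<Sum>i<length (snd c). F (shiftn (int i) y))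
     * indicator {y. cell n y = Some c} y \<partial>\<mu>)"
proof -
  let ?I = "\<lambda>c. indicator {y. cell n y = Some c} :: _ \<Rightarrow> ennreal"
  have Im: "(\<lambda>y. ?I c (shiftn j y)) \<in> borel_measurable MX" for c j
    by (rule measurable_compose[OF measurable_shiftn borel_measurable_indicator[OF cell_sets]])
  have Fm: "(\<lambda>y. F (shiftn j y)) \<in> borel_measurable MX" for j
    by (rule measurable_compose[OF measurable_shiftn assms(2)])
  have m1: "(\<lambda>y. F y * ?I c (shiftn j y)) \<in> borel_measurable MX" for c j
    using assms(2) Im by (rule borel_measurable_times_ennreal)
  have m2: "(\<lambda>y. F (shiftn j y) * ?I c y) \<in> borel_measurable MX" for c j
    using Fm Im[of c 0] unfolding shiftn_0 by (rule borel_measurable_times_ennreal)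
  \<comment> \<open>Exactly one term survives: the cell over the origin, with the offset of the
    origin in it.\<close>
  have pt: "F y = (\<Sum>c\<in>cells n. \<Sum>i<length (snd c). F y * ?I c (shiftn (- int i) y))" if "y \<in> X" for y
  proof -
    define c0 where "c0 = (cx n y 0, cv n y 0)"
    have d: "ldata n y (cx n y) (ck n y) (cv n y)" using level_data_c that .
    have c0: "(c0, nat (ck n y)) \<in> Sigma (cells n) (\<lambda>c. {..<length (snd c)})"
      using d by (auto simp: c0_def cells_def level_data_def)
    have "(\<Sum>c\<in>cells n. \<Sum>i<length (snd c). F y * ?I c (shiftn (- int i) y))
      = (\<Sum>(c, i)\<in>Sigma (cells n) (\<lambda>c. {..<length (snd c)}). F y * ?I c (shiftn (- int i) y))"
      by (rule sum.Sigma) auto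
    also have "\<dots> = (\<Sum>p\<in>Sigma (cells n) (\<lambda>c. {..<length (snd c)}). if p = (c0, nat (ck n y)) then F y else 0)"
    proof (intro sum.cong refl)
      fix p assume p: "p \<in> Sigma (cells n) (\<lambda>c. {..<length (snd c)})"
      obtain c i where ci: "p = (c, i)" by fastforce
      then have "i < length (snd c)" using p by auto
      from cell_shift_back[OF that this, of n]
      show "(case p of (c, i) \<Rightarrow> F y * ?I c (shiftn (- int i) y)) = (if p = (c0, nat (ck n y)) then F y else 0)"
        using d by (auto simp: ci c0_def indicator_def level_data_def)
    qed
    also have "\<dots> = F y" using c0 by (simp add: sum.delta)
    finally show ?thesis by simp
  qed
  have "(\<integral>\<^sup>+y. F y \<partial>\<mu>) = (\<integral>\<^sup>+y. (\<Sum>c\<in>cells n. \<Sum>i<length (snd c). F y * ?I c (shiftn (- int i) y)) \<partial>\<mu>)"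
    by (rule nn_integral_cong_AE) (use siv_AE[OF assms(1)] pt in auto)
  also have "\<dots> = (\<Sum>c\<in>cells n. \<Sum>i<length (snd c). \<integral>\<^sup>+y. F y * ?I c (shiftn (- int i) y) \<partial>\<mu>)"
    by (subst nn_integral_sum, intro borel_measurable_sum siv_measurable[OF assms(1)] m1)
      (intro sum.cong refl nn_integral_sum siv_measurable[OF assms(1)] m1)
  also have "\<dots> = (\<Sum>c\<in>cells n. \<Sum>i<length (snd c). \<integral>\<^sup>+y. F (shiftn (int i) y) * ?I c y \<partial>\<mu>)"
  proof (intro sum.cong refl)
    fix c i
    show "(\<integral>\<^sup>+y. F y * ?I c (shiftn (- int i) y) \<partial>\<mu>) = (\<integral>\<^sup>+y. F (shiftn (int i) y) * ?I c y \<partial>\<mu>)"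
      using siv_nn_integral_shiftn[OF assms(1) m1, of "int i" c "- int i"] by simp
  qed
  also have "\<dots> = (\<Sum>c\<in>cells n. \<integral>\<^sup>+y. (\<Sum>i<length (snd c). F (shiftn (int i) y)) * ?I c y \<partial>\<mu>)"
    by (intro sum.cong refl, subst sum_distrib_right, subst nn_integral_sum)
      (auto intro!: siv_measurable[OF assms(1)] m2)
  finally show ?thesis .
qed

definition dens :: "(int \<Rightarrow> 'a) measure \<Rightarrow> nat \<Rightarrow> 'a \<times> 'a list \<Rightarrow> real" where
  "dens \<mu> n c = measure \<mu> {y. cell n y = Some c}"

lemma dens_nonneg [simp]: "0 \<le> dens \<mu> n c"
  by (simp add: dens_def)

lemma emeasure_cell: "siv \<mu> \<Longrightarrow> emeasure \<mu> {y. cell n y = Some c} = ennreal (dens \<mu> n c)"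
  unfolding dens_def using finite_measure.emeasure_eq_measure prob_space.finite_measure siv_prob by metis

lemma kac_const:
  assumes "siv \<mu>" "F \<in> borel_measurable MX"
    and "\<And>c y. cell n y = Some c \<Longrightarrow> (\<Sum>i<length (snd c). F (shiftn (int i) y)) = ennreal (H c)" "\<And>c. 0 \<le> H c"
  shows "(\<integral>\<^sup>+y. F y \<partial>\<mu>) = ennreal (\<Sum>c\<in>cells n. dens \<mu> n c * H c)"
proof -
  have [measurable_cong]: "sets \<mu> = sets MX" using siv_sets[OF assms(1)] .
  have "(\<integral>\<^sup>+y. F y \<partial>\<mu>) = (\<Sum>c\<in>cells n. \<integral>\<^sup>+y. ennreal (H c) * indicator {y. cell n y = Some c} y \<partial>\<mu>)"
    unfolding kac[OF assms(1,2), of n]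
    by (intro sum.cong refl nn_integral_cong) (auto simp: assms(3) split: split_indicator)
  also have "\<dots> = (\<Sum>c\<in>cells n. ennreal (dens \<mu> n c * H c))"
    by (intro sum.cong refl)
      (simp add: nn_integral_cmult_indicator emeasure_cell[OF assms(1)] ennreal_mult[symmetric] assms(4) mult.commute)
  finally show ?thesis using assms(4) by (simp add: sum_ennreal)
qed

text \<open>Only the upper estimate is stated, since \<open>measure_approx\<close> gets the lower
  one by applying it to the complement.\<close>

lemma kac_upper:
  assumes "siv \<mu>" "A \<in> sets MX"
    and "\<And>c y. cell n y = Some c \<Longrightarrow> (\<Sum>i<length (snd c). indicator A (shiftn (int i) y)) \<le> H c" "\<And>c. 0 \<le> (H c :: real)"
  shows "measure \<mu> A \<le> (\<Sum>c\<in>cells n. dens \<mu> n c * H c)"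
proof -
  have [measurable_cong]: "sets \<mu> = sets MX" using siv_sets[OF assms(1)] .
  interpret prob_space \<mu> using siv_prob[OF assms(1)] .
  have i: "(\<Sum>i<length (snd c). indicator A (shiftn (int i) y)) \<le> ennreal (H c)" if "cell n y = Some c" for c y
  proof -
    have "(\<Sum>i<length (snd c). indicator A (shiftn (int i) y)) = ennreal (\<Sum>i<length (snd c). indicator A (shiftn (int i) y))"
      by (subst sum_ennreal[symmetric], simp, simp only: ennreal_indicator)
    then show ?thesis using assms(3)[OF that] by (simp add: ennreal_leI)
  qed
  have "emeasure \<mu> A = (\<integral>\<^sup>+y. indicator A y \<partial>\<mu>)" using assms(2) by (simp add: siv_sets[OF assms(1)])
  also have "\<dots> \<le> (\<Sum>c\<in>cells n. \<integral>\<^sup>+y. ennreal (H c) * indicator {y. cell n y = Some c} y \<partial>\<mu>)"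
    unfolding kac[OF assms(1) borel_measurable_indicator[OF assms(2)], of n]
    by (intro sum_mono nn_integral_mono) (auto simp: i split: split_indicator)
  also have "\<dots> = (\<Sum>c\<in>cells n. ennreal (dens \<mu> n c * H c))"
    by (intro sum.cong refl)
      (simp add: nn_integral_cmult_indicator emeasure_cell[OF assms(1)] ennreal_mult[symmetric] assms(4) mult.commute)
  also have "\<dots> = ennreal (\<Sum>c\<in>cells n. dens \<mu> n c * H c)" using assms(4) by (simp add: sum_ennreal)
  finally show ?thesis using assms(4)
    by (simp add: emeasure_eq_measure sum_nonneg)
qed

lemma dens_total: "siv \<mu> \<Longrightarrow> (\<Sum>c\<in>cells n. dens \<mu> n c * real (length (snd c))) = 1"
proof -
  assume s: "siv \<mu>"
  interpret prob_space \<mu> using siv_prob[OF s] .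
  have "(\<integral>\<^sup>+y. 1 \<partial>\<mu>) = ennreal (\<Sum>c\<in>cells n. dens \<mu> n c * real (length (snd c)))"
    by (rule kac_const[OF s]) (auto simp: ennreal_of_nat_eq_real_of_nat)
  then have "ennreal (\<Sum>c\<in>cells n. dens \<mu> n c * real (length (snd c))) = 1" by (simp add: emeasure_space_1)
  then show ?thesis by (simp add: sum_nonneg)
qed

definition weight :: "(nat \<Rightarrow> 'a \<times> 'a list \<Rightarrow> real) \<Rightarrow> bool" where
  "weight d \<longleftrightarrow> (\<forall>n c. 0 \<le> d n c) \<and> (\<forall>n. (\<Sum>c\<in>cells n. d n c * real (length (snd c))) = 1)"

lemma weight_dens: "siv \<mu> \<Longrightarrow> weight (dens \<mu>)"
  by (simp add: weight_def dens_total)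

text \<open>Level-n cells have at least \<open>lgrow * lam ^ n\<close> letters, so cuts are rare.
  All edge-effect estimates come from this rate.\<close>

lemma weight_sum_le:
  assumes "weight d"
  shows "(\<Sum>c\<in>cells n. d n c) \<le> 1 / (lgrow * lam ^ n)"
proof -
  have p: "0 < lgrow * lam ^ n" using lgrow_pos lam_gt_1 by simp
  have "lgrow * lam ^ n * (\<Sum>c\<in>cells n. d n c) \<le> (\<Sum>c\<in>cells n. d n c * real (length (snd c)))"
    unfolding sum_distrib_left
    by (intro sum_mono) (use length_pw_ge assms in \<open>auto simp: cells_def weight_def mult.commute intro!: mult_left_mono\<close>)
  also have "\<dots> = 1" using assms by (simp add: weight_def)
  finally show ?thesis using p by (simp add: field_simps)
qed

lemma weight_sum_tendsto:
  assumes "weight d"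
  shows "(\<lambda>n. \<Sum>c\<in>cells n. d n c) \<longlonglongrightarrow> 0"
proof (rule tendsto_sandwich[of "\<lambda>_. 0" _ _ "\<lambda>n. 1 / (lgrow * lam ^ n)"])
  have "(\<lambda>n. 1 / lgrow * (1 / lam) ^ n) \<longlonglongrightarrow> 1 / lgrow * 0"
    by (intro tendsto_intros LIMSEQ_realpow_zero) (use lam_gt_1 in auto)
  then show "(\<lambda>n. 1 / (lgrow * lam ^ n)) \<longlonglongrightarrow> 0" by (simp add: power_divide)
  show "\<forall>\<^sub>F n in sequentially. 0 \<le> (\<Sum>c\<in>cells n. d n c)"
    using assms unfolding weight_def by (intro always_eventually allI sum_nonneg) blast
  show "\<forall>\<^sub>F n in sequentially. (\<Sum>c\<in>cells n. d n c) \<le> 1 / (lgrow * lam ^ n)"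
    using weight_sum_le[OF assms] by simp
qed simp

definition occ :: "nat \<Rightarrow> 'a \<times> 'a list \<Rightarrow> (int \<Rightarrow> 'a) set \<Rightarrow> real" where
  "occ n c A = (\<Sum>i<length (snd c). indicator A (shiftn (int i) (samp n c)))"

lemma occ_nonneg: "0 \<le> occ n c A"
  by (simp add: occ_def sum_nonneg)

text \<open>Away from both ends of the cell the window lies inside the cell, where \<open>y\<close>
  and the sample show the same letters; at most \<open>R\<close> positions at each end
  remain.\<close>

lemma occ_approx:
  assumes A: "windowed R A" and y: "cell n y = Some c"
  shows "\<bar>(\<Sum>i<length (snd c). indicator A (shiftn (int i) y)) - occ n c A\<bar> \<le> 2 * real R"
proof -
  obtain a w where c: "c = (a, w)" by fastforce
  let ?y' = "samp n c" and ?S = "{i. i < length w \<and> (i < R \<or> length w \<le> i + R)}"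
  have y': "cell n ?y' = Some c" using cell_samp cell_in_cells y by blast
  have eq: "indicator A (shiftn (int i) y) = (indicator A (shiftn (int i) ?y') :: real)"
    if i: "R \<le> i" "i + R < length w" for i
  proof -
    have ag: "shiftn (int i) y j = shiftn (int i) ?y' j" if "\<bar>j\<bar> \<le> int R" for j
    proof -
      have "nat (j + int i) < length w" "int (nat (j + int i)) = j + int i" using i that by auto
      then show ?thesis using cell_word y y' c unfolding shiftn_apply by metis
    qed
    have "shiftn (int i) y \<in> A \<longleftrightarrow> shiftn (int i) ?y' \<in> A" using A ag unfolding windowed_def by blast
    then show ?thesis by (simp add: indicator_def)
  qed
  have "\<bar>(\<Sum>i<length (snd c). indicator A (shiftn (int i) y)) - occ n c A\<bar>
    \<le> (\<Sum>i<length w. \<bar>indicator A (shiftn (int i) y) - indicator A (shiftn (int i) ?y')\<bar>)"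
    unfolding occ_def by (simp add: c sum_subtractf[symmetric])
  also have "\<dots> \<le> (\<Sum>i<length w. if i \<in> ?S then 1 else 0)"
  proof (intro sum_mono)
    fix i assume "i \<in> {..<length w}"
    then show "\<bar>indicator A (shiftn (int i) y) - indicator A (shiftn (int i) ?y')\<bar> \<le> (if i \<in> ?S then 1 else (0 :: real))"
      using eq[of i] by (cases "i \<in> ?S") (auto simp: indicator_def)
  qed
  also have "\<dots> = real (card ?S)"
    by (subst sum.If_cases) (auto intro!: arg_cong[where f = card])
  also have "card ?S \<le> card ({..<R} \<union> {length w - R..<length w})" by (intro card_mono) auto
  also have "\<dots> \<le> card {..<R} + card {length w - R..<length w}" by (rule card_Un_le)
  also have "\<dots> \<le> 2 * R" by simp
  finally show ?thesis by simp
qed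

lemma measure_approx:
  assumes s: "siv \<mu>" and A: "windowed R A"
  shows "\<bar>measure \<mu> A - (\<Sum>c\<in>cells n. dens \<mu> n c * occ n c A)\<bar> \<le> 2 * real R * (\<Sum>c\<in>cells n. dens \<mu> n c)"
proof -
  interpret prob_space \<mu> using siv_prob[OF s] .
  have up: "measure \<mu> B \<le> (\<Sum>c\<in>cells n. dens \<mu> n c * occ n c B) + 2 * real R * (\<Sum>c\<in>cells n. dens \<mu> n c)"
    if B: "windowed R B" for B
  proof -
    have "measure \<mu> B \<le> (\<Sum>c\<in>cells n. dens \<mu> n c * (occ n c B + 2 * real R))"
    proof (rule kac_upper[OF s windowed_sets[OF B]])
      show "(\<Sum>i<length (snd c). indicator B (shiftn (int i) y)) \<le> occ n c B + 2 * real R" if "cell n y = Some c" for c y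
        using occ_approx[OF B that] by linarith
    qed (simp add: occ_nonneg)
    then show ?thesis by (simp add: algebra_simps sum.distrib sum_distrib_left)
  qed
  have "measure \<mu> (- A) = 1 - measure \<mu> A"
    using prob_compl[of A] windowed_sets[OF A] by (simp add: siv_sets[OF s] siv_space[OF s] Compl_eq_Diff_UNIV)
  moreover have "occ n c (- A) = real (length (snd c)) - occ n c A" for c
    unfolding occ_def indicator_compl sum_subtractf by simp
  then have "(\<Sum>c\<in>cells n. dens \<mu> n c * occ n c (- A)) = 1 - (\<Sum>c\<in>cells n. dens \<mu> n c * occ n c A)"
    using dens_total[OF s, of n] by (simp add: right_diff_distrib sum_subtractf)
  ultimately show ?thesis using up[OF A] up[OF windowed_Compl[OF A]] by linarith
qed

text \<open>Densities determine the measure of a cylinder up to an error that vanishes with the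
  level, so agreement from a level \<open>N\<close> on suffices. In \<open>shuffle_invariant\<close>
  measures are compared only from the level of the shuffle on.\<close>

lemma siv_eqI:
  assumes s: "siv \<mu>" "siv \<mu>'" and e: "\<And>n c. N \<le> n \<Longrightarrow> c \<in> cells n \<Longrightarrow> dens \<mu> n c = dens \<mu>' n c"
  shows "\<mu> = \<mu>'"
proof (rule measure_eqI_generator_eq[where E = cylalg and \<Omega> = UNIV and A = "\<lambda>_. UNIV"])
  interpret algebra UNIV "cylalg :: (int \<Rightarrow> 'a) set set" by (rule cylalg_algebra)
  show "Int_stable cylalg" unfolding Int_stable_def cylalg_def
    by (clarsimp, metis windowed_Int windowed_mono max.cobounded1 max.cobounded2)
  show "sets \<mu> = sigma_sets UNIV cylalg" "sets \<mu>' = sigma_sets UNIV cylalg"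
    using siv_sets s sets_MX_cylalg by auto
  show "range (\<lambda>_::nat. UNIV) \<subseteq> (cylalg :: (int \<Rightarrow> 'a) set set)" using top by auto
  interpret m1: prob_space \<mu> using siv_prob[OF s(1)] .
  interpret m2: prob_space \<mu>' using siv_prob[OF s(2)] .
  show "emeasure \<mu> UNIV \<noteq> \<infinity>" using m1.emeasure_finite by simp
  fix A :: "(int \<Rightarrow> 'a) set" assume "A \<in> cylalg"
  then obtain R where A: "windowed R A" by (auto simp: cylalg_def)
  have "\<bar>measure \<mu> A - measure \<mu>' A\<bar> \<le> 4 * real R * (\<Sum>c\<in>cells n. dens \<mu> n c)" if "N \<le> n" for n
  proof -
    have "(\<Sum>c\<in>cells n. dens \<mu>' n c * occ n c A) = (\<Sum>c\<in>cells n. dens \<mu> n c * occ n c A)"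
      "(\<Sum>c\<in>cells n. dens \<mu>' n c) = (\<Sum>c\<in>cells n. dens \<mu> n c)" using e that by auto
    then have "\<bar>measure \<mu> A - measure \<mu>' A\<bar> \<le> 2 * real R * (\<Sum>c\<in>cells n. dens \<mu> n c) + 2 * real R * (\<Sum>c\<in>cells n. dens \<mu> n c)"
      using measure_approx[OF s(1) A, of n] measure_approx[OF s(2) A, of n] by (simp only:)
    then show ?thesis by simp
  qed
  moreover have "(\<lambda>n. 4 * real R * (\<Sum>c\<in>cells n. dens \<mu> n c)) \<longlonglongrightarrow> 4 * real R * 0"
    by (intro tendsto_intros weight_sum_tendsto weight_dens s)
  ultimately have "\<bar>measure \<mu> A - measure \<mu>' A\<bar> \<le> 4 * real R * 0"
    by (intro tendsto_lowerbound[where F = sequentially]) (auto simp: eventually_sequentially)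
  then show "emeasure \<mu> A = emeasure \<mu>' A" by (simp add: m1.emeasure_eq_measure m2.emeasure_eq_measure)
qed auto

end

section \<open>Measures from consistent cell weights\<close>

lemma sum_list_map_count:
  fixes h :: "'b \<Rightarrow> real"
  assumes "finite S" "set xs \<subseteq> S"
  shows "(\<Sum>c\<leftarrow>xs. h c) = (\<Sum>c\<in>S. real (count_list xs c) * h c)"
  using assms(2)
proof (induction xs)
  case (Cons x xs)
  have "(\<Sum>c\<in>S. real (count_list (x # xs) c) * h c)
    = (\<Sum>c\<in>S. (if c = x then h c else 0) + real (count_list xs c) * h c)"
    by (rule sum.cong) (auto simp: algebra_simps)
  then show ?case using Cons assms(1) by (simp add: sum.distrib)
qed simp

text \<open>Compactness of the full shift, in the form that yields countable additivity of a content
  on cylinders.\<close>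

lemma cylalg_compact:
  fixes A :: "nat \<Rightarrow> (int \<Rightarrow> 'a::finite) set"
  assumes "range A \<subseteq> cylalg" "decseq A" "\<And>i. A i \<noteq> {}"
  shows "(\<Inter>i. A i) \<noteq> {}"
proof -
  obtain y where y: "\<And>i. y i \<in> A i"
    using that[of "\<lambda>i. SOME y. y \<in> A i"] assms(3) by (simp add: some_in_eq)
  obtain r g where r: "strict_mono r" and g: "\<And>i. \<forall>\<^sub>F m in sequentially. y (r m) i = g i"
    by (rule diagonal_limit[of "\<lambda>_. UNIV" y]) (simp, simp, blast)
  have "g \<in> A j" for j
  proof -
    obtain R where R: "windowed R (A j)" using assms(1) by (auto simp: cylalg_def)
    have "\<forall>\<^sub>F m in sequentially. \<forall>i\<in>{- int R..int R}. y (r m) i = g i"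
      using eventually_agree[of "\<lambda>m. y (r m)" g] g by blast
    then have "\<forall>\<^sub>F m in sequentially. g \<in> A j"
      using eventually_ge_at_top[of j]
    proof eventually_elim
      case (elim m)
      have "j \<le> r m" using seq_suble[OF r, of m] elim by simp
      then have "y (r m) \<in> A j" using decseqD[OF assms(2)] y by blast
      then show ?case using R elim(1) unfolding windowed_def by (metis abs_le_iff atLeastAtMost_iff minus_le_iff)
    qed
    then show ?thesis by simp
  qed
  then show ?thesis by blast
qed

context recog_subst
begin

text \<open>The level-n cells into which a cell of level n + 1 is subdivided.\<close>
definition kids :: "nat \<Rightarrow> 'a \<times> 'a list \<Rightarrow> ('a \<times> 'a list) list" where
  "kids n C = (THE l. \<exists>u ws. parse 1 n (fst C) (snd C) u ws \<and> l = zip u ws)"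

lemma kids_eq: "parse 1 n b W u ws \<Longrightarrow> kids n (b, W) = zip u ws"
  unfolding kids_def by (rule the_equality) (use parse_unique in force)+

lemma kids_parse:
  assumes "C \<in> cells (Suc n)"
  obtains u ws where "parse 1 n (fst C) (snd C) u ws" "kids n C = zip u ws" "length ws = length u"
proof -
  have "snd C \<in> pw (1 + n) (fst C)" using assms by (auto simp: cells_def)
  then obtain u ws where p: "parse 1 n (fst C) (snd C) u ws" using parse_ex by blast
  then have "kids n C = zip u ws" using kids_eq by (metis prod.collapse)
  moreover have "length ws = length u" using p list_all2_lengthD by (auto simp: parse_def)
  ultimately show ?thesis using p that by blast
qed

lemma kids_cells: "C \<in> cells (Suc n) \<Longrightarrow> set (kids n C) \<subseteq> cells n"
  by (erule kids_parse) (auto simp: parse_def cells_def set_zip list_all2_conv_all_nth)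

lemma sum_list_zip:
  "length ws = length u \<Longrightarrow> (\<Sum>c\<leftarrow>zip u ws. h c) = (\<Sum>j<length u. h (u ! j, ws ! j))"
  by (simp add: sum_list_sum_nth atLeast0LessThan)

lemma kids_sum:
  assumes "cell (Suc n) y = Some C"
  shows "(\<Sum>i<length (snd C). oval h (cell n (shiftn (int i) y))) = (\<Sum>c\<leftarrow>kids n C. h c)"
proof -
  have "C \<in> cells (Suc n)" using cell_in_cells[OF assms] .
  then obtain u ws where p: "parse 1 n (fst C) (snd C) u ws" "kids n C = zip u ws" "length ws = length u"
    by (rule kids_parse)
  have "cell (1 + n) y = Some (fst C, snd C)" using assms by simp
  from nested_sum[OF this p(1), of h] show ?thesis using p(2,3) sum_list_zip by metis
qed

text \<open>Densities count starting points of cells, hence the multiplicities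
  \<open>count_list\<close> instead of an inclusion of sets.\<close>

definition consistent :: "(nat \<Rightarrow> 'a \<times> 'a list \<Rightarrow> real) \<Rightarrow> bool" where
  "consistent d \<longleftrightarrow> weight d \<and>
     (\<forall>n. \<forall>c\<in>cells n. d n c = (\<Sum>C\<in>cells (Suc n). d (Suc n) C * real (count_list (kids n C) c)))"

lemma weight_nonneg: "weight d \<Longrightarrow> 0 \<le> d n c"
  unfolding weight_def by blast

lemma consistent_weight: "consistent d \<Longrightarrow> weight d"
  by (simp add: consistent_def)

lemma consistent_eq:
  "consistent d \<Longrightarrow> c \<in> cells n \<Longrightarrow> d n c = (\<Sum>C\<in>cells (Suc n). d (Suc n) C * real (count_list (kids n C) c))"
  by (simp only: consistent_def)

lemma consistent_sum:
  assumes "consistent d"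
  shows "(\<Sum>C\<in>cells (Suc n). d (Suc n) C * (\<Sum>c\<leftarrow>kids n C. h c)) = (\<Sum>c\<in>cells n. d n c * h c)"
proof -
  have "(\<Sum>c\<in>cells n. d n c * h c)
      = (\<Sum>c\<in>cells n. \<Sum>C\<in>cells (Suc n). d (Suc n) C * (real (count_list (kids n C) c) * h c))"
    by (intro sum.cong refl, subst consistent_eq[OF assms], assumption)
      (simp only: sum_distrib_right mult.assoc)
  also have "\<dots> = (\<Sum>C\<in>cells (Suc n). \<Sum>c\<in>cells n. d (Suc n) C * (real (count_list (kids n C) c) * h c))"
    by (rule sum.swap)
  also have "\<dots> = (\<Sum>C\<in>cells (Suc n). d (Suc n) C * (\<Sum>c\<leftarrow>kids n C. h c))"
    by (rule sum.cong) (simp_all add: sum_list_map_count[OF finite_cells kids_cells] sum_distrib_left)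
  finally show ?thesis by simp
qed

text \<open>Kac's formula at level \<open>Suc n\<close>, applied to the indicator of a level-n cell:
  over a coarser cell it sums up to the count in \<open>kids\<close>.\<close>

lemma dens_consistent:
  assumes s: "siv \<mu>"
  shows "consistent (dens \<mu>)"
  unfolding consistent_def
proof (intro conjI allI ballI weight_dens s)
  fix n c assume "c \<in> cells n"
  let ?h = "\<lambda>c'. if c' = c then 1 else (0 :: ennreal)"
  let ?F = "\<lambda>y. indicator {y. cell n y = Some c} y :: ennreal"
  have F: "?F y = oval ?h (cell n y)" for y by (cases "cell n y") auto
  have "(\<integral>\<^sup>+y. ?F y \<partial>\<mu>) = ennreal (\<Sum>C\<in>cells (Suc n). dens \<mu> (Suc n) C * real (count_list (kids n C) c))"
  proof (rule kac_const[OF s])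
    fix C y assume C: "cell (Suc n) y = Some C"
    have "(\<Sum>i<length (snd C). ?F (shiftn (int i) y)) = (\<Sum>c'\<leftarrow>kids n C. ?h c')"
      unfolding F by (rule kids_sum[OF C])
    also have "(\<Sum>c'\<leftarrow>xs. ?h c') = of_nat (count_list xs c)" for xs
      by (induction xs) auto
    finally show "(\<Sum>i<length (snd C). ?F (shiftn (int i) y)) = ennreal (real (count_list (kids n C) c))"
      by (simp add: ennreal_of_nat_eq_real_of_nat)
  qed (auto simp: cell_sets)
  then have "ennreal (dens \<mu> n c) = ennreal (\<Sum>C\<in>cells (Suc n). dens \<mu> (Suc n) C * real (count_list (kids n C) c))"
    by (simp add: emeasure_cell[OF s] siv_sets[OF s] cell_sets)
  then show "dens \<mu> n c = (\<Sum>C\<in>cells (Suc n). dens \<mu> (Suc n) C * real (count_list (kids n C) c))"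
    by (simp add: sum_nonneg)
qed

text \<open>The sample of \<open>C\<close>, read from the start of one of its subcells, is a point
  with that subcell at the origin; it differs from the subcell's own sample by at most
  \<open>B\<close>.\<close>

lemma occ_kids:
  assumes C: "C \<in> cells (Suc n)"
    and B: "\<And>c y. cell n y = Some c \<Longrightarrow> \<bar>(\<Sum>i<length (snd c). indicator A (shiftn (int i) y)) - occ n c A\<bar> \<le> B"
  shows "\<bar>occ (Suc n) C A - (\<Sum>c\<leftarrow>kids n C. occ n c A)\<bar> \<le> (\<Sum>c\<leftarrow>kids n C. B)"
proof -
  obtain u ws where p: "parse 1 n (fst C) (snd C) u ws" "kids n C = zip u ws" "length ws = length u"
    using C by (rule kids_parse)
  let ?y = "samp (Suc n) C"
  have "cell (1 + n) ?y = Some (fst C, snd C)" using cell_samp[OF C] by simp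
  then obtain x v where 1: "ldata n ?y x 0 v" "win x 0 (length u) = u" "win v 0 (length u) = ws"
    "wpos v (int (length u)) = int (length (snd C))" using parse_level_data[OF _ p(1)] by metis
  have xv: "x (int j) = u ! j \<and> v (int j) = ws ! j" if "j < length u" for j
    using 1(2,3) that nth_win[of j "length u" x 0] nth_win[of j "length u" v 0] by simp
  have NEv: "NE v" using level_data_NE[OF 1(1)] .
  have c: "cell n (shiftn (wpos v (int j)) ?y) = Some (u ! j, ws ! j)" if "j < length u" for j
    using cell_inside[OF 1(1), of "int j" "wpos v (int j)"] xv[OF that] wpos_less_iff[OF NEv] by simp
  have "occ (Suc n) C A = (\<Sum>j<length u. \<Sum>i<length (ws ! j). indicator A (shiftn (int i) (shiftn (wpos v (int j)) ?y)))"
  proof -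
    have "occ (Suc n) C A = (\<Sum>i<nat (wpos v (int (length u))). indicator A (shiftn (int i) ?y))"
      by (simp add: occ_def 1(4))
    also have "\<dots> = (\<Sum>j<length u. \<Sum>i<length (v (int j)). indicator A (shiftn (int (nat (wpos v (int j)) + i)) ?y))"
      by (rule sum_wpos)
    also have "\<dots> = (\<Sum>j<length u. \<Sum>i<length (ws ! j). indicator A (shiftn (int i) (shiftn (wpos v (int j)) ?y)))"
    proof (intro sum.cong)
      fix j assume "j \<in> {..<length u}"
      then show "{..<length (v (int j))} = {..<length (ws ! j)}" using xv by simp
      fix i
      have "0 \<le> wpos v (int j)" using wpos_ge[OF NEv, of "int j"] by simp
      then show "indicator A (shiftn (int (nat (wpos v (int j)) + i)) ?y)
        = (indicator A (shiftn (int i) (shiftn (wpos v (int j)) ?y)) :: real)" by (simp add: add.commute)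
    qed simp
    finally show ?thesis .
  qed
  then have "\<bar>occ (Suc n) C A - (\<Sum>c\<leftarrow>kids n C. occ n c A)\<bar>
    = \<bar>\<Sum>j<length u. (\<Sum>i<length (ws ! j). indicator A (shiftn (int i) (shiftn (wpos v (int j)) ?y))) - occ n (u ! j, ws ! j) A\<bar>"
    using p(2,3) by (simp add: sum_list_zip sum_subtractf)
  also have "\<dots> \<le> (\<Sum>j<length u. B)"
    by (rule order_trans[OF sum_abs sum_mono]) (use B[OF c] in auto)
  also have "\<dots> = (\<Sum>c\<leftarrow>kids n C. B)" using p(2,3) by (simp add: sum_list_zip)
  finally show ?thesis .
qed

section \<open>Empirical frequencies and the measure that they define\<close>

text \<open>Frequency of \<open>A\<close> when every level-n cell is replaced by its sample. The
  measure to be constructed is the limit over \<open>n\<close>.\<close>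

definition emp :: "(nat \<Rightarrow> 'a \<times> 'a list \<Rightarrow> real) \<Rightarrow> nat \<Rightarrow> (int \<Rightarrow> 'a) set \<Rightarrow> real" where
  "emp d n A = (\<Sum>c\<in>cells n. d n c * occ n c A)"

text \<open>The error \<open>B\<close> is kept general: cylinders of radius \<open>R\<close> have
  \<open>2 * R\<close>, and a cell of a lower level has 0, since its occurrences in a coarser cell
  are the same for all points.\<close>

lemma emp_step:
  assumes d: "consistent d"
    and B: "\<And>c y. cell n y = Some c \<Longrightarrow> \<bar>(\<Sum>i<length (snd c). indicator A (shiftn (int i) y)) - occ n c A\<bar> \<le> B"
  shows "\<bar>emp d (Suc n) A - emp d n A\<bar> \<le> B * (\<Sum>c\<in>cells n. d n c)"
proof -
  have dn: "0 \<le> d n c" for n c using weight_nonneg[OF consistent_weight[OF d]] .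
  have "emp d (Suc n) A - emp d n A
    = (\<Sum>C\<in>cells (Suc n). d (Suc n) C * (occ (Suc n) C A - (\<Sum>c\<leftarrow>kids n C. occ n c A)))"
  proof -
    have "emp d n A = (\<Sum>C\<in>cells (Suc n). d (Suc n) C * (\<Sum>c\<leftarrow>kids n C. occ n c A))"
      unfolding emp_def by (rule consistent_sum[OF d, symmetric])
    then show ?thesis unfolding emp_def by (simp add: sum_subtractf right_diff_distrib)
  qed
  also have "\<bar>\<dots>\<bar> \<le> (\<Sum>C\<in>cells (Suc n). d (Suc n) C * (\<Sum>c\<leftarrow>kids n C. B))"
  proof (rule order_trans[OF sum_abs sum_mono])
    fix C assume "C \<in> cells (Suc n)"
    from occ_kids[OF this B] dn[of "Suc n" C]
    show "\<bar>d (Suc n) C * (occ (Suc n) C A - (\<Sum>c\<leftarrow>kids n C. occ n c A))\<bar> \<le> d (Suc n) C * (\<Sum>c\<leftarrow>kids n C. B)"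
      by (simp only: abs_mult abs_of_nonneg mult_left_mono)
  qed
  also have "\<dots> = B * (\<Sum>c\<in>cells n. d n c)"
    by (subst consistent_sum[OF d]) (simp add: sum_distrib_left mult.commute)
  finally show ?thesis .
qed

text \<open>The steps from one level to the next are bounded by a geometric series, because cuts
  have density of order \<open>1 / lam ^ n\<close>.\<close>

lemma emp_convergent:
  assumes d: "consistent d" and A: "windowed R A"
  shows "convergent (\<lambda>n. emp d n A)"
proof -
  have w: "weight d" using consistent_weight[OF d] .
  have "summable (\<lambda>n. emp d (Suc n) A - emp d n A)"
  proof (rule summable_comparison_test'[where N = 0])
    show "summable (\<lambda>n. 2 * real R / lgrow * (1 / lam) ^ n)"
      by (intro summable_mult summable_geometric) (use lam_gt_1 in auto)
    fix n :: nat
    have "\<bar>emp d (Suc n) A - emp d n A\<bar> \<le> 2 * real R * (\<Sum>c\<in>cells n. d n c)"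
      by (rule emp_step[OF d]) (rule occ_approx[OF A])
    also have "\<dots> \<le> 2 * real R * (1 / (lgrow * lam ^ n))"
      by (intro mult_left_mono weight_sum_le[OF w]) auto
    finally show "norm (emp d (Suc n) A - emp d n A) \<le> 2 * real R / lgrow * (1 / lam) ^ n"
      by (simp add: power_divide)
  qed
  then have "convergent (\<lambda>n. \<Sum>i<n. emp d (Suc i) A - emp d i A)"
    by (simp add: summable_iff_convergent)
  then have "convergent (\<lambda>n. emp d n A - emp d 0 A)"
    by (simp only: sum_lessThan_telescope[of "\<lambda>i. emp d i A"])
  from convergent_add[OF this convergent_const[of "emp d 0 A"]] show ?thesis by simp
qed

lemma occ_disjoint: "A \<inter> B = {} \<Longrightarrow> occ n c (A \<union> B) = occ n c A + occ n c B"
  by (simp add: occ_def indicator_add sum.distrib[symmetric])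

lemma occ_cong: "c \<in> cells n \<Longrightarrow> X \<inter> A = X \<inter> B \<Longrightarrow> occ n c A = occ n c B"
proof -
  assume c: "c \<in> cells n" and e: "X \<inter> A = X \<inter> B"
  have "samp n c \<in> X" using cell_samp[OF c] by (auto simp: cell_def split: if_splits)
  then have "shiftn (int i) (samp n c) \<in> X" for i by simp
  then have "shiftn (int i) (samp n c) \<in> A \<longleftrightarrow> shiftn (int i) (samp n c) \<in> B" for i using e by blast
  then show ?thesis by (simp add: occ_def indicator_def)
qed

lemma emp_cong: "X \<inter> A = X \<inter> B \<Longrightarrow> emp d n A = emp d n B"
  unfolding emp_def using occ_cong by (metis (no_types, lifting) sum.cong)

lemma occ_X: "c \<in> cells n \<Longrightarrow> X \<subseteq> A \<Longrightarrow> occ n c A = real (length (snd c))"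
  using occ_cong[of c n A UNIV] by (auto simp: occ_def inf.absorb1)

lemma emp_X: "weight d \<Longrightarrow> X \<subseteq> A \<Longrightarrow> emp d n A = 1"
  unfolding emp_def using occ_X by (simp add: weight_def)

text \<open>The difference telescopes to the two ends of the cell.\<close>

lemma occ_shift: "\<bar>occ n c (shift -` A) - occ n c A\<bar> \<le> 1"
proof -
  let ?f = "\<lambda>i. indicator A (shiftn (int i) (samp n c)) :: real"
  have "occ n c (shift -` A) - occ n c A = (\<Sum>i<length (snd c). ?f (Suc i) - ?f i)"
    unfolding occ_def sum_subtractf
    by (intro arg_cong2[where f = "(-)"] sum.cong) (auto simp: shift_shiftn add.commute split: split_indicator)
  also have "\<dots> = ?f (length (snd c)) - ?f 0" by (rule sum_lessThan_telescope)
  finally show ?thesis by (auto simp: indicator_def)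
qed

lemma windowed_shift: "windowed R A \<Longrightarrow> windowed (Suc R) (shift -` A)"
  unfolding windowed_def by (auto simp: shift_def)

lemma emp_shift:
  assumes "weight d"
  shows "\<bar>emp d n (shift -` A) - emp d n A\<bar> \<le> (\<Sum>c\<in>cells n. d n c)"
proof -
  have "emp d n (shift -` A) - emp d n A = (\<Sum>c\<in>cells n. d n c * (occ n c (shift -` A) - occ n c A))"
    by (simp add: emp_def sum_subtractf right_diff_distrib)
  also have "\<bar>\<dots>\<bar> \<le> (\<Sum>c\<in>cells n. d n c * 1)"
    by (rule order_trans[OF sum_abs sum_mono])
      (use weight_nonneg[OF assms] occ_shift in \<open>auto simp: abs_mult simp del: mult_1_right intro!: mult_left_mono\<close>)
  finally show ?thesis by simp
qed

text \<open>At level \<open>n\<close> the sample of a cell meets a level-n cut only at its first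
  position; on higher levels nothing changes, by \<open>emp_step\<close> with error 0.\<close>

lemma emp_cell:
  assumes d: "consistent d" and c: "c \<in> cells n"
  shows "emp d (n + m) {y. cell n y = Some c} = d n c"
proof (induction m)
  case 0
  have "occ n c' {y. cell n y = Some c} = (if c' = c then 1 else 0)" if "c' \<in> cells n" for c'
  proof -
    have "cell n (samp n c') = Some (fst c', snd c')" using cell_samp[OF that] by simp
    then obtain x v where "ldata n (samp n c') x 0 v" "x 0 = fst c'" "v 0 = snd c'" by (rule cell_SomeE)
    then have l: "ldata n (samp n c') x 0 v" "c' = (x 0, v 0)" by auto
    have "occ n c' {y. cell n y = Some c} = (\<Sum>i<nat (wpos v (int 1)). oval (\<lambda>c'. if c' = c then 1 else 0) (cell n (shiftn (int i) (samp n c'))))"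
      unfolding occ_def l(2) by (intro sum.cong) (auto simp: oval_def split: option.split)
    also have "\<dots> = (if c' = c then 1 else 0)" unfolding cell_sum_win[OF l(1)] by (simp add: l(2))
    finally show ?thesis .
  qed
  then have "emp d n {y. cell n y = Some c} = (\<Sum>c'\<in>cells n. if c' = c then d n c' else 0)"
    unfolding emp_def by (intro sum.cong) auto
  then show ?case using c by (simp add: sum.delta)
next
  case (Suc m)
  have "\<bar>emp d (Suc (n + m)) {y. cell n y = Some c} - emp d (n + m) {y. cell n y = Some c}\<bar> \<le> 0 * (\<Sum>c\<in>cells (n + m). d (n + m) c)"
  proof (rule emp_step[OF d])
    fix c' y assume c': "cell (n + m) y = Some c'"
    then have C: "cell (m + n) y = Some (fst c', snd c')" by (simp add: add.commute)
    then have "snd c' \<in> pw (m + n) (fst c')" using cell_SomeE by blast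
    then obtain u ws where p: "parse m n (fst c') (snd c') u ws" using parse_ex by blast
    have C': "cell (m + n) (samp (n + m) c') = Some (fst c', snd c')"
      using cell_samp[OF cell_in_cells[OF c']] by (simp add: add.commute)
    have o: "(indicator {y. cell n y = Some c} z :: real) = oval (\<lambda>c'. if c' = c then 1 else 0) (cell n z)" for z
      by (cases "cell n z") auto
    show "\<bar>(\<Sum>i<length (snd c'). indicator {y. cell n y = Some c} (shiftn (int i) y)) - occ (n + m) c' {y. cell n y = Some c}\<bar> \<le> 0"
      unfolding occ_def o nested_sum[OF C p] nested_sum[OF C' p] by simp
  qed
  then show ?case using Suc by simp
qed

theorem measure_from_consistent:
  assumes d: "consistent d"
  shows "\<exists>\<mu>. siv \<mu> \<and> (\<forall>n. \<forall>c\<in>cells n. dens \<mu> n c = d n c)"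
proof -
  interpret algebra UNIV "cylalg :: (int \<Rightarrow> 'a) set set" by (rule cylalg_algebra)
  have w: "weight d" using consistent_weight[OF d] .
  have dn: "0 \<le> d n c" for n c using weight_nonneg[OF w] .
  define l where "l A = lim (\<lambda>n. emp d n A)" for A
  have lim: "(\<lambda>n. emp d n A) \<longlonglongrightarrow> l A" if "A \<in> cylalg" for A
    using emp_convergent[OF d] that unfolding l_def cylalg_def by (auto simp: convergent_LIMSEQ_iff)
  have emp_nn: "0 \<le> emp d n A" for n A by (simp add: emp_def sum_nonneg dn occ_nonneg)
  have l0: "0 \<le> l A" if "A \<in> cylalg" for A
    by (rule tendsto_lowerbound[OF lim[OF that]]) (auto simp: emp_nn)
  have l_emp: "l {} = 0" using lim[of "{}"] by (simp add: emp_def occ_def LIMSEQ_const_iff)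
  have l_X: "l A = 1" if "A \<in> cylalg" "X \<subseteq> A" for A
    using lim[OF that(1)] emp_X[OF w that(2)] by (simp add: LIMSEQ_const_iff)
  have l_add: "l (A \<union> B) = l A + l B" if "A \<in> cylalg" "B \<in> cylalg" "A \<inter> B = {}" for A B
  proof (rule LIMSEQ_unique[OF lim])
    have "(\<lambda>n. emp d n A + emp d n B) \<longlonglongrightarrow> l A + l B" by (intro tendsto_add lim that)
    then show "(\<lambda>n. emp d n (A \<union> B)) \<longlonglongrightarrow> l A + l B"
      by (simp add: emp_def occ_disjoint[OF that(3)] sum.distrib distrib_left)
  qed (use that in auto)
  have "\<exists>\<nu>. (\<forall>s\<in>cylalg. \<nu> s = ennreal (l s)) \<and> measure_space UNIV (sigma_sets UNIV cylalg) \<nu>"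
  proof (rule caratheodory_empty_continuous)
    show "positive cylalg (\<lambda>s. ennreal (l s))" by (simp add: positive_def l_emp)
    show "additive cylalg (\<lambda>s. ennreal (l s))" by (auto simp: additive_def l_add l0)
    show "ennreal (l A) \<noteq> \<infinity>" for A by simp
    \<comment> \<open>Continuity at the empty set is compactness: decreasing cylinders with empty
      intersection are empty from some index on.\<close>
    fix A :: "nat \<Rightarrow> (int \<Rightarrow> 'a) set" assume A: "range A \<subseteq> cylalg" "decseq A" "(\<Inter>i. A i) = {}"
    then obtain j where "A j = {}" using cylalg_compact by blast
    then have "A i = {}" if "j \<le> i" for i using decseqD[OF A(2) that] by blast
    then have "\<forall>\<^sub>F i in sequentially. ennreal (l (A i)) = 0"
      unfolding eventually_sequentially by (intro exI[of _ j]) (simp add: l_emp)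
    then show "(\<lambda>i. ennreal (l (A i))) \<longlonglongrightarrow> 0" by (rule tendsto_eventually)
  qed
  then obtain \<nu> where nu: "\<And>s. s \<in> cylalg \<Longrightarrow> \<nu> s = ennreal (l s)" "measure_space UNIV (sigma_sets UNIV cylalg) \<nu>"
    by blast
  define \<mu> where "\<mu> = measure_of UNIV cylalg \<nu>"
  have sets_mu: "sets \<mu> = sets MX" unfolding \<mu>_def by (simp add: sets_MX_cylalg)
  have space_mu: "space \<mu> = UNIV" using sets_eq_imp_space_eq[OF sets_mu] by simp
  have em: "emeasure \<mu> A = ennreal (l A)" if "A \<in> cylalg" for A
  proof -
    have "sets \<mu> = sigma_sets UNIV cylalg" by (simp add: sets_mu sets_MX_cylalg)
    then have "emeasure \<mu> A = \<nu> A"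
      using nu(2) that by (intro emeasure_measure_of[OF \<mu>_def]) (auto simp: measure_space_def)
    then show ?thesis using nu(1)[OF that] by simp
  qed
  interpret mu: prob_space \<mu>
    by (rule prob_spaceI) (use em[of UNIV] l_X[of UNIV] top in \<open>simp add: space_mu\<close>)
  have mm: "measure \<mu> A = l A" if "A \<in> cylalg" for A
    using em[OF that] l0[OF that] by (simp add: measure_def)
  \<comment> \<open>\<open>X\<close> is the countable intersection of the cylinders of points with a
    legal word in a given window, and each of these cylinders has measure 1.\<close>
  have AEX: "AE y in \<mu>. y \<in> X"
  proof -
    have "AE y in \<mu>. legal \<sigma> (win y p n)" for p n
    proof -
      have "windowed (nat \<bar>p\<bar> + n) {y. legal \<sigma> (win y p n)}"
        unfolding windowed_def
      proof (intro allI impI)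
        fix y y' :: "int \<Rightarrow> 'a" assume "\<forall>i. \<bar>i\<bar> \<le> int (nat \<bar>p\<bar> + n) \<longrightarrow> y i = y' i"
        then have "win y p n = win y' p n" by (simp add: win_eq_iff)
        then show "y \<in> {y. legal \<sigma> (win y p n)} \<longleftrightarrow> y' \<in> {y. legal \<sigma> (win y p n)}" by simp
      qed
      then have c: "{y. legal \<sigma> (win y p n)} \<in> cylalg" by (auto simp: cylalg_def)
      have "l {y. legal \<sigma> (win y p n)} = 1" by (rule l_X[OF c]) (auto simp: subshift_iff)
      then show ?thesis using mm[OF c] mu.AE_prob_1[of "{y. legal \<sigma> (win y p n)}"] by simp
    qed
    then have "AE y in \<mu>. \<forall>p n. legal \<sigma> (win y p n)" by (simp add: AE_all_countable)
    then show ?thesis by (simp add: subshift_iff)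
  qed
  have "emeasure \<mu> X = 1"
    using mu.emeasure_eq_1_AE[of X] AEX X_sets by (simp add: sets_mu)
  moreover have inv: "emeasure \<mu> (shift -` A) = emeasure \<mu> A" if A: "A \<in> sets MX" for A
  proof -
    have m: "shift \<in> measurable \<mu> MX" unfolding shift_shiftn
      using measurable_shiftn measurable_cong_sets[OF sets_mu refl] by blast
    have "distr \<mu> MX shift = \<mu>"
    proof (rule measure_eqI_generator_eq[where E = cylalg and \<Omega> = UNIV and A = "\<lambda>_. UNIV"])
      show "Int_stable (cylalg :: (int \<Rightarrow> 'a) set set)" unfolding Int_stable_def cylalg_def
        by (clarsimp, metis windowed_Int windowed_mono max.cobounded1 max.cobounded2)
      show "range (\<lambda>_::nat. UNIV) \<subseteq> (cylalg :: (int \<Rightarrow> 'a) set set)" using top by auto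
      show "emeasure (distr \<mu> MX shift) UNIV \<noteq> \<infinity>"
        using m sets.top[of "MX :: (int \<Rightarrow> 'a) measure"] by (subst emeasure_distr) (auto simp: mu.emeasure_finite)
      fix B :: "(int \<Rightarrow> 'a) set" assume B: "B \<in> cylalg"
      then obtain R where R: "windowed R B" by (auto simp: cylalg_def)
      have B': "shift -` B \<in> cylalg" using windowed_shift[OF R] by (auto simp: cylalg_def)
      have "(\<lambda>n. emp d n (shift -` B) - emp d n B) \<longlonglongrightarrow> 0"
        by (rule Lim_null_comparison[OF _ weight_sum_tendsto[OF w]]) (simp add: emp_shift[OF w])
      moreover have "(\<lambda>n. emp d n (shift -` B) - emp d n B) \<longlonglongrightarrow> l (shift -` B) - l B"
        by (intro tendsto_diff lim B B')
      ultimately have "l (shift -` B) = l B" using LIMSEQ_unique by fastforce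
      then show "emeasure (distr \<mu> MX shift) B = emeasure \<mu> B"
        using em[OF B] em[OF B'] emeasure_distr[OF m] windowed_sets[OF R] by (simp add: space_mu)
    qed (auto simp: sets_mu sets_MX_cylalg)
    then have "emeasure \<mu> A = emeasure (distr \<mu> MX shift) A" by simp
    then show ?thesis using emeasure_distr[OF m A] by (simp add: space_mu)
  qed
  ultimately have s: "siv \<mu>"
    unfolding shift_inv_measure_def using sets_mu mu.prob_space_axioms by blast
  have "dens \<mu> n c = d n c" if c: "c \<in> cells n" for n c
  proof -
    \<comment> \<open>The set of points with a given cell is only the trace on \<open>X\<close> of a
      cylinder \<open>A\<close>. The frequencies \<open>emp\<close> cannot tell the two apart, since
      all sample points lie in \<open>X\<close>.\<close>
    obtain R where R: "\<And>P. \<exists>A. windowed R A \<and> {y \<in> X. P (cell n y)} = X \<inter> A"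
      by (rule loc_window[OF loc_cell[of n]]) blast
    then obtain A where A: "windowed R A" "{y \<in> X. cell n y = Some c} = X \<inter> A"
      using R[of "\<lambda>z. z = Some c"] by blast
    have Ac: "A \<in> cylalg" using A(1) by (auto simp: cylalg_def)
    have eq: "{y. cell n y = Some c} = X \<inter> A" using A(2) by (auto simp: cell_def split: if_splits)
    have "dens \<mu> n c = measure \<mu> A"
      unfolding dens_def eq by (rule measure_eq_AE) (use AEX X_sets windowed_sets[OF A(1)] in \<open>auto simp: sets_mu\<close>)
    also have "\<dots> = l A" by (rule mm[OF Ac])
    also have "\<dots> = d n c"
    proof (rule LIMSEQ_unique[OF lim[OF Ac]])
      have "emp d m A = d n c" if "n \<le> m" for m
      proof -
        have "emp d m A = emp d m {y. cell n y = Some c}" by (rule emp_cong) (auto simp: eq)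
        then show ?thesis using emp_cell[OF d c, of "m - n"] that by simp
      qed
      then show "(\<lambda>n. emp d n A) \<longlonglongrightarrow> d n c"
        by (intro tendsto_eventually) (auto simp: eventually_sequentially)
    qed
    finally show ?thesis .
  qed
  then show ?thesis using s by blast
qed

end

section \<open>Uniform cell weights and the productivity matrices\<close>

lemma diagonal_convergent:
  fixes f :: "nat \<Rightarrow> 'i::countable \<Rightarrow> real"
  assumes f: "\<And>m i. \<bar>f m i\<bar> \<le> B"
  obtains r where "strict_mono r" "\<And>i. convergent (\<lambda>m. f (r m) i)"
proof -
  define P where "P n s \<longleftrightarrow> (\<forall>i. to_nat i = n \<longrightarrow> convergent (\<lambda>m. f (s m) i))" for n and s :: "nat \<Rightarrow> nat"
  interpret subseqs P
  proof
    fix n and s :: "nat \<Rightarrow> nat"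
    show "\<exists>r'. strict_mono r' \<and> P n (s \<circ> r')"
    proof (cases "\<exists>i::'i. to_nat i = n")
      case True
      then obtain i :: 'i where i: "to_nat i = n" by blast
      have "bounded (range (\<lambda>m. f (s m) i))"
        unfolding bounded_iff using f by (intro exI[of _ B]) auto
      then obtain l r' where "strict_mono (r' :: nat \<Rightarrow> nat)" "((\<lambda>m. f (s m) i) \<circ> r') \<longlonglongrightarrow> l"
        using bounded_imp_convergent_subsequence by blast
      then show ?thesis using i by (intro exI[of _ r']) (auto simp: P_def o_def convergent_def)
    next
      case False
      then show ?thesis by (intro exI[of _ id]) (auto simp: P_def strict_mono_def)
    qed
  qed
  have "convergent (\<lambda>m. f (diagseq m) i)" for i
  proof -
    have "P (to_nat i) (diagseq \<circ> (+) (Suc (to_nat i)))"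
    proof (rule diagseq_holds)
      fix r s n assume r: "strict_mono (r :: nat \<Rightarrow> nat)" and "P n s"
      then show "P n (s \<circ> r)" unfolding P_def
        using convergent_subseq_convergent[OF _ r] by (fastforce simp: o_def)
    qed
    then have "convergent (\<lambda>m. f (diagseq (m + Suc (to_nat i))) i)"
      by (auto simp: P_def o_def add.commute)
    then show ?thesis by (subst (asm) convergent_ignore_initial_segment)
  qed
  then show ?thesis by (rule that[OF subseq_diagseq])
qed

section \<open>Products of stochastic matrices and inverse orbits\<close>

lemma mmult_assoc: "mmult (mmult A B) C = mmult A (mmult B C)"
proof (intro ext)
  fix i j
  have "mmult (mmult A B) C i j = (\<Sum>k\<in>UNIV. \<Sum>l\<in>UNIV. A i l * B l k * C k j)"
    by (simp add: mmult_def sum_distrib_right)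
  also have "\<dots> = (\<Sum>l\<in>UNIV. \<Sum>k\<in>UNIV. A i l * B l k * C k j)" by (rule sum.swap)
  also have "\<dots> = mmult A (mmult B C) i j" by (simp add: mmult_def sum_distrib_left mult.assoc)
  finally show "mmult (mmult A B) C i j = mmult A (mmult B C) i j" .
qed

lemma mprod_Suc_left: "mprod P n (Suc k) = mmult (P n) (mprod P (Suc n) k)"
proof (induction k)
  case (Suc k)
  have "mprod P n (Suc (Suc k)) = mmult (mprod P n (Suc k)) (P (n + Suc (Suc k)))" by simp
  also have "\<dots> = mmult (P n) (mmult (mprod P (Suc n) k) (P (n + Suc (Suc k))))"
    by (simp only: Suc mmult_assoc)
  finally show ?case by simp
qed simp

lemma column_stochastic_mmult:
  assumes "column_stochastic A" "column_stochastic B"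
  shows "column_stochastic (mmult A B)"
proof -
  have "(\<Sum>i\<in>UNIV. mmult A B i j) = 1" for j
  proof -
    have "(\<Sum>i\<in>UNIV. mmult A B i j) = (\<Sum>k\<in>UNIV. \<Sum>i\<in>UNIV. A i k * B k j)"
      unfolding mmult_def by (rule sum.swap)
    also have "\<dots> = 1" using assms by (simp add: sum_distrib_right[symmetric] column_stochastic_def)
    finally show ?thesis .
  qed
  then show ?thesis using assms by (auto simp: column_stochastic_def mmult_def intro!: sum_nonneg)
qed

lemma column_stochastic_mprod: "(\<And>n. column_stochastic (P n)) \<Longrightarrow> column_stochastic (mprod P n k)"
  by (induction k) (auto intro: column_stochastic_mmult)

lemma column_stochastic_le_1: "column_stochastic A \<Longrightarrow> 0 \<le> A i j \<and> A i j \<le> 1"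
  unfolding column_stochastic_def by (metis UNIV_I finite member_le_sum)

text \<open>A point of the inverse limit of the simplices under the maps \<open>P n\<close>.\<close>

definition inverse_orbit :: "(nat \<Rightarrow> 'a::finite \<Rightarrow> 'a \<Rightarrow> real) \<Rightarrow> (nat \<Rightarrow> 'a \<Rightarrow> real) \<Rightarrow> bool" where
  "inverse_orbit P p \<longleftrightarrow> (\<forall>n a. 0 \<le> p n a) \<and> (\<forall>n. (\<Sum>a\<in>UNIV. p n a) = 1) \<and>
     (\<forall>n a. p n a = (\<Sum>b\<in>UNIV. P n a b * p (Suc n) b))"

lemma inverse_orbit_nonneg: "inverse_orbit P p \<Longrightarrow> 0 \<le> p n a"
  and inverse_orbit_sum: "inverse_orbit P p \<Longrightarrow> (\<Sum>a\<in>UNIV. p n a) = 1"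
  and inverse_orbit_eq: "inverse_orbit P p \<Longrightarrow> p n a = (\<Sum>b\<in>UNIV. P n a b * p (Suc n) b)"
  unfolding inverse_orbit_def by blast+

lemma inverse_orbit_mprod:
  assumes "inverse_orbit P p"
  shows "p n a = (\<Sum>b\<in>UNIV. mprod P n k a b * p (Suc (n + k)) b)"
proof (induction k arbitrary: a)
  case 0
  then show ?case using inverse_orbit_eq[OF assms, of n a] by simp
next
  case (Suc k)
  have "p n a = (\<Sum>b\<in>UNIV. \<Sum>c\<in>UNIV. mprod P n k a b * (P (Suc (n + k)) b c * p (Suc (Suc (n + k))) c))"
  proof -
    have "p (Suc (n + k)) b = (\<Sum>c\<in>UNIV. P (Suc (n + k)) b c * p (Suc (Suc (n + k))) c)" for b
      by (rule inverse_orbit_eq[OF assms])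
    then show ?thesis using Suc by (simp only: sum_distrib_left)
  qed
  also have "\<dots> = (\<Sum>c\<in>UNIV. \<Sum>b\<in>UNIV. mprod P n k a b * (P (Suc (n + k)) b c * p (Suc (Suc (n + k))) c))"
    by (rule sum.swap)
  finally show ?case by (simp add: mmult_def sum_distrib_right mult.assoc)
qed

text \<open>If the columns of the products merge into one vector, every orbit is their mean under a
  later probability vector and equals that vector. Conversely, limits of columns of the products are
  orbits, so a product that stays away from the known orbit would produce a second one.\<close>

theorem ergodic_iff_unique_orbit:
  fixes P :: "nat \<Rightarrow> 'a::finite \<Rightarrow> 'a \<Rightarrow> real"
  assumes P: "\<And>n. column_stochastic (P n)"
  shows "ergodic_inverse_time P \<longleftrightarrow> (\<exists>!p. inverse_orbit P p)"
proof
  assume "ergodic_inverse_time P"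
  then have "\<forall>n. \<exists>\<pi>. (\<forall>a. 0 \<le> \<pi> a) \<and> (\<Sum>a\<in>UNIV. \<pi> a) = 1 \<and> (\<forall>a b. (\<lambda>k. mprod P n k a b) \<longlonglongrightarrow> \<pi> a)"
    by (simp add: ergodic_inverse_time_def)
  then obtain q where q: "\<And>n a. 0 \<le> q n a" "\<And>n. (\<Sum>a\<in>UNIV. q n a) = 1"
    "\<And>n a b. (\<lambda>k. mprod P n k a b) \<longlonglongrightarrow> q n a" by metis
  have "q n a = (\<Sum>b\<in>UNIV. P n a b * q (Suc n) b)" for n a
  proof (rule LIMSEQ_unique)
    show "(\<lambda>k. mprod P n (Suc k) a a) \<longlonglongrightarrow> q n a" using q(3)[of n a a] by (rule LIMSEQ_Suc)
    show "(\<lambda>k. mprod P n (Suc k) a a) \<longlonglongrightarrow> (\<Sum>b\<in>UNIV. P n a b * q (Suc n) b)"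
      unfolding mprod_Suc_left mmult_def by (intro tendsto_intros q)
  qed
  then have "inverse_orbit P q" using q(1,2) unfolding inverse_orbit_def by blast
  moreover have "p = q" if p: "inverse_orbit P p" for p
  proof (intro ext)
    fix n a
    have pp: "0 \<le> p n a" "(\<Sum>a\<in>UNIV. p n a) = 1" for n a
      using inverse_orbit_nonneg[OF p] inverse_orbit_sum[OF p] by blast+
    have ple: "\<bar>p n b\<bar> \<le> 1" for n b using pp member_le_sum[of b UNIV "p n"] by auto
    have "(\<lambda>k. \<Sum>b\<in>UNIV. (mprod P n k a b - q n a) * p (Suc (n + k)) b) \<longlonglongrightarrow> 0"
    proof (rule tendsto_null_sum)
      fix b
      have "(\<lambda>k. mprod P n k a b - q n a) \<longlonglongrightarrow> 0" using q(3)[of n a b] by (simp add: LIM_zero)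
      then show "(\<lambda>k. (mprod P n k a b - q n a) * p (Suc (n + k)) b) \<longlonglongrightarrow> 0"
        by (rule Lim_null_comparison[OF always_eventually, rotated, OF tendsto_rabs_zero])
          (use ple in \<open>auto simp: abs_mult mult_left_le\<close>)
    qed
    moreover have "(\<Sum>b\<in>UNIV. (mprod P n k a b - q n a) * p (Suc (n + k)) b) = p n a - q n a" for k
      using inverse_orbit_mprod[OF p, of n a k] pp(2)[of "Suc (n + k)"]
      by (simp add: left_diff_distrib sum_subtractf sum_distrib_left[symmetric])
    ultimately show "p n a = q n a" by (simp add: LIMSEQ_const_iff)
  qed
  ultimately show "\<exists>!p. inverse_orbit P p" by blast
next
  assume "\<exists>!p. inverse_orbit P p"
  then obtain p where p: "inverse_orbit P p" "\<And>q. inverse_orbit P q \<Longrightarrow> q = p" by blast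
  have "(\<lambda>k. mprod P n k a b) \<longlonglongrightarrow> p n a" for n a b
  proof (rule ccontr)
    assume "\<not> ?thesis"
    then obtain e where e: "0 < e" "\<And>K. \<exists>k\<ge>K. e \<le> \<bar>mprod P n k a b - p n a\<bar>"
      unfolding LIMSEQ_def dist_real_def by (metis not_less)
    \<comment> \<open>All products end at the same index \<open>n + j\<close>, so for fixed
      \<open>j\<close> their columns \<open>b\<close> satisfy the orbit recursion below that index.
      The default 0 concerns only larger \<open>m\<close> and disappears in the limit.\<close>
    define f where "f j z = (case z of (m, c) \<Rightarrow> if m \<le> n + j then mprod P m (n + j - m) c b else 0)" for j and z :: "nat \<times> 'a"
    obtain k where k: "\<And>K. K \<le> k K \<and> e \<le> \<bar>mprod P n (k K) a b - p n a\<bar>" using e(2) by metis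
    have bnd: "\<bar>f (k j) z\<bar> \<le> 1" for j z
      using column_stochastic_le_1[OF column_stochastic_mprod[OF P]] by (auto simp: f_def split: prod.split)
    obtain r where r: "strict_mono r" "\<And>z. convergent (\<lambda>j. f (k (r j)) z)"
      by (rule diagonal_convergent[of "\<lambda>j. f (k j)" 1, OF bnd]) blast
    define q where "q m c = lim (\<lambda>j. f (k (r j)) (m, c))" for m c
    have lim: "(\<lambda>j. f (k (r j)) (m, c)) \<longlonglongrightarrow> q m c" for m c
      using r(2) unfolding q_def by (simp add: convergent_LIMSEQ_iff)
    have ev: "\<forall>\<^sub>F j in sequentially. m < n + k (r j)" for m
      using eventually_gt_at_top[of m]
    proof eventually_elim
      case (elim j)
      then show ?case using seq_suble[OF r(1), of j] k[of "r j"] by linarith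
    qed
    have "inverse_orbit P q" unfolding inverse_orbit_def
    proof (intro conjI allI)
      have f0: "0 \<le> f j z" for j z
        using column_stochastic_le_1[OF column_stochastic_mprod[OF P]] by (auto simp: f_def split: prod.split)
      show "0 \<le> q m c" for m c by (rule tendsto_lowerbound[OF lim]) (auto simp: f0)
      show "(\<Sum>c\<in>UNIV. q m c) = 1" for m
      proof (rule LIMSEQ_unique)
        show "(\<lambda>j. \<Sum>c\<in>UNIV. f (k (r j)) (m, c)) \<longlonglongrightarrow> (\<Sum>c\<in>UNIV. q m c)" by (intro tendsto_sum lim)
        show "(\<lambda>j. \<Sum>c\<in>UNIV. f (k (r j)) (m, c)) \<longlonglongrightarrow> 1"
        proof (rule tendsto_eventually)
          show "\<forall>\<^sub>F j in sequentially. (\<Sum>c\<in>UNIV. f (k (r j)) (m, c)) = 1"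
            using ev[of m] by eventually_elim
              (use column_stochastic_mprod[of P, OF P] in \<open>simp add: f_def column_stochastic_def\<close>)
        qed
      qed
      show "q m c = (\<Sum>b\<in>UNIV. P m c b * q (Suc m) b)" for m c
      proof (rule LIMSEQ_unique[OF lim])
        have "(\<lambda>j. \<Sum>d\<in>UNIV. P m c d * f (k (r j)) (Suc m, d)) \<longlonglongrightarrow> (\<Sum>b\<in>UNIV. P m c b * q (Suc m) b)"
          by (intro tendsto_intros lim)
        moreover have "\<forall>\<^sub>F j in sequentially. (\<Sum>d\<in>UNIV. P m c d * f (k (r j)) (Suc m, d)) = f (k (r j)) (m, c)"
          using ev[of m]
        proof eventually_elim
          case (elim j)
          then obtain i where i: "n + k (r j) = Suc (m + i)" using less_iff_Suc_add by auto
          then show ?case unfolding f_def i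
            using mprod_Suc_left[of P m i] by (simp add: Suc_diff_le mmult_def)
        qed
        ultimately show "(\<lambda>j. f (k (r j)) (m, c)) \<longlonglongrightarrow> (\<Sum>b\<in>UNIV. P m c b * q (Suc m) b)"
          by (rule Lim_transform_eventually)
      qed
    qed
    then have "q = p" by (rule p(2))
    have "(\<lambda>j. \<bar>f (k (r j)) (n, a) - p n a\<bar>) \<longlonglongrightarrow> \<bar>q n a - p n a\<bar>"
      by (intro tendsto_intros lim)
    moreover have "f (k (r j)) (n, a) = mprod P n (k (r j)) a b" for j by (simp add: f_def)
    then have "e \<le> \<bar>f (k (r j)) (n, a) - p n a\<bar>" for j using k[of "r j"] by simp
    ultimately have "e \<le> \<bar>q n a - p n a\<bar>" by (intro tendsto_lowerbound) auto
    then show False using e(1) \<open>q = p\<close> by simp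
  qed
  then show "ergodic_inverse_time P"
    using P p(1) unfolding ergodic_inverse_time_def inverse_orbit_def by blast
qed

context recog_subst
begin

lemma lam_nz [simp]: "lam \<noteq> 0" and L_nz [simp]: "L a \<noteq> 0"
  by (metis lam_gt_1 not_one_less_zero) (metis L_pos less_irrefl)

section \<open>Counting words through their subdivisions\<close>

definition K :: "nat \<Rightarrow> 'a \<Rightarrow> real" where
  "K n a = real (card (pw n a))"

lemma K_pos: "0 < K n a"
  using pw_valid[of n a] by (simp add: K_def card_gt_0_iff)

lemma K_nz [simp]: "K n a \<noteq> 0"
  using K_pos[of n a] by simp

text \<open>Lists of words instead of their concatenations, so that the choices for the single
  letters are visibly independent.\<close>

definition LS :: "nat \<Rightarrow> 'a list \<Rightarrow> 'a list list set" where
  "LS n u = {ws. list_all2 (\<lambda>w c. w \<in> pw n c) ws u}"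

lemma LS_Cons: "LS n (c # u) = (\<lambda>(w, ws). w # ws) ` (pw n c \<times> LS n u)"
  by (auto simp: LS_def list_all2_Cons2)

lemma finite_LS: "finite (LS n u)"
  by (induction u) (auto simp: LS_Cons pw_valid LS_def[of n "[]"])

lemma sum_LS_Cons: "(\<Sum>ws\<in>LS n (c # u). f ws) = (\<Sum>w\<in>pw n c. \<Sum>ws\<in>LS n u. f (w # ws))"
  unfolding LS_Cons by (subst sum.reindex) (auto simp: inj_on_def sum.cartesian_product split_beta)

text \<open>Independence of the choices: the sum over a product set factorises.\<close>

lemma prod_LS:
  fixes f :: "_ \<Rightarrow> real"
  shows "(\<Sum>ws\<in>LS n u. \<Prod>c\<leftarrow>zip u ws. f c) = (\<Prod>c\<leftarrow>u. \<Sum>w\<in>pw n c. f (c, w))"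
proof (induction u)
  case Nil
  then show ?case by (simp add: LS_def)
next
  case (Cons c u)
  then show ?case by (simp add: sum_LS_Cons sum_distrib_left[symmetric] sum_distrib_right[symmetric])
qed

lemma card_LS: "real (card (LS n u)) = (\<Prod>c\<leftarrow>u. K n c)"
  using prod_LS[where f = "\<lambda>_. 1" and n = n and u = u] by (simp add: K_def map_replicate_const)

text \<open>Each occurrence of \<open>a\<close> in \<open>u\<close> carries the word
  \<open>w\<close> in a fraction \<open>1 / K n a\<close> of all lists.\<close>

lemma count_LS:
  assumes w: "w \<in> pw n a"
  shows "(\<Sum>ws\<in>LS n u. real (count_list (zip u ws) (a, w))) * K n a = real (count_list u a) * real (card (LS n u))"
proof (induction u)
  case (Cons c u)
  have "(\<Sum>ws\<in>LS n (c # u). real (count_list (zip (c # u) ws) (a, w)))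
    = (\<Sum>v\<in>pw n c. \<Sum>ws\<in>LS n u. (if (c, v) = (a, w) then 1 else 0) + real (count_list (zip u ws) (a, w)))"
    unfolding sum_LS_Cons by (intro sum.cong) auto
  also have "\<dots> = (\<Sum>v\<in>pw n c. (if (c, v) = (a, w) then real (card (LS n u)) else 0))
     + K n c * (\<Sum>ws\<in>LS n u. real (count_list (zip u ws) (a, w)))"
    unfolding sum.distrib by (intro arg_cong2[where f = "(+)"] sum.cong) (auto simp: K_def)
  also have "(\<Sum>v\<in>pw n c. (if (c, v) = (a, w) then real (card (LS n u)) else 0)) = (if c = a then real (card (LS n u)) else 0)"
    using w pw_valid(1) by (cases "c = a") (auto simp: sum.delta)
  finally have e: "(\<Sum>ws\<in>LS n (c # u). real (count_list (zip (c # u) ws) (a, w)))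
     = (if c = a then real (card (LS n u)) else 0) + K n c * (\<Sum>ws\<in>LS n u. real (count_list (zip u ws) (a, w)))" .
  have "(\<Sum>ws\<in>LS n (c # u). real (count_list (zip (c # u) ws) (a, w))) * K n a
     = (if c = a then real (card (LS n u)) * K n a else 0) + K n c * (real (count_list u a) * real (card (LS n u)))"
    unfolding e Cons[symmetric] by (simp add: algebra_simps)
  also have "\<dots> = real (count_list (c # u) a) * real (card (LS n (c # u)))"
    by (simp add: card_LS algebra_simps)
  finally show ?case .
qed simp

text \<open>By unique parsing, a level-(n+1) word amounts to a word \<open>u\<close> of
  \<open>b\<close> together with a free choice of level-n words for the letters of
  \<open>u\<close>.\<close>

lemma sum_pw_Suc:
  fixes f :: "_ \<Rightarrow> real"
  shows "(\<Sum>W\<in>pw (Suc n) b. f (kids n (b, W))) = (\<Sum>u\<in>\<sigma> b. \<Sum>ws\<in>LS n u. f (zip u ws))"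
proof -
  have "(\<Sum>u\<in>\<sigma> b. \<Sum>ws\<in>LS n u. f (zip u ws)) = (\<Sum>(u, ws)\<in>Sigma (\<sigma> b) (LS n). f (zip u ws))"
    by (rule sum.Sigma) (use valid finite_LS in \<open>auto simp: valid_rsubst_def\<close>)
  also have "\<dots> = (\<Sum>W\<in>pw (Suc n) b. f (kids n (b, W)))"
  proof (rule sum.reindex_bij_betw[of "\<lambda>(u, ws). concat ws" "Sigma (\<sigma> b) (LS n)" "pw (Suc n) b" "\<lambda>W. f (kids n (b, W))", THEN trans[rotated]])
    have p: "parse 1 n b W u ws \<longleftrightarrow> (u, ws) \<in> Sigma (\<sigma> b) (LS n) \<and> W = concat ws" for W u ws
      by (auto simp: parse_def LS_def)
    show "bij_betw (\<lambda>(u, ws). concat ws) (Sigma (\<sigma> b) (LS n)) (pw (Suc n) b)"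
    proof (rule bij_betwI')
      fix x y assume "x \<in> Sigma (\<sigma> b) (LS n)" "y \<in> Sigma (\<sigma> b) (LS n)"
      then show "(case x of (u, ws) \<Rightarrow> concat ws) = (case y of (u, ws) \<Rightarrow> concat ws) \<longleftrightarrow> x = y"
        using parse_unique[of 1 n b _ "fst x" "snd x" "fst y" "snd y"] p by (auto simp: split_beta)
    next
      fix x assume "x \<in> Sigma (\<sigma> b) (LS n)"
      then show "(case x of (u, ws) \<Rightarrow> concat ws) \<in> pw (Suc n) b"
        using parse_pw[of 1 n b] p by (auto simp: split_beta)
    next
      fix W assume "W \<in> pw (Suc n) b"
      then have "W \<in> pw (1 + n) b" by simp
      then obtain u ws where "parse 1 n b W u ws" using parse_ex by blast
      then show "\<exists>x\<in>Sigma (\<sigma> b) (LS n). W = (case x of (u, ws) \<Rightarrow> concat ws)"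
        using p by (intro bexI[of _ "(u, ws)"]) auto
    qed
    show "(\<Sum>(u, ws)\<in>Sigma (\<sigma> b) (LS n). f (zip u ws)) = (\<Sum>x\<in>Sigma (\<sigma> b) (LS n). f (kids n (b, case x of (u, ws) \<Rightarrow> concat ws)))"
      by (intro sum.cong refl) (use p kids_eq in \<open>auto simp: split_beta\<close>)
  qed
  finally show ?thesis by simp
qed

lemma card_rs_word: 
  assumes "u \<in> \<sigma> b"
  shows "card (rs_word (pw n) u) = card (LS n u)"
proof -
  have "rs_word (pw n) u = concat ` LS n u" by (auto simp: rs_word_iff LS_def)
  moreover have "inj_on concat (LS n u)"
  proof (rule inj_onI)
    fix ws ws' assume "ws \<in> LS n u" "ws' \<in> LS n u" "concat ws = concat ws'"
    then show "ws = ws'" using parse_unique[of 1 n b "concat ws" u ws u ws'] assms by (simp add: parse_def LS_def)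
  qed
  ultimately show ?thesis by (simp add: card_image)
qed

lemma K_Suc: "K (Suc n) b = (\<Sum>u\<in>\<sigma> b. real (card (rs_word (pw n) u)))"
  using sum_pw_Suc[of "\<lambda>_. 1" n b] by (simp add: K_def card_rs_word)

definition Mn :: "nat \<Rightarrow> 'a \<Rightarrow> 'a \<Rightarrow> real" where
  "Mn n = M_of \<sigma> (productivity_dist \<sigma> n)"

definition Qn :: "nat \<Rightarrow> 'a \<Rightarrow> 'a \<Rightarrow> real" where
  "Qn n = Q_of \<sigma> lam L (productivity_dist \<sigma> n)"

lemma Mn_eq: "Mn n a b = (\<Sum>u\<in>\<sigma> b. real (card (rs_word (pw n) u)) * real (count_list u a)) / K (Suc n) b"
  unfolding Mn_def M_of_def productivity_dist_def K_def by (simp add: sum_divide_distrib)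

lemma Qn_eq: "Qn n a b = L a * Mn n a b / (lam * L b)"
  by (simp add: Qn_def Q_of_def Mn_def)

text \<open>Every word of \<open>b\<close> has geometric length \<open>lam * L b\<close>, so any
  average over these words gives the same weighted column sum.\<close>

lemma column_stochastic_Qn: "column_stochastic (Qn n)"
proof -
  have "0 \<le> Qn n a b" for a b
    unfolding Qn_eq Mn_eq using lam_gt_1 K_pos[of "Suc n" b]
    by (intro divide_nonneg_nonneg mult_nonneg_nonneg sum_nonneg) auto
  moreover have "(\<Sum>a\<in>UNIV. Qn n a b) = 1" for b
  proof -
    have "(\<Sum>a\<in>UNIV. L a * Mn n a b) * K (Suc n) b
      = (\<Sum>a\<in>UNIV. \<Sum>u\<in>\<sigma> b. real (card (rs_word (pw n) u)) * (L a * real (count_list u a)))"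
    proof -
      have "L a * Mn n a b * K (Suc n) b = (\<Sum>u\<in>\<sigma> b. real (card (rs_word (pw n) u)) * (L a * real (count_list u a)))" for a
        by (simp add: Mn_eq sum_distrib_left mult.left_commute)
      then show ?thesis by (simp add: sum_distrib_right)
    qed
    also have "\<dots> = (\<Sum>u\<in>\<sigma> b. real (card (rs_word (pw n) u)) * (\<Sum>a\<in>UNIV. L a * real (count_list u a)))"
      by (subst sum.swap) (simp add: sum_distrib_left)
    also have "\<dots> = (\<Sum>u\<in>\<sigma> b. real (card (rs_word (pw n) u)) * (lam * L b))"
      by (intro sum.cong refl) (simp add: Lword_count Lword_one)
    also have "\<dots> = lam * L b * K (Suc n) b" by (simp add: K_Suc sum_distrib_left mult.commute)
    finally have "(\<Sum>a\<in>UNIV. L a * Mn n a b) = lam * L b" using K_pos[of "Suc n" b] by simp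
    then show ?thesis using lam_gt_1 L_pos[of b] by (simp add: Qn_eq sum_divide_distrib[symmetric])
  qed
  ultimately show ?thesis by (simp add: column_stochastic_def)
qed

text \<open>Drawing a level-(n+1) word of \<open>b\<close> uniformly means drawing \<open>u\<close>
  from the productivity distribution and then the level-n words of its letters uniformly. This is
  how the productivity matrices enter.\<close>

lemma sum_kids_count:
  assumes "w \<in> pw n a"
  shows "(\<Sum>W\<in>pw (Suc n) b. real (count_list (kids n (b, W)) (a, w))) = K (Suc n) b * Mn n a b / K n a"
proof -
  have "(\<Sum>W\<in>pw (Suc n) b. real (count_list (kids n (b, W)) (a, w))) * K n a
    = (\<Sum>u\<in>\<sigma> b. (\<Sum>ws\<in>LS n u. real (count_list (zip u ws) (a, w))) * K n a)"
    unfolding sum_pw_Suc[of "\<lambda>l. real (count_list l (a, w))"] by (simp add: sum_distrib_right)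
  also have "\<dots> = K (Suc n) b * Mn n a b"
    unfolding count_LS[OF assms] Mn_eq using K_pos[of "Suc n" b] by (simp add: card_rs_word mult.commute)
  finally show ?thesis using K_pos[of n a] by (simp add: field_simps)
qed

lemma sum_cells: "(\<Sum>c\<in>cells n. f c) = (\<Sum>a\<in>UNIV. \<Sum>w\<in>pw n a. f (a, w))"
  unfolding cells_def by (subst sum.Sigma) (auto simp: pw_valid)

section \<open>Uniform densities and spatial frequencies\<close>

definition uniform :: "(nat \<Rightarrow> 'a \<times> 'a list \<Rightarrow> real) \<Rightarrow> bool" where
  "uniform d \<longleftrightarrow> (\<forall>n a. \<forall>v\<in>pw n a. \<forall>w\<in>pw n a. d n (a, v) = d n (a, w))"

text \<open>The mean roof length, see \<open>integral_L\<close>, written with level-0 cells because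
  the same sum has the same value at every level (\<open>ell_eq\<close>).\<close>

definition ell :: "(int \<Rightarrow> 'a) measure \<Rightarrow> real" where
  "ell \<mu> = (\<Sum>c\<in>cells 0. dens \<mu> 0 c * Lword L (snd c))"

text \<open>The measure of the points of the hull inside a copy of the cell c, under the lift of \<mu>.\<close>
definition tile :: "(int \<Rightarrow> 'a) measure \<Rightarrow> nat \<Rightarrow> 'a \<times> 'a list \<Rightarrow> real" where
  "tile \<mu> n c = dens \<mu> n c * Lword L (snd c) / ell \<mu>"

lemma kids_concat: "C \<in> cells (Suc n) \<Longrightarrow> concat (map snd (kids n C)) = snd C"
  by (erule kids_parse) (simp add: parse_def)

lemma Lword_concat: "Lword L (concat ws) = (\<Sum>w\<leftarrow>ws. Lword L w)"
  by (induction ws) auto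

lemma length_concat_sum: "real (length (concat ws)) = (\<Sum>w\<leftarrow>ws. real (length w))"
  by (induction ws) auto

lemma ell_eq:
  assumes s: "siv \<mu>"
  shows "ell \<mu> = (\<Sum>c\<in>cells n. dens \<mu> n c * Lword L (snd c))"
proof (induction n)
  case (Suc n)
  have "(\<Sum>C\<in>cells (Suc n). dens \<mu> (Suc n) C * Lword L (snd C))
    = (\<Sum>C\<in>cells (Suc n). dens \<mu> (Suc n) C * (\<Sum>c\<leftarrow>kids n C. Lword L (snd c)))"
    by (intro sum.cong refl) (simp add: kids_concat[symmetric] Lword_concat o_def)
  then show ?case using Suc consistent_sum[OF dens_consistent[OF s]] by simp
qed (simp add: ell_def)

lemma Lword_cell: "c \<in> cells n \<Longrightarrow> Lword L (snd c) = lam ^ n * L (fst c)"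
  by (auto simp: cells_def Lword_pw)

lemma lamL_pos: "0 < lam ^ n * L a"
  using lam_gt_1 by simp

lemma ell_pos:
  assumes s: "siv \<mu>"
  shows "0 < ell \<mu>"
proof -
  have "Lmin = (\<Sum>c\<in>cells 0. dens \<mu> 0 c * (Lmin * real (length (snd c))))"
    using dens_total[OF s, of 0] by (simp add: sum_distrib_left[symmetric] mult.left_commute)
  also have "\<dots> \<le> ell \<mu>" unfolding ell_def
    by (intro sum_mono mult_left_mono) (auto simp: Lword_length_ge)
  finally show ?thesis using Lmin_pos by linarith
qed

lemma tile_nonneg: "siv \<mu> \<Longrightarrow> c \<in> cells n \<Longrightarrow> 0 \<le> tile \<mu> n c"
  using ell_pos[of \<mu>] lamL_pos[of n "fst c"]
  by (auto simp: tile_def Lword_cell intro!: divide_nonneg_pos mult_nonneg_nonneg)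

lemma tile_total: "siv \<mu> \<Longrightarrow> (\<Sum>c\<in>cells n. tile \<mu> n c) = 1"
  using ell_eq[of \<mu> n] ell_pos[of \<mu>] by (simp add: tile_def sum_divide_distrib[symmetric])

text \<open>\<open>tile\<close> determines the densities only up to the factor \<open>ell\<close>,
  which is then recovered from \<open>dens_total\<close>.\<close>

lemma siv_eqI_tile:
  assumes s: "siv \<mu>" "siv \<mu>'" and e: "\<And>n c. N \<le> n \<Longrightarrow> c \<in> cells n \<Longrightarrow> tile \<mu> n c = tile \<mu>' n c"
  shows "\<mu> = \<mu>'"
proof (rule siv_eqI[OF s])
  fix n c assume n: "N \<le> n" "c \<in> cells n"
  have d: "dens \<mu> n c = ell \<mu> * (tile \<mu> n c / Lword L (snd c))" if "siv \<mu>" "c \<in> cells n" for \<mu> c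
    using ell_pos[OF that(1)] Lword_cell[OF that(2)] by (simp add: tile_def)
  have "1 = ell \<mu> * (\<Sum>c\<in>cells n. tile \<mu> n c / Lword L (snd c) * real (length (snd c)))" if "siv \<mu>" for \<mu>
    using dens_total[OF that, of n] d[OF that] by (simp add: sum_distrib_left mult.assoc)
  from this[OF s(1)] this[OF s(2)] have "ell \<mu> = ell \<mu>'"
  proof -
    assume 1: "1 = ell \<mu> * (\<Sum>c\<in>cells n. tile \<mu> n c / Lword L (snd c) * real (length (snd c)))"
    assume 2: "1 = ell \<mu>' * (\<Sum>c\<in>cells n. tile \<mu>' n c / Lword L (snd c) * real (length (snd c)))"
    define T where "T = (\<Sum>c\<in>cells n. tile \<mu>' n c / Lword L (snd c) * real (length (snd c)))"
    have "(\<Sum>c\<in>cells n. tile \<mu> n c / Lword L (snd c) * real (length (snd c))) = T"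
      unfolding T_def using e[OF n(1)] by (intro sum.cong refl) simp
    then have "1 = ell \<mu> * T" "1 = ell \<mu>' * T" using 1 2 T_def by auto
    then show "ell \<mu> = ell \<mu>'" by (metis mult_cancel_right mult_zero_right zero_neq_one)
  qed
  then show "dens \<mu> n c = dens \<mu>' n c" using d s n e by simp
qed

text \<open>The spatial frequency of \<open>a\<close> at level \<open>n\<close>: the share of the
  hull covered by its level-n cells.\<close>

definition piof :: "(int \<Rightarrow> 'a) measure \<Rightarrow> nat \<Rightarrow> 'a \<Rightarrow> real" where
  "piof \<mu> n a = (\<Sum>w\<in>pw n a. tile \<mu> n (a, w))"

lemma tile_uniform:
  assumes "siv \<mu>" "uniform (dens \<mu>)" "w \<in> pw n a"
  shows "tile \<mu> n (a, w) = piof \<mu> n a / K n a"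
proof -
  have "tile \<mu> n (a, v) = tile \<mu> n (a, w)" if "v \<in> pw n a" for v
    using assms that unfolding uniform_def tile_def by (metis Lword_pw snd_conv)
  then have "piof \<mu> n a = K n a * tile \<mu> n (a, w)" by (simp add: piof_def K_def)
  then show ?thesis using K_pos[of n a] by simp
qed

text \<open>The cell densities (up to the mean roof) for which the cells of type a have total measure p n a in the
  hull, equidistributed over the level-n words of a.\<close>
definition udens :: "(nat \<Rightarrow> 'a \<Rightarrow> real) \<Rightarrow> nat \<Rightarrow> 'a \<times> 'a list \<Rightarrow> real" where
  "udens p n c = p n (fst c) / (lam ^ n * L (fst c) * K n (fst c))"

text \<open>Passing from densities to spatial frequencies multiplies by the cell lengths; this
  conjugates \<open>Mn\<close> into the stochastic matrix \<open>Qn\<close>.\<close>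

lemma sum_udens_kids:
  assumes "w \<in> pw n a"
  shows "(\<Sum>C\<in>cells (Suc n). udens p (Suc n) C * real (count_list (kids n C) (a, w)))
    = (\<Sum>b\<in>UNIV. Qn n a b * p (Suc n) b) / (lam ^ n * L a * K n a)"
proof -
  have "(\<Sum>C\<in>cells (Suc n). udens p (Suc n) C * real (count_list (kids n C) (a, w)))
    = (\<Sum>b\<in>UNIV. p (Suc n) b / (lam ^ Suc n * L b * K (Suc n) b) * (K (Suc n) b * Mn n a b / K n a))"
    unfolding sum_cells udens_def sum_kids_count[OF assms, symmetric] by (simp add: sum_distrib_left)
  also have "\<dots> = (\<Sum>b\<in>UNIV. Qn n a b * p (Suc n) b / (lam ^ n * L a * K n a))"
  proof (intro sum.cong refl)
    fix b
    show "p (Suc n) b / (lam ^ Suc n * L b * K (Suc n) b) * (K (Suc n) b * Mn n a b / K n a)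
        = Qn n a b * p (Suc n) b / (lam ^ n * L a * K n a)"
      using K_pos[of n a] K_pos[of "Suc n" b] L_pos[of a] L_pos[of b] lam_gt_1 by (simp add: Qn_eq field_simps)
  qed
  finally show ?thesis by (simp add: sum_divide_distrib)
qed

lemma udens_piof:
  assumes "siv \<mu>" "uniform (dens \<mu>)" "c \<in> cells n"
  shows "dens \<mu> n c = ell \<mu> * udens (piof \<mu>) n c"
proof -
  have "dens \<mu> n c = ell \<mu> * (tile \<mu> n c / Lword L (snd c))"
    using ell_pos[OF assms(1)] Lword_cell[OF assms(3)] by (simp add: tile_def)
  moreover have "tile \<mu> n c = piof \<mu> n (fst c) / K n (fst c)"
    using tile_uniform[OF assms(1,2), of "snd c" n "fst c"] assms(3) by (auto simp: cells_def)
  ultimately show ?thesis by (simp add: udens_def Lword_cell[OF assms(3)] mult.commute)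
qed

lemma piof_orbit:
  assumes s: "siv \<mu>" and u: "uniform (dens \<mu>)"
  shows "inverse_orbit Qn (piof \<mu>)"
  unfolding inverse_orbit_def
proof (intro conjI allI)
  show "0 \<le> piof \<mu> n a" for n a
    unfolding piof_def by (intro sum_nonneg tile_nonneg[OF s]) (auto simp: cells_def)
  show "(\<Sum>a\<in>UNIV. piof \<mu> n a) = 1" for n
    using tile_total[OF s, of n] by (simp add: piof_def sum_cells)
  show "piof \<mu> n a = (\<Sum>b\<in>UNIV. Qn n a b * piof \<mu> (Suc n) b)" for n a
  proof -
    obtain w where w: "w \<in> pw n a" using pw_valid by blast
    then have c: "(a, w) \<in> cells n" by (auto simp: cells_def)
    have e: "ell \<mu> * udens (piof \<mu>) n (a, w) = ell \<mu> * (\<Sum>C\<in>cells (Suc n). udens (piof \<mu>) (Suc n) C * real (count_list (kids n C) (a, w)))"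
      using consistent_eq[OF dens_consistent[OF s] c] udens_piof[OF s u] c by (simp add: sum_distrib_left mult.assoc)
    then have "udens (piof \<mu>) n (a, w) = (\<Sum>b\<in>UNIV. Qn n a b * piof \<mu> (Suc n) b) / (lam ^ n * L a * K n a)"
      using mult_left_cancel[THEN iffD1, OF _ e] ell_pos[OF s] sum_udens_kids[OF w, of "piof \<mu>"] by simp
    then show ?thesis using K_pos[of n a] lamL_pos[of n a] by (simp add: udens_def)
  qed
qed

lemma measure_from_orbit:
  assumes p: "inverse_orbit Qn p"
  shows "\<exists>\<mu>. siv \<mu> \<and> uniform (dens \<mu>) \<and> piof \<mu> = p"
proof -
  have p0: "0 \<le> p n a" and p1: "(\<Sum>a\<in>UNIV. p n a) = 1" for n a
    using inverse_orbit_nonneg[OF p] inverse_orbit_sum[OF p] by blast+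
  have u0: "0 \<le> udens p n c" for n c
    using p0 K_pos lamL_pos by (simp add: udens_def less_imp_le)
  have ueq: "udens p n c = (\<Sum>C\<in>cells (Suc n). udens p (Suc n) C * real (count_list (kids n C) c))" if "c \<in> cells n" for n c
  proof -
    obtain a w where c: "c = (a, w)" "w \<in> pw n a" using \<open>c \<in> cells n\<close> by (auto simp: cells_def)
    have "p n a = (\<Sum>b\<in>UNIV. Qn n a b * p (Suc n) b)" by (rule inverse_orbit_eq[OF p])
    then show ?thesis unfolding c(1) sum_udens_kids[OF c(2)] by (simp add: udens_def)
  qed
  \<comment> \<open>The mean number of letters per unit of geometric length. Consistency makes it
    the same at all levels, so one division by \<open>s 0\<close> normalises the whole
    family.\<close>
  define s where "s n = (\<Sum>c\<in>cells n. udens p n c * real (length (snd c)))" for n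
  have "s (Suc n) = s n" for n
  proof -
    have "s n = (\<Sum>c\<in>cells n. \<Sum>C\<in>cells (Suc n). udens p (Suc n) C * (real (count_list (kids n C) c) * real (length (snd c))))"
      unfolding s_def by (intro sum.cong refl, subst ueq, assumption) (simp only: sum_distrib_right mult.assoc)
    also have "\<dots> = (\<Sum>C\<in>cells (Suc n). \<Sum>c\<in>cells n. udens p (Suc n) C * (real (count_list (kids n C) c) * real (length (snd c))))"
      by (rule sum.swap)
    also have "\<dots> = (\<Sum>C\<in>cells (Suc n). udens p (Suc n) C * (\<Sum>c\<leftarrow>kids n C. real (length (snd c))))"
      by (intro sum.cong refl) (simp add: sum_list_map_count[OF finite_cells kids_cells] sum_distrib_left)
    also have "\<dots> = s (Suc n)" unfolding s_def
      by (intro sum.cong refl) (simp add: kids_concat[symmetric] length_concat_sum o_def)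
    finally show ?thesis by simp
  qed
  then have sn: "s n = s 0" for n by (induction n) auto
  have tot: "(\<Sum>c\<in>cells n. udens p n c * Lword L (snd c)) = 1" for n
  proof -
    have "(\<Sum>c\<in>cells n. udens p n c * Lword L (snd c)) = (\<Sum>a\<in>UNIV. \<Sum>w\<in>pw n a. p n a / K n a)"
      unfolding sum_cells by (intro sum.cong refl)
        (use K_pos lamL_pos lam_gt_1 L_pos in \<open>auto simp: udens_def Lword_pw field_simps\<close>)
    also have "\<dots> = 1" using p1[of n] K_pos[of n] by (simp add: K_def)
    finally show ?thesis .
  qed
  have s0: "0 < s 0"
  proof -
    have "1 \<le> (\<Sum>c\<in>cells 0. udens p 0 c * (Lmax * real (length (snd c))))"
      unfolding tot[of 0, symmetric] by (intro sum_mono mult_left_mono u0 Lword_length)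
    also have "\<dots> = Lmax * s 0" by (simp add: s_def sum_distrib_left mult.left_commute)
    finally have "0 < Lmax * s 0" by simp
    moreover have "0 < Lmax" using Lmax_ge[of undefined] L_pos[of undefined] by linarith
    ultimately show ?thesis by (rule zero_less_mult_pos)
  qed
  define d where "d n c = udens p n c / s 0" for n c
  have "consistent d" unfolding consistent_def weight_def
  proof (intro conjI allI ballI)
    show "0 \<le> d n c" for n c using u0 s0 by (simp add: d_def)
    show "(\<Sum>c\<in>cells n. d n c * real (length (snd c))) = 1" for n
      using sn[of n] s0 by (simp add: d_def s_def sum_divide_distrib[symmetric])
    show "d n c = (\<Sum>C\<in>cells (Suc n). d (Suc n) C * real (count_list (kids n C) c))" if "c \<in> cells n" for n c
      using ueq[OF that] by (simp add: d_def sum_divide_distrib)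
  qed
  then obtain \<mu> where m: "siv \<mu>" "\<And>n c. c \<in> cells n \<Longrightarrow> dens \<mu> n c = d n c"
    using measure_from_consistent by blast
  have "uniform (dens \<mu>)"
    unfolding uniform_def using m(2) by (auto simp: cells_def d_def udens_def)
  moreover have l: "ell \<mu> = 1 / s 0"
    unfolding ell_eq[OF m(1), of 0] using m(2) tot[of 0] by (simp add: d_def sum_divide_distrib[symmetric])
  have "piof \<mu> n a = p n a" for n a
  proof -
    have "tile \<mu> n (a, w) = p n a / K n a" if "w \<in> pw n a" for w
      using m(2)[of "(a, w)" n] that l s0 K_pos[of n a] lamL_pos[of n a]
      by (simp add: tile_def d_def udens_def cells_def Lword_pw[OF that])
    then show ?thesis using K_pos[of n a] by (simp add: piof_def K_def)
  qed
  ultimately show ?thesis using m(1) by blast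
qed

lemma uniform_eqI:
  assumes "siv \<mu>" "uniform (dens \<mu>)" "siv \<mu>'" "uniform (dens \<mu>')" "piof \<mu> = piof \<mu>'"
  shows "\<mu> = \<mu>'"
  by (rule siv_eqI_tile[OF assms(1,3), of 0]) (use assms tile_uniform in \<open>auto simp: cells_def\<close>)

theorem unique_uniform_iff_ergodic:
  "(\<exists>!\<mu>. siv \<mu> \<and> uniform (dens \<mu>)) \<longleftrightarrow> ergodic_inverse_time Qn"
  unfolding ergodic_iff_unique_orbit[of Qn, OF column_stochastic_Qn]
proof
  assume "\<exists>!\<mu>. siv \<mu> \<and> uniform (dens \<mu>)"
  then obtain \<mu> where m: "siv \<mu>" "uniform (dens \<mu>)" "\<And>\<mu>'. siv \<mu>' \<Longrightarrow> uniform (dens \<mu>') \<Longrightarrow> \<mu>' = \<mu>" by blast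
  show "\<exists>!p. inverse_orbit Qn p"
  proof (rule ex1I[of _ "piof \<mu>"])
    fix p assume "inverse_orbit Qn p"
    then obtain \<mu>' where "siv \<mu>'" "uniform (dens \<mu>')" "piof \<mu>' = p" using measure_from_orbit by blast
    then show "p = piof \<mu>" using m(3) by blast
  qed (rule piof_orbit[OF m(1,2)])
next
  assume "\<exists>!p. inverse_orbit Qn p"
  then obtain p where p: "inverse_orbit Qn p" "\<And>q. inverse_orbit Qn q \<Longrightarrow> q = p" by blast
  obtain \<mu> where m: "siv \<mu>" "uniform (dens \<mu>)" "piof \<mu> = p" using measure_from_orbit[OF p(1)] by blast
  show "\<exists>!\<mu>. siv \<mu> \<and> uniform (dens \<mu>)"
  proof (rule ex1I[of _ \<mu>])
    fix \<mu>' assume "siv \<mu>' \<and> uniform (dens \<mu>')"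
    then show "\<mu>' = \<mu>" using uniform_eqI[of \<mu>' \<mu>] m p(2) piof_orbit by metis
  qed (use m in blast)
qed

end

section \<open>The suspension flow\<close>

context recog_subst
begin

section \<open>Roof sums and the flow\<close>

abbreviation rf where "rf \<equiv> roofsum L"

lemma rf_0 [simp]: "rf x 0 = 0" and rf_1 [simp]: "rf x 1 = L (x 0)"
  by (simp_all add: roofsum_isum)

lemma rf_Suc: "rf x (n + 1) = rf x n + L (x n)"
  by (simp add: roofsum_isum isum_Suc)

lemma rf_add: "rf x (m + n) = rf x m + rf (shiftn m x) n"
  by (simp add: roofsum_isum isum_add shiftn_apply)

lemma rf_less_iff: "rf x m < rf x n \<longleftrightarrow> m < n"
  unfolding roofsum_isum by (rule isum_less_iff[of "Lmin"]) (use Lmin_le Lmin_pos in auto)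

lemma rf_le_iff: "rf x m \<le> rf x n \<longleftrightarrow> m \<le> n"
  using rf_less_iff[of x n m] by linarith

lemma rf_lower: "m \<le> n \<Longrightarrow> rf x m + Lmin * of_int (n - m) \<le> rf x n"
  unfolding roofsum_isum by (rule isum_lower) (use Lmin_le in auto)

lemma rf_ex: "\<exists>n. rf x n \<le> t \<and> t < rf x (n + 1)"
  unfolding roofsum_isum by (rule isum_bracket[of "Lmin"]) (use Lmin_le Lmin_pos in auto)

lemma rf_unique: "rf x n \<le> t \<Longrightarrow> t < rf x (n + 1) \<Longrightarrow> rf x m \<le> t \<Longrightarrow> t < rf x (m + 1) \<Longrightarrow> m = n"
  by (smt (verit) rf_less_iff)

definition idx :: "(int \<Rightarrow> 'a) \<Rightarrow> real \<Rightarrow> int" where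
  "idx x t = (THE n. rf x n \<le> t \<and> t < rf x (n + 1))"

lemma idx_eqI: "rf x n \<le> t \<Longrightarrow> t < rf x (n + 1) \<Longrightarrow> idx x t = n"
  unfolding idx_def by (rule the_equality) (use rf_unique in blast)+

lemma idx: "rf x (idx x t) \<le> t" "t < rf x (idx x t + 1)"
  using rf_ex[of x t] idx_eqI[of x _ t] by auto

lemma idx_eq_iff: "idx x t = n \<longleftrightarrow> rf x n \<le> t \<and> t < rf x (n + 1)"
  using idx idx_eqI by blast

lemma flow_idx: "flow L t (x, s) = (shiftn (idx x (s + t)) x, s + t - rf x (idx x (s + t)))"
  by (simp add: flow_def idx_def Let_def)

lemma flow_eq:
  "rf x n \<le> s + t \<Longrightarrow> s + t < rf x (n + 1) \<Longrightarrow> flow L t (x, s) = (shiftn n x, s + t - rf x n)"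
  by (simp add: flow_idx idx_eqI)

lemma flow_flow: "flow L t (flow L u p) = flow L (t + u) p"
proof -
  obtain x s where p: "p = (x, s)" by fastforce
  define n where "n = idx x (s + u)"
  define m where "m = idx (shiftn n x) (s + u - rf x n + t)"
  have "rf (shiftn n x) m \<le> s + u - rf x n + t" "s + u - rf x n + t < rf (shiftn n x) (m + 1)"
    using idx m_def by auto
  then have "rf x (n + m) \<le> s + (t + u)" "s + (t + u) < rf x (n + m + 1)"
    using rf_add[of x n m] rf_add[of x n "m + 1"] by (simp_all add: add.assoc)
  then have "flow L (t + u) p = (shiftn (n + m) x, s + (t + u) - rf x (n + m))"
    unfolding p by (rule flow_eq)
  moreover have "flow L t (flow L u p) = (shiftn m (shiftn n x), s + u - rf x n + t - rf (shiftn n x) m)"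
    by (simp only: p flow_idx n_def m_def)
  ultimately show ?thesis using rf_add[of x n m] by (simp add: add.commute)
qed

lemma flow_snd: "0 \<le> snd (flow L t p)" "snd (flow L t p) < L (fst (flow L t p) 0)"
  using idx[where x = "fst p" and t = "snd p + t"] rf_Suc[of "fst p" "idx (fst p) (snd p + t)"]
  by (cases p; simp add: flow_idx shiftn_apply)+

lemma flow_0: "0 \<le> s \<Longrightarrow> s < L (x 0) \<Longrightarrow> flow L 0 (x, s) = (x, s)"
  using flow_eq[of x 0 s 0] by simp

lemma hull_iff: "(x, s) \<in> HY \<longleftrightarrow> x \<in> X \<and> 0 \<le> s \<and> s < L (x 0)"
  by (simp add: geo_hull_def)

lemma flow_X: "fst (flow L t p) \<in> X \<longleftrightarrow> fst p \<in> X"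
  by (cases p) (simp add: flow_idx)

lemma flow_hull: "p \<in> HY \<Longrightarrow> flow L t p \<in> HY"
  using flow_snd[of t p] flow_X[of t p] by (cases p; cases "flow L t p") (auto simp: hull_iff)

text \<open>For a height outside the interval of its letter, time 0 moves the point to its normal
  form; in the hull the flow is a genuine group action.\<close>

lemma flow_0_hull: "p \<in> HY \<Longrightarrow> flow L 0 p = p"
  by (cases p) (simp add: hull_iff flow_0)

lemma rf_measurable [measurable]: "(\<lambda>x. rf x n) \<in> borel_measurable MX"
proof -
  have "(\<lambda>x. L (x i)) \<in> borel_measurable MX" for i
    by (rule measurable_compose[OF measurable_coord]) simp
  then show ?thesis unfolding roofsum_def by (cases "0 \<le> n") auto
qed

lemma L0_measurable [measurable]: "(\<lambda>x. L (x i)) \<in> borel_measurable MX"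
  by (rule measurable_compose[OF measurable_coord]) simp

lemma space_MY [simp]: "space MY = UNIV"
  by (simp add: MY_def space_pair_measure)

lemma hull_sets [measurable]: "HY \<in> sets MY"
proof -
  have "HY = {z \<in> space (MX \<Otimes>\<^sub>M lborel). fst z \<in> X \<and> 0 \<le> snd z \<and> snd z < L (fst z 0)}"
    by (auto simp: geo_hull_def space_pair_measure)
  also have "\<dots> \<in> sets (MX \<Otimes>\<^sub>M lborel)" by measurable
  finally show ?thesis by (simp add: MY_def)
qed

text \<open>On each of the countably many sets where \<open>idx\<close> is constant, the flow is a
  shift combined with a translation of the height.\<close>

lemma flow_measurable_joint: "(\<lambda>z. flow L (fst z) (snd z)) \<in> measurable (lborel \<Otimes>\<^sub>M MY) MY"
proof -
  let ?M = "lborel \<Otimes>\<^sub>M (MX \<Otimes>\<^sub>M lborel) :: (real \<times> (int \<Rightarrow> 'a) \<times> real) measure"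
  let ?i = "\<lambda>z. idx (fst (snd z)) (snd (snd z) + fst z)"
  have i: "?i \<in> measurable ?M (count_space UNIV)"
  proof (rule measurable_count_space_eq2_countable[THEN iffD2])
    show "?i \<in> space ?M \<rightarrow> UNIV \<and> (\<forall>n\<in>UNIV. ?i -` {n} \<inter> space ?M \<in> sets ?M)"
    proof safe
      fix n
      have "?i -` {n} \<inter> space ?M = {z \<in> space ?M. rf (fst (snd z)) n \<le> snd (snd z) + fst z \<and> snd (snd z) + fst z < rf (fst (snd z)) (n + 1)}"
        by (auto simp: idx_eq_iff[symmetric])
      also have "\<dots> \<in> sets ?M" by measurable
      finally show "?i -` {n} \<inter> space ?M \<in> sets ?M" .
    qed auto
  qed
  have 1: "(\<lambda>z. shiftn (?i z) (fst (snd z))) \<in> measurable ?M MX"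
    by (rule measurable_compose_countable[OF _ i]) measurable
  have 2: "(\<lambda>z. snd (snd z) + fst z - rf (fst (snd z)) (?i z)) \<in> borel_measurable ?M"
    by (rule measurable_compose_countable[OF _ i]) measurable
  have "(\<lambda>z. (shiftn (?i z) (fst (snd z)), snd (snd z) + fst z - rf (fst (snd z)) (?i z))) \<in> measurable ?M (MX \<Otimes>\<^sub>M lborel)"
    using 1 2 by (intro measurable_Pair) auto
  moreover have "(\<lambda>z. flow L (fst z) (snd z)) = (\<lambda>z. (shiftn (?i z) (fst (snd z)), snd (snd z) + fst z - rf (fst (snd z)) (?i z)))"
    by (auto simp: flow_idx fun_eq_iff)
  ultimately show ?thesis by (simp add: MY_def)
qed

lemma flow_measurable [measurable]: "flow L t \<in> measurable MY MY"
  using measurable_compose[OF measurable_Pair1' flow_measurable_joint, of t] by simp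

section \<open>Flow-invariant measures and lifts\<close>

abbreviation finv where "finv \<equiv> flow_inv_measure \<sigma> L"

lemma finv_sets: "finv \<nu> \<Longrightarrow> sets \<nu> = sets MY"
  and finv_prob: "finv \<nu> \<Longrightarrow> prob_space \<nu>"
  by (auto simp: flow_inv_measure_def)

lemma finv_space: "finv \<nu> \<Longrightarrow> space \<nu> = UNIV"
  using sets_eq_imp_space_eq[OF finv_sets] by simp

lemma finv_AE: "finv \<nu> \<Longrightarrow> AE p in \<nu>. p \<in> HY"
  by (rule prob_space.AE_prob_1[OF finv_prob]) (auto simp: flow_inv_measure_def measure_def)

lemma finv_measurable: "finv \<nu> \<Longrightarrow> f \<in> measurable MY N \<Longrightarrow> f \<in> measurable \<nu> N"
  using measurable_cong_sets[OF finv_sets refl] by blast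

lemma finv_nn_integral:
  assumes n: "finv \<nu>" and F: "F \<in> borel_measurable MY"
  shows "(\<integral>\<^sup>+p. F (flow L t p) \<partial>\<nu>) = (\<integral>\<^sup>+p. F p \<partial>\<nu>)"
proof -
  have m: "flow L t \<in> measurable \<nu> MY" using finv_measurable[OF n flow_measurable] .
  have "distr \<nu> MY (flow L t) = \<nu>"
  proof (rule measure_eqI)
    fix A assume "A \<in> sets (distr \<nu> MY (flow L t))"
    then show "emeasure (distr \<nu> MY (flow L t)) A = emeasure \<nu> A"
      using n m by (simp add: emeasure_distr flow_inv_measure_def)
  qed (simp add: finv_sets[OF n])
  then have "(\<integral>\<^sup>+p. F p \<partial>\<nu>) = (\<integral>\<^sup>+p. F p \<partial>distr \<nu> MY (flow L t))" by simp
  also have "\<dots> = (\<integral>\<^sup>+p. F (flow L t p) \<partial>\<nu>)" by (rule nn_integral_distr[OF m]) (simp add: F)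
  finally show ?thesis by simp
qed

lemma finv_flow_integral:
  assumes n: "finv \<nu>" and G: "G \<in> borel_measurable MY" and T: "0 \<le> T"
  shows "(\<integral>\<^sup>+p. (\<integral>\<^sup>+t. G (flow L t p) * indicator {0..<T} t \<partial>lborel) \<partial>\<nu>) = ennreal T * (\<integral>\<^sup>+p. G p \<partial>\<nu>)"
proof -
  interpret prob_space \<nu> using finv_prob[OF n] .
  interpret P: pair_sigma_finite lborel \<nu> ..
  have [measurable_cong]: "sets \<nu> = sets MY" by (rule finv_sets[OF n])
  have [measurable]: "(\<lambda>z. G (flow L (fst z) (snd z))) \<in> borel_measurable (lborel \<Otimes>\<^sub>M \<nu>)"
    using measurable_compose[OF flow_measurable_joint G] by simp
  have "(\<integral>\<^sup>+p. (\<integral>\<^sup>+t. G (flow L t p) * indicator {0..<T} t \<partial>lborel) \<partial>\<nu>)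
    = (\<integral>\<^sup>+t. (\<integral>\<^sup>+p. G (flow L t p) * indicator {0..<T} t \<partial>\<nu>) \<partial>lborel)"
    by (rule P.Fubini') (auto simp: split_beta)
  also have "\<dots> = (\<integral>\<^sup>+t. (\<integral>\<^sup>+p. G p \<partial>\<nu>) * indicator {0..<T} t \<partial>lborel)"
  proof (intro nn_integral_cong)
    fix t
    have "(\<lambda>p. G (flow L t p)) \<in> borel_measurable \<nu>"
      by (rule finv_measurable[OF n measurable_compose[OF flow_measurable G]])
    then show "(\<integral>\<^sup>+p. G (flow L t p) * indicator {0..<T} t \<partial>\<nu>) = (\<integral>\<^sup>+p. G p \<partial>\<nu>) * indicator {0..<T} t"
      by (simp add: nn_integral_multc finv_nn_integral[OF n G])
  qed
  also have "\<dots> = ennreal T * (\<integral>\<^sup>+p. G p \<partial>\<nu>)"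
    using T by (simp add: nn_integral_cmult_indicator mult.commute)
  finally show ?thesis .
qed

lemma nn_integral_L:
  assumes s: "siv \<mu>"
  shows "(\<integral>\<^sup>+x. ennreal (L (x 0)) \<partial>\<mu>) = ennreal (ell \<mu>)"
proof -
  have "(\<integral>\<^sup>+x. ennreal (L (x 0)) \<partial>\<mu>) = ennreal (\<Sum>c\<in>cells 0. dens \<mu> 0 c * \<bar>Lword L (snd c)\<bar>)"
  proof (rule kac_const[OF s])
    fix c y assume c: "cell 0 y = Some c"
    have "(\<Sum>i<length (snd c). ennreal (L (shiftn (int i) y 0))) = (\<Sum>i<length (snd c). ennreal (L (snd c ! i)))"
      using cell_word[of 0 y "fst c" "snd c"] c by (intro sum.cong refl) (simp add: shiftn_apply)
    also have "\<dots> = ennreal (Lword L (snd c))"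
      by (simp add: sum_ennreal Lword_def sum_list_sum_nth atLeast0LessThan)
    moreover have "0 \<le> Lword L (snd c)" using Lword_cell[OF cell_in_cells[OF c]] lamL_pos[of 0 "fst c"] by simp
    ultimately show "(\<Sum>i<length (snd c). ennreal (L (shiftn (int i) y 0))) = ennreal \<bar>Lword L (snd c)\<bar>" by simp
  qed auto
  moreover have "\<bar>Lword L (snd c)\<bar> = Lword L (snd c)" if "c \<in> cells 0" for c
    using Lword_cell[OF that] lamL_pos[of 0 "fst c"] by simp
  ultimately show ?thesis by (simp add: ell_def)
qed

lemma integral_L: "siv \<mu> \<Longrightarrow> (\<integral>x. L (x 0) \<partial>\<mu>) = ell \<mu>"
  using nn_integral_L[of \<mu>] ell_pos[of \<mu>]
  by (subst integral_eq_nn_integral) (auto intro: siv_measurable)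

lemma sets_lift: "siv \<mu> \<Longrightarrow> sets (lifted \<mu>) = sets MY"
  unfolding lift_def MY_def by (simp add: sets_pair_measure_cong[OF siv_sets refl])

lemma space_lift: "siv \<mu> \<Longrightarrow> space (lifted \<mu>) = UNIV"
  using sets_eq_imp_space_eq[OF sets_lift] by simp

lemma nn_integral_lift:
  assumes s: "siv \<mu>" and F: "F \<in> borel_measurable MY"
  shows "(\<integral>\<^sup>+p. F p \<partial>lifted \<mu>)
    = (\<integral>\<^sup>+x. (\<integral>\<^sup>+r. F (x, r) * indicator {0..<L (x 0)} r \<partial>lborel) \<partial>\<mu>) / ennreal (ell \<mu>)"
proof -
  interpret prob_space \<mu> using siv_prob[OF s] .
  have [measurable_cong]: "sets \<mu> = sets MX" using siv_sets[OF s] .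
  have c: "sets (\<mu> \<Otimes>\<^sub>M lborel) = sets MY" unfolding MY_def by (rule sets_pair_measure_cong[OF siv_sets[OF s] refl])
  have F' [measurable]: "F \<in> borel_measurable (\<mu> \<Otimes>\<^sub>M lborel)" using F measurable_cong_sets[OF c refl] by blast
  have h [measurable]: "HY \<in> sets (\<mu> \<Otimes>\<^sub>M lborel)" using hull_sets c by simp
  have "(\<integral>\<^sup>+p. F p \<partial>lifted \<mu>) = (\<integral>\<^sup>+p. ennreal (indicator (HY) p / ell \<mu>) * F p \<partial>(\<mu> \<Otimes>\<^sub>M lborel))"
    unfolding lift_def integral_L[OF s] by (rule nn_integral_density) auto
  also have "\<dots> = (\<integral>\<^sup>+p. (F p * indicator (HY) p) / ennreal (ell \<mu>) \<partial>(\<mu> \<Otimes>\<^sub>M lborel))"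
  proof (intro nn_integral_cong)
    fix p :: "(int \<Rightarrow> 'a) \<times> real"
    have "ennreal (1 / ell \<mu>) = inverse (ennreal (ell \<mu>))"
      using ell_pos[OF s] by (simp add: inverse_ennreal divide_inverse)
    then show "ennreal (indicator (HY) p / ell \<mu>) * F p = (F p * indicator (HY) p) / ennreal (ell \<mu>)"
      by (cases "p \<in> HY") (simp_all add: divide_ennreal_def mult.commute)
  qed
  also have "\<dots> = (\<integral>\<^sup>+p. F p * indicator (HY) p \<partial>(\<mu> \<Otimes>\<^sub>M lborel)) / ennreal (ell \<mu>)"
    by (rule nn_integral_divide) auto
  also have "(\<integral>\<^sup>+p. F p * indicator (HY) p \<partial>(\<mu> \<Otimes>\<^sub>M lborel))
      = (\<integral>\<^sup>+x. \<integral>\<^sup>+r. F (x, r) * indicator (HY) (x, r) \<partial>lborel \<partial>\<mu>)"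
    by (subst lborel.nn_integral_fst[symmetric]) auto
  also have "\<dots> = (\<integral>\<^sup>+x. (\<integral>\<^sup>+r. F (x, r) * indicator {0..<L (x 0)} r \<partial>lborel) \<partial>\<mu>)"
    by (rule nn_integral_cong_AE, rule AE_mp[OF siv_AE[OF s]], rule AE_I2)
      (auto intro!: nn_integral_cong simp: hull_iff indicator_def)
  finally show ?thesis .
qed

lemma prob_lift: 
  assumes s: "siv \<mu>"
  shows "prob_space (lifted \<mu>)" "emeasure (lifted \<mu>) (HY) = 1"
proof -
  have 1: "emeasure (lifted \<mu>) (HY) = 1" "emeasure (lifted \<mu>) UNIV = 1"
  proof -
    have e: "(\<integral>\<^sup>+p. indicator A p \<partial>lifted \<mu>) = 1" if "A \<in> sets MY" "HY \<subseteq> A" for A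
    proof -
      have "(\<integral>\<^sup>+p. indicator A p \<partial>lifted \<mu>) = (\<integral>\<^sup>+x. (\<integral>\<^sup>+r. indicator A (x, r) * indicator {0..<L (x 0)} r \<partial>lborel) \<partial>\<mu>) / ennreal (ell \<mu>)"
        by (rule nn_integral_lift[OF s borel_measurable_indicator[OF that(1)]])
      also have "(\<integral>\<^sup>+x. (\<integral>\<^sup>+r. indicator A (x, r) * indicator {0..<L (x 0)} r \<partial>lborel) \<partial>\<mu>) = (\<integral>\<^sup>+x. ennreal (L (x 0)) \<partial>\<mu>)"
      proof (rule nn_integral_cong_AE, rule AE_mp[OF siv_AE[OF s]], rule AE_I2, rule impI)
        fix x assume "x \<in> X"
        then have "(\<integral>\<^sup>+r. indicator A (x, r) * indicator {0..<L (x 0)} r \<partial>lborel) = (\<integral>\<^sup>+r. indicator {0..<L (x 0)} r \<partial>lborel)"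
          using that(2) by (intro nn_integral_cong) (auto simp: indicator_def hull_iff subset_iff)
        then show "(\<integral>\<^sup>+r. indicator A (x, r) * indicator {0..<L (x 0)} r \<partial>lborel) = ennreal (L (x 0))" by simp
      qed
      finally show ?thesis using ell_pos[OF s] by (simp add: nn_integral_L[OF s] divide_ennreal)
    qed
    show "emeasure (lifted \<mu>) (HY) = 1" using e[OF hull_sets] by (simp add: sets_lift[OF s])
    have "UNIV \<in> sets MY" using sets.top[of MY] by simp
    then show "emeasure (lifted \<mu>) UNIV = 1" using e[of UNIV] by (simp add: sets_lift[OF s] space_lift[OF s])
  qed
  then show "prob_space (lifted \<mu>)" by (intro prob_spaceI) (simp add: space_lift[OF s])
  show "emeasure (lifted \<mu>) (HY) = 1" by (rule 1)
qed

lemma nn_integral_translate: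
  fixes f :: "real \<Rightarrow> ennreal"
  assumes "f \<in> borel_measurable borel"
  shows "(\<integral>\<^sup>+r. f (r + t) \<partial>lborel) = (\<integral>\<^sup>+r. f r \<partial>lborel)"
  using nn_integral_real_affine[OF assms, of 1 t] by (simp add: add.commute)

lemma section_measurable: "F \<in> borel_measurable MY \<Longrightarrow> (\<lambda>r. F (x, r)) \<in> borel_measurable borel"
  unfolding MY_def by (drule measurable_Pair2[where x = x]) (auto simp: measurable_lborel1)

lemma base_integral_measurable:
  assumes F: "F \<in> borel_measurable MY" and a: "a \<in> borel_measurable MX" "b \<in> borel_measurable MX"
  shows "(\<lambda>x. \<integral>\<^sup>+r. F (x, r) * indicator {a x..<b x} r \<partial>lborel) \<in> borel_measurable MX"
proof -
  have [measurable]: "F \<in> borel_measurable (MX \<Otimes>\<^sub>M lborel)" using F by (simp add: MY_def)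
  note [measurable] = a
  have "(\<lambda>z. F z * indicator {z \<in> space (MX \<Otimes>\<^sub>M lborel). a (fst z) \<le> snd z \<and> snd z < b (fst z)} z) \<in> borel_measurable (MX \<Otimes>\<^sub>M lborel)"
    by measurable
  then have "(\<lambda>x. \<integral>\<^sup>+r. F (x, r) * indicator {z \<in> space (MX \<Otimes>\<^sub>M lborel). a (fst z) \<le> snd z \<and> snd z < b (fst z)} (x, r) \<partial>lborel) \<in> borel_measurable MX"
    by (rule lborel.borel_measurable_nn_integral_fst)
  then show ?thesis by (simp add: space_pair_measure indicator_def)
qed

text \<open>Up to time \<open>Lmin\<close> at most one letter boundary is crossed. \<open>A\<close>
  collects the points that land in the same letter and \<open>B\<close> those that land in the next
  one; shift invariance brings the latter back.\<close>

lemma lift_small_flow: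
  assumes s: "siv \<mu>" and t: "0 \<le> t" "t \<le> Lmin" and F: "F \<in> borel_measurable MY"
  shows "(\<integral>\<^sup>+p. F (flow L t p) \<partial>lifted \<mu>) = (\<integral>\<^sup>+p. F p \<partial>lifted \<mu>)"
proof -
  have [measurable_cong]: "sets \<mu> = sets MX" using siv_sets[OF s] .
  have Ft: "(\<lambda>p. F (flow L t p)) \<in> borel_measurable MY" by (rule measurable_compose[OF flow_measurable F])
  have tL: "t \<le> L a" for a using t Lmin_le[of a] by linarith
  define A where "A x = (\<integral>\<^sup>+r. F (x, r) * indicator {t..<L (x 0)} r \<partial>lborel)" for x
  define B where "B x = (\<integral>\<^sup>+r. F (x, r) * indicator {0..<t} r \<partial>lborel)" for x
  note sm = section_measurable[OF F]
  have A: "A \<in> borel_measurable MX" unfolding A_def by (rule base_integral_measurable[OF F]) auto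
  have B: "B \<in> borel_measurable MX" unfolding B_def by (rule base_integral_measurable[OF F]) auto
  have 1: "(\<integral>\<^sup>+r. F (flow L t (x, r)) * indicator {0..<L (x 0)} r \<partial>lborel) = A x + B (shiftn 1 x)" for x
  proof -
    have "(\<integral>\<^sup>+r. F (flow L t (x, r)) * indicator {0..<L (x 0)} r \<partial>lborel)
      = (\<integral>\<^sup>+r. F (x, r + t) * indicator {t..<L (x 0)} (r + t)
          + F (shiftn 1 x, r + (t - L (x 0))) * indicator {0..<t} (r + (t - L (x 0))) \<partial>lborel)"
    proof (intro nn_integral_cong)
      fix r
      have e1: "flow L t (x, r) = (x, r + t)" if "0 \<le> r" "r + t < L (x 0)"
        using flow_eq[of x 0 r t] that t by simp
      have e2: "flow L t (x, r) = (shiftn 1 x, r + (t - L (x 0)))" if "r < L (x 0)" "L (x 0) \<le> r + t"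
        using flow_eq[of x 1 r t] that tL[of "x 1"] rf_Suc[of x 1] by simp
      show "F (flow L t (x, r)) * indicator {0..<L (x 0)} r
        = F (x, r + t) * indicator {t..<L (x 0)} (r + t)
          + F (shiftn 1 x, r + (t - L (x 0))) * indicator {0..<t} (r + (t - L (x 0)))"
      proof -
        have tx: "t \<le> L (x 0)" by (rule tL)
        consider "0 \<le> r \<and> r + t < L (x 0)" | "0 \<le> r \<and> r < L (x 0) \<and> L (x 0) \<le> r + t" | "r < 0 \<or> L (x 0) \<le> r"
          by linarith
        then show ?thesis
        proof cases
          case 1 then show ?thesis using e1 t(1) by (simp add: indicator_def)
        next
          case 2 then show ?thesis using e2 t(1) by (simp add: indicator_def)
        next
          case 3 then show ?thesis using tx t(1) by (auto simp: indicator_def)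
        qed
      qed
    qed
    also have "\<dots> = (\<integral>\<^sup>+r. F (x, r + t) * indicator {t..<L (x 0)} (r + t) \<partial>lborel)
         + (\<integral>\<^sup>+r. F (shiftn 1 x, r + (t - L (x 0))) * indicator {0..<t} (r + (t - L (x 0))) \<partial>lborel)"
    proof (rule nn_integral_add)
      have m1: "(\<lambda>r. F (x, r) * indicator {t..<L (x 0)} r) \<in> borel_measurable borel" using sm by auto
      have m2: "(\<lambda>r. F (shiftn 1 x, r) * indicator {0..<t} r) \<in> borel_measurable borel" using sm by auto
      show "(\<lambda>r. F (x, r + t) * indicator {t..<L (x 0)} (r + t)) \<in> borel_measurable lborel"
        using measurable_compose[OF _ m1, of "\<lambda>r. r + t" lborel] by simp
      show "(\<lambda>r. F (shiftn 1 x, r + (t - L (x 0))) * indicator {0..<t} (r + (t - L (x 0)))) \<in> borel_measurable lborel"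
        using measurable_compose[OF _ m2, of "\<lambda>r. r + (t - L (x 0))" lborel] by simp
    qed
    also have "(\<integral>\<^sup>+r. F (x, r + t) * indicator {t..<L (x 0)} (r + t) \<partial>lborel) = A x"
      unfolding A_def by (rule nn_integral_translate[of "\<lambda>r. F (x, r) * indicator {t..<L (x 0)} r"]) (use sm in auto)
    also have "(\<integral>\<^sup>+r. F (shiftn 1 x, r + (t - L (x 0))) * indicator {0..<t} (r + (t - L (x 0))) \<partial>lborel) = B (shiftn 1 x)"
      unfolding B_def by (rule nn_integral_translate[of "\<lambda>r. F (shiftn 1 x, r) * indicator {0..<t} r"]) (use sm in auto)
    finally show ?thesis .
  qed
  have 2: "(\<integral>\<^sup>+r. F (x, r) * indicator {0..<L (x 0)} r \<partial>lborel) = A x + B x" for x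
  proof -
    have "A x + B x = (\<integral>\<^sup>+r. F (x, r) * indicator {t..<L (x 0)} r + F (x, r) * indicator {0..<t} r \<partial>lborel)"
      unfolding A_def B_def by (rule nn_integral_add[symmetric]) (use sm in auto)
    also have "\<dots> = (\<integral>\<^sup>+r. F (x, r) * indicator {0..<L (x 0)} r \<partial>lborel)"
    proof (intro nn_integral_cong)
      fix r
      have "t \<le> L (x 0)" by (rule tL)
      then show "F (x, r) * indicator {t..<L (x 0)} r + F (x, r) * indicator {0..<t} r = F (x, r) * indicator {0..<L (x 0)} r"
        using t(1) by (auto simp: indicator_def)
    qed
    finally show ?thesis by simp
  qed
  have "(\<integral>\<^sup>+x. A x + B (shiftn 1 x) \<partial>\<mu>) = (\<integral>\<^sup>+x. A x \<partial>\<mu>) + (\<integral>\<^sup>+x. B (shiftn 1 x) \<partial>\<mu>)"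
    by (rule nn_integral_add) (auto intro!: siv_measurable[OF s] A measurable_compose[OF measurable_shiftn B])
  also have "\<dots> = (\<integral>\<^sup>+x. A x + B x \<partial>\<mu>)"
    unfolding siv_nn_integral_shiftn[OF s B]
    by (rule nn_integral_add[symmetric]) (auto intro!: siv_measurable[OF s] A B)
  finally show ?thesis unfolding nn_integral_lift[OF s F] nn_integral_lift[OF s Ft] 1 2 by simp
qed

text \<open>Positive times are split into equal steps of size at most \<open>Lmin\<close>; negative
  times are inverted, which is possible almost everywhere because the hull has full measure.\<close>

theorem lift_flow_inv:
  assumes s: "siv \<mu>"
  shows "finv (lifted \<mu>)"
proof -
  let ?\<nu> = "lifted \<mu>"
  interpret prob_space ?\<nu> using prob_lift[OF s] by blast
  have vm: "flow L t -` A \<in> sets MY" if "A \<in> sets MY" for A t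
    using measurable_sets[OF flow_measurable that] by simp
  have small: "emeasure ?\<nu> (flow L t -` A) = emeasure ?\<nu> A" if "0 \<le> t" "t \<le> Lmin" "A \<in> sets MY" for t A
  proof -
    have "(\<integral>\<^sup>+p. indicator A (flow L t p) \<partial>?\<nu>) = (\<integral>\<^sup>+p. indicator A p \<partial>?\<nu>)"
      by (rule lift_small_flow[OF s that(1,2)]) (use that in auto)
    moreover have "indicator A (flow L t p) = (indicator (flow L t -` A) p :: ennreal)" for p by (simp add: indicator_def)
    ultimately show ?thesis using that vm by (simp add: sets_lift[OF s])
  qed
  have pos: "emeasure ?\<nu> (flow L t -` A) = emeasure ?\<nu> A" if t: "0 \<le> t" and A: "A \<in> sets MY" for t A
  proof -
    obtain e0 where e0: "e0 = Lmin" "0 < e0" using Lmin_pos by blast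
    obtain n :: nat where n: "t < real n * e0"
      using ex_less_of_nat_mult[OF e0(2)] by blast
    then have "0 < real n" using t e0 by (cases n) auto
    define u where "u = t / real n"
    have u: "0 \<le> u" "u \<le> Lmin"
      using n t \<open>0 < real n\<close> unfolding e0(1)[symmetric] u_def by (simp_all add: divide_le_eq mult.commute)
    have "emeasure ?\<nu> (flow L (real k * u + u) -` A) = emeasure ?\<nu> A" if "A \<in> sets MY" for k A
      using that
    proof (induction k)
      case 0
      then show ?case using small[OF u] by simp
    next
      case (Suc k)
      have "flow L (real (Suc k) * u + u) -` A = flow L u -` (flow L (real k * u + u) -` A)"
        by (simp add: vimage_def flow_flow algebra_simps)
      then show ?case using small[OF u vm[OF Suc.prems]] Suc by simp
    qed
    from this[OF A, of "n - 1"] show ?thesis using \<open>0 < real n\<close> by (simp add: u_def field_simps of_nat_diff)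
  qed
  have AEh: "AE p in ?\<nu>. p \<in> HY"
    by (rule AE_prob_1) (use prob_lift[OF s] in \<open>simp add: measure_def\<close>)
  have "emeasure ?\<nu> (flow L t -` A) = emeasure ?\<nu> A" if A: "A \<in> sets MY" for t A
  proof (cases "0 \<le> t")
    case False
    have "emeasure ?\<nu> (flow L t -` A) = emeasure ?\<nu> (flow L (- t) -` (flow L t -` A))"
      using pos[of "- t", OF _ vm[OF A]] False by simp
    also have "\<dots> = emeasure ?\<nu> A"
    proof (rule emeasure_eq_AE)
      show "AE p in ?\<nu>. p \<in> flow L (- t) -` (flow L t -` A) \<longleftrightarrow> p \<in> A"
        by (rule AE_mp[OF AEh], rule AE_I2) (simp add: flow_flow flow_0_hull)
    qed (simp_all add: sets_lift[OF s] A vm)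
    finally show ?thesis .
  qed (use pos A in auto)
  then show ?thesis
    unfolding flow_inv_measure_def using sets_lift[OF s] prob_lift[OF s] by (simp add: space_lift[OF s])
qed

text \<open>Height minus elapsed time changes only at letter boundaries: moving forward makes it
  negative, moving backward makes it at least \<open>Lmin\<close>. So the condition holds only if
  letter 0 has not been left.\<close>

lemma hull_start_iff:
  assumes "(x, s) \<in> HY"
  shows "0 \<le> snd (flow L t (x, s)) - t \<and> snd (flow L t (x, s)) - t < Lmin
    \<longleftrightarrow> s < Lmin \<and> 0 \<le> t + s \<and> t + s < L (x 0)"
proof -
  define e where "e = Lmin"
  define n where "n = idx x (s + t)"
  have s: "0 \<le> s" "s < L (x 0)" using assms by (auto simp: hull_iff)
  have n: "rf x n \<le> s + t" "s + t < rf x (n + 1)"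
    using idx[where x = x and t = "s + t"] by (auto simp: n_def)
  have e: "snd (flow L t (x, s)) - t = s - rf x n" by (simp add: flow_idx n_def)
  have "0 \<le> s - rf x n \<and> s - rf x n < e \<longleftrightarrow> n = 0 \<and> s < e"
  proof (cases n "0 :: int" rule: linorder_cases)
    case less
    have "rf x n + e * of_int (0 - n) \<le> rf x 0" unfolding e_def by (rule rf_lower) (use less in simp)
    moreover have "e * 1 \<le> e * of_int (0 - n)"
      using less Lmin_pos unfolding e_def[symmetric] by (intro mult_left_mono) auto
    ultimately show ?thesis using s less by simp
  next
    case greater
    then have "rf x 1 \<le> rf x n" by (simp only: rf_le_iff)
    then show ?thesis using s greater by simp
  qed (use s in auto)
  moreover have "n = 0 \<longleftrightarrow> 0 \<le> t + s \<and> t + s < L (x 0)"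
    unfolding n_def idx_eq_iff by (simp add: add.commute)
  ultimately show ?thesis unfolding e e_def by blast
qed

text \<open>Mass transport along the flow. A point \<open>(x, s)\<close> with
  \<open>s < Lmin\<close> is linked to each point \<open>(x, r)\<close> over the same letter by the
  time \<open>t = r - s\<close>. Seen from \<open>(x, r)\<close>, these times form an interval of
  length \<open>Lmin\<close>, which the factor \<open>1 / Lmin\<close> cancels; invariance under
  each \<open>flow L t\<close> and Fubini exchange the two views.\<close>

lemma finv_base_integral:
  assumes n: "finv \<nu>" and F: "F \<in> borel_measurable MY"
  shows "(\<integral>\<^sup>+p. ennreal (1 / Lmin) * indicator {p. snd p < Lmin} p *
     (\<integral>\<^sup>+r. F (fst p, r) * indicator {0..<L (fst p 0)} r \<partial>lborel) \<partial>\<nu>) = (\<integral>\<^sup>+p. F p \<partial>\<nu>)"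
proof -
  define e where "e = Lmin"
  have e0: "0 < e" using Lmin_pos by (simp add: e_def)
  interpret prob_space \<nu> using finv_prob[OF n] .
  interpret P: pair_sigma_finite lborel \<nu> ..
  have [measurable_cong]: "sets \<nu> = sets MY" by (rule finv_sets[OF n])
  have [measurable]: "F \<in> borel_measurable \<nu>" using finv_measurable[OF n F] .
  have snd_m [measurable]: "snd \<in> borel_measurable MY" unfolding MY_def by simp
  define G where "G = (\<lambda>(t, q). ennreal (1 / e) * F q * indicator {t. 0 \<le> snd q - t \<and> snd q - t < e} t)"
  have Gm: "G \<in> borel_measurable (lborel \<Otimes>\<^sub>M MY)"
  proof -
    have "(\<lambda>z. ennreal (1 / e) * F (snd z) * indicator {z \<in> space (lborel \<Otimes>\<^sub>M MY). 0 \<le> snd (snd z) - fst z \<and> snd (snd z) - fst z < e} z)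
      \<in> borel_measurable (lborel \<Otimes>\<^sub>M MY)" using F by measurable
    then show ?thesis by (simp add: G_def split_beta' space_pair_measure indicator_def)
  qed
  have Gm' [measurable]: "G \<in> borel_measurable (lborel \<Otimes>\<^sub>M \<nu>)"
    using Gm measurable_cong_sets[OF sets_pair_measure_cong[OF refl finv_sets[OF n]] refl] by blast
  have fm: "(\<lambda>z. (fst z, flow L (fst z) (snd z))) \<in> measurable (lborel \<Otimes>\<^sub>M MY) (lborel \<Otimes>\<^sub>M MY)"
    using flow_measurable_joint by (intro measurable_Pair) auto
  have Gf: "(\<lambda>z. G (fst z, flow L (fst z) (snd z))) \<in> borel_measurable (lborel \<Otimes>\<^sub>M \<nu>)"
    using measurable_compose[OF fm Gm] measurable_cong_sets[OF sets_pair_measure_cong[OF refl finv_sets[OF n]] refl] by blast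
  have "(\<integral>\<^sup>+p. ennreal (1 / e) * indicator {p. snd p < e} p * (\<integral>\<^sup>+r. F (fst p, r) * indicator {0..<L (fst p 0)} r \<partial>lborel) \<partial>\<nu>)
    = (\<integral>\<^sup>+p. (\<integral>\<^sup>+t. G (t, flow L t p) \<partial>lborel) \<partial>\<nu>)"
  proof (rule nn_integral_cong_AE, rule AE_mp[OF finv_AE[OF n]], rule AE_I2, rule impI)
    fix p assume ph: "p \<in> HY"
    obtain x s where p: "p = (x, s)" by fastforce
    have m: "(\<lambda>r. F (x, r) * indicator {0..<L (x 0)} r) \<in> borel_measurable borel"
      using section_measurable[OF F] by auto
    have m2: "(\<lambda>t. F (x, t + s) * indicator {0..<L (x 0)} (t + s)) \<in> borel_measurable lborel"
      using measurable_compose[OF _ m, of "\<lambda>r. r + s" lborel] by simp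
    have "ennreal (1 / e) * indicator {p. snd p < e} p * (\<integral>\<^sup>+r. F (x, r) * indicator {0..<L (x 0)} r \<partial>lborel)
      = ennreal (1 / e) * indicator {p. snd p < e} p * (\<integral>\<^sup>+t. F (x, t + s) * indicator {0..<L (x 0)} (t + s) \<partial>lborel)"
      by (simp add: nn_integral_translate[OF m])
    also have "\<dots> = (\<integral>\<^sup>+t. ennreal (1 / e) * indicator {p. snd p < e} p * (F (x, t + s) * indicator {0..<L (x 0)} (t + s)) \<partial>lborel)"
      by (rule nn_integral_cmult[symmetric, OF m2])
    also have "\<dots> = (\<integral>\<^sup>+t. G (t, flow L t p) \<partial>lborel)"
    proof (intro nn_integral_cong)
      fix t
      have i: "0 \<le> snd (flow L t p) - t \<and> snd (flow L t p) - t < e \<longleftrightarrow> s < e \<and> 0 \<le> t + s \<and> t + s < L (x 0)"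
        using hull_start_iff[of x s t] ph unfolding p e_def by blast
      have f: "flow L t p = (x, t + s)" if "0 \<le> t + s" "t + s < L (x 0)"
        using flow_eq[of x 0 s t] that by (simp add: p add.commute)
      show "ennreal (1 / e) * indicator {p. snd p < e} p * (F (x, t + s) * indicator {0..<L (x 0)} (t + s)) = G (t, flow L t p)"
      proof (cases "s < e \<and> 0 \<le> t + s \<and> t + s < L (x 0)")
        case True
        then show ?thesis using i f by (simp add: G_def p)
      next
        case False
        then have "G (t, flow L t p) = 0" using i by (simp add: G_def)
        then show ?thesis using False by (auto simp: p indicator_def)
      qed
    qed
    finally show "ennreal (1 / e) * indicator {p. snd p < e} p * (\<integral>\<^sup>+r. F (fst p, r) * indicator {0..<L (fst p 0)} r \<partial>lborel)
      = (\<integral>\<^sup>+t. G (t, flow L t p) \<partial>lborel)" by (simp add: p)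
  qed
  also have "\<dots> = (\<integral>\<^sup>+t. (\<integral>\<^sup>+p. G (t, flow L t p) \<partial>\<nu>) \<partial>lborel)"
    by (rule P.Fubini') (use Gf in \<open>simp add: split_beta'\<close>)
  also have "\<dots> = (\<integral>\<^sup>+t. (\<integral>\<^sup>+q. G (t, q) \<partial>\<nu>) \<partial>lborel)"
  proof (rule nn_integral_cong)
    fix t
    have "(\<lambda>q. G (t, q)) \<in> borel_measurable MY" using measurable_compose[OF measurable_Pair1' Gm, of t] by simp
    from finv_nn_integral[OF n this] show "(\<integral>\<^sup>+p. G (t, flow L t p) \<partial>\<nu>) = (\<integral>\<^sup>+q. G (t, q) \<partial>\<nu>)" .
  qed
  also have "\<dots> = (\<integral>\<^sup>+q. (\<integral>\<^sup>+t. G (t, q) \<partial>lborel) \<partial>\<nu>)"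
    by (rule P.Fubini'[symmetric]) (use Gm' in simp)
  also have "\<dots> = (\<integral>\<^sup>+q. F q \<partial>\<nu>)"
  proof (rule nn_integral_cong)
    fix q :: "(int \<Rightarrow> 'a) \<times> real"
    have set: "{t. 0 \<le> snd q - t \<and> snd q - t < e} = {snd q - e<..snd q}" by auto
    have "(\<integral>\<^sup>+t. G (t, q) \<partial>lborel) = ennreal (1 / e) * F q * emeasure lborel {snd q - e<..snd q}"
      unfolding G_def prod.case set by (rule nn_integral_cmult_indicator) simp
    also have "\<dots> = F q * (ennreal (1 / e) * ennreal e)" using e0 by (simp add: mult_ac)
    also have "ennreal (1 / e) * ennreal e = 1" using e0 by (simp add: ennreal_mult[symmetric])
    finally show "(\<integral>\<^sup>+t. G (t, q) \<partial>lborel) = F q" by simp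
  qed
  finally show ?thesis by (simp add: e_def)
qed

text \<open>The base measure is read off from the strip of height \<open>Lmin\<close> at the bottom
  of the hull, which is present over every letter; \<open>finv_base_integral\<close> recovers the
  whole measure from it.\<close>

theorem finv_is_lift:
  assumes n: "finv \<nu>"
  obtains \<mu> where "siv \<mu>" "\<nu> = lifted \<mu>"
proof -
  define e where "e = Lmin"
  have e0: "0 < e" using Lmin_pos by (simp add: e_def)
  have eL: "e \<le> L a" for a using Lmin_le by (simp add: e_def)
  interpret prob_space \<nu> using finv_prob[OF n] .
  have [measurable_cong]: "sets \<nu> = sets MY" by (rule finv_sets[OF n])
  have snd_m [measurable]: "snd \<in> borel_measurable MY" unfolding MY_def by simp
  have fst_m [measurable]: "fst \<in> measurable MY MX" unfolding MY_def by simp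
  define w where "w = (\<lambda>p :: (int \<Rightarrow> 'a) \<times> real. ennreal (1 / e) * indicator {p. snd p < e} p)"
  have wm [measurable]: "w \<in> borel_measurable MY"
  proof -
    have "{p \<in> space MY. snd p < e} \<in> sets MY" by measurable
    then show ?thesis unfolding w_def by simp
  qed
  have wm' [measurable]: "w \<in> borel_measurable \<nu>" using finv_measurable[OF n wm] .
  define m0 where "m0 = distr (density \<nu> w) MX fst"
  have sm0: "sets m0 = sets MX" by (simp add: m0_def)
  have int0: "(\<integral>\<^sup>+x. f x \<partial>m0) = (\<integral>\<^sup>+p. w p * f (fst p) \<partial>\<nu>)" if [measurable]: "f \<in> borel_measurable MX" for f
  proof -
    have "(\<integral>\<^sup>+x. f x \<partial>m0) = (\<integral>\<^sup>+p. f (fst p) \<partial>density \<nu> w)"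
      unfolding m0_def by (rule nn_integral_distr) (simp_all add: finv_measurable[OF n fst_m])
    also have "\<dots> = (\<integral>\<^sup>+p. w p * f (fst p) \<partial>\<nu>)" by (rule nn_integral_density) auto
    finally show ?thesis .
  qed
  have main: "(\<integral>\<^sup>+x. (\<integral>\<^sup>+r. F (x, r) * indicator {0..<L (x 0)} r \<partial>lborel) \<partial>m0) = (\<integral>\<^sup>+p. F p \<partial>\<nu>)"
    if F: "F \<in> borel_measurable MY" for F
    using finv_base_integral[OF n F] int0[OF base_integral_measurable[OF F, of "\<lambda>_. 0" "\<lambda>x. L (x 0)"]]
    by (simp add: w_def e_def)
  have em0: "emeasure m0 A = (\<integral>\<^sup>+x. indicator A x \<partial>m0)" if "A \<in> sets MX" for A using that by (simp add: sm0)
  have UX: "UNIV \<in> sets (MX :: (int \<Rightarrow> 'a) measure)" using sets.top[of "MX :: (int \<Rightarrow> 'a) measure"] by simp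
  \<comment> \<open>Any strip of constant height \<open>e\<close> inside the hull sees the same base
    measure, wherever it lies over the single letters. It is applied to the strips at the bottom and
    at the top of the letters.\<close>
  have cyl: "(\<integral>\<^sup>+p. indicator {p. fst p \<in> A \<and> a (fst p) \<le> snd p \<and> snd p < b (fst p)} p \<partial>\<nu>) = ennreal e * emeasure m0 A"
    if [measurable]: "A \<in> sets MX" "a \<in> borel_measurable MX" "b \<in> borel_measurable MX"
      and ab: "\<And>x. 0 \<le> a x" "\<And>x. b x \<le> L (x 0)" "\<And>x. b x - a x = e" for A a b
  proof -
    let ?S = "{p. fst p \<in> A \<and> a (fst p) \<le> snd p \<and> snd p < b (fst p)}"
    have "{p \<in> space MY. fst p \<in> A \<and> a (fst p) \<le> snd p \<and> snd p < b (fst p)} \<in> sets MY" by measurable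
    then have S: "(indicator ?S :: _ \<Rightarrow> ennreal) \<in> borel_measurable MY" by simp
    have "(\<integral>\<^sup>+p. indicator ?S p \<partial>\<nu>) = (\<integral>\<^sup>+x. (\<integral>\<^sup>+r. indicator ?S (x, r) * indicator {0..<L (x 0)} r \<partial>lborel) \<partial>m0)"
      by (rule main[OF S, symmetric])
    also have "\<dots> = (\<integral>\<^sup>+x. ennreal e * indicator A x \<partial>m0)"
    proof (intro nn_integral_cong)
      fix x
      have "(\<integral>\<^sup>+r. indicator ?S (x, r) * indicator {0..<L (x 0)} r \<partial>lborel) = (\<integral>\<^sup>+r. indicator A x * indicator {a x..<b x} r \<partial>lborel)"
        using ab(1)[of x] ab(2)[of x] by (intro nn_integral_cong) (auto simp: indicator_def)
      also have "\<dots> = indicator A x * ennreal (b x - a x)"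
        using ab(3)[of x] e0 by (subst nn_integral_cmult_indicator) auto
      finally show "(\<integral>\<^sup>+r. indicator ?S (x, r) * indicator {0..<L (x 0)} r \<partial>lborel) = ennreal e * indicator A x"
        by (simp add: ab(3) mult.commute)
    qed
    also have "\<dots> = ennreal e * emeasure m0 A" by (subst nn_integral_cmult_indicator) (auto simp: sm0)
    finally show ?thesis .
  qed
  \<comment> \<open>The flow by time \<open>e\<close> carries the strip at the top of a letter onto
    the strip at the bottom of the next letter, so flow invariance becomes shift invariance.\<close>
  have inv: "emeasure m0 (shift -` A) = emeasure m0 A" if A: "A \<in> sets MX" for A
  proof -
    have sA: "shift -` A \<in> sets MX" using measurable_sets[OF measurable_shiftn A, of 1] by (simp add: shift_shiftn)
    let ?S = "{p. fst p \<in> A \<and> 0 \<le> snd p \<and> snd p < e}"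
    have "{p \<in> space MY. fst p \<in> A \<and> 0 \<le> snd p \<and> snd p < e} \<in> sets MY" using A by measurable
    then have S: "(indicator ?S :: _ \<Rightarrow> ennreal) \<in> borel_measurable MY" by simp
    have "ennreal e * emeasure m0 A = (\<integral>\<^sup>+p. indicator ?S p \<partial>\<nu>)"
      using cyl[OF A, of "\<lambda>_. 0" "\<lambda>_. e"] eL by simp
    also have "\<dots> = (\<integral>\<^sup>+p. indicator ?S (flow L e p) \<partial>\<nu>)" by (rule finv_nn_integral[OF n S, symmetric])
    also have "\<dots> = (\<integral>\<^sup>+p. indicator {p. fst p \<in> shift -` A \<and> L (fst p 0) - e \<le> snd p \<and> snd p < L (fst p 0)} p \<partial>\<nu>)"
    proof (rule nn_integral_cong_AE, rule AE_mp[OF finv_AE[OF n]], rule AE_I2, rule impI)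
      fix p assume ph: "p \<in> HY"
      obtain x s where p: "p = (x, s)" by fastforce
      have s: "0 \<le> s" "s < L (x 0)" using ph by (auto simp: p hull_iff)
      show "indicator ?S (flow L e p) = (indicator {p. fst p \<in> shift -` A \<and> L (fst p 0) - e \<le> snd p \<and> snd p < L (fst p 0)} p :: ennreal)"
      proof (cases "s + e < L (x 0)")
        case True
        then have "flow L e p = (x, s + e)" using flow_eq[of x 0 s e] s e0 by (simp add: p)
        then show ?thesis using s True by (simp add: p indicator_def)
      next
        case False
        then have "flow L e p = (shiftn 1 x, s + e - L (x 0))"
          using flow_eq[of x 1 s e] s e0 eL[of "x 1"] rf_Suc[of x 1] by (simp add: p)
        then show ?thesis using s False by (simp add: p indicator_def shift_shiftn)
      qed
    qed
    also have "\<dots> = ennreal e * emeasure m0 (shift -` A)"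
      by (rule cyl[OF sA]) (use eL in auto)
    finally have "ennreal e * emeasure m0 A = ennreal e * emeasure m0 (shift -` A)" .
    then show ?thesis using e0 by (simp add: ennreal_mult_cancel_left)
  qed
  have tot: "(\<integral>\<^sup>+x. ennreal (L (x 0)) \<partial>m0) = 1"
  proof -
    have "(\<integral>\<^sup>+x. (\<integral>\<^sup>+r. 1 * indicator {0..<L (x 0)} r \<partial>lborel) \<partial>m0) = (\<integral>\<^sup>+p. 1 \<partial>\<nu>)" by (rule main) simp
    then show ?thesis by (simp add: emeasure_space_1)
  qed
  have c1: "ennreal e * emeasure m0 UNIV \<le> 1" and c2: "1 \<le> ennreal Lmax * emeasure m0 UNIV"
  proof -
    have "ennreal k * emeasure m0 UNIV = (\<integral>\<^sup>+x. ennreal k \<partial>m0)" for k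
      using sets_eq_imp_space_eq[OF sm0] by simp
    then have "ennreal e * emeasure m0 UNIV = (\<integral>\<^sup>+x. ennreal e \<partial>m0)"
      "ennreal Lmax * emeasure m0 UNIV = (\<integral>\<^sup>+x. ennreal Lmax \<partial>m0)" by blast+
    moreover have "(\<integral>\<^sup>+x. ennreal e \<partial>m0) \<le> (\<integral>\<^sup>+x. ennreal (L (x 0)) \<partial>m0)"
      by (intro nn_integral_mono ennreal_leI) (use eL in auto)
    moreover have "(\<integral>\<^sup>+x. ennreal (L (x 0)) \<partial>m0) \<le> (\<integral>\<^sup>+x. ennreal Lmax \<partial>m0)"
      by (intro nn_integral_mono ennreal_leI) (use Lmax_ge in auto)
    ultimately show "ennreal e * emeasure m0 UNIV \<le> 1" "1 \<le> ennreal Lmax * emeasure m0 UNIV"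
      using tot by auto
  qed
  have fin: "emeasure m0 UNIV \<noteq> \<infinity>" using c1 e0 by (auto simp: ennreal_mult_top top_unique)
  have pos: "emeasure m0 UNIV \<noteq> 0" using c2 by auto
  obtain c where c: "emeasure m0 UNIV = ennreal c" "0 < c"
    using fin pos by (cases "emeasure m0 UNIV") auto
  define \<mu> where "\<mu> = scale_measure (ennreal (1 / c)) m0"
  have sm: "sets \<mu> = sets MX" by (simp add: \<mu>_def sm0)
  have em: "emeasure \<mu> A = ennreal (1 / c) * emeasure m0 A" for A by (simp add: \<mu>_def)
  have X0: "emeasure m0 (- X) = 0"
  proof -
    have m: "- X \<in> sets MX" using X_sets sets.compl_sets[of X MX] by (simp add: Compl_eq_Diff_UNIV)
    have "emeasure m0 (- X) = (\<integral>\<^sup>+p. w p * indicator (- X) (fst p) \<partial>\<nu>)" using em0[OF m] int0[of "indicator (- X)"] m by simp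
    also have "\<dots> = (\<integral>\<^sup>+p. 0 \<partial>\<nu>)"
      by (rule nn_integral_cong_AE, rule AE_mp[OF finv_AE[OF n]], rule AE_I2) (auto simp: hull_iff)
    finally show ?thesis by simp
  qed
  have XU: "emeasure m0 X = ennreal c"
  proof -
    have "emeasure m0 (X \<union> - X) = emeasure m0 X + emeasure m0 (- X)"
      by (rule plus_emeasure[symmetric]) (use X_sets sets.compl_sets[of X MX] in \<open>auto simp: sm0 Compl_eq_Diff_UNIV\<close>)
    then show ?thesis using X0 c by simp
  qed
  have one: "ennreal (1 / c) * ennreal c = 1" using c(2) by (simp add: ennreal_mult[symmetric])
  have s: "siv \<mu>" unfolding shift_inv_measure_def
  proof (intro conjI ballI)
    show "prob_space \<mu>"
      by (rule prob_spaceI) (use em[of UNIV] c one sets_eq_imp_space_eq[OF sm] in simp)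
    show "emeasure \<mu> X = 1" using em[of X] XU one by simp
    show "emeasure \<mu> (shift -` A) = emeasure \<mu> A" if "A \<in> sets MX" for A using inv[OF that] em by simp
  qed (rule sm)
  have nm: "(\<integral>\<^sup>+x. f x \<partial>\<mu>) = ennreal (1 / c) * (\<integral>\<^sup>+x. f x \<partial>m0)" if "f \<in> borel_measurable MX" for f
    unfolding \<mu>_def by (rule nn_integral_scale_measure) (use that measurable_cong_sets[OF sm0 refl] in blast)
  have ell: "ennreal (ell \<mu>) = ennreal (1 / c)"
    using nn_integral_L[OF s] nm[of "\<lambda>x. ennreal (L (x 0))"] tot by simp
  have "\<nu> = lifted \<mu>"
  proof (rule measure_eqI)
    show "sets \<nu> = sets (lifted \<mu>)" using finv_sets[OF n] sets_lift[OF s] by simp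
    fix A assume "A \<in> sets \<nu>"
    then have A: "A \<in> sets MY" by (simp add: finv_sets[OF n])
    let ?H = "\<lambda>x. \<integral>\<^sup>+r. indicator A (x, r) * indicator {0..<L (x 0)} r \<partial>lborel"
    have iA: "(indicator A :: _ \<Rightarrow> ennreal) \<in> borel_measurable MY" using A by simp
    have Hm: "?H \<in> borel_measurable MX" by (rule base_integral_measurable[OF iA]) auto
    have "emeasure (lifted \<mu>) A = (\<integral>\<^sup>+p. indicator A p \<partial>lifted \<mu>)" using A by (simp add: sets_lift[OF s])
    also have "\<dots> = (\<integral>\<^sup>+x. ?H x \<partial>\<mu>) / ennreal (ell \<mu>)" by (rule nn_integral_lift[OF s iA])
    also have "\<dots> = ennreal (1 / c) * (\<integral>\<^sup>+p. indicator A p \<partial>\<nu>) / ennreal (1 / c)"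
      by (simp only: nm[OF Hm] main[OF iA] ell)
    also have "\<dots> = (\<integral>\<^sup>+p. indicator A p \<partial>\<nu>)"
      by (subst mult.commute, rule mult_divide_eq_ennreal) (use c(2) in auto)
    finally show "emeasure \<nu> A = emeasure (lifted \<mu>) A" using A by simp
  qed
  then show ?thesis using that s by blast
qed

lemma base_sum:
  assumes F: "F \<in> borel_measurable MY"
  shows "(\<Sum>i<k. \<integral>\<^sup>+r. F (shiftn (int i) y, r) * indicator {0..<L (y (int i))} r \<partial>lborel)
    = (\<integral>\<^sup>+t. F (flow L t (y, 0)) * indicator {0..<rf y (int k)} t \<partial>lborel)"
proof (induction k)
  case (Suc k)
  have Ft: "(\<lambda>t. F (flow L t (y, 0))) \<in> borel_measurable lborel"
  proof -
    have "(\<lambda>t. (t, (y, 0))) \<in> measurable lborel (lborel \<Otimes>\<^sub>M MY)" by (rule measurable_Pair) auto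
    from measurable_compose[OF this measurable_compose[OF flow_measurable_joint F]] show ?thesis by simp
  qed
  have r: "rf y (int (Suc k)) = rf y (int k) + L (y (int k))" using rf_Suc[of y "int k"] by (simp add: add.commute)
  have r0: "0 \<le> rf y (int k)" using rf_le_iff[of y 0 "int k"] by simp
  have m: "(\<lambda>r. F (shiftn (int k) y, r) * indicator {0..<L (y (int k))} r) \<in> borel_measurable borel"
    using section_measurable[OF F] by auto
  have "(\<integral>\<^sup>+r. F (shiftn (int k) y, r) * indicator {0..<L (y (int k))} r \<partial>lborel)
    = (\<integral>\<^sup>+t. F (shiftn (int k) y, t + - rf y (int k)) * indicator {0..<L (y (int k))} (t + - rf y (int k)) \<partial>lborel)"
    by (rule nn_integral_translate[OF m, symmetric])
  also have "\<dots> = (\<integral>\<^sup>+t. F (flow L t (y, 0)) * indicator {rf y (int k)..<rf y (int (Suc k))} t \<partial>lborel)"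
  proof (intro nn_integral_cong)
    fix t
    show "F (shiftn (int k) y, t + - rf y (int k)) * indicator {0..<L (y (int k))} (t + - rf y (int k))
      = F (flow L t (y, 0)) * indicator {rf y (int k)..<rf y (int (Suc k))} t"
    proof (cases "rf y (int k) \<le> t \<and> t < rf y (int (Suc k))")
      case True
      then have "flow L t (y, 0) = (shiftn (int k) y, t - rf y (int k))"
        using flow_eq[of y "int k" 0 t] by (simp add: add.commute)
      then show ?thesis using True r by (auto simp: indicator_def)
    next
      case False
      then show ?thesis using r by (auto simp: indicator_def)
    qed
  qed
  finally have "(\<Sum>i<Suc k. \<integral>\<^sup>+r. F (shiftn (int i) y, r) * indicator {0..<L (y (int i))} r \<partial>lborel)
    = (\<integral>\<^sup>+t. F (flow L t (y, 0)) * indicator {0..<rf y (int k)} t \<partial>lborel)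
     + (\<integral>\<^sup>+t. F (flow L t (y, 0)) * indicator {rf y (int k)..<rf y (int (Suc k))} t \<partial>lborel)"
    using Suc by simp
  also have "\<dots> = (\<integral>\<^sup>+t. F (flow L t (y, 0)) * indicator {0..<rf y (int k)} t
       + F (flow L t (y, 0)) * indicator {rf y (int k)..<rf y (int (Suc k))} t \<partial>lborel)"
    by (rule nn_integral_add[symmetric]) (use Ft in auto)
  also have "\<dots> = (\<integral>\<^sup>+t. F (flow L t (y, 0)) * indicator {0..<rf y (int (Suc k))} t \<partial>lborel)"
  proof (intro nn_integral_cong)
    fix t
    have "rf y (int k) \<le> rf y (int (Suc k))" by (simp add: rf_le_iff)
    then show "F (flow L t (y, 0)) * indicator {0..<rf y (int k)} t
       + F (flow L t (y, 0)) * indicator {rf y (int k)..<rf y (int (Suc k))} t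
       = F (flow L t (y, 0)) * indicator {0..<rf y (int (Suc k))} t"
      using r0 by (auto simp: indicator_def)
  qed
  finally show ?case .
qed simp

lemma rf_win: "rf y (int k) = Lword L (win y 0 k)"
proof (induction k)
  case (Suc k)
  then show ?case using rf_Suc[of y "int k"] by (simp add: win_Suc add.commute)
qed simp

lemma cell_win: "cell n y = Some c \<Longrightarrow> win y 0 (length (snd c)) = snd c"
  using cell_word[of n y "fst c" "snd c"] by (intro nth_equalityI) auto

text \<open>Kac's formula with time in place of positions: a cell contributes the time integral
  along the orbit segment that crosses it.\<close>

theorem lift_kac:
  assumes s: "siv \<mu>" and F: "F \<in> borel_measurable MY"
  shows "(\<integral>\<^sup>+p. F p \<partial>lifted \<mu>) = (\<Sum>c\<in>cells n. \<integral>\<^sup>+y.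
     (\<integral>\<^sup>+t. F (flow L t (y, 0)) * indicator {0..<Lword L (snd c)} t \<partial>lborel)
     * indicator {y. cell n y = Some c} y \<partial>\<mu>) / ennreal (ell \<mu>)"
proof -
  let ?H = "\<lambda>x. \<integral>\<^sup>+r. F (x, r) * indicator {0..<L (x 0)} r \<partial>lborel"
  have Hm: "?H \<in> borel_measurable MX" by (rule base_integral_measurable[OF F]) auto
  have "(\<Sum>i<length (snd c). ?H (shiftn (int i) y)) * indicator {y. cell n y = Some c} y
    = (\<integral>\<^sup>+t. F (flow L t (y, 0)) * indicator {0..<Lword L (snd c)} t \<partial>lborel) * indicator {y. cell n y = Some c} y" for c y
    using base_sum[OF F, where y = y and k = "length (snd c)"] cell_win[of n y c]
    by (simp add: shiftn_apply rf_win indicator_def)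
  then show ?thesis unfolding nn_integral_lift[OF s F] kac[OF s Hm, of n] by simp
qed

definition tileset :: "nat \<Rightarrow> 'a \<times> 'a list \<Rightarrow> ((int \<Rightarrow> 'a) \<times> real) set" where
  "tileset n c = {p \<in> HY. cx n (fst p) 0 = fst c \<and> cv n (fst p) 0 = snd c}"

lemma tileset_sets [measurable]: "tileset n c \<in> sets MY"
proof -
  have "loc (\<lambda>y. (cx n y 0, cv n y 0))" by (intro loc_Pair loc_cx loc_cv)
  from loc_sets[OF this, of "\<lambda>z. z = c"] have "{y \<in> X. (cx n y 0, cv n y 0) = c} \<in> sets MX" .
  then have "{y \<in> X. (cx n y 0, cv n y 0) = c} \<times> UNIV \<in> sets MY" unfolding MY_def by simp
  moreover have "tileset n c = HY \<inter> ({y \<in> X. (cx n y 0, cv n y 0) = c} \<times> UNIV)"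
    by (auto simp: tileset_def hull_iff prod_eq_iff)
  ultimately show ?thesis using hull_sets by simp
qed

lemma tile_flow:
  assumes "ldata n y x 0 v" "0 \<le> t" "t < Lword L (v 0)"
  shows "ldata n (fst (flow L t (y, 0))) x (idx y t) v" "fst (flow L t (y, 0)) = shiftn (idx y t) y"
proof -
  have NEv: "NE v" using level_data_NE[OF assms(1)] .
  have w: "win y 0 (length (v 0)) = v 0"
    using assms(1) win_biconcat_one[OF NEv, of 0] by (simp add: level_data_def)
  show f: "fst (flow L t (y, 0)) = shiftn (idx y t) y" by (simp add: flow_idx)
  have "rf y 0 < rf y (idx y t + 1)" using idx[where x = y and t = t] assms(2) by simp
  then have i0: "0 \<le> idx y t" unfolding rf_less_iff by simp
  have "rf y (idx y t) < rf y (int (length (v 0)))"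
    using idx[where x = y and t = t] assms(3) by (simp add: rf_win w)
  then have "idx y t < int (length (v 0))" unfolding rf_less_iff .
  then show "ldata n (fst (flow L t (y, 0))) x (idx y t) v"
    unfolding f using level_data_inside[OF assms(1), of 0 "idx y t"] i0 by simp
qed

lemma emeasure_tile:
  assumes s: "siv \<mu>" and c: "c \<in> cells n"
  shows "emeasure (lifted \<mu>) (tileset n c) = ennreal (tile \<mu> n c)"
proof -
  have iT: "(indicator (tileset n c) :: _ \<Rightarrow> ennreal) \<in> borel_measurable MY" by simp
  have "(\<integral>\<^sup>+t. indicator (tileset n c) (flow L t (y, 0)) * indicator {0..<Lword L (snd c')} t \<partial>lborel) * indicator {y. cell n y = Some c'} y
    = (if c' = c then ennreal (Lword L (snd c)) else 0) * indicator {y. cell n y = Some c'} y" if c': "c' \<in> cells n" for c' y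
  proof (cases "cell n y = Some c'")
    case True
    obtain x v where d: "ldata n y x 0 v" "x 0 = fst c'" "v 0 = snd c'" "y \<in> X"
      using True cell_SomeE[of n y "fst c'" "snd c'"] by (metis prod.collapse)
    have hy: "(y, 0) \<in> HY" using d by (simp add: hull_iff)
    have "(\<integral>\<^sup>+t. indicator (tileset n c) (flow L t (y, 0)) * indicator {0..<Lword L (snd c')} t \<partial>lborel)
      = (\<integral>\<^sup>+t. (if c' = c then 1 else 0) * indicator {0..<Lword L (snd c')} t \<partial>lborel)"
    proof (intro nn_integral_cong)
      fix t
      show "indicator (tileset n c) (flow L t (y, 0)) * indicator {0..<Lword L (snd c')} t
        = ((if c' = c then 1 else 0) * indicator {0..<Lword L (snd c')} t :: ennreal)"
      proof (cases "0 \<le> t \<and> t < Lword L (snd c')")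
        case True
        then have "ldata n (fst (flow L t (y, 0))) x (idx y t) v" using tile_flow(1)[OF d(1), of t] d(3) by simp
        from level_data_cD[OF this] show ?thesis using flow_hull[OF hy, of t] d
          by (auto simp: tileset_def indicator_def prod_eq_iff)
      qed auto
    qed
    also have "\<dots> = (if c' = c then ennreal (Lword L (snd c)) else 0)"
      using Lword_cell[OF c'] lamL_pos[of n "fst c'"] by (auto simp: nn_integral_cmult_indicator)
    finally show ?thesis by simp
  qed simp
  then have "emeasure (lifted \<mu>) (tileset n c) = (\<Sum>c'\<in>cells n. \<integral>\<^sup>+y. (if c' = c then ennreal (Lword L (snd c)) else 0) * indicator {y. cell n y = Some c'} y \<partial>\<mu>) / ennreal (ell \<mu>)"
    using lift_kac[OF s iT, of n] by (simp add: sets_lift[OF s])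
  also have "(\<Sum>c'\<in>cells n. \<integral>\<^sup>+y. (if c' = c then ennreal (Lword L (snd c)) else 0) * indicator {y. cell n y = Some c'} y \<partial>\<mu>)
    = (\<Sum>c'\<in>cells n. if c' = c then ennreal (Lword L (snd c) * dens \<mu> n c) else 0)"
    using Lword_cell[OF c] lamL_pos[of n "fst c"]
    by (intro sum.cong refl) (auto simp: nn_integral_cmult_indicator siv_sets[OF s] cell_sets emeasure_cell[OF s] ennreal_mult)
  also have "\<dots> / ennreal (ell \<mu>) = ennreal (tile \<mu> n c)"
    using c ell_pos[OF s] Lword_cell[OF c] lamL_pos[of n "fst c"]
    by (simp add: sum.delta tile_def divide_ennreal mult.commute)
  finally show ?thesis .
qed

end

section \<open>Shuffles and uniformity measures\<close>

lemma biconcat_map2: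
  assumes "NE S" "\<And>i. length (U i) = length (S i)"
  shows "biconcat (\<lambda>i. map2 g (U i) (S i)) = (\<lambda>p. g (biconcat U p) (biconcat S p))"
proof (rule biconcat_eqI)
  have ne: "NE U" using assms by (metis length_0_conv)
  have w: "wpos (\<lambda>i. map2 g (U i) (S i)) i = wpos S i" "wpos U i = wpos S i" for i
    using assms(2) by (simp_all add: wpos_isum)
  show "NE (\<lambda>i. map2 g (U i) (S i))" using assms(1) ne by (auto simp: zip_eq_Nil_iff)
  fix i k assume "k < length (map2 g (U i) (S i))"
  then show "g (biconcat U (wpos (\<lambda>i. map2 g (U i) (S i)) i + int k)) (biconcat S (wpos (\<lambda>i. map2 g (U i) (S i)) i + int k))
    = map2 g (U i) (S i) ! k"
    using biconcat_at[OF assms(1), of k i] biconcat_at[OF ne, of k i] assms(2)[of i] w[of i] by simp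
qed

context recog_subst
begin

section \<open>Recognisability data of points of the hull\<close>

abbreviation rpred where "rpred \<equiv> rec_data_pred \<sigma> L"

text \<open>Separates the data of a point of the hull into symbolic data cut at the origin and a
  flow time inside the cell of index 0.\<close>

lemma rpred_iff:
  "rpred n p x t v \<longleftrightarrow> ldata n (biconcat v) x 0 v \<and> 0 \<le> t \<and> t < Lword L (v 0) \<and> p = flow L t (biconcat v, 0)"
proof -
  have "v 0 \<noteq> []" if "\<forall>i. v i \<in> pw n (x i)" using that pw_valid by metis
  then show ?thesis by (auto simp: rec_data_pred_def level_data_def)
qed

lemma rpred_level_data: "rpred n p x t v \<Longrightarrow> ldata n (fst p) x (idx (biconcat v) t) v"
  using tile_flow(1)[of n "biconcat v" x v t] by (auto simp: rpred_iff)

lemma rpred_unique: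
  assumes "rpred n p x t v" "rpred n p x' t' v'"
  shows "x = x' \<and> t = t' \<and> v = v'"
proof -
  have e: "x = x'" "idx (biconcat v) t = idx (biconcat v') t'" "v = v'"
    using level_data_unique[OF rpred_level_data[OF assms(1)] rpred_level_data[OF assms(2)]] by auto
  have "snd p = t - rf (biconcat v) (idx (biconcat v) t)" "snd p = t' - rf (biconcat v') (idx (biconcat v') t')"
    using assms by (auto simp: rpred_iff flow_idx)
  moreover have "rf (biconcat v) (idx (biconcat v) t) = rf (biconcat v') (idx (biconcat v') t')"
    by (rule arg_cong2[where f = "\<lambda>b i. rf b i"], simp only: e(3), rule e(2))
  ultimately have "t = t'" by linarith
  then show ?thesis using e by blast
qed

lemma rec_data_eq: "rpred n p x t v \<Longrightarrow> rec_data \<sigma> L n p = (x, t, v)"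
  unfolding rec_data_def
proof (rule the_equality)
  fix q assume "rpred n p x t v" "case q of (x, t, v) \<Rightarrow> rpred n p x t v"
  then show "q = (x, t, v)" using rpred_unique[of n p x t v "fst q" "fst (snd q)" "snd (snd q)"]
    by (simp add: split_beta prod_eq_iff)
qed simp

lemma rpred_c:
  assumes "(y, s) \<in> HY"
  shows "rpred n (y, s) (cx n y) (rf (biconcat (cv n y)) (ck n y) + s) (cv n y)"
proof -
  define v where "v = cv n y"
  define b where "b = biconcat v"
  define k where "k = ck n y"
  have s: "y \<in> X" "0 \<le> s" "s < L (y 0)" using assms by (auto simp: hull_iff)
  have d: "ldata n y (cx n y) k v" using level_data_c[OF s(1)] by (simp add: k_def v_def)
  have NEv: "NE v" using level_data_NE[OF d] .
  have y: "y = shiftn k b" and k: "0 \<le> k" "k < int (length (v 0))" using d by (auto simp: level_data_def b_def)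
  have r: "rf b (k + 1) = rf b k + L (y 0)" using rf_Suc[of b k] by (simp add: y shiftn_apply)
  have "rf b 0 \<le> rf b k" "rf b (k + 1) \<le> rf b (int (length (v 0)))" using k unfolding rf_le_iff by auto
  moreover have "rf b (int (length (v 0))) = Lword L (v 0)"
    using win_biconcat_one[OF NEv, of 0] by (simp add: rf_win b_def)
  moreover have "flow L (rf b k + s) (b, 0) = (y, s)"
    using flow_eq[of b k 0 "rf b k + s"] s r by (simp add: y)
  ultimately have "rpred n (y, s) (cx n y) (rf b k + s) v"
    using d s r k by (auto simp: rec_data_pred_def level_data_def b_def)
  then show ?thesis by (simp add: b_def v_def k_def)
qed

lemma rpred_hull: "rpred n p x t v \<Longrightarrow> p \<in> HY"
  using flow_hull[of "(biconcat v, 0)" t] level_data_in_X[of n "biconcat v" x 0 v]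
  by (auto simp: rpred_iff hull_iff)

lemma rpred_ex: "p \<in> HY \<Longrightarrow> \<exists>x t v. rpred n p x t v"
  using rpred_c[of "fst p" "snd p" n] by auto

lemma rpred_tileset: "rpred n p x t v \<Longrightarrow> p \<in> tileset n c \<longleftrightarrow> x 0 = fst c \<and> v 0 = snd c"
  using level_data_cD[OF rpred_level_data] rpred_hull by (simp add: tileset_def)

text \<open>The cell boundaries in the hull depend on the letters \<open>x\<close> and not on the
  words \<open>v\<close>; hence a shuffle does not move them.\<close>

lemma rf_wpos:
  assumes "ldata n (biconcat v) x 0 v"
  shows "rf (biconcat v) (wpos v j) = isum (\<lambda>i. lam ^ n * L (x i)) j"
proof -
  have NEv: "NE v" using level_data_NE[OF assms] .
  have st: "rf (biconcat v) (wpos v (j + 1)) = rf (biconcat v) (wpos v j) + lam ^ n * L (x j)" for j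
  proof -
    have "rf (biconcat v) (wpos v (j + 1)) = rf (biconcat v) (wpos v j) + Lword L (win (biconcat v) (wpos v j) (length (v j)))"
      unfolding wpos_Suc rf_add rf_win win_shiftn by simp
    also have "win (biconcat v) (wpos v j) (length (v j)) = v j" by (rule win_biconcat_one[OF NEv])
    also have "Lword L (v j) = lam ^ n * L (x j)" using assms by (intro Lword_pw) (simp add: level_data_def)
    finally show ?thesis .
  qed
  show ?thesis
  proof (induction j rule: int_induct[where k = 0])
    case (step1 i)
    then show ?case using st[of i] by (simp add: isum_Suc)
  next
    case (step2 i)
    then show ?case using st[of "i - 1"] isum_Suc[of "\<lambda>i. lam ^ n * L (x i)" "i - 1"] by simp
  qed simp
qed

lemma tile_bracket: "\<exists>j. isum (\<lambda>i. lam ^ n * L (x i)) j \<le> t \<and> t < isum (\<lambda>i. lam ^ n * L (x i)) (j + 1)"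
proof (rule isum_bracket)
  show "0 < lam ^ n * Lmin" using Lmin_pos lam_gt_1 by simp
  show "lam ^ n * Lmin \<le> lam ^ n * L (x i)" for i
    using Lmin_le[of "x i"] lam_gt_1 by (intro mult_left_mono) auto
qed

lemma rpred_flow:
  assumes p: "rpred n p x t v"
    and j: "isum (\<lambda>i. lam ^ n * L (x i)) j \<le> t + u" "t + u < isum (\<lambda>i. lam ^ n * L (x i)) (j + 1)"
  shows "rpred n (flow L u p) (shiftn j x) (t + u - isum (\<lambda>i. lam ^ n * L (x i)) j) (shiftn j v)"
proof -
  have d: "ldata n (biconcat v) x 0 v" and p': "p = flow L t (biconcat v, 0)" using p by (auto simp: rpred_iff)
  have NEv: "NE v" using level_data_NE[OF d] .
  define T where "T = isum (\<lambda>i. lam ^ n * L (x i)) j"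
  have T1: "isum (\<lambda>i. lam ^ n * L (x i)) (j + 1) = T + Lword L (v j)"
    using d Lword_pw[of "v j" n "x j"] by (simp add: isum_Suc T_def level_data_def)
  have T: "rf (biconcat v) (wpos v j) = T" using rf_wpos[OF d] T_def by simp
  have f: "flow L T (biconcat v, 0) = (biconcat (shiftn j v), 0)"
    using flow_eq[of "biconcat v" "wpos v j" 0 T] T rf_Suc[of "biconcat v" "wpos v j"]
    by (simp add: biconcat_shiftn[OF NEv])
  have "ldata n (biconcat (shiftn j v)) (shiftn j x) 0 (shiftn j v)"
    using d NEv by (auto simp: level_data_def shiftn_apply)
  moreover have "flow L u p = flow L (t + u - T) (biconcat (shiftn j v), 0)"
    unfolding f[symmetric] p' by (simp add: flow_flow add.commute)
  ultimately show ?thesis using j T1 unfolding rpred_iff T_def[symmetric] by (simp add: shiftn_apply)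
qed

definition shw :: "'a \<Rightarrow> ('a list \<Rightarrow> 'a list) \<Rightarrow> (int \<Rightarrow> 'a) \<Rightarrow> (int \<Rightarrow> 'a list) \<Rightarrow> int \<Rightarrow> 'a list" where
  "shw a \<alpha> x v i = (if x i = a then \<alpha> (v i) else v i)"

lemma loc_cong: "(\<And>y. y \<in> X \<Longrightarrow> f y = g y) \<Longrightarrow> loc f \<Longrightarrow> loc g"
  unfolding loc_def by metis

lemma loc_measurable:
  assumes f: "loc f" "\<And>y. f y \<in> space N" and c: "c \<in> space N"
  shows "(\<lambda>y. if y \<in> X then f y else c) \<in> measurable MX N"
proof (rule measurableI)
  fix A assume "A \<in> sets N"
  have "(\<lambda>y. if y \<in> X then f y else c) -` A \<inter> space MX = {y \<in> X. f y \<in> A} \<union> (if c \<in> A then - X else {})"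
    by (auto split: if_splits)
  moreover have "- X \<in> sets MX" using X_sets sets.compl_sets[of X MX] by (simp add: Compl_eq_Diff_UNIV)
  ultimately show "(\<lambda>y. if y \<in> X then f y else c) -` A \<inter> space MX \<in> sets MX"
    using loc_sets[OF f(1), of "\<lambda>z. z \<in> A"] by auto
qed (use assms in auto)

lemma loc_biconcat:
  assumes "\<And>i. loc (\<lambda>y. g y i)" "\<And>y. y \<in> X \<Longrightarrow> NE (g y)"
  shows "loc (\<lambda>y. biconcat (g y) p)"
proof (rule loc_cong)
  \<comment> \<open>The value at \<open>p\<close> depends only on the words of index at most
    \<open>\<bar>p\<bar>\<close>; the filler outside this range must be a non-empty word for the
    concatenation to make sense.\<close>
  let ?h = "\<lambda>w. biconcat (\<lambda>j. if \<bar>j\<bar> \<le> \<bar>p\<bar> then w ! nat (j + \<bar>p\<bar>) else [undefined]) p"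
  show "loc (\<lambda>y. ?h (win (g y) (- \<bar>p\<bar>) (nat (2 * \<bar>p\<bar> + 1))))"
    by (rule loc_comp[OF loc_win]) (rule assms(1))
  fix y assume y: "y \<in> X"
  have e: "win (g y) (- \<bar>p\<bar>) (nat (2 * \<bar>p\<bar> + 1)) ! nat (j + \<bar>p\<bar>) = g y j" if "\<bar>j\<bar> \<le> \<bar>p\<bar>" for j
    using that by (subst nth_win) auto
  show "?h (win (g y) (- \<bar>p\<bar>) (nat (2 * \<bar>p\<bar> + 1))) = biconcat (g y) p"
    by (rule biconcat_cong) (use assms(2)[OF y] e in auto)
qed

lemma shw_abs: "shw a \<alpha> x v = (\<lambda>i. if x i = a then \<alpha> (v i) else v i)"
  by (rule ext) (simp add: shw_def)

context
  fixes n :: nat and a :: 'a and \<alpha> :: "'a list \<Rightarrow> 'a list"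
  assumes \<alpha>: "bij_betw \<alpha> (pw n a) (pw n a)"
begin

abbreviation sh where "sh \<equiv> shuffle \<sigma> L n a \<alpha>"

lemma \<alpha>_pw: "w \<in> pw n a \<Longrightarrow> \<alpha> w \<in> pw n a"
  using \<alpha> by (auto simp: bij_betw_def)

lemma shw_level_data:
  assumes "ldata n (biconcat v) x 0 v"
  shows "ldata n (biconcat (shw a \<alpha> x v)) x 0 (shw a \<alpha> x v)" "Lword L (shw a \<alpha> x v i) = Lword L (v i)"
proof -
  have i: "shw a \<alpha> x v i \<in> pw n (x i)" for i
    using assms \<alpha>_pw[of "v i"] by (auto simp: shw_def level_data_def)
  then have "shw a \<alpha> x v 0 \<noteq> []" using pw_valid by metis
  then show "ldata n (biconcat (shw a \<alpha> x v)) x 0 (shw a \<alpha> x v)"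
    using i assms by (simp add: level_data_def)
  show "Lword L (shw a \<alpha> x v i) = Lword L (v i)"
    using Lword_pw[OF i[of i]] Lword_pw[of "v i" n "x i"] assms by (simp add: level_data_def)
qed

lemma shuffle_eq:
  assumes "rpred n p x t v"
  shows "sh p = flow L t (biconcat (shw a \<alpha> x v), 0)" "rpred n (sh p) x t (shw a \<alpha> x v)"
proof -
  show "sh p = flow L t (biconcat (shw a \<alpha> x v), 0)"
    using rpred_hull[OF assms] rec_data_eq[OF assms] by (simp add: shuffle_def shw_abs)
  then show "rpred n (sh p) x t (shw a \<alpha> x v)"
    using assms shw_level_data[of v x] by (simp add: rpred_iff)
qed

lemma shuffle_hull: "p \<in> HY \<Longrightarrow> sh p \<in> HY"
  using rpred_ex[of p n] shuffle_eq(2) rpred_hull by blast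

text \<open>After a flow time both the point and its shuffle are described by data moved by the same
  index \<open>j\<close>, because their cell boundaries are the same.\<close>

lemma shuffle_flow:
  assumes "p \<in> HY"
  shows "sh (flow L u p) = flow L u (sh p)"
proof -
  obtain x t v where p: "rpred n p x t v" using rpred_ex[OF assms] by blast
  let ?T = "isum (\<lambda>i. lam ^ n * L (x i))"
  obtain j where j: "?T j \<le> t + u" "t + u < ?T (j + 1)" using tile_bracket[of n x "t + u"] by blast
  have "sh (flow L u p) = flow L (t + u - ?T j) (biconcat (shw a \<alpha> (shiftn j x) (shiftn j v)), 0)"
    by (rule shuffle_eq(1)[OF rpred_flow[OF p j]])
  also have "shw a \<alpha> (shiftn j x) (shiftn j v) = shiftn j (shw a \<alpha> x v)" by (auto simp: shw_def shiftn_apply)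
  also have "flow L (t + u - ?T j) (biconcat (shiftn j (shw a \<alpha> x v)), 0) = flow L u (sh p)"
    using rpred_flow[OF shuffle_eq(2)[OF p] j] by (simp add: rpred_iff)
  finally show ?thesis .
qed

text \<open>How the level-n shuffle acts on a single level-(m+n) word: on all its level-n subwords
  of type \<open>a\<close>. That it permutes \<open>pw (m + n) b\<close> (\<open>deep_bij\<close>)
  lets the shuffle be compared with uniform densities at higher levels.\<close>

definition deep :: "nat \<Rightarrow> 'a \<Rightarrow> 'a list \<Rightarrow> 'a list" where
  "deep m b W = (THE W'. \<exists>u ws. parse m n b W u ws \<and> W' = concat (map2 (\<lambda>c w. if c = a then \<alpha> w else w) u ws))"

lemma deep_eq: "parse m n b W u ws \<Longrightarrow> deep m b W = concat (map2 (\<lambda>c w. if c = a then \<alpha> w else w) u ws)"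
  unfolding deep_def by (rule the_equality) (use parse_unique in blast)+

lemma deep_parse:
  "parse m n b W u ws \<Longrightarrow> parse m n b (deep m b W) u (map2 (\<lambda>c w. if c = a then \<alpha> w else w) u ws)"
proof -
  have "(if c = a then \<alpha> w else w) \<in> pw n c" if "w \<in> pw n c" for c w using \<alpha>_pw that by auto
  then show "parse m n b W u ws \<Longrightarrow> ?thesis"
    by (simp add: deep_eq) (simp add: parse_def list_all2_conv_all_nth)
qed

lemma deep_bij: "bij_betw (deep m b) (pw (m + n) b) (pw (m + n) b)"
proof -
  have 1: "deep m b ` pw (m + n) b \<subseteq> pw (m + n) b"
    using parse_ex deep_parse parse_pw by blast
  have 2: "inj_on (deep m b) (pw (m + n) b)"
  proof (rule inj_onI)
    fix W W' assume "W \<in> pw (m + n) b" "W' \<in> pw (m + n) b" and e: "deep m b W = deep m b W'"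
    then obtain u ws u' ws' where p: "parse m n b W u ws" "parse m n b W' u' ws'" using parse_ex by meson
    let ?g = "\<lambda>c w. if c = a then \<alpha> w else w"
    have q: "u = u'" "map2 ?g u ws = map2 ?g u' ws'"
      using parse_unique[OF deep_parse[OF p(1)] deep_parse[OF p(2), folded e]] by auto
    have l: "length ws = length u" "length ws' = length u"
      using p q(1) list_all2_lengthD by (fastforce simp: parse_def)+
    have "ws ! i = ws' ! i" if i: "i < length u" for i
    proof -
      have "map2 ?g u ws ! i = map2 ?g u ws' ! i" using q by simp
      then have "?g (u ! i) (ws ! i) = ?g (u ! i) (ws' ! i)" using i l by simp
      moreover have "ws ! i \<in> pw n (u ! i)" "ws' ! i \<in> pw n (u ! i)"
        using p q(1) i l by (auto simp: parse_def list_all2_conv_all_nth)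
      ultimately show ?thesis using \<alpha> by (auto simp: bij_betw_def inj_on_def split: if_splits)
    qed
    then have "ws = ws'" using l by (intro nth_equalityI) auto
    then show "W = W'" using p by (simp add: parse_def)
  qed
  show ?thesis using endo_inj_surj[OF pw_valid(1) 1 2] 2 by (simp add: bij_betw_def)
qed

text \<open>It is enough to treat the left end of the level-(m+n) cell, where the fine data are also
  cut at the origin; the rest of the cell follows since the shuffle commutes with the flow.\<close>

lemma shuffle_deep:
  assumes p: "rpred (m + n) p x t V"
  shows "rpred (m + n) (sh p) x t (\<lambda>i. deep m (x i) (V i))"
proof -
  have d: "ldata (m + n) (biconcat V) x 0 V" and x: "x \<in> X" and t: "0 \<le> t" "t < Lword L (V 0)"
    and pf: "p = flow L t (biconcat V, 0)"
    using p by (auto simp: rpred_iff level_data_def)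
  have "\<exists>u ws. parse m n (x i) (V i) u ws" for i using d by (intro parse_ex) (simp add: level_data_def)
  then obtain U S where US: "\<And>i. parse m n (x i) (V i) (U i) (S i)" by metis
  let ?g = "\<lambda>c w. if c = a then \<alpha> w else w"
  define V' where "V' i = deep m (x i) (V i)" for i
  define S' where "S' i = map2 ?g (U i) (S i)" for i
  have US': "parse m n (x i) (V' i) (U i) (S' i)" for i
    using deep_parse[OF US] by (simp add: V'_def S'_def)
  note f = parse_family[OF x US] and f' = parse_family[OF x US']
  have len: "length (U i) = length (S i)" for i by (rule f(4))
  have "S' = (\<lambda>i. map2 ?g (U i) (S i))" by (rule ext) (rule S'_def)
  then have bS: "biconcat S' = shw a \<alpha> (biconcat U) (biconcat S)"
    using biconcat_map2[OF f(3) len, of ?g] by (simp only: shw_abs)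
  have bV: "biconcat V = biconcat (biconcat S)" "biconcat V' = biconcat (biconcat S')"
    using f(2) f'(2) by (auto simp: level_data_def)
  have h: "(biconcat V, 0) \<in> HY" "(biconcat V', 0) \<in> HY"
    using level_data_in_X[OF f(2)] level_data_in_X[OF f'(2)] by (auto simp: hull_iff)
  have "S 0 \<noteq> []" using f(3) by blast
  have NEbS: "NE (biconcat S)" using level_data_NE[OF f(2)] .
  have "0 < Lword L (biconcat S 0)"
    using f(2) Lword_pw[of "biconcat S 0" n "biconcat U 0"] lamL_pos by (simp add: level_data_def)
  then have r0: "rpred n (biconcat V, 0) (biconcat U) 0 (biconcat S)"
    using f(2) flow_0_hull[OF h(1)] bV(1) by (simp add: rpred_iff)
  have s0: "sh (biconcat V, 0) = (biconcat V', 0)"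
    using shuffle_eq(1)[OF r0] flow_0_hull[OF h(2)] by (simp add: bS[symmetric] bV(2))
  have "sh p = flow L t (biconcat V', 0)" unfolding pf shuffle_flow[OF h(1)] s0 ..
  moreover have "Lword L (V 0) = Lword L (V' 0)"
    using f(1) f'(1) Lword_pw[of _ "m + n" "x 0"] by (simp add: level_data_def)
  ultimately have "rpred (m + n) (sh p) x t V'" using f'(1) t by (simp add: rpred_iff)
  then show ?thesis by (simp add: V'_def[abs_def])
qed

lemma shuffle_tileset:
  assumes "p \<in> HY" "W \<in> pw (m + n) b"
  shows "sh p \<in> tileset (m + n) (b, deep m b W) \<longleftrightarrow> p \<in> tileset (m + n) (b, W)"
proof -
  obtain x t V where p: "rpred (m + n) p x t V" using rpred_ex[OF assms(1)] by blast
  have "V 0 \<in> pw (m + n) (x 0)" using p by (simp add: rec_data_pred_def)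
  then show ?thesis
    unfolding rpred_tileset[OF p] rpred_tileset[OF shuffle_deep[OF p]]
    using deep_bij[of m b] assms(2) by (auto simp: bij_betw_def inj_on_def)
qed

text \<open>Over \<open>X\<close> the shuffled sequence and the flow time are local functions of the
  base point; one flow map then gives the result.\<close>

lemma shuffle_measurable: "sh \<in> measurable MY MY"
proof -
  define bb where "bb y = (if y \<in> X then biconcat (shw a \<alpha> (cx n y) (cv n y)) else (\<lambda>_. undefined))" for y
  define tt where "tt y = (if y \<in> X then rf (biconcat (cv n y)) (ck n y) else 0)" for y
  have shw_NE: "NE (shw a \<alpha> (cx n y) (cv n y))" if "y \<in> X" for y
  proof -
    have "shw a \<alpha> (cx n y) (cv n y) i \<in> pw n (cx n y i)" for i
      using level_data_c[OF that, of n] \<alpha>_pw[of "cv n y i"] by (auto simp: shw_def level_data_def)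
    then show ?thesis using pw_valid by metis
  qed
  have lw: "loc (\<lambda>y. shw a \<alpha> (cx n y) (cv n y) i)" for i
    unfolding shw_def using loc_comp2[OF loc_cx loc_cv, of "\<lambda>c w. if c = a then \<alpha> w else w"] by simp
  have bbm: "bb \<in> measurable MX MX"
  proof -
    have "(\<lambda>y. bb y i) \<in> measurable MX (count_space UNIV)" for i
      using loc_measurable[OF loc_biconcat[OF lw shw_NE, of i], of "count_space UNIV" undefined]
      by (simp add: bb_def if_distrib[of "\<lambda>f. f i"])
    then show ?thesis unfolding MX_def by (intro measurable_PiM_single') (auto simp: space_PiM MX_def[symmetric])
  qed
  have ttm: "tt \<in> borel_measurable MX"
    unfolding tt_def
  proof (rule loc_measurable)
    show "loc (\<lambda>y. rf (biconcat (cv n y)) (ck n y))"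
    proof (rule loc_cong)
      show "loc (\<lambda>y. Lword L (take (nat (ck n y)) (cv n y 0)))"
        using loc_comp2[OF loc_ck loc_cv, of "\<lambda>k w. Lword L (take (nat k) w)"] by simp
      fix y assume y: "y \<in> X"
      have d: "ldata n y (cx n y) (ck n y) (cv n y)" using level_data_c[OF y] .
      have NEv: "NE (cv n y)" using level_data_NE[OF d] .
      define k where "k = nat (ck n y)"
      have k: "ck n y = int k" "k < length (cv n y 0)" using d by (auto simp: level_data_def k_def)
      have "win (biconcat (cv n y)) 0 (length (cv n y 0)) = cv n y 0" using win_biconcat_one[OF NEv, of 0] by simp
      then have "win (biconcat (cv n y)) 0 k = take k (cv n y 0)" using k(2) take_win by (metis less_imp_le)
      then show "Lword L (take (nat (ck n y)) (cv n y 0)) = rf (biconcat (cv n y)) (ck n y)"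
        by (simp add: k(1) rf_win)
    qed
  qed auto
  have "(\<lambda>p. (tt (fst p) + snd p, (bb (fst p), 0 :: real))) \<in> measurable (MX \<Otimes>\<^sub>M lborel) (lborel \<Otimes>\<^sub>M (MX \<Otimes>\<^sub>M lborel))"
    by (intro measurable_Pair) (use bbm ttm in measurable)
  then have "(\<lambda>p. (tt (fst p) + snd p, (bb (fst p), 0 :: real))) \<in> measurable MY (lborel \<Otimes>\<^sub>M MY)" by (simp add: MY_def)
  from measurable_compose[OF this flow_measurable_joint]
  have fm: "(\<lambda>p. flow L (tt (fst p) + snd p) (bb (fst p), 0)) \<in> measurable MY MY" by simp
  have "(\<lambda>p. if p \<in> HY then flow L (tt (fst p) + snd p) (bb (fst p), 0) else p) \<in> measurable MY MY"
    by (rule measurable_If_set) (use fm hull_sets in auto)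
  moreover have "sh p = (if p \<in> HY then flow L (tt (fst p) + snd p) (bb (fst p), 0) else p)" for p
  proof (cases "p \<in> HY")
    case True
    obtain y s where p: "p = (y, s)" by fastforce
    show ?thesis using shuffle_eq(1)[OF rpred_c[of y s n]] True by (simp add: p tt_def bb_def hull_iff)
  qed (simp add: shuffle_def)
  then have "sh = (\<lambda>p. if p \<in> HY then flow L (tt (fst p) + snd p) (bb (fst p), 0) else p)"
    by (rule ext)
  ultimately show ?thesis by simp
qed

text \<open>The image of the lift under the shuffle is again flow-invariant and hence a lift. From
  level \<open>n\<close> on the shuffle only permutes words of one type, whose cells have equal
  measure, so both measures have the same cells.\<close>

lemma shuffle_invariant:
  assumes s: "siv \<mu>" and u: "uniform (dens \<mu>)" and A: "A \<in> sets MY"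
  shows "emeasure (lifted \<mu>) (sh -` A) = emeasure (lifted \<mu>) A"
proof -
  let ?\<nu> = "lifted \<mu>"
  have fi: "finv ?\<nu>" by (rule lift_flow_inv[OF s])
  interpret prob_space ?\<nu> using prob_lift[OF s] by blast
  have m: "sh \<in> measurable ?\<nu> MY" by (rule finv_measurable[OF fi shuffle_measurable])
  have vm: "sh -` B \<in> sets MY" "flow L t -` B \<in> sets MY" if "B \<in> sets MY" for B t
    using measurable_sets[OF shuffle_measurable that] measurable_sets[OF flow_measurable that] by simp_all
  have em: "emeasure (distr ?\<nu> MY sh) B = emeasure ?\<nu> (sh -` B)" if "B \<in> sets MY" for B
    using emeasure_distr[OF m that] by (simp add: space_lift[OF s])
  have AEh: "AE p in ?\<nu>. p \<in> HY" by (rule finv_AE[OF fi])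
  have "finv (distr ?\<nu> MY sh)" unfolding flow_inv_measure_def
  proof (intro conjI allI ballI)
    show "prob_space (distr ?\<nu> MY sh)" by (rule prob_space_distr[OF m])
    have "emeasure ?\<nu> (sh -` HY) = emeasure ?\<nu> (space ?\<nu>)"
    proof (rule emeasure_eq_AE)
      show "AE p in ?\<nu>. p \<in> sh -` HY \<longleftrightarrow> p \<in> space ?\<nu>"
        by (rule AE_mp[OF AEh], rule AE_I2) (simp add: shuffle_hull)
    qed (use vm hull_sets sets.top[of "?\<nu>"] in \<open>simp_all add: sets_lift[OF s]\<close>)
    then show "emeasure (distr ?\<nu> MY sh) (HY) = 1" using em[OF hull_sets] emeasure_space_1 by simp
    fix t B assume B: "B \<in> sets (MY :: ((int \<Rightarrow> 'a) \<times> real) measure)"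
    have "emeasure ?\<nu> (sh -` (flow L t -` B)) = emeasure ?\<nu> (flow L t -` (sh -` B))"
    proof (rule emeasure_eq_AE)
      show "AE p in ?\<nu>. p \<in> sh -` (flow L t -` B) \<longleftrightarrow> p \<in> flow L t -` (sh -` B)"
        by (rule AE_mp[OF AEh], rule AE_I2) (simp add: shuffle_flow)
    qed (use vm B in \<open>simp_all add: sets_lift[OF s]\<close>)
    also have "\<dots> = emeasure ?\<nu> (sh -` B)" using fi vm(1)[OF B] by (simp add: flow_inv_measure_def space_lift[OF s])
    finally show "emeasure (distr ?\<nu> MY sh) (flow L t -` B \<inter> space (distr ?\<nu> MY sh)) = emeasure (distr ?\<nu> MY sh) B"
      using em[OF B] em[OF vm(2)[OF B]] by simp
  qed simp
  then obtain \<mu>' where s': "siv \<mu>'" and l: "distr ?\<nu> MY sh = lifted \<mu>'" by (rule finv_is_lift)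
  have "\<mu> = \<mu>'"
  proof (rule siv_eqI_tile[OF s s', of n])
    fix N c assume N: "n \<le> N" and c: "c \<in> cells N"
    obtain m where m: "N = m + n" using N by (metis le_add_diff_inverse2)
    obtain b W' where c': "c = (b, W')" "W' \<in> pw (m + n) b" using c by (auto simp: cells_def m)
    then obtain W where W: "W \<in> pw (m + n) b" "W' = deep m b W" using deep_bij[of m b] by (auto simp: bij_betw_def)
    have "ennreal (tile \<mu>' N c) = emeasure ?\<nu> (sh -` tileset N c)"
      using emeasure_tile[OF s' c] em[OF tileset_sets, of N c] by (simp add: l)
    also have "\<dots> = emeasure ?\<nu> (tileset N (b, W))"
    proof (rule emeasure_eq_AE)
      show "AE p in ?\<nu>. p \<in> sh -` tileset N c \<longleftrightarrow> p \<in> tileset N (b, W)"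
        by (rule AE_mp[OF AEh], rule AE_I2) (simp add: m c' W(2) shuffle_tileset[OF _ W(1)])
    qed (use vm tileset_sets in \<open>simp_all add: sets_lift[OF s]\<close>)
    also have "\<dots> = ennreal (tile \<mu> N (b, W))" by (rule emeasure_tile[OF s]) (use W m in \<open>auto simp: cells_def\<close>)
    also have "tile \<mu> N (b, W) = tile \<mu> N c"
      using tile_uniform[OF s u] W c' m by simp
    finally show "tile \<mu> N c = tile \<mu>' N c" using tile_nonneg[OF s c] tile_nonneg[OF s' c] by simp
  qed
  then show ?thesis using em[OF A] l by simp
qed

end

theorem uniformity_measure_iff: "uniformity_measure \<sigma> L \<mu> \<longleftrightarrow> siv \<mu> \<and> uniform (dens \<mu>)"
proof
  assume "siv \<mu> \<and> uniform (dens \<mu>)"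
  then show "uniformity_measure \<sigma> L \<mu>"
    unfolding uniformity_measure_def using shuffle_invariant by simp
next
  assume um: "uniformity_measure \<sigma> L \<mu>"
  then have s: "siv \<mu>" by (simp add: uniformity_measure_def)
  have "dens \<mu> n (a, v) = dens \<mu> n (a, w)" if v: "v \<in> pw n a" and w: "w \<in> pw n a" for n a v w
  proof -
    \<comment> \<open>Transposing \<open>v\<close> and \<open>w\<close> is enough: the shuffle
      exchanges their cells in the hull.\<close>
    let ?\<alpha> = "\<lambda>z. if z = v then w else if z = w then v else z"
    have bij: "bij_betw ?\<alpha> (pw n a) (pw n a)"
      by (rule bij_betw_byWitness[of _ ?\<alpha>]) (use v w in auto)
    let ?f = "shuffle \<sigma> L n a ?\<alpha>" and ?\<nu> = "lifted \<mu>"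
    have "emeasure ?\<nu> (tileset n (a, w)) = emeasure ?\<nu> (?f -` tileset n (a, w))"
      using um bij tileset_sets by (simp add: uniformity_measure_def)
    also have "\<dots> = emeasure ?\<nu> (tileset n (a, v))"
    proof (rule emeasure_eq_AE)
      show "AE p in ?\<nu>. p \<in> ?f -` tileset n (a, w) \<longleftrightarrow> p \<in> tileset n (a, v)"
      proof (rule AE_mp[OF finv_AE[OF lift_flow_inv[OF s]]], rule AE_I2, rule impI)
        fix p assume "p \<in> HY"
        then obtain x t V where p: "rpred n p x t V" using rpred_ex by blast
        show "p \<in> ?f -` tileset n (a, w) \<longleftrightarrow> p \<in> tileset n (a, v)"
          using rpred_tileset[OF p] rpred_tileset[OF shuffle_eq(2)[OF bij p]] by (auto simp: shw_def)
      qed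
    qed (use measurable_sets[OF shuffle_measurable[OF bij] tileset_sets] tileset_sets in \<open>simp_all add: sets_lift[OF s]\<close>)
    finally have "tile \<mu> n (a, w) = tile \<mu> n (a, v)"
      using emeasure_tile[OF s] tile_nonneg[OF s] v w by (simp add: cells_def)
    then show ?thesis using ell_pos[OF s] Lword_pw[OF v] Lword_pw[OF w] by (simp add: tile_def)
  qed
  then show "siv \<mu> \<and> uniform (dens \<mu>)" using s unfolding uniform_def by blast
qed

end

section \<open>Entropy of partitions\<close>

text \<open>The comparison weights \<open>q\<close> may have total less than 1, as for the Kraft
  inequality: codes used below waste some weight.\<close>

lemma gibbs:
  fixes p q :: "'b \<Rightarrow> real"
  assumes "finite S" "\<And>i. i \<in> S \<Longrightarrow> 0 \<le> p i" "\<And>i. i \<in> S \<Longrightarrow> 0 \<le> q i"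
    and "\<And>i. i \<in> S \<Longrightarrow> 0 < p i \<Longrightarrow> 0 < q i" "(\<Sum>i\<in>S. p i) = 1" "(\<Sum>i\<in>S. q i) \<le> 1"
  shows "- (\<Sum>i\<in>S. p i * ln (p i)) \<le> - (\<Sum>i\<in>S. p i * ln (q i))"
proof -
  have "p i * ln (q i) - p i * ln (p i) \<le> q i - p i" if i: "i \<in> S" for i
  proof (cases "p i = 0")
    case False
    then have p: "0 < p i" "0 < q i" using assms(2,4) i by (auto simp: less_le)
    have "ln (q i / p i) \<le> q i / p i - 1" using p by (intro ln_le_minus_one) simp
    then have "p i * (ln (q i) - ln (p i)) \<le> p i * (q i / p i - 1)"
      using p by (intro mult_left_mono) (simp_all add: ln_div)
    then show ?thesis using p by (simp add: algebra_simps)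
  qed (use assms(3) i in simp)
  then have "(\<Sum>i\<in>S. p i * ln (q i) - p i * ln (p i)) \<le> (\<Sum>i\<in>S. q i - p i)" by (rule sum_mono)
  then show ?thesis using assms(5,6) by (simp add: sum_subtractf)
qed

lemma part_sum_measure:
  assumes "prob_space M" "fin_partition M P"
  shows "(\<Sum>A\<in>P. measure M A) = 1"
proof -
  interpret prob_space M by fact
  have "(\<Sum>A\<in>P. measure M A) = measure M (\<Union>A\<in>P. A)"
    using assms(2) by (intro finite_measure_finite_Union[symmetric])
      (auto simp: fin_partition_def disjoint_def disjoint_family_on_def)
  then show ?thesis using assms(2) prob_space by (simp add: fin_partition_def)
qed

lemma part_integral:
  fixes g :: "'b \<Rightarrow> real"
  assumes "prob_space M" "fin_partition M P" "integrable M g"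
  shows "(\<Sum>A\<in>P. \<integral>x. indicator A x * g x \<partial>M) = (\<integral>x. g x \<partial>M)"
proof -
  have P: "finite P" "P \<subseteq> sets M" "disjoint P" "\<Union>P = space M" using assms(2) by (auto simp: fin_partition_def)
  have "(\<Sum>A\<in>P. \<integral>x. indicator A x * g x \<partial>M) = (\<integral>x. (\<Sum>A\<in>P. indicator A x * g x) \<partial>M)"
    by (rule Bochner_Integration.integral_sum[symmetric])
      (use P integrable_mult_indicator[OF _ assms(3)] in auto)
  also have "\<dots> = (\<integral>x. g x \<partial>M)"
  proof (rule Bochner_Integration.integral_cong[OF refl])
    fix x assume "x \<in> space M"
    then obtain A where A: "A \<in> P" "x \<in> A" using P(4) by blast
    have "(\<Sum>B\<in>P. indicator B x * g x) = (\<Sum>B\<in>P. if B = A then g x else 0)"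
      using A P(3) by (intro sum.cong refl) (auto simp: disjoint_def indicator_def)
    then show "(\<Sum>A\<in>P. indicator A x * g x) = g x" using A P(1) by (simp add: sum.delta)
  qed
  finally show ?thesis .
qed

text \<open>A code that determines the atom bounds the entropy by its mean length. Every atom takes
  the weight of its heaviest code; distinct atoms have distinct codes, so Gibbs' inequality applies,
  and the heaviest code makes the bound by \<open>g\<close> valid at each point of the atom. Only
  \<open>g\<close> is integrated, so \<phi> may be an arbitrary function.\<close>

lemma part_entropy_le:
  fixes g :: "'b \<Rightarrow> real" and \<phi> :: "'b \<Rightarrow> 'c"
  assumes M: "prob_space M" and P: "fin_partition M P" and H: "AE x in M. x \<in> H" "H \<subseteq> space M"
    and fin: "finite (\<phi> ` H)"
    and det: "\<And>x x' A. x \<in> H \<Longrightarrow> x' \<in> H \<Longrightarrow> \<phi> x = \<phi> x' \<Longrightarrow> A \<in> P \<Longrightarrow> x \<in> A \<Longrightarrow> x' \<in> A"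
    and Q: "\<And>c. c \<in> \<phi> ` H \<Longrightarrow> 0 < Q c" "(\<Sum>c\<in>\<phi> ` H. Q c) \<le> 1"
    and g: "integrable M g" "\<And>x. x \<in> H \<Longrightarrow> - ln (Q (\<phi> x)) \<le> g x"
  shows "part_entropy M P \<le> (\<integral>x. g x \<partial>M)"
proof -
  interpret prob_space M by fact
  have P': "finite P" "P \<subseteq> sets M" "disjoint P" "\<Union>P = space M" using P by (auto simp: fin_partition_def)
  have "\<exists>x. x \<in> A \<inter> H \<and> (\<forall>x'\<in>A \<inter> H. Q (\<phi> x') \<le> Q (\<phi> x))" if "A \<inter> H \<noteq> {}" for A
  proof -
    have f: "finite (Q ` \<phi> ` (A \<inter> H))" using fin by (auto intro: finite_subset[of _ "\<phi> ` H"])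
    then have "Max (Q ` \<phi> ` (A \<inter> H)) \<in> Q ` \<phi> ` (A \<inter> H)" using that by (intro Max_in) auto
    then obtain x where "x \<in> A \<inter> H" "Q (\<phi> x) = Max (Q ` \<phi> ` (A \<inter> H))" by auto
    then show ?thesis using f by (intro exI[of _ x]) (auto intro!: Max_ge)
  qed
  then obtain z where z: "\<And>A. A \<inter> H \<noteq> {} \<Longrightarrow> z A \<in> A \<inter> H"
    "\<And>A x'. A \<inter> H \<noteq> {} \<Longrightarrow> x' \<in> A \<inter> H \<Longrightarrow> Q (\<phi> x') \<le> Q (\<phi> (z A))" by metis
  define P1 where "P1 = {A \<in> P. A \<inter> H \<noteq> {}}"
  define q where "q A = (if A \<inter> H \<noteq> {} then Q (\<phi> (z A)) else 0)" for A
  have null: "measure M A = 0" if "A \<in> P" "A \<inter> H = {}" for A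
  proof -
    have "AE x in M. x \<notin> A" using H(1) by (rule AE_mp) (use that in \<open>auto intro!: AE_I2\<close>)
    then have "emeasure M A = 0" using P'(2) that(1) by (subst (asm) AE_iff_measurable) (auto dest: sets.sets_into_space)
    then show ?thesis by (simp add: measure_def)
  qed
  have inj: "inj_on (\<lambda>A. \<phi> (z A)) P1"
  proof (rule inj_onI)
    fix A B assume AB: "A \<in> P1" "B \<in> P1" "\<phi> (z A) = \<phi> (z B)"
    then have "z B \<in> A" using det[of "z A" "z B" A] z(1)[of A] z(1)[of B] by (auto simp: P1_def)
    then show "A = B" using P'(3) AB z(1)[of B] by (auto simp: P1_def disjoint_def)
  qed
  have "(\<Sum>A\<in>P. q A) = (\<Sum>A\<in>P1. Q (\<phi> (z A)))"
    unfolding P1_def q_def using P'(1) by (subst sum.inter_filter) (auto intro!: sum.cong)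
  also have "\<dots> = (\<Sum>c\<in>(\<lambda>A. \<phi> (z A)) ` P1. Q c)" using inj by (simp add: sum.reindex)
  also have "\<dots> \<le> (\<Sum>c\<in>\<phi> ` H. Q c)"
    by (rule sum_mono2[OF fin]) (use z(1) Q(1) in \<open>auto simp: P1_def less_imp_le\<close>)
  finally have qsum: "(\<Sum>A\<in>P. q A) \<le> 1" using Q(2) by simp
  have qpos: "0 < q A" if "A \<inter> H \<noteq> {}" for A using z(1)[OF that] Q(1) that by (auto simp: q_def)
  have "part_entropy M P \<le> - (\<Sum>A\<in>P. measure M A * ln (q A))"
    unfolding part_entropy_def
  proof (rule gibbs)
    show "0 < q A" if "A \<in> P" "0 < measure M A" for A using null[OF that(1)] that(2) qpos by fastforce
    show "0 \<le> q A" for A using qpos[of A] by (cases "A \<inter> H = {}") (auto simp: q_def)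
  qed (use P' qsum part_sum_measure[OF M P] in auto)
  also have "\<dots> = (\<Sum>A\<in>P. measure M A * (- ln (q A)))" by (simp add: sum_negf)
  also have "\<dots> \<le> (\<Sum>A\<in>P. \<integral>x. indicator A x * g x \<partial>M)"
  proof (rule sum_mono)
    fix A assume A: "A \<in> P"
    have "measure M A * (- ln (q A)) = (\<integral>x. indicator A x * (- ln (q A)) \<partial>M)"
      using A P'(2) sets.sets_into_space[of A M] by (simp add: subset_iff Int_absorb1 inf.absorb1)
    also have "\<dots> \<le> (\<integral>x. indicator A x * g x \<partial>M)"
    proof (rule integral_mono_AE)
      show "integrable M (\<lambda>x. indicator A x * (- ln (q A)))"
        using A P'(2) by (intro integrable_mult_left integrable_real_indicator) (auto simp: less_top[symmetric])
      show "integrable M (\<lambda>x. indicator A x * g x)"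
        using integrable_mult_indicator[OF _ g(1), of A] A P'(2) by auto
      show "AE x in M. indicator A x * (- ln (q A)) \<le> indicator A x * g x"
      proof (rule AE_mp[OF H(1)], rule AE_I2, rule impI)
        fix x assume x: "x \<in> H"
        show "indicator A x * (- ln (q A)) \<le> indicator A x * g x"
        proof (cases "x \<in> A")
          case True
          then have ne: "A \<inter> H \<noteq> {}" using x by blast
          have "ln (Q (\<phi> x)) \<le> ln (q A)" using z(2)[OF ne, of x] Q(1)[of "\<phi> x"] x True ne by (simp add: q_def)
          then show ?thesis using g(2)[OF x] True by simp
        qed simp
      qed
    qed
    finally show "measure M A * (- ln (q A)) \<le> (\<integral>x. indicator A x * g x \<partial>M)" .
  qed
  also have "\<dots> = (\<integral>x. g x \<partial>M)" by (rule part_integral[OF M P g(1)])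
  finally show ?thesis .
qed

text \<open>The entropy is the integral of the information function, which is constant on
  atoms.\<close>

lemma part_entropy_ge:
  fixes F :: "'b \<Rightarrow> real"
  assumes M: "prob_space M" and P: "fin_partition M P" and H: "AE x in M. x \<in> H"
    and F: "integrable M F"
    and le: "\<And>A x. A \<in> P \<Longrightarrow> x \<in> A \<Longrightarrow> x \<in> H \<Longrightarrow> 0 < measure M A \<Longrightarrow> F x \<le> - ln (measure M A)"
  shows "(\<integral>x. F x \<partial>M) \<le> part_entropy M P"
proof -
  interpret prob_space M by fact
  have P': "finite P" "P \<subseteq> sets M" "disjoint P" "\<Union>P = space M" using P by (auto simp: fin_partition_def)
  have "(\<integral>x. F x \<partial>M) = (\<Sum>A\<in>P. \<integral>x. indicator A x * F x \<partial>M)" by (rule part_integral[OF M P F, symmetric])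
  also have "\<dots> \<le> (\<Sum>A\<in>P. measure M A * (- ln (measure M A)))"
  proof (rule sum_mono)
    fix A assume A: "A \<in> P"
    have "(\<integral>x. indicator A x * F x \<partial>M) \<le> (\<integral>x. indicator A x * (- ln (measure M A)) \<partial>M)"
    proof (rule integral_mono_AE)
      show "integrable M (\<lambda>x. indicator A x * (- ln (measure M A)))"
        using A P'(2) by (intro integrable_mult_left integrable_real_indicator) (auto simp: less_top[symmetric])
      show "integrable M (\<lambda>x. indicator A x * F x)"
        using integrable_mult_indicator[OF _ F, of A] A P'(2) by auto
      show "AE x in M. indicator A x * F x \<le> indicator A x * (- ln (measure M A))"
      proof (cases "measure M A = 0")
        case True
        then have "AE x in M. x \<notin> A" using A P'(2)
          by (intro AE_iff_null_sets[THEN iffD1]) (auto simp: null_sets_def emeasure_eq_measure)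
        then show ?thesis by (rule AE_mp) (auto intro!: AE_I2)
      next
        case False
        then have "0 < measure M A" by (simp add: less_le)
        show ?thesis
        proof (rule AE_mp[OF H], rule AE_I2, rule impI)
          fix x assume "x \<in> H"
          then show "indicator A x * F x \<le> indicator A x * (- ln (measure M A))"
            using le[OF A, of x] \<open>0 < measure M A\<close> by (cases "x \<in> A") simp_all
        qed
      qed
    qed
    also have "\<dots> = measure M A * (- ln (measure M A))"
      using A P'(2) sets.sets_into_space[of A M] by (simp add: subset_iff Int_absorb1 inf.absorb1)
    finally show "(\<integral>x. indicator A x * F x \<partial>M) \<le> measure M A * (- ln (measure M A))" .
  qed
  also have "\<dots> = part_entropy M P" by (simp add: part_entropy_def sum_negf)
  finally show ?thesis .
qed

lemma refine_partition:
  assumes P: "fin_partition M P" and f: "f \<in> measurable M M"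
  shows "fin_partition M (refine M f P n)"
  unfolding fin_partition_def
proof (intro conjI)
  have P': "finite P" "P \<subseteq> sets M" "disjoint P" "\<Union>P = space M" using P by (auto simp: fin_partition_def)
  have fm: "(f ^^ i) \<in> measurable M M" for i
  proof (induction i)
    case (Suc i)
    then show ?case using measurable_comp[OF Suc f] by (simp add: o_def)
  qed (simp add: id_def)
  let ?C = "\<lambda>c. space M \<inter> (\<Inter>i\<in>{..<n}. (f ^^ i) -` c i)"
  show "finite (refine M f P n)"
  proof (rule finite_subset)
    show "refine M f P n \<subseteq> ?C ` (PiE {..<n} (\<lambda>_. P))"
    proof
      fix A assume "A \<in> refine M f P n"
      then obtain c where c: "A = ?C c" "\<forall>i<n. c i \<in> P" by (auto simp: refine_def)
      show "A \<in> ?C ` (PiE {..<n} (\<lambda>_. P))"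
        by (rule image_eqI[of _ _ "restrict c {..<n}"]) (use c in auto)
    qed
    show "finite (?C ` (PiE {..<n} (\<lambda>_. P)))" using P'(1) by (intro finite_imageI finite_PiE) auto
  qed
  show "refine M f P n \<subseteq> sets M"
  proof
    fix A assume "A \<in> refine M f P n"
    then obtain c where c: "A = ?C c" "\<forall>i<n. c i \<in> P" by (auto simp: refine_def)
    have "A = {x \<in> space M. \<forall>i\<in>{..<n}. (f ^^ i) x \<in> c i}" using c(1) by auto
    also have "\<dots> \<in> sets M"
    proof (rule sets.sets_Collect_finite_All)
      fix i assume "i \<in> {..<n}"
      then have "c i \<in> sets M" using c(2) P'(2) by auto
      from measurable_sets[OF fm[of i] this] show "{x \<in> space M. (f ^^ i) x \<in> c i} \<in> sets M"
        by (simp add: vimage_def Int_def conj_commute)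
    qed simp
    finally show "A \<in> sets M" .
  qed
  show "disjoint (refine M f P n)"
  proof (rule disjointI)
    fix A B assume "A \<in> refine M f P n" "B \<in> refine M f P n" "A \<noteq> B"
    then obtain c c' where c: "A = ?C c" "\<forall>i<n. c i \<in> P" "B = ?C c'" "\<forall>i<n. c' i \<in> P" by (auto simp: refine_def)
    show "A \<inter> B = {}"
    proof (rule ccontr)
      assume "A \<inter> B \<noteq> {}"
      then obtain x where x: "x \<in> A" "x \<in> B" by blast
      have "c i = c' i" if "i < n" for i
      proof -
        have "(f ^^ i) x \<in> c i" "(f ^^ i) x \<in> c' i" using x c that by auto
        then show ?thesis using P'(3) c(2,4) that unfolding disjoint_def by blast
      qed
      then have "A = B" using c by auto
      then show False using \<open>A \<noteq> B\<close> by blast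
    qed
  qed
  show "\<Union> (refine M f P n) = space M"
  proof
    show "\<Union> (refine M f P n) \<subseteq> space M" by (auto simp: refine_def)
    show "space M \<subseteq> \<Union> (refine M f P n)"
    proof
      fix x assume x: "x \<in> space M"
      have "\<exists>A. A \<in> P \<and> (f ^^ i) x \<in> A" for i using measurable_space[OF fm x, of i] P'(4) by blast
      then obtain c where "\<And>i. c i \<in> P \<and> (f ^^ i) x \<in> c i" by metis
      then have "?C c \<in> refine M f P n" "x \<in> ?C c" using x by (auto simp: refine_def)
      then show "x \<in> \<Union> (refine M f P n)" by blast
    qed
  qed
qed

lemma refine_same_cell:
  assumes "A \<in> refine M f P n" "x \<in> A" "x' \<in> space M"
    and "\<And>i C. i < n \<Longrightarrow> C \<in> P \<Longrightarrow> (f ^^ i) x \<in> C \<Longrightarrow> (f ^^ i) x' \<in> C"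
  shows "x' \<in> A"
  using assms by (fastforce simp: refine_def)

text \<open>\<open>C\<close> and \<open>D\<close> may depend on the partition and on \<eta>: their
  terms vanish after division by the number of steps, and \<eta> tends to 0 afterwards.\<close>

lemma ks_entropy_le:
  assumes "\<And>P \<eta>. fin_partition M P \<Longrightarrow> 0 < \<eta> \<Longrightarrow> \<exists>C D. \<forall>n. part_entropy M (refine M f P (Suc n)) \<le> (V + \<eta>) * real (Suc n) + C + D * ln (real (Suc n))"
  shows "ks_entropy M f \<le> ereal V"
  unfolding ks_entropy_def
proof (rule SUP_least)
  fix P assume "P \<in> {P. fin_partition M P}"
  then have P: "fin_partition M P" by simp
  have lim: "liminf (\<lambda>n. ereal (part_entropy M (refine M f P (Suc n)) / real (Suc n))) \<le> ereal (V + \<eta>)" if \<eta>: "0 < \<eta>" for \<eta>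
  proof -
    obtain C D where CD: "\<And>n. part_entropy M (refine M f P (Suc n)) \<le> (V + \<eta>) * real (Suc n) + C + D * ln (real (Suc n))"
      using assms[OF P \<eta>] by blast
    let ?b = "\<lambda>n. (V + \<eta>) + (C / real (Suc n) + D * (ln (real (Suc n)) / real (Suc n)))"
    have l: "(\<lambda>n. ln (real (Suc n)) / real (Suc n)) \<longlonglongrightarrow> 0" by (rule LIMSEQ_Suc[OF lim_ln_over_n])
    have "?b \<longlonglongrightarrow> (V + \<eta>) + (0 + D * 0)"
      by (intro tendsto_intros l LIMSEQ_Suc lim_const_over_n)
    then have b: "(\<lambda>n. ereal (?b n)) \<longlonglongrightarrow> ereal (V + \<eta>)" by simp
    have "part_entropy M (refine M f P (Suc n)) / real (Suc n) \<le> ?b n" for n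
    proof -
      have "part_entropy M (refine M f P (Suc n)) / real (Suc n) \<le> ((V + \<eta>) * real (Suc n) + C + D * ln (real (Suc n))) / real (Suc n)"
        by (rule divide_right_mono[OF CD]) simp
      also have "\<dots> = ?b n" by (simp add: add_divide_distrib del: of_nat_Suc)
      finally show ?thesis .
    qed
    then have "liminf (\<lambda>n. ereal (part_entropy M (refine M f P (Suc n)) / real (Suc n))) \<le> liminf (\<lambda>n. ereal (?b n))"
      by (intro Liminf_mono always_eventually allI) (simp only: ereal_less_eq)
    also have "\<dots> = ereal (V + \<eta>)" using lim_imp_Liminf[OF _ b] by simp
    finally show ?thesis .
  qed
  show "liminf (\<lambda>n. ereal (part_entropy M (refine M f P (Suc n)) / real (Suc n))) \<le> ereal V"
  proof (rule ereal_le_epsilon2)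
    fix e :: real assume "0 < e"
    from lim[OF this] show "liminf (\<lambda>n. ereal (part_entropy M (refine M f P (Suc n)) / real (Suc n))) \<le> ereal V + ereal e"
      by (simp only: plus_ereal.simps(1))
  qed
qed

lemma ks_entropy_ge:
  assumes P: "fin_partition M P" and ge: "\<And>n. h * real (Suc n) - C \<le> part_entropy M (refine M f P (Suc n))"
  shows "ereal h \<le> ks_entropy M f"
proof -
  have "(\<lambda>n. h - C / real (Suc n)) \<longlonglongrightarrow> h - 0"
    by (intro tendsto_intros LIMSEQ_Suc lim_const_over_n)
  then have "(\<lambda>n. ereal (h - C / real (Suc n))) \<longlonglongrightarrow> ereal h" by simp
  from lim_imp_Liminf[OF _ this] have "ereal h = liminf (\<lambda>n. ereal (h - C / real (Suc n)))" by simp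
  also have "\<dots> \<le> liminf (\<lambda>n. ereal (part_entropy M (refine M f P (Suc n)) / real (Suc n)))"
  proof (intro Liminf_mono always_eventually allI)
    fix n
    have "h - C / real (Suc n) = (h * real (Suc n) - C) / real (Suc n)" by (simp add: diff_divide_distrib del: of_nat_Suc)
    also have "\<dots> \<le> part_entropy M (refine M f P (Suc n)) / real (Suc n)" by (rule divide_right_mono[OF ge]) simp
    finally show "ereal (h - C / real (Suc n)) \<le> ereal (part_entropy M (refine M f P (Suc n)) / real (Suc n))" by simp
  qed
  also have "\<dots> \<le> ks_entropy M f" unfolding ks_entropy_def by (rule SUP_upper) (use P in simp)
  finally show ?thesis .
qed

text \<open>Independent sub-probability choices, one for each entry of the list.\<close>

lemma prod_lists_sum_le:
  fixes f :: "nat \<Rightarrow> 'b \<Rightarrow> real"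
  assumes "finite S" "\<And>i c. c \<in> S \<Longrightarrow> 0 \<le> f i c" "\<And>i. i < n \<Longrightarrow> (\<Sum>c\<in>S. f i c) \<le> 1"
  shows "(\<Sum>cs\<in>{cs. set cs \<subseteq> S \<and> length cs = n}. \<Prod>i<n. f i (cs ! i)) \<le> 1"
  using assms(3)
proof (induction n)
  case 0
  have "{cs. set cs \<subseteq> S \<and> cs = []} = {[]}" by auto
  then show ?case by simp
next
  case (Suc n)
  have fin: "finite {cs. set cs \<subseteq> S \<and> length cs = n}" using assms(1) by (rule finite_lists_length_eq)
  have eq: "{cs. set cs \<subseteq> S \<and> length cs = Suc n} = (\<lambda>(cs, c). cs @ [c]) ` ({cs. set cs \<subseteq> S \<and> length cs = n} \<times> S)"
  proof safe
    fix cs assume cs: "set cs \<subseteq> S" "length cs = Suc n"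
    then have ne: "cs \<noteq> []" by auto
    have "cs = butlast cs @ [last cs]" using ne by simp
    moreover have "last cs \<in> S" using last_in_set[OF ne] cs by blast
    moreover have "set (butlast cs) \<subseteq> S" using cs by (meson in_set_butlastD subset_iff)
    ultimately show "cs \<in> (\<lambda>(cs, c). cs @ [c]) ` ({cs. set cs \<subseteq> S \<and> length cs = n} \<times> S)"
      using cs by (intro image_eqI[of _ _ "(butlast cs, last cs)"]) auto
  qed auto
  have "(\<Sum>cs\<in>{cs. set cs \<subseteq> S \<and> length cs = Suc n}. \<Prod>i<Suc n. f i (cs ! i))
    = (\<Sum>(cs, c)\<in>{cs. set cs \<subseteq> S \<and> length cs = n} \<times> S. (\<Prod>i<n. f i (cs ! i)) * f n c)"
    unfolding eq by (subst sum.reindex) (auto simp: inj_on_def nth_append intro!: sum.cong)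
  also have "\<dots> = (\<Sum>cs\<in>{cs. set cs \<subseteq> S \<and> length cs = n}. (\<Prod>i<n. f i (cs ! i)) * (\<Sum>c\<in>S. f n c))"
    unfolding sum.cartesian_product[symmetric] sum_distrib_left ..
  also have "\<dots> \<le> (\<Sum>cs\<in>{cs. set cs \<subseteq> S \<and> length cs = n}. (\<Prod>i<n. f i (cs ! i)) * 1)"
    using assms(2) Suc.prems by (intro sum_mono mult_left_mono prod_nonneg) (auto simp: subset_iff)
  also have "\<dots> \<le> 1" using Suc by simp
  finally show ?case .
qed

text \<open>Sets that are approximable by the generating algebra are closed under complements and
  countable unions; a countable union is first truncated to finitely many terms.\<close>

lemma algebra_approx:
  assumes alg: "algebra \<Omega> N" and M: "finite_measure M" "sets M = sigma_sets \<Omega> N" "space M = \<Omega>" and A: "A \<in> sets M" and e: "0 < (e :: real)"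
  shows "\<exists>D\<in>N. measure M ((A - D) \<union> (D - A)) < e"
proof -
  interpret finite_measure M by fact
  interpret algebra \<Omega> N by fact
  have NM: "D \<in> sets M" if "D \<in> N" for D using that M(2) by auto
  have "A \<in> sigma_sets \<Omega> N" using A M(2) by simp
  then show ?thesis using e
  proof (induction arbitrary: e rule: sigma_sets.induct)
    case (Basic a)
    then show ?case by (intro bexI[of _ a]) auto
  next
    case Empty
    then show ?case by (intro bexI[of _ "{}"]) auto
  next
    case (Compl a)
    obtain D where D: "D \<in> N" "measure M ((a - D) \<union> (D - a)) < e" using Compl.IH[OF Compl.prems] by blast
    have "a \<subseteq> \<Omega>" using sets.sets_into_space[of a M] Compl.hyps M by simp
    then have "((\<Omega> - a) - (\<Omega> - D)) \<union> ((\<Omega> - D) - (\<Omega> - a)) = (a - D) \<union> (D - a)"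
      using D(1) sets_into_space by blast
    then show ?case using D by (intro bexI[of _ "\<Omega> - D"]) auto
  next
    case (Union a)
    have am: "a i \<in> sets M" for i using Union.hyps M(2) by simp
    let ?U = "\<lambda>n. \<Union>i<n. a i"
    have "(\<lambda>n. measure M (?U n)) \<longlonglongrightarrow> measure M (\<Union>n. ?U n)"
      by (rule finite_Lim_measure_incseq) (use am in \<open>auto simp: incseq_def, metis lessThan_iff less_le_trans\<close>)
    moreover have "(\<Union>n. ?U n) = (\<Union>i. a i)" by auto
    ultimately have "\<forall>\<^sub>F n in sequentially. dist (measure M (?U n)) (measure M (\<Union>i. a i)) < e / 2"
      using tendstoD[of _ "measure M (\<Union>i. a i)" sequentially "e / 2"] Union.prems by simp
    then obtain n where "dist (measure M (?U n)) (measure M (\<Union>i. a i)) < e / 2"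
      by (auto simp: eventually_sequentially)
    then have n: "measure M (\<Union>i. a i) - measure M (?U n) < e / 2" unfolding dist_real_def by linarith
    \<comment> \<open>With \<open>n + 1\<close> in the denominator the \<open>n\<close> errors add
      up to at most \<open>e / 2\<close>, and the bound also makes sense for
      \<open>n = 0\<close>.\<close>
    have "\<exists>D\<in>N. measure M ((a i - D) \<union> (D - a i)) < e / (2 * (real n + 1))" for i
      by (rule Union.IH) (use Union.prems in simp)
    then obtain D where D: "\<And>i. D i \<in> N" "\<And>i. measure M ((a i - D i) \<union> (D i - a i)) < e / (2 * (real n + 1))" by metis
    define E where "E = (\<Union>i<n. D i)"
    have E: "E \<in> N" unfolding E_def using D(1) by (intro finite_UN) auto
    have dm: "(a i - D i) \<union> (D i - a i) \<in> sets M" for i using am NM[OF D(1)] by auto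
    have "measure M (((\<Union>i. a i) - E) \<union> (E - (\<Union>i. a i))) \<le> measure M (((\<Union>i. a i) - ?U n) \<union> (\<Union>i<n. (a i - D i) \<union> (D i - a i)))"
      by (rule finite_measure_mono) (use am dm in \<open>auto simp: E_def\<close>)
    also have "\<dots> \<le> measure M ((\<Union>i. a i) - ?U n) + measure M (\<Union>i<n. (a i - D i) \<union> (D i - a i))"
      by (rule measure_Un_le) (use am dm in auto)
    also have "measure M ((\<Union>i. a i) - ?U n) = measure M (\<Union>i. a i) - measure M (?U n)"
      by (rule finite_measure_Diff) (use am in auto)
    also have "measure M (\<Union>i<n. (a i - D i) \<union> (D i - a i)) \<le> (\<Sum>i<n. measure M ((a i - D i) \<union> (D i - a i)))"
      by (rule finite_measure_subadditive_finite) (use dm in auto)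
    also have "\<dots> \<le> (\<Sum>i<n. e / (2 * (real n + 1)))" by (intro sum_mono less_imp_le D)
    also have "\<dots> \<le> e / 2" using Union.prems by (simp add: field_simps)
    finally have "measure M (((\<Union>i. a i) - E) \<union> (E - (\<Union>i. a i))) < e" using n by simp
    then show ?case using E by blast
  qed
qed

section \<open>The upper bound for the entropy\<close>

context recog_subst
begin

lemma flow_funpow: "p \<in> HY \<Longrightarrow> (flow L 1 ^^ i) p = flow L (real i) p"
  by (induction i) (simp_all add: flow_0_hull flow_flow add.commute)

context
  fixes \<mu> :: "(int \<Rightarrow> 'a) measure" and N :: nat and p :: "'a \<times> 'a list \<Rightarrow> real"
  assumes s: "siv \<mu>" and p_pos: "\<And>c. c \<in> cells N \<Longrightarrow> 0 < p c"
    and p_sum: "\<And>a. (\<Sum>w\<in>pw N a. p (a, w)) \<le> 1"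
begin

text \<open>The cost of coding a cell c: choose a letter uniformly, then a word with the weights p.  By dl it is
  spread evenly over the time spent in the cell, so that the total cost becomes a time integral.\<close>
definition gc :: "'a \<times> 'a list \<Rightarrow> real" where
  "gc c = ln (real CARD('a)) - ln (p c)"

lemma p_le_1: "c \<in> cells N \<Longrightarrow> p c \<le> 1"
proof -
  assume c: "c \<in> cells N"
  then have "p (fst c, snd c) \<le> (\<Sum>w\<in>pw N (fst c). p (fst c, w))"
    by (intro member_le_sum) (use p_pos pw_valid in \<open>auto simp: cells_def less_imp_le\<close>)
  then show "p c \<le> 1" using p_sum[of "fst c"] by simp
qed

lemma gc_nonneg: "c \<in> cells N \<Longrightarrow> 0 \<le> gc c"
proof -
  assume c: "c \<in> cells N"
  have "0 \<le> ln (real CARD('a))" using Suc_leI[OF zero_less_card_finite[where 'a = 'a]] by simp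
  moreover have "ln (p c) \<le> 0" using p_pos[OF c] p_le_1[OF c] by simp
  ultimately show "0 \<le> gc c" unfolding gc_def by linarith
qed

definition dl :: "(int \<Rightarrow> 'a) \<Rightarrow> real" where
  "dl y = (if y \<in> X then gc (cx N y 0, cv N y 0) / Lword L (cv N y 0) else 0)"

lemma c0_cell: "y \<in> X \<Longrightarrow> (cx n y 0, cv n y 0) \<in> cells n"
  using level_data_c[of y n] by (simp add: level_data_def cells_def)

lemma dl_nonneg: "0 \<le> dl y"
  using gc_nonneg[OF c0_cell, of y] Lword_cell[OF c0_cell, of y N] lamL_pos[of N "cx N y 0"]
  by (auto simp: dl_def intro!: divide_nonneg_pos)

definition dmax :: real where
  "dmax = (\<Sum>c\<in>cells N. gc c / Lword L (snd c))"

lemma Lword_cell_pos: "c \<in> cells n \<Longrightarrow> 0 < Lword L (snd c)"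
  using Lword_cell[of c n] lamL_pos[of n "fst c"] by simp

lemma dl_le: "dl y \<le> dmax"
proof (cases "y \<in> X")
  case True
  have "gc (cx N y 0, cv N y 0) / Lword L (snd (cx N y 0, cv N y 0)) \<le> dmax"
    unfolding dmax_def by (rule member_le_sum[OF c0_cell[OF True]])
      (use gc_nonneg Lword_cell_pos in \<open>auto simp: less_imp_le\<close>)
  then show ?thesis using True by (simp add: dl_def)
next
  case False
  then show ?thesis unfolding dl_def dmax_def
    using gc_nonneg Lword_cell_pos by (auto intro!: sum_nonneg divide_nonneg_pos)
qed

lemma dmax_nonneg: "0 \<le> dmax"
  using dl_nonneg dl_le order_trans by blast

lemma dl_measurable [measurable]: "dl \<in> borel_measurable MX"
  unfolding dl_def
  by (rule loc_measurable[OF loc_comp2[OF loc_cx loc_cv, of "\<lambda>a w. gc (a, w) / Lword L w"]]) auto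

text \<open>The mean coding cost per unit of flow time; \<open>dl_integral\<close> identifies it
  with the integral of the rate \<open>dl\<close>.\<close>

definition Vp :: real where
  "Vp = (\<Sum>c\<in>cells N. dens \<mu> N c * gc c) / ell \<mu>"

lemma Vp_nonneg: "0 \<le> Vp"
  unfolding Vp_def using gc_nonneg ell_pos[OF s] by (intro divide_nonneg_pos sum_nonneg mult_nonneg_nonneg) auto

lemma finv_lift: "finv (lifted \<mu>)"
  by (rule lift_flow_inv[OF s])

lemma fst_MY [measurable]: "fst \<in> measurable MY MX"
  unfolding MY_def by simp

lemma dl_fst_measurable: "(\<lambda>q. ennreal (dl (fst q))) \<in> borel_measurable MY"
  by measurable

lemma dl_integral: "(\<integral>\<^sup>+q. ennreal (dl (fst q)) \<partial>lifted \<mu>) = ennreal Vp"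
proof -
  let ?\<nu> = "lifted \<mu>"
  have [measurable_cong]: "sets ?\<nu> = sets MY" by (rule sets_lift[OF s])
  have "(\<integral>\<^sup>+q. ennreal (dl (fst q)) \<partial>?\<nu>)
    = (\<integral>\<^sup>+q. (\<Sum>c\<in>cells N. ennreal (gc c / Lword L (snd c)) * indicator (tileset N c) q) \<partial>?\<nu>)"
  proof (rule nn_integral_cong_AE, rule AE_mp[OF finv_AE[OF finv_lift]], rule AE_I2, rule impI)
    fix q assume q: "q \<in> HY"
    have yX: "fst q \<in> X" using q by (cases q) (simp add: hull_iff)
    define c0 where "c0 = (cx N (fst q) 0, cv N (fst q) 0)"
    have "(\<Sum>c\<in>cells N. ennreal (gc c / Lword L (snd c)) * indicator (tileset N c) q)
      = (\<Sum>c\<in>cells N. if c = c0 then ennreal (gc c / Lword L (snd c)) else 0)"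
      using q by (intro sum.cong refl) (auto simp: tileset_def c0_def indicator_def)
    also have "\<dots> = ennreal (dl (fst q))"
      using c0_cell[OF yX, of N] yX by (simp add: sum.delta c0_def dl_def)
    finally show "ennreal (dl (fst q)) = (\<Sum>c\<in>cells N. ennreal (gc c / Lword L (snd c)) * indicator (tileset N c) q)" by simp
  qed
  also have "\<dots> = (\<Sum>c\<in>cells N. \<integral>\<^sup>+q. ennreal (gc c / Lword L (snd c)) * indicator (tileset N c) q \<partial>?\<nu>)"
    by (rule nn_integral_sum) (auto simp: sets_lift[OF s])
  also have "\<dots> = (\<Sum>c\<in>cells N. ennreal (dens \<mu> N c * gc c / ell \<mu>))"
  proof (intro sum.cong refl)
    fix c assume c: "c \<in> cells N"
    have "(\<integral>\<^sup>+q. ennreal (gc c / Lword L (snd c)) * indicator (tileset N c) q \<partial>?\<nu>) = ennreal (gc c / Lword L (snd c)) * ennreal (tile \<mu> N c)"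
      using emeasure_tile[OF s c] by (simp add: nn_integral_cmult_indicator sets_lift[OF s] tileset_sets)
    also have "\<dots> = ennreal (gc c / Lword L (snd c) * tile \<mu> N c)"
      using gc_nonneg[OF c] Lword_cell_pos[OF c] tile_nonneg[OF s c] by (intro ennreal_mult[symmetric]) auto
    also have "gc c / Lword L (snd c) * tile \<mu> N c = dens \<mu> N c * gc c / ell \<mu>"
      using Lword_cell_pos[OF c] by (simp add: tile_def)
    finally show "(\<integral>\<^sup>+q. ennreal (gc c / Lword L (snd c)) * indicator (tileset N c) q \<partial>?\<nu>) = ennreal (dens \<mu> N c * gc c / ell \<mu>)" .
  qed
  also have "\<dots> = ennreal Vp"
    using gc_nonneg ell_pos[OF s] unfolding Vp_def sum_divide_distrib
    by (intro sum_ennreal) (auto intro!: divide_nonneg_pos mult_nonneg_nonneg)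
  finally show ?thesis .
qed

definition Iint :: "real \<Rightarrow> (int \<Rightarrow> 'a) \<times> real \<Rightarrow> ennreal" where
  "Iint T q = (\<integral>\<^sup>+t. ennreal (dl (fst (flow L t q))) * indicator {0..<T} t \<partial>lborel)"

lemma Iint_measurable: "Iint T \<in> borel_measurable MY"
proof -
  have "(\<lambda>z. flow L (snd z) (fst z)) \<in> measurable (MY \<Otimes>\<^sub>M lborel) MY"
    using measurable_compose[OF measurable_pair_swap' flow_measurable_joint] by (simp add: split_beta')
  then have [measurable]: "(\<lambda>z. ennreal (dl (fst (flow L (snd z) (fst z))))) \<in> borel_measurable (MY \<Otimes>\<^sub>M lborel)"
    by (rule measurable_compose[OF _ dl_fst_measurable])
  have "(\<lambda>z. ennreal (dl (fst (flow L (snd z) (fst z)))) * indicator {0..<T} (snd z)) \<in> borel_measurable (MY \<Otimes>\<^sub>M lborel)"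
    by measurable
  then show ?thesis unfolding Iint_def
    by (intro lborel.borel_measurable_nn_integral) (simp add: split_beta')
qed

lemma Iint_le: "0 \<le> T \<Longrightarrow> Iint T q \<le> ennreal (dmax * T)"
proof -
  assume T: "0 \<le> T"
  have "Iint T q \<le> (\<integral>\<^sup>+t. ennreal dmax * indicator {0..<T} t \<partial>lborel)"
    unfolding Iint_def by (intro nn_integral_mono) (auto simp: indicator_def dl_le ennreal_leI)
  also have "\<dots> = ennreal (dmax * T)"
    using T dmax_nonneg by (simp add: nn_integral_cmult_indicator ennreal_mult)
  finally show ?thesis .
qed

lemma Iint_integral:
  assumes T: "0 \<le> T"
  shows "integrable (lifted \<mu>) (\<lambda>q. enn2real (Iint T q))" "(\<integral>q. enn2real (Iint T q) \<partial>lifted \<mu>) = T * Vp"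
proof -
  interpret prob_space "lifted \<mu>" using prob_lift[OF s] by blast
  have m: "(\<lambda>q. enn2real (Iint T q)) \<in> borel_measurable (lifted \<mu>)"
    using finv_measurable[OF finv_lift Iint_measurable] by measurable
  have fin: "Iint T q < \<top>" for q using Iint_le[OF T, of q] by (rule le_less_trans) simp
  have b: "enn2real (Iint T q) \<le> dmax * T" for q
    using Iint_le[OF T, of q] dmax_nonneg T by (simp add: enn2real_leI)
  show i: "integrable (lifted \<mu>) (\<lambda>q. enn2real (Iint T q))"
    by (rule integrable_const_bound[of _ "dmax * T"]) (use m b in auto)
  have "(\<integral>\<^sup>+q. ennreal (enn2real (Iint T q)) \<partial>lifted \<mu>) = (\<integral>\<^sup>+q. Iint T q \<partial>lifted \<mu>)"
    using fin by (intro nn_integral_cong) simp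
  also have "\<dots> = ennreal T * ennreal Vp"
    unfolding Iint_def using finv_flow_integral[OF finv_lift dl_fst_measurable T] dl_integral by simp
  also have "\<dots> = ennreal (T * Vp)" using T Vp_nonneg by (simp add: ennreal_mult)
  finally show "(\<integral>q. enn2real (Iint T q) \<partial>lifted \<mu>) = T * Vp"
    using m T Vp_nonneg by (subst integral_eq_nn_integral) auto
qed

definition lc :: "(int \<Rightarrow> 'a) \<Rightarrow> int \<Rightarrow> real" where
  "lc y m = L (y m) * dl (shiftn m y)"

lemma lc_nonneg: "0 \<le> lc y m"
  by (simp add: lc_def dl_nonneg)

lemma lc_le: "lc y m \<le> Lmax * dmax"
  unfolding lc_def using L_pos[of undefined] Lmax_ge[of undefined]
  by (intro mult_mono dl_le dl_nonneg Lmax_ge) linarith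

text \<open>Letter 0 is entered midway and letter \<open>idx y (r + T)\<close> need not be
  completed; the letters in between are crossed entirely, and the cost of each is the time integral
  of its rate.\<close>

lemma lc_time:
  assumes q: "(y, r) \<in> HY" and T: "0 \<le> T"
  shows "(\<Sum>m\<in>{1..<idx y (r + T)}. lc y m) \<le> enn2real (Iint T (y, r))"
proof -
  define J where "J = idx y (r + T)"
  have r: "0 \<le> r" "r < L (y 0)" using q by (auto simp: hull_iff)
  have "ennreal (\<Sum>m\<in>{1..<J}. lc y m) = (\<Sum>m\<in>{1..<J}. ennreal (lc y m))"
    by (rule sum_ennreal[symmetric]) (rule lc_nonneg)
  also have "\<dots> = (\<Sum>m\<in>{1..<J}. \<integral>\<^sup>+t. ennreal (dl (shiftn m y)) * indicator {rf y m - r..<rf y (m + 1) - r} t \<partial>lborel)"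
    by (intro sum.cong refl)
      (simp add: nn_integral_cmult_indicator rf_Suc lc_def ennreal_mult dl_nonneg mult.commute)
  also have "\<dots> = (\<integral>\<^sup>+t. (\<Sum>m\<in>{1..<J}. ennreal (dl (shiftn m y)) * indicator {rf y m - r..<rf y (m + 1) - r} t) \<partial>lborel)"
    by (rule nn_integral_sum[symmetric]) auto
  also have "\<dots> \<le> Iint T (y, r)" unfolding Iint_def
  proof (rule nn_integral_mono)
    fix t
    define m0 where "m0 = idx y (r + t)"
    have i: "t \<in> {rf y m - r..<rf y (m + 1) - r} \<longleftrightarrow> m = m0" for m
      using idx_eq_iff[of y "r + t" m] by (auto simp: m0_def)
    have "(\<Sum>m\<in>{1..<J}. ennreal (dl (shiftn m y)) * indicator {rf y m - r..<rf y (m + 1) - r} t)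
      = (\<Sum>m\<in>{1..<J}. if m = m0 then ennreal (dl (shiftn m y)) else 0)"
      by (intro sum.cong refl) (simp add: indicator_def i del: atLeastLessThan_iff)
    also have "\<dots> = (if m0 \<in> {1..<J} then ennreal (dl (shiftn m0 y)) else 0)" by simp
    also have "\<dots> \<le> ennreal (dl (fst (flow L t (y, r)))) * indicator {0..<T} t"
    proof (cases "m0 \<in> {1..<J}")
      case True
      have "rf y 1 \<le> rf y m0" "rf y (m0 + 1) \<le> rf y J" using True by (simp_all only: rf_le_iff) auto
      moreover have "rf y m0 \<le> r + t" "r + t < rf y (m0 + 1)" "rf y J \<le> r + T"
        using idx[where x = y and t = "r + t"] idx[where x = y and t = "r + T"] by (auto simp: m0_def J_def)
      ultimately have "0 \<le> t" "t < T" using r by auto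
      then show ?thesis using True by (simp add: flow_idx m0_def)
    next
      case False
      then show ?thesis by (simp del: atLeastLessThan_iff)
    qed
    finally show "(\<Sum>m\<in>{1..<J}. ennreal (dl (shiftn m y)) * indicator {rf y m - r..<rf y (m + 1) - r} t)
      \<le> ennreal (dl (fst (flow L t (y, r)))) * indicator {0..<T} t" .
  qed
  finally have "ennreal (\<Sum>m\<in>{1..<J}. lc y m) \<le> Iint T (y, r)" .
  moreover have "Iint T (y, r) < \<top>" using Iint_le[OF T] by (rule le_less_trans) simp
  ultimately show ?thesis unfolding J_def[symmetric]
    by (metis enn2real_ennreal enn2real_mono sum_nonneg lc_nonneg)
qed

lemma lc_cells:
  assumes d: "ldata N y x 0 v"
  shows "(\<Sum>i<nat (wpos v (int c)). lc y (int i)) = (\<Sum>j<c. gc (x (int j), v (int j)))"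
  unfolding sum_wpos
proof (intro sum.cong refl)
  fix j
  have NEv: "NE v" using level_data_NE[OF d] .
  have vj: "v (int j) \<in> pw N (x (int j))" using d by (simp add: level_data_def)
  have w0: "0 \<le> wpos v (int j)" using wpos_ge[OF NEv, of "int j"] by simp
  have "(\<Sum>i<length (v (int j)). lc y (int (nat (wpos v (int j)) + i)))
    = (\<Sum>i<length (v (int j)). L (v (int j) ! i) * (gc (x (int j), v (int j)) / Lword L (v (int j))))"
  proof (intro sum.cong refl)
    fix i assume i: "i \<in> {..<length (v (int j))}"
    let ?m = "int (nat (wpos v (int j)) + i)"
    have m: "?m = wpos v (int j) + int i" using w0 by simp
    have "ldata N (shiftn ?m y) (shiftn (int j) x) (?m - wpos v (int j)) (shiftn (int j) v)"
      by (rule level_data_inside[OF d]) (use i wpos_Suc[of v "int j"] m in auto)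
    from level_data_cD[OF this] have "dl (shiftn ?m y) = gc (x (int j), v (int j)) / Lword L (v (int j))"
      using level_data_in_X[OF d] by (simp add: dl_def shiftn_apply)
    moreover have "y ?m = v (int j) ! i"
      using biconcat_at[OF NEv, of i "int j"] i d m by (simp add: level_data_def)
    ultimately show "lc y ?m = L (v (int j) ! i) * (gc (x (int j), v (int j)) / Lword L (v (int j)))"
      by (simp add: lc_def)
  qed
  also have "\<dots> = Lword L (v (int j)) * (gc (x (int j), v (int j)) / Lword L (v (int j)))"
    unfolding sum_distrib_right[symmetric] by (simp add: Lword_def sum_list_sum_nth atLeast0LessThan)
  also have "\<dots> = gc (x (int j), v (int j))" using Lword_pw[OF vj] by simp
  finally show "(\<Sum>i<length (v (int j)). lc y (int (nat (wpos v (int j)) + i))) = gc (x (int j), v (int j))" .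
qed

text \<open>The number of cells that cover the positions from \<open>- R\<close> to
  \<open>J + R\<close>, counted from the cell over \<open>- R\<close>; \<open>ck\<close> is the
  offset of that position in its cell.\<close>

definition ncell :: "nat \<Rightarrow> int \<Rightarrow> (int \<Rightarrow> 'a) \<Rightarrow> nat" where
  "ncell R J y = (LEAST c. ck N (shiftn (- int R) y) + (J + 2 * int R + 1) \<le> wpos (cv N (shiftn (- int R) y)) (int c))"

definition wcells :: "nat \<Rightarrow> int \<Rightarrow> (int \<Rightarrow> 'a) \<Rightarrow> ('a \<times> 'a list) list" where
  "wcells R J y = map (\<lambda>j. (cx N (shiftn (- int R) y) (int j), cv N (shiftn (- int R) y) (int j))) [0..<ncell R J y]"

lemma ncell:
  fixes R :: nat
  assumes "y \<in> X" "0 \<le> J"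
  defines "z \<equiv> shiftn (- int R) y"
  shows "ck N z + (J + 2 * int R + 1) \<le> wpos (cv N z) (int (ncell R J y))"
    "int (ncell R J y) \<le> ck N z + (J + 2 * int R + 1)"
    "wpos (cv N z) (int (ncell R J y)) \<le> ck N z + (J + 2 * int R + 1) + int (maxlen N)"
proof -
  have d: "ldata N z (cx N z) (ck N z) (cv N z)" using assms by (intro level_data_c) (simp add: z_def)
  have NEv: "NE (cv N z)" using level_data_NE[OF d] .
  have k: "0 \<le> ck N z" using d by (simp add: level_data_def)
  define K where "K = ck N z + (J + 2 * int R + 1)"
  have K: "0 < K" using k assms(2) by (simp add: K_def)
  have ex: "K \<le> wpos (cv N z) (int (nat K))" using wpos_ge[OF NEv, of "int (nat K)"] K by simp
  have n: "ncell R J y = (LEAST c. K \<le> wpos (cv N z) (int c))" by (simp add: ncell_def z_def K_def)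
  show 1: "ck N z + (J + 2 * int R + 1) \<le> wpos (cv N z) (int (ncell R J y))"
    using LeastI[of "\<lambda>c. K \<le> wpos (cv N z) (int c)", OF ex] unfolding n K_def .
  have "ncell R J y \<le> nat K" unfolding n by (rule Least_le) (rule ex)
  then show "int (ncell R J y) \<le> ck N z + (J + 2 * int R + 1)" using K unfolding K_def by linarith
  have "ncell R J y \<noteq> 0"
  proof
    assume "ncell R J y = 0"
    then show False using 1 K by (simp add: K_def)
  qed
  then obtain c where c: "ncell R J y = Suc c" using not0_implies_Suc by blast
  have "\<not> K \<le> wpos (cv N z) (int c)" using not_less_Least[of c "\<lambda>c. K \<le> wpos (cv N z) (int c)"] c n by simp
  moreover have "wpos (cv N z) (int (Suc c)) = wpos (cv N z) (int c) + int (length (cv N z (int c)))"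
    using wpos_Suc[of "cv N z" "int c"] by (simp add: add.commute)
  moreover have "length (cv N z (int c)) \<le> maxlen N"
    using length_le_maxlen[of "cv N z (int c)" N "cx N z (int c)"] d by (simp add: level_data_def)
  ultimately show "wpos (cv N z) (int (ncell R J y)) \<le> ck N z + (J + 2 * int R + 1) + int (maxlen N)"
    unfolding c K_def by linarith
qed

text \<open>The list of cells and the offset of the first one determine all letters from
  \<open>- R\<close> to \<open>J + R\<close>, which makes the list usable as a code.\<close>

lemma wcells_letters:
  assumes y: "y \<in> X" "0 \<le> J" and m: "- int R \<le> m" "m \<le> J + int R"
  shows "y m = concat (map snd (wcells R J y)) ! nat (m + int R + ck N (shiftn (- int R) y))"
proof -
  define z where "z = shiftn (- int R) y"
  define c where "c = ncell R J y"
  have d: "ldata N z (cx N z) (ck N z) (cv N z)" using y by (intro level_data_c) (simp add: z_def)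
  have NEv: "NE (cv N z)" using level_data_NE[OF d] .
  have k: "0 \<le> ck N z" using d by (simp add: level_data_def)
  note n = ncell(1)[OF y, of R, folded z_def c_def]
  have w: "map snd (wcells R J y) = win (cv N z) 0 c" by (simp add: wcells_def win_def z_def c_def)
  define i where "i = nat (m + int R + ck N z)"
  have i: "int i = m + int R + ck N z" using m k by (simp add: i_def)
  have "i < length (concat (win (cv N z) 0 c))"
    using win_biconcat(2)[OF NEv, of 0 c] n i m by simp
  then have "biconcat (cv N z) (int i) = concat (win (cv N z) 0 c) ! i"
    using win_biconcat(1)[OF NEv, of 0 c] nth_win[of i "length (concat (win (cv N z) 0 c))" "biconcat (cv N z)" 0] by simp
  moreover have "z = shiftn (ck N z) (biconcat (cv N z))" using d by (simp only: level_data_def)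
  from fun_cong[OF this, of "m + int R"] have "z (m + int R) = biconcat (cv N z) (int i)"
    by (simp only: i shiftn_apply)
  moreover have "z (m + int R) = y m" by (simp add: z_def shiftn_apply)
  ultimately show ?thesis unfolding w z_def[symmetric] i_def[symmetric] by simp
qed

lemma wcells_cells: "y \<in> X \<Longrightarrow> set (wcells R J y) \<subseteq> cells N"
  using level_data_c[of "shiftn (- int R) y" N] by (auto simp: wcells_def cells_def level_data_def)

text \<open>All but a bounded number of the letters covered by the cells are crossed within time
  \<open>T\<close>, and their cost is at most the time integral. The others lie in the margins of
  width \<open>R\<close> or in the parts of the first and last cell that stick out.\<close>

lemma wcells_cost:
  assumes q: "(y, r) \<in> HY" and T: "0 \<le> T"
  shows "(\<Sum>c\<leftarrow>wcells R (idx y (r + T)) y. gc c)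
    \<le> enn2real (Iint T (y, r)) + Lmax * dmax * real (2 * R + 2 + 2 * maxlen N)"
proof -
  define J where "J = idx y (r + T)"
  define z where "z = shiftn (- int R) y"
  define k where "k = ck N z"
  define v where "v = cv N z"
  define c where "c = ncell R J y"
  define b where "b = shiftn (- k) z"
  define w where "w = wpos v (int c)"
  have y: "y \<in> X" and r: "0 \<le> r" using q by (auto simp: hull_iff)
  have "rf y 0 < rf y (J + 1)" using idx[where x = y and t = "r + T"] r T by (simp add: J_def)
  then have J0: "0 \<le> J" unfolding rf_less_iff by simp
  have d: "ldata N z (cx N z) k v" using y unfolding k_def v_def by (intro level_data_c) (simp add: z_def)
  have NEv: "NE v" using level_data_NE[OF d] .
  have k: "0 \<le> k" "k \<le> int (maxlen N)" using d level_data_finite(2)[OF d] by auto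
  have db: "ldata N b (cx N z) 0 v"
    using d NEv by (auto simp: level_data_def b_def)
  note n = ncell(1,3)[OF y J0, of R, folded z_def, folded k_def v_def, folded c_def, folded w_def]
  have bm: "lc b i = lc y (i - k - int R)" for i by (simp add: lc_def b_def z_def shiftn_apply algebra_simps)
  have "(\<Sum>c\<leftarrow>wcells R J y. gc c) = (\<Sum>j<c. gc (cx N z (int j), v (int j)))"
    by (simp add: wcells_def sum_list_sum_nth atLeast0LessThan z_def c_def v_def)
  also have "\<dots> = (\<Sum>i<nat w. lc b (int i))" by (simp add: lc_cells[OF db] w_def)
  also have "\<dots> = (\<Sum>m\<in>(\<lambda>i. int i - k - int R) ` {..<nat w}. lc y m)"
    by (subst sum.reindex) (auto simp: inj_on_def bm)
  also have "(\<lambda>i. int i - k - int R) ` {..<nat w} = {- k - int R..<w - k - int R}"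
  proof
    show "{- k - int R..<w - k - int R} \<subseteq> (\<lambda>i. int i - k - int R) ` {..<nat w}"
    proof
      fix m assume "m \<in> {- k - int R..<w - k - int R}"
      then show "m \<in> (\<lambda>i. int i - k - int R) ` {..<nat w}"
        by (intro image_eqI[of _ _ "nat (m + k + int R)"]) auto
    qed
  qed auto
  also have "(\<Sum>m\<in>{- k - int R..<w - k - int R}. lc y m)
    \<le> (\<Sum>m\<in>{1..<J} \<union> ({- k - int R..<1} \<union> {J..<w - k - int R}). lc y m)"
    by (rule sum_mono2) (auto simp: lc_nonneg)
  also have "\<dots> \<le> (\<Sum>m\<in>{1..<J}. lc y m) + (\<Sum>m\<in>{- k - int R..<1} \<union> {J..<w - k - int R}. lc y m)"
    by (subst sum.union_inter[symmetric]) (auto intro!: sum_nonneg lc_nonneg)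
  also have "(\<Sum>m\<in>{- k - int R..<1} \<union> {J..<w - k - int R}. lc y m)
    \<le> real (card ({- k - int R..<1} \<union> {J..<w - k - int R})) * (Lmax * dmax)"
    using sum_bounded_above[of "{- k - int R..<1} \<union> {J..<w - k - int R}" "lc y" "Lmax * dmax"] lc_le by simp
  also have "\<dots> \<le> real (2 * R + 2 + 2 * maxlen N) * (Lmax * dmax)"
  \<comment> \<open>On the left at most \<open>1 + maxlen N + R\<close> positions are left over, on
    the right at most \<open>R + 1 + maxlen N\<close>.\<close>
  proof (intro mult_right_mono)
    have "card ({- k - int R..<1} \<union> {J..<w - k - int R}) \<le> card {- k - int R..<1} + card {J..<w - k - int R}"
      by (rule card_Un_le)
    also have "\<dots> = nat (1 + k + int R) + nat (w - k - int R - J)" by (simp add: add.commute)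
    also have "\<dots> \<le> 2 * R + 2 + 2 * maxlen N" using n k J0 by simp
    finally show "real (card ({- k - int R..<1} \<union> {J..<w - k - int R})) \<le> real (2 * R + 2 + 2 * maxlen N)"
      by (simp only: of_nat_le_iff)
    show "0 \<le> Lmax * dmax" using lc_nonneg lc_le order_trans by blast
  qed
  also have "(\<Sum>m\<in>{1..<J}. lc y m) \<le> enn2real (Iint T (y, r))"
    unfolding J_def by (rule lc_time[OF q T])
  finally show ?thesis unfolding J_def by (simp add: mult.commute)
qed

end

end

section \<open>Labels that read finitely many letters and thresholds\<close>

text \<open>The rank of a height in a finite set decides all its comparisons with that set. So
  polynomially many comparisons are coded by one number of polynomial size instead of one bit for
  each.\<close>

lemma card_le_threshold:
  fixes S :: "real set"
  assumes "finite S" "card {\<beta>\<in>S. \<beta> \<le> r} = card {\<beta>\<in>S. \<beta> \<le> r'}" "\<beta> \<in> S"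
  shows "\<beta> \<le> r \<longleftrightarrow> \<beta> \<le> r'"
proof -
  have "{\<beta>\<in>S. \<beta> \<le> r} = {\<beta>\<in>S. \<beta> \<le> r'}"
  proof (cases "r \<le> r'")
    case True
    then show ?thesis using assms(1,2) by (intro card_subset_eq) auto
  next
    case False
    then show ?thesis using assms(1,2) by (intro card_subset_eq[symmetric]) auto
  qed
  then show ?thesis using assms(3) by blast
qed

context recog_subst
begin

text \<open>f depends only on the letters near the origin and on the position of the height relative to B.\<close>
definition nicew :: "nat \<Rightarrow> real set \<Rightarrow> ((int \<Rightarrow> 'a) \<times> real \<Rightarrow> 'c) \<Rightarrow> bool" where
  "nicew R B f \<longleftrightarrow> (\<forall>y r y' r'. (y, r) \<in> HY \<longrightarrow> (y', r') \<in> HY \<longrightarrow>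
     (\<forall>i. \<bar>i\<bar> \<le> int R \<longrightarrow> y i = y' i) \<longrightarrow> (\<forall>b\<in>B. b \<le> r \<longleftrightarrow> b \<le> r') \<longrightarrow> f (y, r) = f (y', r'))"

lemma nicewD: "nicew R B f \<Longrightarrow> (y, r) \<in> HY \<Longrightarrow> (y', r') \<in> HY \<Longrightarrow>
  (\<And>i. \<bar>i\<bar> \<le> int R \<Longrightarrow> y i = y' i) \<Longrightarrow> (\<And>b. b \<in> B \<Longrightarrow> b \<le> r \<longleftrightarrow> b \<le> r') \<Longrightarrow> f (y, r) = f (y', r')"
  unfolding nicew_def by blast

lemma nicew_mono: "nicew R B f \<Longrightarrow> R \<le> R' \<Longrightarrow> B \<subseteq> B' \<Longrightarrow> nicew R' B' f"
  unfolding nicew_def[of R']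
proof (intro allI impI)
  fix y t y' t'
  assume f: "nicew R B f" and RB: "R \<le> R'" "B \<subseteq> B'" and h: "(y, t) \<in> HY" "(y', t') \<in> HY"
    and a: "\<forall>i. \<bar>i\<bar> \<le> int R' \<longrightarrow> y i = y' i" "\<forall>b\<in>B'. (b \<le> t) = (b \<le> t')"
  show "f (y, t) = f (y', t')" by (rule nicewD[OF f h]) (use a RB in auto)
qed

text \<open>By \<open>sets_MY_nicealg\<close> this algebra generates the measurable sets, so every
  finite partition is close to one that the code determines.\<close>

definition nicealg :: "((int \<Rightarrow> 'a) \<times> real) set set" where
  "nicealg = {D \<in> sets MY. \<exists>R B. finite B \<and> nicew R B (\<lambda>q. q \<in> D)}"

lemma nicealg_algebra: "algebra UNIV nicealg"
  unfolding algebra_iff_Un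
proof (intro conjI ballI)
  have e: "nicew 0 {} (\<lambda>q. q \<in> {})" by (simp add: nicew_def)
  show "{} \<in> nicealg" unfolding nicealg_def using e by blast
  fix A assume "A \<in> nicealg"
  then obtain R B where A: "A \<in> sets MY" "finite B" "nicew R B (\<lambda>q. q \<in> A)" by (auto simp: nicealg_def)
  then have "nicew R B (\<lambda>q. q \<in> UNIV - A)" unfolding nicew_def by (metis DiffE DiffI UNIV_I)
  moreover have "UNIV - A \<in> sets MY" using sets.compl_sets[OF A(1)] by simp
  ultimately show "UNIV - A \<in> nicealg" using A(2) unfolding nicealg_def by blast
next
  fix A A' assume "A \<in> nicealg" "A' \<in> nicealg"
  then obtain R B R' B' where A: "A \<in> sets MY" "finite B" "nicew R B (\<lambda>q. q \<in> A)"
    and A': "A' \<in> sets MY" "finite B'" "nicew R' B' (\<lambda>q. q \<in> A')" by (auto simp: nicealg_def)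
  have "nicew (max R R') (B \<union> B') (\<lambda>q. q \<in> A)" by (rule nicew_mono[OF A(3)]) auto
  moreover have "nicew (max R R') (B \<union> B') (\<lambda>q. q \<in> A')" by (rule nicew_mono[OF A'(3)]) auto
  ultimately have "nicew (max R R') (B \<union> B') (\<lambda>q. q \<in> A \<union> A')" unfolding nicew_def by (metis Un_iff)
  moreover have "A \<union> A' \<in> sets MY" using A A' by auto
  ultimately show "A \<union> A' \<in> nicealg" using A(2) A'(2) unfolding nicealg_def by blast
qed auto

lemma measurable_fst_MY: "fst \<in> measurable MY MX"
  unfolding MY_def by simp

lemma snd_MY: "snd \<in> borel_measurable MY"
  unfolding MY_def by simp

lemma sets_MY_nicealg: "sets (MY :: ((int \<Rightarrow> 'a) \<times> real) measure) = sigma_sets UNIV nicealg"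
proof
  show "sigma_sets UNIV nicealg \<subseteq> sets (MY :: ((int \<Rightarrow> 'a) \<times> real) measure)"
    using sets.sigma_sets_subset[of nicealg "MY :: ((int \<Rightarrow> 'a) \<times> real) measure"] by (auto simp: nicealg_def)
  define S where "S = sigma (UNIV :: ((int \<Rightarrow> 'a) \<times> real) set) nicealg"
  have sS: "sets S = sigma_sets UNIV nicealg" "space S = UNIV" by (auto simp: S_def)
  have inS: "D \<in> sets S" if "D \<in> nicealg" for D using that sS by auto
  have c: "(\<lambda>q. fst q i) \<in> measurable S (count_space UNIV)" for i
  proof (rule measurableI)
    fix A :: "'a set"
    have "(\<lambda>q. fst q i) -` A \<inter> space MY \<in> sets (MY :: ((int \<Rightarrow> 'a) \<times> real) measure)"
      by (rule measurable_sets[OF measurable_compose[OF measurable_fst_MY measurable_coord]]) simp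
    moreover have "nicew (nat \<bar>i\<bar>) {} (\<lambda>q. q \<in> (\<lambda>q. fst q i) -` A)" by (simp add: nicew_def)
    ultimately have "(\<lambda>q. fst q i) -` A \<in> nicealg"
      unfolding nicealg_def mem_Collect_eq by (intro conjI exI[of _ "nat \<bar>i\<bar>"] exI[of _ "{}"]) simp_all
    then show "(\<lambda>q. fst q i) -` A \<inter> space S \<in> sets S" using inS sS by simp
  qed simp
  have 1: "fst \<in> measurable S MX"
    unfolding MX_def by (rule measurable_PiM_single') (use c in \<open>auto simp: space_PiM\<close>)
  have 2: "snd \<in> borel_measurable S"
    unfolding borel_measurable_iff_ge
  proof
    fix a :: real
    have "snd -` {a..} \<inter> space MY \<in> sets (MY :: ((int \<Rightarrow> 'a) \<times> real) measure)"
      by (rule measurable_sets[OF snd_MY]) simp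
    moreover have "nicew 0 {a} (\<lambda>q. q \<in> snd -` {a..})" by (simp add: nicew_def)
    ultimately have "snd -` {a..} \<in> nicealg"
      unfolding nicealg_def mem_Collect_eq by (intro conjI exI[of _ 0] exI[of _ "{a}"]) simp_all
    moreover have "{w \<in> space S. a \<le> snd w} = snd -` {a..}" by (auto simp: sS)
    ultimately show "{w \<in> space S. a \<le> snd w} \<in> sets S" using inS by simp
  qed
  have m: "(\<lambda>q. (fst q, snd q)) \<in> measurable S MY"
    unfolding MY_def using 1 2 by (intro measurable_Pair) auto
  have "A \<in> sets S" if "A \<in> sets (MY :: ((int \<Rightarrow> 'a) \<times> real) measure)" for A
    using measurable_sets[OF m that] sS(2) by (simp add: vimage_def)
  then show "sets (MY :: ((int \<Rightarrow> 'a) \<times> real) measure) \<subseteq> sigma_sets UNIV nicealg" using sS by blast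
qed

text \<open>Each piece is approximated by a set of the algebra, and a point is labelled by the first
  of these sets that contains it. Outside the union \<open>E\<close> of the symmetric differences
  this is the true label.\<close>

lemma nice_labels:
  fixes h :: "nat \<Rightarrow> ((int \<Rightarrow> 'a) \<times> real) set"
  assumes n: "finv \<nu>" and h: "\<And>j. j < r \<Longrightarrow> h j \<in> sets MY" "\<And>i j. i < r \<Longrightarrow> j < r \<Longrightarrow> i \<noteq> j \<Longrightarrow> h i \<inter> h j = {}"
    and e: "0 < e"
  obtains d :: "(int \<Rightarrow> 'a) \<times> real \<Rightarrow> nat" and R B E where "finite B" "nicew R B d" "E \<in> sets MY"
    "measure \<nu> E \<le> real r * e" "\<And>q j. q \<notin> E \<Longrightarrow> j < r \<Longrightarrow> q \<in> h j \<Longrightarrow> d q = j"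
proof -
  interpret prob_space \<nu> using finv_prob[OF n] .
  have "\<exists>D\<in>nicealg. measure \<nu> ((h j - D) \<union> (D - h j)) < e" if "j < r" for j
    by (rule algebra_approx[OF nicealg_algebra finite_measure_axioms])
      (use finv_sets[OF n] sets_MY_nicealg finv_space[OF n] h(1)[OF that] e in auto)
  then obtain D where D: "\<And>j. j < r \<Longrightarrow> D j \<in> nicealg" "\<And>j. j < r \<Longrightarrow> measure \<nu> ((h j - D j) \<union> (D j - h j)) < e" by metis
  then have "\<exists>R B. finite B \<and> nicew R B (\<lambda>q. q \<in> D j)" if "j < r" for j using that by (auto simp: nicealg_def)
  then obtain R B where RB: "\<And>j. j < r \<Longrightarrow> finite (B j)" "\<And>j. j < r \<Longrightarrow> nicew (R j) (B j) (\<lambda>q. q \<in> D j)" by metis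
  define R0 where "R0 = (\<Sum>j<r. R j)"
  define B0 where "B0 = (\<Union>j<r. B j)"
  define d where "d q = (LEAST j. j < r \<and> q \<in> D j)" for q
  define E where "E = (\<Union>j<r. (h j - D j) \<union> (D j - h j))"
  have dm: "(h j - D j) \<union> (D j - h j) \<in> sets MY" if "j < r" for j
    using h(1)[OF that] D(1)[OF that] by (auto simp: nicealg_def)
  show ?thesis
  proof (rule that[of B0 R0 d E])
    show "finite B0" using RB(1) by (auto simp: B0_def)
    have nj: "nicew R0 B0 (\<lambda>q. q \<in> D j)" if "j < r" for j
      by (rule nicew_mono[OF RB(2)[OF that]]) (use that in \<open>auto simp: R0_def B0_def intro: member_le_sum\<close>)
    show "nicew R0 B0 d"
      unfolding nicew_def
    proof (intro allI impI)
      fix y t y' t' assume a: "(y, t) \<in> HY" "(y', t') \<in> HY"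
        "\<forall>i. \<bar>i\<bar> \<le> int R0 \<longrightarrow> y i = y' i" "\<forall>b\<in>B0. (b \<le> t) = (b \<le> t')"
      have "((y, t) \<in> D j) = ((y', t') \<in> D j)" if "j < r" for j
        by (rule nicewD[OF nj[OF that] a(1,2)]) (use a in auto)
      then have "(\<lambda>j. j < r \<and> (y, t) \<in> D j) = (\<lambda>j. j < r \<and> (y', t') \<in> D j)" by blast
      then show "d (y, t) = d (y', t')" by (simp only: d_def)
    qed
    show "E \<in> sets MY" using dm by (auto simp: E_def)
    have "measure \<nu> E \<le> (\<Sum>j<r. measure \<nu> ((h j - D j) \<union> (D j - h j)))"
      unfolding E_def by (rule finite_measure_subadditive_finite) (use dm finv_sets[OF n] in auto)
    also have "\<dots> \<le> (\<Sum>j<r. e)" by (intro sum_mono less_imp_le D) simp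
    finally show "measure \<nu> E \<le> real r * e" by simp
    fix q j assume q: "q \<notin> E" "j < r" "q \<in> h j"
    have "q \<in> D i \<longleftrightarrow> i = j" if "i < r" for i
      using q that h(2)[of i j] by (auto simp: E_def)
    then show "d q = j" unfolding d_def using q(2) by (intro Least_equality) auto
  qed
qed

text \<open>The heights at which one of the first n points of the orbit changes its letter or passes a threshold in B.\<close>
definition bps :: "nat \<Rightarrow> real set \<Rightarrow> (int \<Rightarrow> 'a) \<Rightarrow> int \<Rightarrow> real set" where
  "bps n B y J = (\<lambda>(b, i, m). b - real i + rf y m) ` (insert 0 B \<times> {..<n} \<times> {0..J})"

text \<open>Equal letters give equal roof sums, hence the same break points; equal ranks then give
  equal comparisons. The break points with \<open>b = 0\<close> decide which letter lies below each
  unit step, those with \<open>b \<in> B\<close> how the height there compares with the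
  thresholds.\<close>

lemma same_times:
  assumes q: "(y, r) \<in> HY" "(y', r') \<in> HY" and B: "finite B"
    and J: "idx y (r + real n) = J" "idx y' (r' + real n) = J"
    and letters: "\<And>m. - int R \<le> m \<Longrightarrow> m \<le> J + int R \<Longrightarrow> y m = y' m"
    and rank: "card {\<beta> \<in> bps n B y J. \<beta> \<le> r} = card {\<beta> \<in> bps n B y' J. \<beta> \<le> r'}"
    and f: "nicew R B f" and i: "i < n"
  shows "f (flow L (real i) (y, r)) = f (flow L (real i) (y', r'))"
proof -
  have r: "0 \<le> r" "r < L (y 0)" "0 \<le> r'" "r' < L (y' 0)" using q by (auto simp: hull_iff)
  have rfe: "rf y m = rf y' m" if "0 \<le> m" "m \<le> J + 1" for m
  proof -
    have "win y 0 (nat m) = win y' 0 (nat m)" unfolding win_eq_iff using letters that by auto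
    then show ?thesis using rf_win[of y "nat m"] rf_win[of y' "nat m"] that by simp
  qed
  have bp: "bps n B y J = bps n B y' J" unfolding bps_def using rfe by (intro image_cong) auto
  have fin: "finite (bps n B y J)" using B by (simp add: bps_def)
  have th: "\<beta> \<le> r \<longleftrightarrow> \<beta> \<le> r'" if "\<beta> \<in> bps n B y J" for \<beta>
    by (rule card_le_threshold[OF fin _ that]) (use rank in \<open>simp only: bp\<close>)
  define m where "m = idx y (r + real i)"
  have m: "rf y m \<le> r + real i" "r + real i < rf y (m + 1)"
    using idx[where x = y and t = "r + real i"] by (auto simp: m_def)
  have Jb: "rf y J \<le> r + real n" "r + real n < rf y (J + 1)" "rf y' J \<le> r' + real n" "r' + real n < rf y' (J + 1)"
    using idx[where x = y and t = "r + real n"] idx[where x = y' and t = "r' + real n"] J by auto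
  have "rf y 0 < rf y (m + 1)" "rf y m < rf y (J + 1)" using m Jb r i by auto
  then have m0: "0 \<le> m" "m \<le> J" unfolding rf_less_iff by auto
  have b: "b \<le> r + real i - rf y m \<longleftrightarrow> b \<le> r' + real i - rf y' m" if "b \<in> insert 0 B" for b
  proof -
    have "b - real i + rf y m \<in> bps n B y J"
      unfolding bps_def using that i m0 by (intro image_eqI[of _ _ "(b, i, m)"]) auto
    from th[OF this] rfe[of m] m0 show ?thesis by auto
  qed
  have "rf y' m \<le> r' + real i" using b[of 0] m by simp
  moreover have "r' + real i < rf y' (m + 1)"
  \<comment> \<open>The start of letter \<open>m + 1\<close> is a break point only for
    \<open>m < J\<close>; for \<open>m = J\<close> the bound comes from the position at time
    \<open>n\<close>.\<close>
  proof (cases "m = J")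
    case True
    then show ?thesis using Jb i by simp
  next
    case False
    then have "0 - real i + rf y (m + 1) \<in> bps n B y J"
      unfolding bps_def using i m0 by (intro image_eqI[of _ _ "(0, i, m + 1)"]) auto
    from th[OF this] rfe[of "m + 1"] m m0 show ?thesis by auto
  qed
  ultimately have "idx y' (r' + real i) = m" by (rule idx_eqI)
  then have fl: "flow L (real i) (y, r) = (shiftn m y, r + real i - rf y m)"
    "flow L (real i) (y', r') = (shiftn m y', r' + real i - rf y' m)" by (simp_all add: flow_idx m_def)
  show ?thesis unfolding fl
  proof (rule nicewD[OF f])
    show "(shiftn m y, r + real i - rf y m) \<in> HY" "(shiftn m y', r' + real i - rf y' m) \<in> HY"
      using flow_hull[OF q(1), of "real i"] flow_hull[OF q(2), of "real i"] fl by auto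
    show "shiftn m y j = shiftn m y' j" if "\<bar>j\<bar> \<le> int R" for j
      using letters[of "j + m"] that m0 by (simp add: shiftn_apply)
  qed (use b in auto)
qed

text \<open>The number of letters crossed is linear in the time, which keeps every number in the
  header of the code polynomial.\<close>

lemma J_bound:
  assumes q: "(y, r) \<in> HY" and n: "1 \<le> n"
  shows "0 \<le> idx y (r + real n)"
    "idx y (r + real n) \<le> int (nat \<lceil>(1 + Lmax) / Lmin\<rceil> * n)"
proof -
  define J where "J = idx y (r + real n)"
  define e where "e = Lmin"
  define M where "M = Lmax"
  have e0: "0 < e" using Lmin_pos by (simp add: e_def)
  have r: "0 \<le> r" "r < L (y 0)" using q by (auto simp: hull_iff)
  have LM: "L (y 0) \<le> M" using Lmax_ge by (simp add: M_def)
  have J: "rf y J \<le> r + real n" "r + real n < rf y (J + 1)"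
    using idx[where x = y and t = "r + real n"] by (auto simp: J_def)
  then have "rf y 0 < rf y (J + 1)" using r by simp
  then have J0: "0 \<le> J" unfolding rf_less_iff by simp
  have "rf y 0 + e * of_int (J - 0) \<le> rf y J" unfolding e_def by (rule rf_lower[OF J0])
  then have "e * of_int J \<le> M + real n" using J(1) r LM by simp
  also have "\<dots> \<le> (1 + M) * real n"
  proof -
    have "M * 1 \<le> M * real n" using n r LM by (intro mult_left_mono) auto
    then show ?thesis by (simp add: algebra_simps)
  qed
  finally have "of_int J \<le> (1 + M) / e * real n" using e0 by (simp add: field_simps)
  also have "\<dots> \<le> real (nat \<lceil>(1 + M) / e\<rceil>) * real n" by (intro mult_right_mono real_nat_ceiling_ge) simp
  finally have "real_of_int J \<le> real_of_int (int (nat \<lceil>(1 + M) / e\<rceil> * n))"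
    by (metis of_int_of_nat_eq of_nat_mult)
  then show "J \<le> int (nat \<lceil>(1 + M) / e\<rceil> * n)" unfolding of_int_le_iff .
  show "0 \<le> J" by (rule J0)
qed

context
  fixes \<mu> :: "(int \<Rightarrow> 'a) measure" and N :: nat and p :: "'a \<times> 'a list \<Rightarrow> real"
  assumes s: "siv \<mu>" and p_pos: "\<And>c. c \<in> cells N \<Longrightarrow> 0 < p c"
    and p_sum: "\<And>a. (\<Sum>w\<in>pw N a. p (a, w)) \<le> 1"
begin

lemmas up = s p_pos p_sum

text \<open>The partition is approximated by nice labels d.  A point is coded by the cells along its orbit, by data
  of polynomial size that then determine the nice labels, and by its true labels; kap gives the nice label
  almost all the weight, so that the true labels cost little.\<close>
theorem ks_upper: "ks_entropy (lifted \<mu>) (flow L 1) \<le> ereal (Vp \<mu> N p)"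
proof (rule ks_entropy_le)
  let ?\<nu> = "lifted \<mu>" and ?H = "HY"
  fix P \<eta> assume P: "fin_partition ?\<nu> P" and \<eta>: "0 < (\<eta> :: real)"
  have fi: "finv ?\<nu>" by (rule lift_flow_inv[OF s])
  interpret prob_space ?\<nu> using prob_lift[OF s] by blast
  have P': "finite P" "P \<subseteq> sets MY" "disjoint P" "\<Union>P = UNIV"
    using P by (auto simp: fin_partition_def sets_lift[OF s] space_lift[OF s])
  define r where "r = card P"
  have r: "0 < r" using P' by (auto simp: r_def card_gt_0_iff)
  obtain h where h: "bij_betw h {0..<r} P" using ex_bij_betw_nat_finite[OF P'(1)] r_def by blast
  have hP: "h j \<in> P" if "j < r" for j using h that by (auto simp: bij_betw_def)
  have hdisj: "h i \<inter> h j = {}" if "i < r" "j < r" "i \<noteq> j" for i j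
    using P'(3) hP that h unfolding disjoint_def bij_betw_def inj_on_def by (metis atLeastLessThan_iff le0)
  define cc where "cc q = (THE j. j < r \<and> q \<in> h j)" for q
  have cc: "cc q = j" if "j < r" "q \<in> h j" for q j
    unfolding cc_def by (rule the_equality) (use that hdisj in blast)+
  have cc': "cc q < r" "q \<in> h (cc q)" for q
  proof -
    obtain A where "A \<in> P" "q \<in> A" using P'(4) by blast
    moreover from this obtain j where "j < r" "A = h j" using h by (auto simp: bij_betw_def)
    ultimately show "cc q < r" "q \<in> h (cc q)" using cc by auto
  qed
  \<comment> \<open>A label that agrees with the nice label costs
    \<open>- ln (1 - \<delta>) = \<eta> / 3\<close> per unit step, and any other label costs
    \<kappa>. The approximation error \<open>e\<close> is then chosen so that wrong labels add at
    most another \<open>\<eta> / 3\<close> per step on average.\<close>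
  define \<delta> where "\<delta> = 1 - exp (- \<eta> / 3)"
  have \<delta>: "0 < \<delta>" "\<delta> < 1" "- ln (1 - \<delta>) = \<eta> / 3" using \<eta> by (auto simp: \<delta>_def)
  define \<kappa> where "\<kappa> = - ln (\<delta> / real r)"
  have \<delta>r: "0 < \<delta> / real r" "\<delta> / real r \<le> 1" using \<delta> r by (auto simp: field_simps)
  have \<kappa>0: "0 \<le> \<kappa>" using \<delta>r by (simp add: \<kappa>_def)
  define e where "e = \<eta> / (3 * real r * (\<kappa> + 1))"
  have e0: "0 < e" using \<eta> r \<kappa>0 by (simp add: e_def)
  obtain d R B E where nl: "finite B" "nicew R B d" "E \<in> sets MY" "measure ?\<nu> E \<le> real r * e"
    "\<And>q j. q \<notin> E \<Longrightarrow> j < r \<Longrightarrow> q \<in> h j \<Longrightarrow> d q = j"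
    by (rule nice_labels[OF fi, of r h e]) (use hP P'(2) hdisj e0 in auto)
  define jj where "jj = nat \<lceil>(1 + Lmax) / Lmin\<rceil>"
  \<comment> \<open>\<open>Dn * n * n\<close> dominates the number of break points (thresholds with
    0, times unit steps, times letters) and the other numbers in the header.\<close>
  define Dn where "Dn = (card (insert 0 B) + 1) * (jj + maxlen N + 2 * R + 2)"
  define C0 where "C0 = Lmax * dmax N p * real (2 * R + 2 + 2 * maxlen N)"
  have main: "part_entropy ?\<nu> (refine ?\<nu> (flow L 1) P n) \<le> (Vp \<mu> N p + \<eta>) * real n + (C0 + 4 * ln (real (Dn + 1))) + 8 * ln (real n)"
    if n: "1 \<le> n" for n
  proof -
    define M where "M = Dn * n * n"
    define J where "J q = idx (fst q) (snd q + real n)" for q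
    define rk where "rk q = card {\<beta> \<in> bps n B (fst q) (J q). \<beta> \<le> snd q}" for q
    \<comment> \<open>The header: index of the last letter, offset of the first cell, number of
      cells, rank of the height among the break points. Each entry is at most \<open>M\<close>, so a
      uniform weight costs \<open>4 * ln (M + 1)\<close>.\<close>
    define hd where "hd q = (nat (J q), nat (ck N (shiftn (- int R) (fst q))), ncell N R (J q) (fst q), rk q)" for q
    define l where "l q = wcells N R (J q) (fst q)" for q
    define cs where "cs q = map (\<lambda>i. cc (flow L (real i) q)) [0..<n]" for q
    define \<phi> where "\<phi> q = (hd q, l q, cs q)" for q
    \<comment> \<open>The nice labels as a function of the header and the cells: any point with the
      same header and cells may be chosen, because \<open>same_times\<close> gives all of them the
      same labels.\<close>
    define lab where "lab x y i = d (flow L (real i) (SOME q. q \<in> ?H \<and> hd q = x \<and> l q = y))" for x y i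
    define kap where "kap a c = (if c = a then 1 - \<delta> else \<delta> / real r)" for a c :: nat
    let ?PY = "\<lambda>y. (\<Prod>j<length y. p (y ! j) / real CARD('a))" and ?KP = "\<lambda>q. (\<Prod>i<n. kap (d (flow L (real i) q)) (cc (flow L (real i) q)))"
    let ?ZE = "\<lambda>q. (\<Sum>i<n. \<eta> / 3 + \<kappa> * indicator E (flow L (real i) q))"
    define Q where "Q = (\<lambda>(x, y, z). 1 / real ((M + 1) ^ 4) * ?PY y * (\<Prod>i<n. kap (lab x y i) (z ! i)))"
    define Hd where "Hd = {..M} \<times> {..M} \<times> {..M} \<times> {..M}"
    \<comment> \<open>The header fixes the length of the list of cells; for each single length the
      product weights have total at most 1.\<close>
    define \<Omega> where "\<Omega> = (SIGMA x:Hd. SIGMA y:{y. set y \<subseteq> cells N \<and> length y = fst (snd (snd x))}. {z. set z \<subseteq> {..<r} \<and> length z = n})"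
    define g where "g q = 4 * ln (real (M + 1)) + (enn2real (Iint N p (real n) q) + C0) + ?ZE q" for q
    have J0: "0 \<le> J q" "J q \<le> int (jj * n)" if "q \<in> ?H" for q
      using J_bound[of "fst q" "snd q" n] that n unfolding J_def jj_def by auto
    have lab: "lab (hd q) (l q) i = d (flow L (real i) q)" if q: "q \<in> ?H" and i: "i < n" for q i
    proof -
      define q' where "q' = (SOME q'. q' \<in> ?H \<and> hd q' = hd q \<and> l q' = l q)"
      have q': "q' \<in> ?H" "hd q' = hd q" "l q' = l q"
        using someI[of "\<lambda>q'. q' \<in> ?H \<and> hd q' = hd q \<and> l q' = l q" q] q unfolding q'_def by auto
      have X: "fst q \<in> X" "fst q' \<in> X" using q q'(1) by (cases q; cases q'; simp add: hull_iff)+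
      have kk: "0 \<le> ck N y" if "y \<in> X" for y using level_data_c[OF that, of N] by (simp add: level_data_def)
      have kx: "0 \<le> ck N (shiftn (- int R) (fst q))" "0 \<le> ck N (shiftn (- int R) (fst q'))" using kk X by auto
      have eq: "J q' = J q" "ck N (shiftn (- int R) (fst q')) = ck N (shiftn (- int R) (fst q))" "rk q' = rk q"
        using q'(2) J0[OF q] J0[OF q'(1)] kx by (auto simp: hd_def)
      have "d (flow L (real i) (fst q', snd q')) = d (flow L (real i) (fst q, snd q))"
      proof (rule same_times[where n = n and B = B and J = "J q" and R = R])
        show "idx (fst q') (snd q' + real n) = J q" using eq(1) by (simp add: J_def)
        show "card {\<beta> \<in> bps n B (fst q') (J q). \<beta> \<le> snd q'} = card {\<beta> \<in> bps n B (fst q) (J q). \<beta> \<le> snd q}"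
          using eq(1,3) by (simp add: rk_def)
        fix m assume m: "- int R \<le> m" "m \<le> J q + int R"
        show "fst q' m = fst q m"
          using wcells_letters[OF up X(1) J0(1)[OF q] m] wcells_letters[OF up X(2) J0(1)[OF q] m] eq q'(3)
          by (simp add: l_def)
      qed (use q q' nl i in \<open>auto simp: J_def\<close>)
      then show ?thesis unfolding lab_def q'_def[symmetric] by simp
    qed
    have \<phi>\<Omega>: "\<phi> q \<in> \<Omega>" if q: "q \<in> ?H" for q
    proof -
      have X: "fst q \<in> X" using q by (cases q; simp add: hull_iff)
      have d: "ldata N (shiftn (- int R) (fst q)) (cx N (shiftn (- int R) (fst q))) (ck N (shiftn (- int R) (fst q))) (cv N (shiftn (- int R) (fst q)))"
        using X by (intro level_data_c) simp
      have k: "ck N (shiftn (- int R) (fst q)) \<le> int (maxlen N)" "0 \<le> ck N (shiftn (- int R) (fst q))"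
        using level_data_finite(2)[OF d] by auto
      have nc: "int (ncell N R (J q) (fst q)) \<le> int (maxlen N) + (int (jj * n) + 2 * int R + 1)"
        using ncell(2)[OF up X J0(1)[OF q], of R] k J0(2)[OF q] by linarith
      define K0 where "K0 = jj + maxlen N + 2 * R + 2"
      have a: "jj * n + maxlen N + 2 * R + 1 \<le> K0 * n"
        using n by (cases n) (simp_all add: algebra_simps K0_def)
      have Md: "M = (card (insert 0 B) + 1) * (n * (K0 * n))"
        unfolding M_def Dn_def K0_def[symmetric] by (simp only: mult_ac)
      have "1 * (1 * (K0 * n)) \<le> (card (insert 0 B) + 1) * (n * (K0 * n))"
        using n by (intro mult_le_mono) auto
      then have b: "K0 * n \<le> M" unfolding Md by simp
      have J1: "nat (J q + 1) \<le> K0 * n" using J0[OF q] a by linarith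
      have "rk q \<le> card (bps n B (fst q) (J q))"
        unfolding rk_def by (rule card_mono) (use nl(1) in \<open>auto simp: bps_def\<close>)
      also have "\<dots> \<le> card (insert 0 B \<times> {..<n} \<times> {0..J q})"
        unfolding bps_def by (rule card_image_le) (use nl(1) in auto)
      also have "\<dots> = card (insert 0 B) * (n * nat (J q + 1))" by (simp add: card_cartesian_product)
      also have "\<dots> \<le> M" unfolding Md using J1 by (intro mult_le_mono) auto
      finally have "rk q \<le> M" .
      moreover have "nat (J q) \<le> M" using J0[OF q] a b by linarith
      moreover have "nat (ck N (shiftn (- int R) (fst q))) \<le> M" using k a b by linarith
      moreover have "ncell N R (J q) (fst q) \<le> M" using nc a b by linarith
      moreover have "set (l q) \<subseteq> cells N" unfolding l_def by (rule wcells_cells[OF up X])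
      moreover have "length (l q) = ncell N R (J q) (fst q)" by (simp add: l_def wcells_def[OF up])
      moreover have "set (cs q) \<subseteq> {..<r}" "length (cs q) = n" using cc'(1)[of "flow L _ q"] by (auto simp: cs_def)
      ultimately show ?thesis by (simp add: \<phi>_def \<Omega>_def Hd_def hd_def)
    qed
    have kap0: "0 < kap a c" for a c using \<delta> \<delta>r by (simp add: kap_def)
    have Qpos: "0 < Q w" if "w \<in> \<Omega>" for w
    proof -
      obtain x y z where w: "w = (x, y, z)" by (cases w) auto
      have "0 < p (y ! j) / real CARD('a)" if "j < length y" for j
      proof -
        have "y ! j \<in> cells N" using \<open>w \<in> \<Omega>\<close> nth_mem[OF that] by (auto simp: w \<Omega>_def)
        then show ?thesis using p_pos by (intro divide_pos_pos) simp_all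
      qed
      then have "0 < ?PY y" by (intro prod_pos) auto
      moreover have "0 < (\<Prod>i<n. kap (lab x y i) (z ! i))" using kap0 by (intro prod_pos) auto
      moreover have "0 < 1 / real ((M + 1) ^ 4)" by (simp del: of_nat_power)
      ultimately show ?thesis unfolding w Q_def prod.case by (intro mult_pos_pos)
    qed
    have fin\<Omega>: "finite \<Omega>" unfolding \<Omega>_def Hd_def
      by (intro finite_SigmaI finite_lists_length_eq) auto
    have Qsum: "(\<Sum>w\<in>\<Omega>. Q w) \<le> 1"
    proof -
      let ?Y = "\<lambda>x. {y. set y \<subseteq> cells N \<and> length y = fst (snd (snd x))}" and ?Z = "{z. set z \<subseteq> {..<r} \<and> length z = n}"
      have fY: "finite (?Y x)" for x :: "nat \<times> nat \<times> nat \<times> nat" by (rule finite_lists_length_eq) simp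
      have fZ: "finite ?Z" by (rule finite_lists_length_eq) simp
      have Z1: "(\<Sum>z\<in>?Z. \<Prod>i<n. kap (lab x y i) (z ! i)) \<le> 1" for x y
      proof (rule prod_lists_sum_le)
        fix i
        have "(\<Sum>c<r. kap (lab x y i) c) \<le> (\<Sum>c<r. (if c = lab x y i then 1 - \<delta> else 0) + \<delta> / real r)"
          using \<delta> \<delta>r by (intro sum_mono) (auto simp: kap_def)
        also have "\<dots> \<le> (1 - \<delta>) + \<delta>" using \<delta> r by (simp add: sum.distrib)
        finally show "(\<Sum>c\<in>{..<r}. kap (lab x y i) c) \<le> 1" by simp
      qed (use kap0 in \<open>auto simp: less_imp_le\<close>)
      have Y1: "(\<Sum>y\<in>?Y x. \<Prod>j<length y. p (y ! j) / real CARD('a)) \<le> 1" for x :: "nat \<times> nat \<times> nat \<times> nat"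
      proof -
        have "(\<Sum>c\<in>cells N. p c / real CARD('a)) = (\<Sum>a\<in>UNIV. (\<Sum>w\<in>pw N a. p (a, w)) / real CARD('a))"
          by (simp add: sum_cells sum_divide_distrib)
        also have "\<dots> \<le> (\<Sum>a\<in>(UNIV :: 'a set). 1 / real CARD('a))"
          by (intro sum_mono divide_right_mono p_sum) simp
        finally have "(\<Sum>c\<in>cells N. p c / real CARD('a)) \<le> 1" by simp
        then have "(\<Sum>y\<in>?Y x. \<Prod>j<fst (snd (snd x)). p (y ! j) / real CARD('a)) \<le> 1"
          by (intro prod_lists_sum_le) (use p_pos in \<open>auto simp: less_imp_le\<close>)
        moreover have "(\<Sum>y\<in>?Y x. \<Prod>j<length y. p (y ! j) / real CARD('a)) = (\<Sum>y\<in>?Y x. \<Prod>j<fst (snd (snd x)). p (y ! j) / real CARD('a))"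
          by (rule sum.cong) auto
        ultimately show ?thesis by simp
      qed
      have "(\<Sum>w\<in>\<Omega>. Q w) = (\<Sum>x\<in>Hd. \<Sum>(y, z)\<in>(SIGMA y:?Y x. ?Z). Q (x, y, z))"
        using sum.Sigma[of Hd "\<lambda>x. SIGMA y:?Y x. ?Z" "\<lambda>x w. Q (x, w)"] fY fZ
        by (simp add: \<Omega>_def Hd_def split_beta' finite_SigmaI)
      also have "\<dots> = (\<Sum>x\<in>Hd. \<Sum>y\<in>?Y x. \<Sum>z\<in>?Z. Q (x, y, z))"
        by (intro sum.cong refl, subst sum.Sigma) (use fY fZ in auto)
      also have "\<dots> = (\<Sum>x\<in>Hd. 1 / real ((M + 1) ^ 4) * (\<Sum>y\<in>?Y x. ?PY y * (\<Sum>z\<in>?Z. \<Prod>i<n. kap (lab x y i) (z ! i))))"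
        by (simp add: Q_def sum_distrib_left mult.assoc)
      also have "\<dots> \<le> (\<Sum>x\<in>Hd. 1 / real ((M + 1) ^ 4) * 1)"
      proof (intro sum_mono mult_left_mono)
        fix x assume "x \<in> Hd"
        have "(\<Sum>y\<in>?Y x. ?PY y * (\<Sum>z\<in>?Z. \<Prod>i<n. kap (lab x y i) (z ! i)))
          \<le> (\<Sum>y\<in>?Y x. ?PY y * 1)"
        proof (intro sum_mono mult_left_mono Z1 prod_nonneg)
          fix y j assume "y \<in> ?Y x" "j \<in> {..<length y}"
          then show "0 \<le> p (y ! j) / real CARD('a)"
            by (intro divide_nonneg_pos less_imp_le[OF p_pos]) (auto dest: nth_mem)
        qed
        then show "(\<Sum>y\<in>?Y x. ?PY y * (\<Sum>z\<in>?Z. \<Prod>i<n. kap (lab x y i) (z ! i))) \<le> 1"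
          using Y1[of x] by simp
      qed simp
      also have "\<dots> = 1"
      proof -
        have "card Hd = (M + 1) ^ 4" by (simp add: Hd_def card_cartesian_product power4_eq_xxxx)
        then show ?thesis by (simp del: power_Suc of_nat_power)
      qed
      finally show ?thesis .
    qed
    have sub: "\<phi> ` ?H \<subseteq> \<Omega>" using \<phi>\<Omega> by blast
    have gint: "integrable ?\<nu> g" "(\<integral>q. g q \<partial>?\<nu>) \<le> 4 * ln (real (M + 1)) + C0 + real n * (Vp \<mu> N p + \<eta>)"
    proof -
      have fl: "flow L t \<in> measurable ?\<nu> ?\<nu>" for t
        using finv_measurable[OF fi flow_measurable] measurable_cong_sets[OF refl sets_lift[OF s]] by blast
      have vE: "flow L t -` E \<in> sets ?\<nu>" for t
        using measurable_sets[OF flow_measurable nl(3)] by (simp add: sets_lift[OF s])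
      have iE: "indicator E (flow L t q) = (indicator (flow L t -` E) q :: real)" for t q by (simp add: indicator_def)
      have i1: "integrable ?\<nu> (\<lambda>q. indicator E (flow L t q) :: real)" for t
        unfolding iE using vE by (intro integrable_real_indicator) (auto simp: less_top[symmetric])
      have v1: "(\<integral>q. indicator E (flow L t q) \<partial>?\<nu>) = measure ?\<nu> E" for t
      proof -
        have "emeasure ?\<nu> (flow L t -` E) = emeasure ?\<nu> E"
          using fi nl(3) by (simp add: flow_inv_measure_def space_lift[OF s])
        then show ?thesis unfolding iE using vE by (simp add: space_lift[OF s] measure_def)
      qed
      have n0: "0 \<le> real n" by simp
      note I = Iint_integral[OF up n0]
      have i2: "integrable ?\<nu> (\<lambda>q. \<eta> / 3 + \<kappa> * indicator E (flow L (real i) q))" for i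
        by (intro Bochner_Integration.integrable_add integrable_mult_right i1) simp
      show "integrable ?\<nu> g" unfolding g_def
        by (intro Bochner_Integration.integrable_add Bochner_Integration.integrable_sum I i2 integrable_const)
      have "(\<integral>q. g q \<partial>?\<nu>) = 4 * ln (real (M + 1)) + (real n * Vp \<mu> N p + C0) + (\<Sum>i<n. \<eta> / 3 + \<kappa> * measure ?\<nu> E)"
      proof -
        have 1: "(\<integral>q. \<eta> / 3 + \<kappa> * indicator E (flow L (real i) q) \<partial>?\<nu>) = \<eta> / 3 + \<kappa> * measure ?\<nu> E" for i
          by (subst Bochner_Integration.integral_add) (use i1 v1 prob_space in \<open>auto intro!: integrable_mult_right\<close>)
        have 2: "(\<integral>q. ?ZE q \<partial>?\<nu>) = (\<Sum>i<n. \<eta> / 3 + \<kappa> * measure ?\<nu> E)"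
          by (subst Bochner_Integration.integral_sum) (use i2 1 in auto)
        have 3: "(\<integral>q. enn2real (Iint N p (real n) q) + C0 \<partial>?\<nu>) = real n * Vp \<mu> N p + C0"
          by (subst Bochner_Integration.integral_add) (use I prob_space in auto)
        have i3: "integrable ?\<nu> (\<lambda>q. enn2real (Iint N p (real n) q) + C0)"
          by (intro Bochner_Integration.integrable_add I integrable_const)
        have i4: "integrable ?\<nu> (\<lambda>q. \<Sum>i<n. \<eta> / 3 + \<kappa> * indicator E (flow L (real i) q))"
          by (intro Bochner_Integration.integrable_sum i2)
        have c: "integrable ?\<nu> (\<lambda>q. 4 * ln (real (M + 1)))" by simp
        show ?thesis unfolding g_def
          Bochner_Integration.integral_add[OF Bochner_Integration.integrable_add[OF c i3] i4]
          Bochner_Integration.integral_add[OF c i3] 2 3 using prob_space by simp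
      qed
      moreover have "\<kappa> * measure ?\<nu> E \<le> \<eta> / 3"
      proof -
        have "\<kappa> * measure ?\<nu> E \<le> (\<kappa> + 1) * (real r * e)" using nl(4) \<kappa>0 by (intro mult_mono) auto
        also have "\<dots> = \<eta> / 3"
        proof -
          have "\<kappa> + 1 \<noteq> 0" "real r \<noteq> 0" using r \<kappa>0 by auto
          moreover have "c * (x * (\<eta> / (3 * x * c))) = \<eta> / 3" if "c \<noteq> 0" "x \<noteq> 0" for c x :: real using that by simp
          ultimately show ?thesis unfolding e_def by blast
        qed
        finally show ?thesis .
      qed
      then have "(\<Sum>i<n. \<eta> / 3 + \<kappa> * measure ?\<nu> E) \<le> (\<Sum>i<n. \<eta>)" using \<eta> by (intro sum_mono) auto
      ultimately show "(\<integral>q. g q \<partial>?\<nu>) \<le> 4 * ln (real (M + 1)) + C0 + real n * (Vp \<mu> N p + \<eta>)"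
        by (simp add: algebra_simps)
    qed
    have "part_entropy ?\<nu> (refine ?\<nu> (flow L 1) P n) \<le> (\<integral>q. g q \<partial>?\<nu>)"
    proof (rule part_entropy_le[where H = ?H and \<phi> = \<phi> and Q = Q])
      show "prob_space ?\<nu>" by (rule prob_space_axioms)
      show "fin_partition ?\<nu> (refine ?\<nu> (flow L 1) P n)"
        by (rule refine_partition[OF P])
          (use finv_measurable[OF fi flow_measurable] measurable_cong_sets[OF refl sets_lift[OF s]] in blast)
      show "AE q in ?\<nu>. q \<in> ?H" by (rule finv_AE[OF fi])
      show "?H \<subseteq> space ?\<nu>" by (simp add: space_lift[OF s])
      show "finite (\<phi> ` ?H)" using fin\<Omega> sub by (rule finite_subset[rotated])
      show "0 < Q w" if "w \<in> \<phi> ` ?H" for w using Qpos that sub by blast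
      show "(\<Sum>w\<in>\<phi> ` ?H. Q w) \<le> 1"
        using sum_mono2[OF fin\<Omega> sub, of Q] Qpos Qsum by (force simp: less_imp_le)
      show "integrable ?\<nu> g" by (rule gint)
      fix q q' A assume q: "q \<in> ?H" "q' \<in> ?H" "\<phi> q = \<phi> q'" "A \<in> refine ?\<nu> (flow L 1) P n" "q \<in> A"
      show "q' \<in> A"
      proof (rule refine_same_cell[OF q(4,5)])
        show "q' \<in> space ?\<nu>" by (simp add: space_lift[OF s])
        fix i C assume i: "i < n" and C: "C \<in> P" "(flow L 1 ^^ i) q \<in> C"
        obtain j where j: "j < r" "C = h j" using C(1) h by (auto simp: bij_betw_def)
        have "cs q ! i = cs q' ! i" using q(3) by (simp add: \<phi>_def)
        then have "cc (flow L (real i) q) = cc (flow L (real i) q')" using i by (simp add: cs_def)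
        moreover have "cc (flow L (real i) q) = j" using cc[OF j(1)] C(2) j(2) flow_funpow[OF q(1)] by simp
        ultimately show "(flow L 1 ^^ i) q' \<in> C"
          using cc'(2)[of "flow L (real i) q'"] j(2) flow_funpow[OF q(2)] by simp
      qed
    next
      fix q assume q: "q \<in> ?H"
      have X: "fst q \<in> X" using q by (cases q; simp add: hull_iff)
      have ll: "set (l q) \<subseteq> cells N" unfolding l_def by (rule wcells_cells[OF up X])
      have pp: "0 < p (l q ! j) / real CARD('a)" if "j < length (l q)" for j
        by (intro divide_pos_pos p_pos subsetD[OF ll] nth_mem that) simp
      have Qq: "Q (\<phi> q) = 1 / real ((M + 1) ^ 4) * ?PY (l q) * ?KP q"
        unfolding \<phi>_def Q_def prod.case by (intro arg_cong2[where f = "(*)"] refl prod.cong) (simp_all add: lab[OF q] cs_def)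
      have A: "0 < ?PY (l q)" using pp by (intro prod_pos) auto
      have A': "0 < ?KP q" using kap0 by (intro prod_pos) auto
      have l1: "- ln (?PY (l q)) = (\<Sum>c\<leftarrow>l q. gc p c)"
      proof -
        have "ln (?PY (l q)) = (\<Sum>j<length (l q). ln (p (l q ! j) / real CARD('a)))"
          by (rule ln_prod) (use pp in force)+
        also have "\<dots> = (\<Sum>j<length (l q). - gc p (l q ! j))"
        proof (intro sum.cong refl)
          fix j assume "j \<in> {..<length (l q)}"
          then have "0 < p (l q ! j)" by (intro p_pos subsetD[OF ll] nth_mem) simp
          then show "ln (p (l q ! j) / real CARD('a)) = - gc p (l q ! j)" by (simp add: ln_div gc_def[OF up])
        qed
        finally show ?thesis by (simp add: sum_negf sum_list_sum_nth atLeast0LessThan)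
      qed
      have l2: "- ln (?KP q) \<le> ?ZE q"
      proof -
        have "- ln (?KP q) = (\<Sum>i<n. - ln (kap (d (flow L (real i) q)) (cc (flow L (real i) q))))"
          by (subst ln_prod) (use kap0 in \<open>auto simp: sum_negf less_imp_neq[OF kap0, symmetric]\<close>)
        also have "\<dots> \<le> ?ZE q"
        proof (rule sum_mono)
          fix i
          let ?z = "flow L (real i) q"
          show "- ln (kap (d ?z) (cc ?z)) \<le> \<eta> / 3 + \<kappa> * indicator E ?z"
          proof (cases "?z \<in> E")
            case True
            then show ?thesis using \<delta>(3) \<kappa>0 \<eta> by (simp add: kap_def \<kappa>_def)
          next
            case False
            then have "d ?z = cc ?z" using nl(5)[OF False cc'] by simp
            then show ?thesis using \<delta>(3) False by (simp add: kap_def)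
          qed
        qed
        finally show ?thesis .
      qed
      have l3: "(\<Sum>c\<leftarrow>l q. gc p c) \<le> enn2real (Iint N p (real n) q) + C0"
        using wcells_cost[OF up, of "fst q" "snd q" "real n" R] q by (simp add: l_def J_def C0_def)
      have M1: "0 < 1 / real ((M + 1) ^ 4)" by (simp del: of_nat_power)
      have "- ln (Q (\<phi> q)) = - ln (1 / real ((M + 1) ^ 4)) - ln (?PY (l q))
         - ln (?KP q)"
        unfolding Qq ln_mult_pos[OF mult_pos_pos[OF M1 A] A'] ln_mult_pos[OF M1 A] by simp
      also have "- ln (1 / real ((M + 1) ^ 4)) = 4 * ln (real (M + 1))"
        by (simp add: ln_div ln_realpow del: of_nat_Suc of_nat_add)
      finally show "- ln (Q (\<phi> q)) \<le> g q" using l1 l2 l3 by (simp add: g_def)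
    qed
    also have "\<dots> \<le> 4 * ln (real (M + 1)) + C0 + real n * (Vp \<mu> N p + \<eta>)" by (rule gint)
    \<comment> \<open>\<open>M\<close> is quadratic in \<open>n\<close>, so the header costs
      \<open>8 * ln n\<close> up to a constant.\<close>
    also have "ln (real (M + 1)) \<le> ln (real (Dn + 1)) + 2 * ln (real n)"
    proof -
      have "M + 1 \<le> (Dn + 1) * (n * n)" using n by (cases n) (auto simp: M_def algebra_simps)
      then have "real (M + 1) \<le> real ((Dn + 1) * (n * n))" by (simp only: of_nat_le_iff)
      then have "ln (real (M + 1)) \<le> ln (real ((Dn + 1) * (n * n)))" by (intro iffD2[OF ln_le_cancel_iff]) (use n in auto)
      also have "\<dots> = ln (real (Dn + 1) * (real n * real n))" by (simp only: of_nat_mult)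
      also have "\<dots> = ln (real (Dn + 1)) + 2 * ln (real n)" using n by (simp add: ln_mult_pos)
      finally show ?thesis .
    qed
    finally show ?thesis by (simp add: algebra_simps)
  qed
  show "\<exists>C D. \<forall>n. part_entropy ?\<nu> (refine ?\<nu> (flow L 1) P (Suc n)) \<le> (Vp \<mu> N p + \<eta>) * real (Suc n) + C + D * ln (real (Suc n))"
    by (intro exI allI) (rule main, simp)
qed

end

end

section \<open>The lower bound for the entropy\<close>

context recog_subst
begin

section \<open>Words crossed in a time interval\<close>

lemma idx_mono: "s \<le> t \<Longrightarrow> idx y s \<le> idx y t"
proof -
  assume "s \<le> t"
  then have "rf y (idx y s) < rf y (idx y t + 1)"
    using idx[where x = y and t = s] idx[where x = y and t = t] by linarith
  then show ?thesis unfolding rf_less_iff by simp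
qed

lemma idx_nonneg: "0 \<le> t \<Longrightarrow> 0 \<le> idx y t"
  using idx_mono[of 0 t y] idx_eqI[of y 0 0] by simp

text \<open>Letter boundaries are at least \<open>Lmin\<close> apart, so a time interval of length
  \<open>n\<close> meets at most this many; the summand 1 accounts for the first.\<close>

definition cb :: "nat \<Rightarrow> nat" where
  "cb n = nat \<lceil>real n / Lmin\<rceil> + 1"

lemma idx_diff: "idx y (t + real n) - idx y t \<le> int (cb n)"
proof -
  define i where "i = idx y t"
  define j where "j = idx y (t + real n)"
  have b: "t < rf y (i + 1)" "rf y j \<le> t + real n"
    using idx[where x = y and t = t] idx[where x = y and t = "t + real n"] by (auto simp: i_def j_def)
  show ?thesis
  proof (cases "i + 1 \<le> j")
    case True
    have "Lmin * of_int (j - (i + 1)) \<le> real n"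
      using rf_lower[OF True, of y] b by linarith
    then have "of_int (j - (i + 1)) \<le> real n / Lmin"
      using Lmin_pos by (simp add: pos_le_divide_eq mult.commute)
    also have "\<dots> \<le> of_int \<lceil>real n / Lmin\<rceil>" by (rule le_of_int_ceiling)
    finally have "j - (i + 1) \<le> \<lceil>real n / Lmin\<rceil>" by (simp only: of_int_le_iff)
    then show ?thesis unfolding cb_def i_def[symmetric] j_def[symmetric] by linarith
  next
    case False
    then show ?thesis unfolding i_def j_def by simp
  qed
qed

text \<open>The window starts at position 1: the letter in which the interval begins is left out, so
  that the words of consecutive intervals concatenate (\<open>crossed_Suc\<close>).\<close>

definition crossed :: "nat \<Rightarrow> (int \<Rightarrow> 'a) \<times> real \<Rightarrow> 'a list" where
  "crossed n q = win (fst q) 1 (nat (idx (fst q) (snd q + real n)))"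

lemma crossed_flow:
  "crossed n (flow L t (y, s)) = win y (idx y (s + t) + 1) (nat (idx y (s + t + real n) - idx y (s + t)))"
proof -
  define i where "i = idx y (s + t)"
  have "idx (shiftn i y) (s + t - rf y i + real n) = idx y (s + t + real n) - i"
  proof (rule idx_eqI)
    show "rf (shiftn i y) (idx y (s + t + real n) - i) \<le> s + t - rf y i + real n"
      using rf_add[of y i "idx y (s + t + real n) - i"] idx(1)[of y "s + t + real n"] by simp
    show "s + t - rf y i + real n < rf (shiftn i y) (idx y (s + t + real n) - i + 1)"
      using rf_add[of y i "idx y (s + t + real n) - i + 1"] idx(2)[of "s + t + real n" y] by simp
  qed
  then show ?thesis by (simp add: crossed_def flow_idx i_def[symmetric] win_shiftn add.commute)
qed

lemma crossed_Suc:
  assumes "q \<in> HY"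
  shows "crossed (Suc n) q = crossed n q @ crossed 1 (flow L (real n) q)"
proof -
  obtain y s where q: "q = (y, s)" by fastforce
  have s: "0 \<le> s" using assms by (simp add: q hull_iff)
  have i: "0 \<le> idx y (s + real n)" "idx y (s + real n) \<le> idx y (s + real n + 1)"
    using s by (auto intro: idx_nonneg idx_mono)
  have "nat (idx y (s + real n + 1)) = nat (idx y (s + real n)) + nat (idx y (s + real n + 1) - idx y (s + real n))"
    using i by simp
  then show ?thesis using i
    by (simp add: q crossed_flow) (simp add: crossed_def win_add add_ac)
qed

definition wordsle :: "nat \<Rightarrow> 'a list set" where
  "wordsle n = {w. length w \<le> n}"

lemma finite_wordsle [simp]: "finite (wordsle n)"
  using finite_lists_length_le[of "UNIV :: 'a set" n] by (simp add: wordsle_def)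

lemma card_wordsle_pos: "0 < real (card (wordsle n))"
proof -
  have "[] \<in> wordsle n" by (simp add: wordsle_def)
  then show ?thesis by (metis card_gt_0_iff empty_iff finite_wordsle of_nat_0_less_iff)
qed

lemma crossed_wordsle:
  assumes "q \<in> HY"
  shows "crossed n q \<in> wordsle (cb n)"
proof -
  obtain y s where q: "q = (y, s)" by fastforce
  have "crossed n q = crossed n (flow L 0 (y, s))" using flow_0_hull[OF assms] q by simp
  then show ?thesis using idx_diff[of y s n] by (simp add: crossed_flow wordsle_def)
qed

definition cset :: "nat \<Rightarrow> 'a list \<Rightarrow> ((int \<Rightarrow> 'a) \<times> real) set" where
  "cset n w = {q \<in> HY. crossed n q = w}"

lemma cset_sets [measurable]: "cset n w \<in> sets MY"
proof -
  let ?j = "int (length w)"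
  have W: "{y. win y 1 (length w) = w} \<in> sets MX"
    using measurable_sets[OF measurable_win, of "{w}" 1 "length w"] by (simp add: vimage_def)
  have "{q. win (fst q) 1 (length w) = w} = fst -` {y. win y 1 (length w) = w} \<inter> space MY" by auto
  then have 1: "{q. win (fst q) 1 (length w) = w} \<in> sets MY"
    using measurable_sets[OF measurable_fst_MY W] by simp
  have [measurable]: "(\<lambda>q. rf (fst q) j) \<in> borel_measurable MY" for j
    by (rule measurable_compose[OF measurable_fst_MY]) simp
  note [measurable] = snd_MY
  have "{q \<in> space MY. rf (fst q) ?j \<le> snd q + real n \<and> snd q + real n < rf (fst q) (?j + 1)} \<in> sets MY"
    by measurable
  then have 2: "{q. idx (fst q) (snd q + real n) = ?j} \<in> sets MY" by (simp add: idx_eq_iff)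
  have "cset n w = HY \<inter> ({q. win (fst q) 1 (length w) = w} \<inter> {q. idx (fst q) (snd q + real n) = ?j})"
  proof (intro set_eqI)
    fix q :: "(int \<Rightarrow> 'a) \<times> real"
    obtain y s where q: "q = (y, s)" by fastforce
    have "0 \<le> idx y (s + real n)" if "q \<in> HY" using that by (auto simp: q hull_iff intro: idx_nonneg)
    moreover have "length (win y 1 m) = m" for m by (simp add: win_def)
    ultimately show "q \<in> cset n w \<longleftrightarrow> q \<in> HY \<inter> ({q. win (fst q) 1 (length w) = w} \<inter> {q. idx (fst q) (snd q + real n) = ?j})"
      by (auto simp: cset_def crossed_def q)
  qed
  then show ?thesis using 1 2 hull_sets by simp
qed

lemma cell_idx:
  assumes c: "cell M y = Some c" "cell M y' = Some c" and t: "0 \<le> t" "t < Lword L (snd c)"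
  shows "idx y t = idx y' t" "idx y t < int (length (snd c))"
proof -
  have rfe: "rf y (int m) = rf y' (int m)" if "m \<le> length (snd c)" for m
    using cell_win[OF c(1)] cell_win[OF c(2)] that take_win[OF that, of y 0] take_win[OF that, of y' 0] by (simp add: rf_win)
  have i0: "0 \<le> idx y t" using t by (intro idx_nonneg)
  have "rf y (int (length (snd c))) = Lword L (snd c)" using cell_win[OF c(1)] by (simp add: rf_win)
  then have "rf y (idx y t) < rf y (int (length (snd c)))" using idx(1)[of y t] t by simp
  then show il: "idx y t < int (length (snd c))" unfolding rf_less_iff .
  obtain m where m: "idx y t = int m" using i0 nonneg_int_cases by blast
  have "rf y (int m) = rf y' (int m)" "rf y (int m + 1) = rf y' (int m + 1)"
    using il m rfe[of m] rfe[of "Suc m"] by (auto simp: add.commute)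
  then show "idx y t = idx y' t"
    using idx[where x = y and t = t] m by (intro idx_eqI[symmetric]) auto
qed

lemma cell_crossed:
  assumes c: "cell M y = Some c" "cell M y' = Some c" and t: "0 \<le> t" "t + real n < Lword L (snd c)"
  shows "crossed n (flow L t (y, 0)) = crossed n (flow L t (y', 0))"
proof -
  have e: "idx y t = idx y' t" "idx y (t + real n) = idx y' (t + real n)" "idx y (t + real n) < int (length (snd c))"
    using cell_idx[OF c, of t] cell_idx[OF c, of "t + real n"] t by auto
  have i0: "0 \<le> idx y t" using t by (intro idx_nonneg)
  have "y i = y' i" if "0 \<le> i" "i < int (length (snd c))" for i
    using cell_word[of M y "fst c" "snd c" "nat i"] cell_word[of M y' "fst c" "snd c" "nat i"] c that by simp
  then show ?thesis using e i0 by (auto simp: crossed_flow win_eq_iff)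
qed

lemma nn_integral_chunks:
  fixes g :: "real \<Rightarrow> ennreal"
  assumes g: "g \<in> borel_measurable borel" and n: "0 \<le> n"
  shows "(\<integral>\<^sup>+t. g t * indicator {0..<real k * n} t \<partial>lborel) = (\<Sum>j<k. \<integral>\<^sup>+r. g (r + real j * n) * indicator {0..<n} r \<partial>lborel)"
proof (induction k)
  case (Suc k)
  have "(\<integral>\<^sup>+t. g t * indicator {0..<real (Suc k) * n} t \<partial>lborel)
    = (\<integral>\<^sup>+t. g t * indicator {0..<real k * n} t + g t * indicator {real k * n..<real (Suc k) * n} t \<partial>lborel)"
  proof (intro nn_integral_cong)
    fix t
    have "0 \<le> real k * n" "real (Suc k) * n = real k * n + n" using n by (auto simp: algebra_simps)
    moreover have "g t * indicator {0..<b + n} t = g t * indicator {0..<b} t + g t * indicator {b..<b + n} t" if "0 \<le> b" for b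
      using n that by (auto simp: indicator_def)
    ultimately show "g t * indicator {0..<real (Suc k) * n} t = g t * indicator {0..<real k * n} t + g t * indicator {real k * n..<real (Suc k) * n} t"
      by (simp only:)
  qed
  also have "\<dots> = (\<integral>\<^sup>+t. g t * indicator {0..<real k * n} t \<partial>lborel) + (\<integral>\<^sup>+t. g t * indicator {real k * n..<real (Suc k) * n} t \<partial>lborel)"
    using g by (intro nn_integral_add) auto
  also have "(\<integral>\<^sup>+t. g t * indicator {real k * n..<real (Suc k) * n} t \<partial>lborel)
    = (\<integral>\<^sup>+r. g (r + real k * n) * indicator {real k * n..<real (Suc k) * n} (r + real k * n) \<partial>lborel)"
    using g by (intro nn_integral_translate[symmetric, where f = "\<lambda>t. g t * indicator {real k * n..<real (Suc k) * n} t"] borel_measurable_times_ennreal borel_measurable_indicator) simp_all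
  also have "\<dots> = (\<integral>\<^sup>+r. g (r + real k * n) * indicator {0..<n} r \<partial>lborel)"
    by (intro nn_integral_cong) (auto simp: indicator_def algebra_simps)
  finally show ?case using Suc by simp
qed simp

context
  fixes \<mu> :: "(int \<Rightarrow> 'a) measure"
  assumes s: "siv \<mu>" and u: "uniform (dens \<mu>)"
begin

text \<open>The law of the crossed word, mixed with the uniform law to be positive on all short
  words. The factor 2 costs \<open>ln 2\<close> once, for any \<open>n\<close>.\<close>

definition qm :: "nat \<Rightarrow> 'a list \<Rightarrow> real" where
  "qm n w = (measure (lifted \<mu>) (cset n w) + 1 / real (card (wordsle (cb n)))) / 2"

lemma qm_pos: "0 < qm n w"
  using card_wordsle_pos[of "cb n"] by (auto simp: qm_def intro!: add_nonneg_pos)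

lemma qm_sum: "(\<Sum>w\<in>wordsle (cb n). qm n w) \<le> 1"
proof -
  interpret prob_space "lifted \<mu>" using prob_lift[OF s] by blast
  have "(\<Sum>w\<in>wordsle (cb n). measure (lifted \<mu>) (cset n w)) = measure (lifted \<mu>) (\<Union>w\<in>wordsle (cb n). cset n w)"
    by (rule finite_measure_finite_Union[symmetric]) (auto simp: sets_lift[OF s] disjoint_family_on_def, auto simp: cset_def)
  then have "(\<Sum>w\<in>wordsle (cb n). measure (lifted \<mu>) (cset n w)) \<le> 1" by simp
  then show ?thesis using card_wordsle_pos[of "cb n"]
    by (simp add: qm_def sum_divide_distrib[symmetric] sum.distrib)
qed

lemma qm_le_1: "w \<in> wordsle (cb n) \<Longrightarrow> qm n w \<le> 1"
  using member_le_sum[of w "wordsle (cb n)" "qm n"] qm_sum[of n] qm_pos by (force simp: less_imp_le)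

text \<open>The code length of the crossed word, by \<open>fv_eq\<close>, written as a finite sum
  over measurable sets.\<close>

definition fv :: "nat \<Rightarrow> (int \<Rightarrow> 'a) \<times> real \<Rightarrow> real" where
  "fv n q = (\<Sum>w\<in>wordsle (cb n). - ln (qm n w) * indicator (cset n w) q)"

lemma fv_eq:
  assumes "q \<in> HY"
  shows "fv n q = - ln (qm n (crossed n q))"
proof -
  have "fv n q = (\<Sum>w\<in>wordsle (cb n). if w = crossed n q then - ln (qm n w) else 0)"
    unfolding fv_def using assms by (intro sum.cong) (auto simp: cset_def)
  then show ?thesis using crossed_wordsle[OF assms, of n] by simp
qed

lemma fv_nonneg: "0 \<le> fv n q"
  unfolding fv_def
proof (intro sum_nonneg mult_nonneg_nonneg)
  fix w assume "w \<in> wordsle (cb n)"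
  from qm_le_1[OF this] qm_pos[of n w] show "0 \<le> - ln (qm n w)" by simp
qed simp

lemma fv_measurable [measurable]: "fv n \<in> borel_measurable MY"
  unfolding fv_def by measurable

lemma fv_integrable: "integrable (lifted \<mu>) (fv n)"
proof -
  interpret prob_space "lifted \<mu>" using prob_lift[OF s] by blast
  show ?thesis unfolding fv_def
    by (intro Bochner_Integration.integrable_sum integrable_mult_right integrable_real_indicator)
      (auto simp: sets_lift[OF s] less_top[symmetric])
qed

text \<open>The cost of naming the two end words in \<open>chunk_gibbs\<close>; for fixed
  \<open>n\<close> it is negligible against a long cell.\<close>

definition cost :: "nat \<Rightarrow> real" where
  "cost n = ln (real (card (wordsle (cb n + cb (2 * n) + 1) \<times> wordsle (cb n + cb (2 * n) + 1))))"

text \<open>Gibbs' inequality for the uniform distribution on the level-M words of a, where a word is coded by the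
  letters crossed in k consecutive intervals of length n and by two short words at its ends.\<close>
lemma chunk_gibbs:
  assumes n: "1 \<le> n" and r: "0 \<le> r" "r < real n"
    and k: "r + real k * real n < lam ^ M * L a" "lam ^ M * L a \<le> r + real k * real n + 2 * real n"
  shows "K M a * (ln (K M a) - cost n) \<le> (\<Sum>w\<in>pw M a. \<Sum>j<k. fv n (flow L (r + real j * real n) (samp M (a, w), 0)))"
proof -
  define B where "B = cb n + cb (2 * n) + 1"
  define y where "y w = samp M (a, w)" for w
  define e where "e w j = idx (y w) (r + real j * real n)" for w j
  \<comment> \<open>The prefix ends with the letter below time \<open>r\<close>, which the first
    chunk leaves out; hence \<open>e w 0 + 1\<close> letters.\<close>
  define pre where "pre w = win (y w) 0 (nat (e w 0 + 1))" for w
  define ch where "ch w j = win (y w) (e w j + 1) (nat (e w (Suc j) - e w j))" for w j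
  define suf where "suf w = win (y w) (e w k + 1) (nat (int (length w) - (e w k + 1)))" for w
  define \<Phi> where "\<Phi> w = ((pre w, suf w), map (ch w) [0..<k])" for w
  define Z where "Z = {z. set z \<subseteq> wordsle (cb n) \<and> length z = k}"
  define Q where "Q = (\<lambda>(x :: 'a list \<times> 'a list, z). 1 / real (card (wordsle B \<times> wordsle B)) * (\<Prod>j<k. qm n (z ! j)))"
  have fZ: "finite Z" unfolding Z_def by (rule finite_lists_length_eq) simp
  have cB: "0 < real (card (wordsle B \<times> wordsle B))" using card_wordsle_pos[of B] by (simp add: card_cartesian_product)
  have cl: "cell M (y w) = Some (a, w)" if "w \<in> pw M a" for w
    unfolding y_def using that by (intro cell_samp) (simp add: cells_def)
  have yX: "(y w, 0) \<in> HY" if "w \<in> pw M a" for w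
    using cell_SomeE[OF cl[OF that]] by (metis L_pos hull_iff order_refl)
  have e0: "0 \<le> e w j" for w j using r by (auto simp: e_def intro!: idx_nonneg)
  have eS: "e w j \<le> e w (Suc j)" for w j by (auto simp: e_def algebra_simps intro!: idx_mono)
  have ek: "e w k < int (length w)" if "w \<in> pw M a" for w
    using cell_idx(2)[OF cl[OF that] cl[OF that], of "r + real k * real n"] r k Lword_pw[OF that] by (simp add: e_def)
  have chc: "crossed n (flow L (r + real j * real n) (y w, 0)) = ch w j" for w j
    by (simp add: crossed_flow ch_def e_def algebra_simps)
  have pc: "pre w @ concat (map (ch w) [0..<j]) = win (y w) 0 (nat (e w j + 1))" for w j
  proof (induction j)
    case (Suc j)
    have "nat (e w (Suc j) + 1) = nat (e w j + 1) + nat (e w (Suc j) - e w j)" using e0[of w j] eS[of w j] by simp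
    then have "win (y w) 0 (nat (e w (Suc j) + 1)) = win (y w) 0 (nat (e w j + 1)) @ ch w j"
      using e0[of w j] by (simp add: win_add ch_def)
    then show ?case using Suc by simp
  qed (simp add: pre_def)
  have rec: "w = pre w @ concat (map (ch w) [0..<k]) @ suf w" if "w \<in> pw M a" for w
  proof -
    have "length w = nat (e w k + 1) + nat (int (length w) - (e w k + 1))" using e0[of w k] ek[OF that] by simp
    then have "win (y w) 0 (length w) = win (y w) 0 (nat (e w k + 1)) @ suf w"
      using win_add[of "y w" 0 "nat (e w k + 1)" "nat (int (length w) - (e w k + 1))"] e0[of w k] by (simp add: suf_def)
    then show ?thesis using cell_win[OF cl[OF that]] pc[of w k]
      by (simp add: append_assoc[symmetric] del: append_assoc)
  qed
  \<comment> \<open>Prefix, chunks and suffix spell \<open>w\<close>, so distinct words have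
    distinct codes and the code weights form a sub-probability on \<open>pw M a\<close>.\<close>
  have inj: "inj_on \<Phi> (pw M a)"
  proof (rule inj_onI)
    fix w w' assume w: "w \<in> pw M a" "w' \<in> pw M a" "\<Phi> w = \<Phi> w'"
    then have "pre w = pre w'" "suf w = suf w'" "map (ch w) [0..<k] = map (ch w') [0..<k]" by (simp_all only: \<Phi>_def prod.inject)
    then show "w = w'" using rec[OF w(1)] rec[OF w(2)] by metis
  qed
  have sub: "\<Phi> ` pw M a \<subseteq> (wordsle B \<times> wordsle B) \<times> Z"
  proof (rule image_subsetI)
    fix w assume w: "w \<in> pw M a"
    have "idx (y w) r \<le> idx (y w) (0 + real n)" using r by (intro idx_mono) simp
    then have "e w 0 \<le> int (cb n)" using idx_diff[of "y w" 0 n] idx_nonneg[of 0 "y w"] idx_eqI[of "y w" 0 0] by (simp add: e_def)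
    then have 1: "pre w \<in> wordsle B" using e0[of w 0] by (simp add: pre_def wordsle_def B_def)
    have T: "rf (y w) (int (length w)) = lam ^ M * L a" using cell_win[OF cl[OF w]] Lword_pw[OF w] by (simp add: rf_win)
    then have "idx (y w) (lam ^ M * L a) = int (length w)"
      using rf_less_iff[of "y w" "int (length w)" "int (length w) + 1"] by (intro idx_eqI) auto
    moreover have "idx (y w) (lam ^ M * L a) \<le> idx (y w) (r + real k * real n + real (2 * n))" using k by (intro idx_mono) simp
    ultimately have "int (length w) - e w k \<le> int (cb (2 * n))"
      using idx_diff[of "y w" "r + real k * real n" "2 * n"] by (simp add: e_def)
    then have 2: "suf w \<in> wordsle B" by (simp add: suf_def wordsle_def B_def)
    have "ch w j \<in> wordsle (cb n)" for j
      unfolding chc[symmetric] by (rule crossed_wordsle[OF flow_hull[OF yX[OF w]]])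
    then have 3: "map (ch w) [0..<k] \<in> Z" by (auto simp: Z_def)
    show "\<Phi> w \<in> (wordsle B \<times> wordsle B) \<times> Z" using 1 2 3 by (simp add: \<Phi>_def)
  qed
  have Q0: "0 < Q z" for z
    using cB by (auto simp: Q_def split_beta' intro!: divide_pos_pos prod_pos qm_pos)
  have "(\<Sum>w\<in>pw M a. Q (\<Phi> w)) = (\<Sum>z\<in>\<Phi> ` pw M a. Q z)" by (simp add: sum.reindex[OF inj])
  also have "\<dots> \<le> (\<Sum>z\<in>(wordsle B \<times> wordsle B) \<times> Z. Q z)"
    using fZ Q0 by (intro sum_mono2[OF _ sub]) (auto simp: less_imp_le)
  also have "\<dots> = (\<Sum>x\<in>wordsle B \<times> wordsle B. \<Sum>z\<in>Z. Q (x, z))"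
    by (simp add: sum.cartesian_product split_beta')
  also have "\<dots> = (\<Sum>z\<in>Z. \<Prod>j<k. qm n (z ! j))"
    unfolding Q_def prod.case sum_distrib_left[symmetric] sum_constant using card_wordsle_pos[of B] by auto
  also have "\<dots> \<le> 1" unfolding Z_def
    by (rule prod_lists_sum_le) (use qm_sum qm_pos in \<open>auto simp: less_imp_le\<close>)
  finally have Qs: "(\<Sum>w\<in>pw M a. Q (\<Phi> w)) \<le> 1" .
  have lnQ: "- ln (Q (\<Phi> w)) = cost n + (\<Sum>j<k. fv n (flow L (r + real j * real n) (y w, 0)))" if w: "w \<in> pw M a" for w
  proof -
    have P: "0 < (\<Prod>j<k. qm n (ch w j))" by (intro prod_pos qm_pos)
    have "Q (\<Phi> w) = 1 / real (card (wordsle B \<times> wordsle B)) * (\<Prod>j<k. qm n (ch w j))"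
      unfolding Q_def \<Phi>_def by simp
    then have "ln (Q (\<Phi> w)) = ln (1 / real (card (wordsle B \<times> wordsle B))) + ln (\<Prod>j<k. qm n (ch w j))"
      using cB P by (simp only: ln_mult_pos[OF divide_pos_pos[OF zero_less_one cB] P])
    also have "ln (1 / real (card (wordsle B \<times> wordsle B))) = - cost n"
      using cB by (simp add: ln_div cost_def B_def del: card_cartesian_product)
    also have "ln (\<Prod>j<k. qm n (ch w j)) = (\<Sum>j<k. ln (qm n (ch w j)))"
      by (rule ln_prod) (use qm_pos in \<open>auto simp: less_imp_neq[symmetric]\<close>)
    also have "\<dots> = (\<Sum>j<k. - fv n (flow L (r + real j * real n) (y w, 0)))"
      by (intro sum.cong refl) (simp add: fv_eq flow_hull yX[OF w] chc)
    finally show ?thesis by (simp add: sum_negf)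
  qed
  \<comment> \<open>The uniform law has entropy \<open>ln (K M a)\<close>, which the mean code
    length cannot undercut.\<close>
  have "- (\<Sum>w\<in>pw M a. 1 / K M a * ln (1 / K M a)) \<le> - (\<Sum>w\<in>pw M a. 1 / K M a * ln (Q (\<Phi> w)))"
    by (rule gibbs) (use pw_valid K_pos[of M a] Q0 Qs in \<open>auto simp: less_imp_le K_def\<close>)
  moreover have "(\<Sum>w\<in>pw M a. 1 / K M a * ln (1 / K M a)) = - ln (K M a)"
  proof -
    have "(\<Sum>w\<in>pw M a. 1 / K M a * ln (1 / K M a)) = K M a * (1 / K M a * ln (1 / K M a))"
      unfolding sum_constant K_def ..
    also have "\<dots> = ln (1 / K M a)" by simp
    finally show ?thesis using K_pos[of M a] by (simp add: ln_div)
  qed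
  ultimately have "ln (K M a) \<le> (\<Sum>w\<in>pw M a. - ln (Q (\<Phi> w))) / K M a"
    by (simp add: sum_divide_distrib sum_negf)
  also have "(\<Sum>w\<in>pw M a. - ln (Q (\<Phi> w))) = (\<Sum>w\<in>pw M a. cost n + (\<Sum>j<k. fv n (flow L (r + real j * real n) (y w, 0))))"
    by (intro sum.cong refl lnQ)
  also have "\<dots> = K M a * cost n + (\<Sum>w\<in>pw M a. \<Sum>j<k. fv n (flow L (r + real j * real n) (y w, 0)))"
    by (simp add: sum.distrib K_def)
  finally show ?thesis using K_pos[of M a] by (simp add: y_def field_simps)
qed

definition timeint :: "nat \<Rightarrow> (int \<Rightarrow> 'a) \<Rightarrow> real \<Rightarrow> ennreal" where
  "timeint n y T = (\<integral>\<^sup>+t. ennreal (fv n (flow L t (y, 0))) * indicator {0..<T} t \<partial>lborel)"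

lemma fv_flow_measurable: "(\<lambda>t. fv n (flow L t q)) \<in> borel_measurable borel"
proof -
  have "(\<lambda>t. (t, q)) \<in> measurable lborel (lborel \<Otimes>\<^sub>M MY)" by (rule measurable_Pair) auto
  from measurable_compose[OF this measurable_compose[OF flow_measurable_joint fv_measurable]] show ?thesis by simp
qed

text \<open>Integrating \<open>chunk_gibbs\<close> over the offsets \<open>r\<close> in
  \<open>{0..<n}\<close> lets the starting times \<open>r + j * n\<close> sweep
  \<open>{0..<k * n}\<close> exactly once, so the sum over chunks becomes a time integral.\<close>

lemma timeint_samp:
  assumes n: "1 \<le> n" and k: "real k * real n + real n \<le> lam ^ M * L a" "lam ^ M * L a \<le> real k * real n + 2 * real n"
  shows "ennreal (real n * (K M a * (ln (K M a) - cost n))) \<le> (\<Sum>w\<in>pw M a. timeint n (samp M (a, w)) (real k * real n))"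
proof -
  let ?f = "\<lambda>w t. ennreal (fv n (flow L t (samp M (a, w), 0)))"
  let ?c = "K M a * (ln (K M a) - cost n)"
  have fm [measurable]: "?f w \<in> borel_measurable borel" for w
    using fv_flow_measurable by measurable
  have fm2 [measurable]: "(\<lambda>r. ?f w (r + c)) \<in> borel_measurable borel" for w c
    using measurable_compose[OF _ fm, of "\<lambda>r. r + c"] by simp
  have "ennreal (real n * ?c) = (\<integral>\<^sup>+r. ennreal ?c * indicator {0..<real n} r \<partial>lborel)"
    by (subst nn_integral_cmult_indicator) (simp_all add: ennreal_mult''[symmetric] mult.commute[of "real n"])
  also have "\<dots> \<le> (\<integral>\<^sup>+r. (\<Sum>w\<in>pw M a. \<Sum>j<k. ?f w (r + real j * real n) * indicator {0..<real n} r) \<partial>lborel)"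
  proof (rule nn_integral_mono)
    fix r
    show "ennreal ?c * indicator {0..<real n} r \<le> (\<Sum>w\<in>pw M a. \<Sum>j<k. ?f w (r + real j * real n) * indicator {0..<real n} r)"
    proof (cases "r \<in> {0..<real n}")
      case True
      then have "?c \<le> (\<Sum>w\<in>pw M a. \<Sum>j<k. fv n (flow L (r + real j * real n) (samp M (a, w), 0)))"
        using k by (intro chunk_gibbs n) auto
      then have "ennreal ?c \<le> (\<Sum>w\<in>pw M a. \<Sum>j<k. ?f w (r + real j * real n))"
        by (simp add: sum_ennreal fv_nonneg sum_nonneg ennreal_leI)
      then show ?thesis using True by simp
    qed simp
  qed
  also have "\<dots> = (\<Sum>w\<in>pw M a. \<Sum>j<k. \<integral>\<^sup>+r. ?f w (r + real j * real n) * indicator {0..<real n} r \<partial>lborel)"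
  proof -
    have m: "(\<lambda>r. ?f w (r + real j * real n) * indicator {0..<real n} r) \<in> borel_measurable lborel" for w j
      by (intro borel_measurable_times_ennreal borel_measurable_indicator) (use fm2 in auto)
    have "(\<integral>\<^sup>+r. (\<Sum>w\<in>pw M a. \<Sum>j<k. ?f w (r + real j * real n) * indicator {0..<real n} r) \<partial>lborel)
      = (\<Sum>w\<in>pw M a. \<integral>\<^sup>+r. (\<Sum>j<k. ?f w (r + real j * real n) * indicator {0..<real n} r) \<partial>lborel)"
      by (intro nn_integral_sum borel_measurable_sum m)
    also have "\<dots> = (\<Sum>w\<in>pw M a. \<Sum>j<k. \<integral>\<^sup>+r. ?f w (r + real j * real n) * indicator {0..<real n} r \<partial>lborel)"
      by (intro sum.cong refl nn_integral_sum m)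
    finally show ?thesis .
  qed
  also have "\<dots> = (\<Sum>w\<in>pw M a. timeint n (samp M (a, w)) (real k * real n))"
    unfolding timeint_def by (intro sum.cong refl nn_integral_chunks[symmetric] fm) simp
  finally show ?thesis .
qed

text \<open>Kac's formula in the hull with \<open>timeint_samp\<close> applied to each letter type.
  Uniformity enters here: the words of one type have equal densities, so the sum over
  \<open>pw M a\<close> is taken with equal weights.\<close>

lemma fv_integral_ge:
  assumes n: "1 \<le> n" and h: "0 \<le> h"
    and M: "\<And>a. 2 * real n \<le> lam ^ M * L a" "\<And>a. h \<le> (ln (K M a) - cost n) / (lam ^ M * L a)"
  shows "real n * h \<le> (\<integral>q. fv n q \<partial>lifted \<mu>)"
proof -
  \<comment> \<open>The largest number of chunks that fits into the cell for every offset
    \<open>r < n\<close>: one chunk length is kept in reserve, and at most two are left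
    over.\<close>
  define k where "k a = nat \<lfloor>lam ^ M * L a / real n\<rfloor> - 1" for a
  have k: "real (k a) * real n + real n \<le> lam ^ M * L a" "lam ^ M * L a \<le> real (k a) * real n + 2 * real n" for a
  proof -
    define x where "x = lam ^ M * L a / real n"
    have x: "2 \<le> x" "x * real n = lam ^ M * L a" using M(1)[of a] n by (auto simp: x_def pos_le_divide_eq)
    have "real (k a) + 1 \<le> x" "x \<le> real (k a) + 2" using x(1) unfolding k_def x_def[symmetric] by linarith+
    then have "(real (k a) + 1) * real n \<le> x * real n" "x * real n \<le> (real (k a) + 2) * real n"
      by (auto intro: mult_right_mono)
    then show "real (k a) * real n + real n \<le> lam ^ M * L a" "lam ^ M * L a \<le> real (k a) * real n + 2 * real n"
      unfolding x(2) by (simp_all add: algebra_simps)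
  qed
  let ?tc = "\<lambda>c. timeint n (samp M c) (real (k (fst c)) * real n)" and ?tl = "\<lambda>c y. timeint n y (Lword L (snd c))"
  define A where "A a = piof \<mu> M a / (lam ^ M * L a * K M a)" for a
  define B where "B a = real n * (K M a * (ln (K M a) - cost n))" for a
  have l0: "0 < ell \<mu>" using ell_pos[OF s] .
  \<comment> \<open>A chunk that starts before \<open>k * n\<close> ends inside the cell, so
    \<open>fv\<close> takes the same values along \<open>y\<close> as along the sample; the
    remaining time of the cell is dropped.\<close>
  have le: "?tc c * indicator {y. cell M y = Some c} y
    \<le> ?tl c y * indicator {y. cell M y = Some c} y" if c: "c \<in> cells M" for c y
  proof (cases "cell M y = Some c")
    case True
    have T: "Lword L (snd c) = lam ^ M * L (fst c)" by (rule Lword_cell[OF c])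
    have hy: "(y, 0) \<in> HY" "(samp M c, 0) \<in> HY"
      using cell_SomeE[of M y "fst c" "snd c"] cell_SomeE[of M "samp M c" "fst c" "snd c"] True cell_samp[OF c]
      by (metis L_pos hull_iff order_refl prod.collapse)+
    have "?tc c \<le> ?tl c y"
      unfolding timeint_def
    proof (rule nn_integral_mono)
      fix t
      show "ennreal (fv n (flow L t (samp M c, 0))) * indicator {0..<real (k (fst c)) * real n} t
        \<le> ennreal (fv n (flow L t (y, 0))) * indicator {0..<Lword L (snd c)} t"
      proof (cases "t \<in> {0..<real (k (fst c)) * real n}")
        case tt: True
        then have tn: "0 \<le> t" "t + real n < Lword L (snd c)" using k(1)[of "fst c"] unfolding T by auto
        have "fv n (flow L t (samp M c, 0)) = fv n (flow L t (y, 0))"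
          using cell_crossed[OF cell_samp[OF c] True tn] by (simp add: fv_eq flow_hull hy)
        then show ?thesis using tt tn by simp
      qed simp
    qed
    then show ?thesis using True by simp
  qed simp
  have d: "dens \<mu> M (a, w) / ell \<mu> = A a" if "w \<in> pw M a" for a w
    using udens_piof[OF s u, of "(a, w)" M] that l0 by (simp add: cells_def udens_def A_def)
  have pi: "0 \<le> piof \<mu> M a" "(\<Sum>a\<in>UNIV. piof \<mu> M a) = 1" for a
    using inverse_orbit_nonneg[OF piof_orbit[OF s u]] inverse_orbit_sum[OF piof_orbit[OF s u]] by auto
  have c0: "0 \<le> A a" for a
    unfolding A_def using pi(1)[of a] mult_pos_pos[OF lamL_pos[of M a] K_pos[of M a]] by (rule divide_nonneg_pos)
  have "ennreal (real n * h) = ennreal (\<Sum>a\<in>UNIV. piof \<mu> M a * (real n * h))"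
    using pi(2) by (simp add: sum_distrib_right[symmetric])
  also have "\<dots> \<le> ennreal (\<Sum>a\<in>UNIV. A a * B a)"
  proof (intro ennreal_leI sum_mono)
    fix a
    have "piof \<mu> M a * (real n * h) \<le> piof \<mu> M a * (real n * ((ln (K M a) - cost n) / (lam ^ M * L a)))"
      using pi(1)[of a] M(2)[of a] by (intro mult_left_mono) auto
    also have "\<dots> = A a * B a"
      using lamL_pos[of M a] K_pos[of M a] by (simp add: A_def B_def)
    finally show "piof \<mu> M a * (real n * h) \<le> A a * B a" .
  qed
  also have "\<dots> = (\<Sum>a\<in>UNIV. ennreal (A a) * ennreal (B a))"
  proof -
    have p: "0 \<le> B a" for a
    proof -
      have "0 \<le> (ln (K M a) - cost n) / (lam ^ M * L a)" using M(2)[of a] h by linarith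
      then have "0 \<le> ln (K M a) - cost n" using lamL_pos[of M a] by (simp only: zero_le_divide_iff) linarith
      then show ?thesis using K_pos[of M a] by (simp add: B_def)
    qed
    have "ennreal (\<Sum>a\<in>UNIV. A a * B a) = (\<Sum>a\<in>UNIV. ennreal (A a * B a))"
      by (intro sum_ennreal[symmetric] mult_nonneg_nonneg[OF c0 p])
    also have "\<dots> = (\<Sum>a\<in>UNIV. ennreal (A a) * ennreal (B a))"
      by (intro sum.cong refl ennreal_mult c0 p)
    finally show ?thesis .
  qed
  also have "\<dots> \<le> (\<Sum>a\<in>UNIV. ennreal (A a) * (\<Sum>w\<in>pw M a. timeint n (samp M (a, w)) (real (k a) * real n)))"
    by (intro sum_mono mult_left_mono timeint_samp[OF n k, folded B_def]) simp
  also have "\<dots> = (\<Sum>c\<in>cells M. ?tc c * ennreal (dens \<mu> M c / ell \<mu>))"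
    unfolding sum_cells sum_distrib_left by (intro sum.cong refl) (simp add: d mult.commute)
  also have "\<dots> = (\<Sum>c\<in>cells M. \<integral>\<^sup>+y. ?tc c * indicator {y. cell M y = Some c} y \<partial>\<mu>) / ennreal (ell \<mu>)"
  proof -
    have "ennreal (dens \<mu> M c / ell \<mu>) = ennreal (dens \<mu> M c) * inverse (ennreal (ell \<mu>))" for c
      using l0 by (simp add: divide_ennreal[symmetric] divide_ennreal_def)
    then show ?thesis unfolding divide_ennreal_def sum_distrib_right
      by (intro sum.cong refl)
        (simp add: nn_integral_cmult_indicator siv_sets[OF s] cell_sets emeasure_cell[OF s] mult.assoc)
  qed
  also have "\<dots> \<le> (\<Sum>c\<in>cells M. \<integral>\<^sup>+y. ?tl c y * indicator {y. cell M y = Some c} y \<partial>\<mu>) / ennreal (ell \<mu>)"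
    by (intro divide_right_mono_ennreal sum_mono nn_integral_mono le)
  also have "\<dots> = (\<integral>\<^sup>+q. ennreal (fv n q) \<partial>lifted \<mu>)"
    unfolding timeint_def by (rule lift_kac[OF s, symmetric]) measurable
  also have "\<dots> = ennreal (\<integral>q. fv n q \<partial>lifted \<mu>)"
    by (rule nn_integral_eq_integral[OF fv_integrable]) (simp add: fv_nonneg)
  finally show ?thesis by (simp add: ennreal_le_iff integral_nonneg_AE fv_nonneg)
qed

lemma cost_nonneg: "0 \<le> cost n"
proof -
  let ?W = "wordsle (cb n + cb (2 * n) + 1) \<times> wordsle (cb n + cb (2 * n) + 1)"
  have "0 < card ?W" using card_wordsle_pos[of "cb n + cb (2 * n) + 1"] by simp
  then have "1 \<le> real (card ?W)" by linarith
  then show ?thesis unfolding cost_def by (rule ln_ge_zero)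
qed

lemma fv_integral_ge_limit:
  assumes n: "1 \<le> n" and h: "\<And>e. 0 < e \<Longrightarrow> \<exists>M0. \<forall>M\<ge>M0. \<forall>a. h - e \<le> ln (K M a) / (lam ^ M * L a)"
  shows "real n * h \<le> (\<integral>q. fv n q \<partial>lifted \<mu>)"
proof -
  have "h' \<le> (\<integral>q. fv n q \<partial>lifted \<mu>) / real n" if h': "h' < h" for h'
  proof (cases "0 \<le> h'")
    case True
    define e where "e = (h - h') / 2"
    have e: "0 < e" using h' by (simp add: e_def)
    obtain M0 where M0: "\<And>M a. M0 \<le> M \<Longrightarrow> h - e \<le> ln (K M a) / (lam ^ M * L a)" using h[OF e] by blast
    \<comment> \<open>\<open>lam ^ M \<ge> R\<close> makes every cell longer than two chunks and
      brings the end cost per unit of time below \<open>e\<close>.\<close>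
    define R where "R = (2 * real n + cost n / e) / Lmin"
    obtain M1 where M1: "R < lam ^ M1" using real_arch_pow[OF lam_gt_1] by blast
    define M where "M = max M0 M1"
    have "lam ^ M1 \<le> lam ^ M" by (rule power_increasing) (use lam_gt_1 in \<open>auto simp: M_def\<close>)
    then have "R \<le> lam ^ M" using M1 by linarith
    then have R: "2 * real n + cost n / e \<le> lam ^ M * Lmin" using Lmin_pos by (simp add: R_def pos_divide_le_eq)
    have b: "2 * real n + cost n / e \<le> lam ^ M * L a" for a
    proof -
      have "lam ^ M * Lmin \<le> lam ^ M * L a" using lam_gt_1 Lmin_le by (intro mult_left_mono) auto
      with R show ?thesis by linarith
    qed
    have ce: "0 \<le> cost n / e" using cost_nonneg e by simp
    have "real n * h' \<le> (\<integral>q. fv n q \<partial>lifted \<mu>)"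
    proof (rule fv_integral_ge[OF n True, of M])
      fix a
      show "2 * real n \<le> lam ^ M * L a" using b[of a] ce by linarith
      have "cost n / e \<le> lam ^ M * L a" using b[of a] by simp
      then have "cost n \<le> e * (lam ^ M * L a)" using e by (simp add: pos_divide_le_eq mult.commute)
      then have "cost n / (lam ^ M * L a) \<le> e" using lamL_pos[of M a] by (simp add: pos_divide_le_eq)
      moreover have "h - e \<le> ln (K M a) / (lam ^ M * L a)" by (rule M0) (simp add: M_def)
      moreover have "h' = h - e - e" by (simp add: e_def field_simps)
      ultimately show "h' \<le> (ln (K M a) - cost n) / (lam ^ M * L a)"
        unfolding diff_divide_distrib by linarith
    qed
    then show ?thesis using n by (simp add: pos_le_divide_eq mult.commute)
  next
    case False
    have "0 \<le> (\<integral>q. fv n q \<partial>lifted \<mu>) / real n" by (simp add: integral_nonneg_AE fv_nonneg)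
    then show ?thesis using False by linarith
  qed
  then have "h \<le> (\<integral>q. fv n q \<partial>lifted \<mu>) / real n" by (rule dense_le)
  then show ?thesis using n by (simp add: pos_le_divide_eq mult.commute)
qed

definition ccode :: "(int \<Rightarrow> 'a) \<times> real \<Rightarrow> 'a list option" where
  "ccode q = (if q \<in> HY then Some (crossed 1 q) else None)"

text \<open>Atoms read the word crossed in unit time, with one more for the complement of the hull;
  by concatenation, its refinements read the words crossed in longer times.\<close>

definition cpart :: "((int \<Rightarrow> 'a) \<times> real) set set" where
  "cpart = (\<lambda>z. ccode -` {z}) ` insert None (Some ` wordsle (cb 1))"

lemma cpart_partition: "fin_partition (lifted \<mu>) cpart"
  unfolding fin_partition_def
proof (intro conjI)
  show "finite cpart" by (simp add: cpart_def)
  have "ccode -` {None} = UNIV - HY" "ccode -` {Some w} = cset 1 w" for w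
    by (auto simp: ccode_def cset_def split: if_splits)
  moreover have "UNIV - HY \<in> sets MY" using sets.compl_sets[OF hull_sets] by simp
  ultimately show "cpart \<subseteq> sets (lifted \<mu>)" unfolding sets_lift[OF s] by (auto simp: cpart_def)
  show "disjoint cpart" by (auto simp: cpart_def disjoint_def)
  have "q \<in> \<Union>cpart" for q
    using crossed_wordsle[of q 1] unfolding cpart_def ccode_def by (cases "q \<in> HY") auto
  then show "\<Union>cpart = space (lifted \<mu>)" by (auto simp: space_lift[OF s])
qed

lemma refine_crossed:
  assumes A: "A \<in> refine (lifted \<mu>) (flow L 1) cpart n" and q: "q \<in> A" "q' \<in> A" "q \<in> HY" "q' \<in> HY"
  shows "crossed n q = crossed n q'"
proof -
  have "crossed 1 (flow L (real i) q) = crossed 1 (flow L (real i) q')" if i: "i < n" for i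
  proof -
    obtain c where c: "A = space (lifted \<mu>) \<inter> (\<Inter>i\<in>{..<n}. (flow L 1 ^^ i) -` c i)" "\<And>i. i < n \<Longrightarrow> c i \<in> cpart"
      using A by (auto simp: refine_def)
    have "(flow L 1 ^^ i) q \<in> c i" "(flow L 1 ^^ i) q' \<in> c i" using c(1) q(1,2) i by auto
    then have "flow L (real i) q \<in> c i" "flow L (real i) q' \<in> c i"
      unfolding flow_funpow[OF q(3)] flow_funpow[OF q(4)] .
    then have "ccode (flow L (real i) q) = ccode (flow L (real i) q')" using c(2)[OF i] by (auto simp: cpart_def)
    then show ?thesis using flow_hull[OF q(3)] flow_hull[OF q(4)] by (simp add: ccode_def)
  qed
  then show ?thesis
  proof (induction n)
    case 0
    have "crossed 0 p = []" if "p \<in> HY" for p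
      using that idx_eqI[of "fst p" 0 "snd p"] by (cases p) (simp add: crossed_def hull_iff)
    then show ?case using q by simp
  next
    case (Suc n)
    then show ?case using crossed_Suc[OF q(3), of n] crossed_Suc[OF q(4), of n] by simp
  qed
qed

text \<open>An atom of the refinement lies, up to a null set, in a single \<open>cset\<close>, whose
  measure is at most \<open>2 * qm\<close>; so the information function is at least
  \<open>fv - ln 2\<close>.\<close>

theorem ks_lower:
  assumes h: "\<And>e. 0 < e \<Longrightarrow> \<exists>M0. \<forall>M\<ge>M0. \<forall>a. h - e \<le> ln (K M a) / (lam ^ M * L a)"
  shows "ereal h \<le> ks_entropy (lifted \<mu>) (flow L 1)"
proof (rule ks_entropy_ge[OF cpart_partition, where C = "ln 2"])
  fix n
  let ?\<nu> = "lifted \<mu>"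
  interpret prob_space ?\<nu> using prob_lift[OF s] by blast
  have fi: "finv ?\<nu>" by (rule lift_flow_inv[OF s])
  have fl: "flow L 1 \<in> measurable ?\<nu> ?\<nu>"
    using finv_measurable[OF fi flow_measurable] measurable_cong_sets[OF refl sets_lift[OF s]] by blast
  have c: "integrable ?\<nu> (\<lambda>q. ln 2)" by (rule integrable_const)
  have "h * real (Suc n) - ln 2 \<le> (\<integral>q. fv (Suc n) q \<partial>?\<nu>) - ln 2"
    using fv_integral_ge_limit[OF _ h, of "Suc n"] by (simp add: mult.commute)
  also have "\<dots> = (\<integral>q. fv (Suc n) q - ln 2 \<partial>?\<nu>)"
    using Bochner_Integration.integral_diff[OF fv_integrable c] prob_space by simp
  also have "\<dots> \<le> part_entropy ?\<nu> (refine ?\<nu> (flow L 1) cpart (Suc n))"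
  proof (rule part_entropy_ge[where H = "HY"])
    show "prob_space ?\<nu>" by (rule prob_space_axioms)
    show "fin_partition ?\<nu> (refine ?\<nu> (flow L 1) cpart (Suc n))" by (rule refine_partition[OF cpart_partition fl])
    show "AE q in ?\<nu>. q \<in> HY" by (rule finv_AE[OF fi])
    show "integrable ?\<nu> (\<lambda>q. fv (Suc n) q - ln 2)" by (rule Bochner_Integration.integrable_diff[OF fv_integrable c])
    fix A q assume A: "A \<in> refine ?\<nu> (flow L 1) cpart (Suc n)" "q \<in> A" "q \<in> HY" "0 < measure ?\<nu> A"
    have "measure ?\<nu> A \<le> measure ?\<nu> (cset (Suc n) (crossed (Suc n) q))"
    proof (rule finite_measure_mono_AE)
      show "AE x in ?\<nu>. x \<in> A \<longrightarrow> x \<in> cset (Suc n) (crossed (Suc n) q)"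
        by (rule AE_mp[OF finv_AE[OF fi] AE_I2]) (use refine_crossed[OF A(1) _ A(2) _ A(3)] in \<open>auto simp: cset_def\<close>)
      show "cset (Suc n) (crossed (Suc n) q) \<in> sets ?\<nu>" by (simp add: sets_lift[OF s])
    qed
    also have "\<dots> \<le> 2 * qm (Suc n) (crossed (Suc n) q)"
      using card_wordsle_pos[of "cb (Suc n)"] by (simp add: qm_def)
    finally have "ln (measure ?\<nu> A) \<le> ln (2 * qm (Suc n) (crossed (Suc n) q))"
      using A(4) by (intro iffD2[OF ln_le_cancel_iff]) (auto simp: qm_pos)
    also have "\<dots> = ln 2 + ln (qm (Suc n) (crossed (Suc n) q))" using qm_pos by (intro ln_mult_pos) auto
    finally show "fv (Suc n) q - ln 2 \<le> - ln (measure ?\<nu> A)" by (simp add: fv_eq[OF A(3)])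
  qed
  finally show "h * real (Suc n) - ln 2 \<le> part_entropy ?\<nu> (refine ?\<nu> (flow L 1) cpart (Suc n))" .
qed

end

end

section \<open>Measures of maximal entropy\<close>

context recog_subst
begin

section \<open>Growth rates of the number of level-n words\<close>

definition growth :: "nat \<Rightarrow> 'a \<Rightarrow> real" where
  "growth n a = ln (K n a) / (lam ^ n * L a)"

lemma K_ge_1: "1 \<le> K n a"
  using K_pos[of n a] by (simp add: K_def)

lemma lnK: "ln (K n a) = growth n a * (lam ^ n * L a)"
  using lamL_pos[of n a] by (simp add: growth_def)

lemma growth_nonneg: "0 \<le> growth n a"
  unfolding growth_def using K_ge_1[of n a] lamL_pos[of n a] by (intro divide_nonneg_pos) auto

lemma ln_card_LS: "ln (real (card (LS n u))) = (\<Sum>c\<leftarrow>u. ln (K n c))"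
proof -
  have "0 < (\<Prod>c\<leftarrow>u. K n c) \<and> ln (\<Prod>c\<leftarrow>u. K n c) = (\<Sum>c\<leftarrow>u. ln (K n c))"
    by (induction u) (auto simp: ln_mult_pos K_pos)
  then show ?thesis by (simp add: card_LS)
qed

lemma card_LS_pos: "0 < real (card (LS n u))"
  unfolding card_LS by (induction u) (auto simp: K_pos)

lemma K_Suc_LS: "K (Suc n) b = (\<Sum>u\<in>\<sigma> b. real (card (LS n u)))"
  unfolding K_Suc by (intro sum.cong refl) (simp add: card_rs_word)

lemma finite_subst: "finite (\<sigma> b)"
  using valid by (simp add: valid_rsubst_def)

text \<open>The level-n words substituted for the letters of \<open>u\<close> can be chosen freely,
  and by unique parsing different choices give different words of \<open>b\<close>. The induction
  does this one level at a time.\<close>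

lemma sum_lnK_le: "u \<in> pw m b \<Longrightarrow> (\<Sum>c\<leftarrow>u. ln (K n c)) \<le> ln (K (m + n) b)"
proof (induction m arbitrary: n u)
  case (Suc m)
  have one: "(\<Sum>c\<leftarrow>v. ln (K n c)) \<le> ln (K (Suc n) a)" if "v \<in> \<sigma> a" for v a
  proof -
    have "real (card (LS n v)) \<le> K (Suc n) a"
      unfolding K_Suc_LS using that finite_subst by (intro member_le_sum) auto
    then show ?thesis using card_LS_pos[of n v] by (simp add: ln_card_LS[symmetric])
  qed
  obtain u' where u': "u' \<in> pw m b" "u \<in> rs_word \<sigma> u'" using Suc.prems by auto
  then obtain vs where vs: "u = concat vs" "list_all2 (\<lambda>v c. v \<in> \<sigma> c) vs u'" by (auto simp: rs_word_def)
  from vs(2) have "(\<Sum>c\<leftarrow>concat vs. ln (K n c)) \<le> (\<Sum>c\<leftarrow>u'. ln (K (Suc n) c))"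
    by (induction rule: list_all2_induct) (auto intro: add_mono one)
  also have "\<dots> \<le> ln (K (m + Suc n) b)" by (rule Suc.IH[OF u'(1)])
  finally show ?case by (simp add: vs)
qed simp

definition mn :: "nat \<Rightarrow> real" where "mn n = Min (range (growth n))"
definition mx :: "nat \<Rightarrow> real" where "mx n = Max (range (growth n))"

lemma mn_le: "mn n \<le> growth n a" and mx_ge: "growth n a \<le> mx n"
  by (simp_all add: mn_def mx_def)

lemma mn_le_sum: "mn n * (\<Sum>c\<leftarrow>v. L c) \<le> (\<Sum>c\<leftarrow>v. growth n c * L c)"
  by (induction v) (auto simp: distrib_left intro!: add_mono mult_right_mono mn_le less_imp_le[OF L_pos])

lemma mn_ex: "\<exists>a. mn n = growth n a" and mx_ex: "\<exists>a. mx n = growth n a"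
proof -
  have "mn n \<in> range (growth n)" "mx n \<in> range (growth n)"
    unfolding mn_def mx_def by (intro Min_in Max_in; simp)+
  then show "\<exists>a. mn n = growth n a" "\<exists>a. mx n = growth n a" by auto
qed

text \<open>Since \<open>u\<close> has geometric length \<open>lam ^ m * L b\<close>, this bounds
  the growth rate of \<open>b\<close> below by the length-weighted mean of the rates of the letters
  of \<open>u\<close>.\<close>

lemma sum_growth:
  assumes "u \<in> pw m b"
  shows "(\<Sum>c\<leftarrow>u. growth n c * L c) \<le> growth (m + n) b * (lam ^ m * L b)"
proof -
  have "lam ^ n * (\<Sum>c\<leftarrow>u. growth n c * L c) = (\<Sum>c\<leftarrow>u. ln (K n c))"
    by (simp add: lnK sum_list_const_mult[symmetric] mult_ac)
  also have "\<dots> \<le> growth (m + n) b * (lam ^ (m + n) * L b)"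
    using sum_lnK_le[OF assms, of n] by (simp add: lnK)
  also have "\<dots> = lam ^ n * (growth (m + n) b * (lam ^ m * L b))" by (simp add: power_add mult_ac)
  finally show ?thesis using lam_gt_1 by simp
qed

lemma Lmax_pos: "0 < Lmax"
  using L_pos[of undefined] Lmax_ge[of undefined] by linarith

text \<open>A level-m word with all letters contains one of maximal rate, whose share of the
  geometric length is at least \<open>Lmin / (lam ^ m * Lmax)\<close>; all other letters have at
  least the minimal rate.\<close>

lemma mn_mono_spread:
  assumes m: "\<And>b. \<exists>w\<in>pw m b. set w = UNIV"
  shows "mn n + Lmin / (lam ^ m * Lmax) * (mx n - mn n) \<le> mn (m + n)"
proof -
  obtain b where b: "mn (m + n) = growth (m + n) b" using mn_ex by blast
  obtain w where w: "w \<in> pw m b" "set w = UNIV" using m by blast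
  obtain a where a: "mx n = growth n a" using mx_ex by blast
  obtain w1 w2 where s: "w = w1 @ a # w2" using w(2) split_list[of a w] by blast
  have T: "(\<Sum>c\<leftarrow>w. L c) = lam ^ m * L b" using Lword_pw[OF w(1)] by (simp add: Lword_def)
  have "mn n * (lam ^ m * L b) + Lmin * (mx n - mn n) \<le> mn n * (\<Sum>c\<leftarrow>w. L c) + L a * (mx n - mn n)"
    unfolding T using Lmin_le[of a] mn_le[of n a] a by (intro add_left_mono mult_right_mono) auto
  also have "\<dots> = mn n * (\<Sum>c\<leftarrow>w1. L c) + (growth n a * L a + mn n * (\<Sum>c\<leftarrow>w2. L c))"
    by (simp add: s a algebra_simps)
  also have "\<dots> \<le> (\<Sum>c\<leftarrow>w. growth n c * L c)"
    using mn_le_sum[of n w1] mn_le_sum[of n w2] by (simp add: s)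
  also have "\<dots> \<le> mn (m + n) * (lam ^ m * L b)" using sum_growth[OF w(1), of n] b by simp
  finally have "Lmin * (mx n - mn n) \<le> (mn (m + n) - mn n) * (lam ^ m * L b)" by (simp add: algebra_simps)
  then have "Lmin * (mx n - mn n) / (lam ^ m * L b) \<le> mn (m + n) - mn n"
    using lamL_pos[of m b] by (simp only: pos_divide_le_eq)
  moreover have "Lmin * (mx n - mn n) / (lam ^ m * Lmax) \<le> Lmin * (mx n - mn n) / (lam ^ m * L b)"
    using Lmin_pos mn_le[of n a] a Lmax_pos Lmax_ge[of b] lam_gt_1 by (intro divide_left_mono mult_left_mono mult_nonneg_nonneg mult_pos_pos) auto
  ultimately show ?thesis by simp
qed

lemma mn_incseq: "incseq mn"
proof (rule incseq_SucI)
  fix n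
  obtain b where b: "mn (Suc n) = growth (Suc n) b" using mn_ex by blast
  obtain u where u: "u \<in> pw 1 b" using pw_valid(2) by blast
  have "mn n * (lam ^ 1 * L b) \<le> (\<Sum>c\<leftarrow>u. growth n c * L c)"
    using Lword_pw[OF u] mn_le_sum[of n u] unfolding Lword_def by simp
  also have "\<dots> \<le> growth (1 + n) b * (lam ^ 1 * L b)" by (rule sum_growth[OF u])
  finally show "mn n \<le> mn (Suc n)" using lamL_pos[of 1 b] b by (simp add: mult_le_cancel_right)
qed

definition gconst :: real where
  "gconst = (\<Sum>b\<in>UNIV. ln (real (card (\<sigma> b)))) / Lmin"

lemma card_subst_pos: "0 < real (card (\<sigma> b))"
  using valid by (auto simp: valid_rsubst_def card_gt_0_iff)

lemma gconst_nonneg: "0 \<le> gconst"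
  unfolding gconst_def using card_subst_pos Lmin_pos
  by (intro divide_nonneg_pos sum_nonneg ln_ge_zero) (auto simp: Suc_le_eq[symmetric])

text \<open>For each of the words \<open>u\<close> of \<open>b\<close> the number of subdivisions is
  bounded through the maximal rate; the choice of \<open>u\<close> adds
  \<open>ln (card (\<sigma> b))\<close>, which is divided by a length of order
  \<open>lam ^ Suc n\<close>.\<close>

lemma mx_Suc: "mx (Suc n) \<le> mx n + gconst / lam ^ Suc n"
proof -
  obtain b where b: "mx (Suc n) = growth (Suc n) b" using mx_ex by blast
  have le: "(\<Sum>c\<leftarrow>v. growth n c * L c) \<le> mx n * (\<Sum>c\<leftarrow>v. L c)" for v
    by (induction v) (auto simp: distrib_left intro!: add_mono mult_right_mono mx_ge less_imp_le[OF L_pos])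
  define E where "E = exp (mx n * (lam ^ Suc n * L b))"
  have "real (card (LS n u)) \<le> E" if "u \<in> \<sigma> b" for u
  proof -
    have u: "u \<in> pw 1 b" using that by simp
    have "ln (real (card (LS n u))) = lam ^ n * (\<Sum>c\<leftarrow>u. growth n c * L c)"
      by (simp add: ln_card_LS lnK sum_list_const_mult[symmetric] mult_ac)
    also have "\<dots> \<le> lam ^ n * (mx n * (\<Sum>c\<leftarrow>u. L c))" using lam_gt_1 by (intro mult_left_mono le) auto
    also have "(\<Sum>c\<leftarrow>u. L c) = lam ^ 1 * L b" using Lword_pw[OF u] by (simp add: Lword_def)
    finally have "ln (real (card (LS n u))) \<le> mx n * (lam ^ Suc n * L b)" by (simp add: mult_ac)
    then have "exp (ln (real (card (LS n u)))) \<le> E" by (simp add: E_def)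
    then show ?thesis using card_LS_pos[of n u] by simp
  qed
  then have "K (Suc n) b \<le> (\<Sum>u\<in>\<sigma> b. E)" unfolding K_Suc_LS by (rule sum_mono)
  then have "K (Suc n) b \<le> real (card (\<sigma> b)) * E" by simp
  then have "ln (K (Suc n) b) \<le> ln (real (card (\<sigma> b)) * E)"
    using K_pos[of "Suc n" b] by (intro iffD2[OF ln_le_cancel_iff]) auto
  also have "\<dots> = ln (real (card (\<sigma> b))) + mx n * (lam ^ Suc n * L b)"
    using card_subst_pos[of b] by (subst ln_mult_pos) (auto simp: E_def)
  finally have "growth (Suc n) b \<le> (ln (real (card (\<sigma> b))) + mx n * (lam ^ Suc n * L b)) / (lam ^ Suc n * L b)"
    unfolding growth_def using lamL_pos[of "Suc n" b] by (intro divide_right_mono) (auto simp del: power_Suc)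
  also have "\<dots> = ln (real (card (\<sigma> b))) / (L b * lam ^ Suc n) + mx n"
    using lamL_pos[of "Suc n" b] by (simp add: add_divide_distrib mult.commute)
  also have "ln (real (card (\<sigma> b))) / (L b * lam ^ Suc n) \<le> gconst / lam ^ Suc n"
  proof -
    have g: "0 \<le> ln (real (card (\<sigma> c)))" for c using card_subst_pos[of c] by (intro ln_ge_zero) simp
    have "ln (real (card (\<sigma> b))) / L b \<le> ln (real (card (\<sigma> b))) / Lmin"
      using Lmin_pos Lmin_le[of b] g by (intro divide_left_mono) auto
    also have "\<dots> \<le> gconst" unfolding gconst_def using Lmin_pos g
      by (intro divide_right_mono member_le_sum) auto
    finally have "ln (real (card (\<sigma> b))) / L b / lam ^ Suc n \<le> gconst / lam ^ Suc n"
      using lam_gt_1 by (intro divide_right_mono) auto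
    then show ?thesis by (simp add: divide_divide_eq_left)
  qed
  finally show ?thesis using b by simp
qed

definition hlim :: real where "hlim = lim mn"

lemma growth_limit: "mn \<longlonglongrightarrow> hlim" "mx \<longlonglongrightarrow> hlim"
proof -
  \<comment> \<open>\<open>B / lam ^ n\<close> is the sum of all later error terms of
    \<open>mx_Suc\<close>, so adding it makes the sequence decreasing.\<close>
  define B where "B = gconst / (lam - 1)"
  define x where "x n = mx n + B / lam ^ n" for n
  have l0: "0 < lam - 1" using lam_gt_1 by simp
  have B0: "0 \<le> B" using gconst_nonneg l0 by (simp add: B_def)
  have mx0: "0 \<le> mx n" for n using growth_nonneg[of n undefined] mx_ge[of n undefined] by linarith
  have xs: "x (Suc n) \<le> x n" for n
  proof -
    have "gconst = B * (lam - 1)" using l0 by (simp add: B_def)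
    then have "gconst / lam ^ Suc n + B / lam ^ Suc n = B / lam ^ n"
      using lam_gt_1 by (simp add: field_simps)
    then show ?thesis using mx_Suc[of n] unfolding x_def by linarith
  qed
  have x0: "0 \<le> x n" for n using mx0 B0 lam_gt_1 by (auto simp: x_def)
  obtain X where X: "x \<longlonglongrightarrow> X"
    by (rule decseq_convergent[OF decseq_SucI[of x, OF xs], of 0]) (use x0 in auto)
  have bl: "(\<lambda>n. B / lam ^ n) \<longlonglongrightarrow> 0"
    using LIMSEQ_divide_realpow_zero[OF lam_gt_1] .
  have mxX: "mx \<longlonglongrightarrow> X"
    using tendsto_diff[OF X bl] by (simp add: x_def)
  have "mn n \<le> x 0" for n
  proof -
    have "mn n \<le> mx n" using mn_le[of n undefined] mx_ge[of n undefined] by linarith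
    also have "\<dots> \<le> x n" using B0 lam_gt_1 by (simp add: x_def)
    also have "\<dots> \<le> x 0" using decseqD[OF decseq_SucI[of x, OF xs], of 0 n] by simp
    finally show ?thesis .
  qed
  then obtain Y where Y: "mn \<longlonglongrightarrow> Y" using incseq_convergent[OF mn_incseq, of "x 0"] by blast
  obtain m where m: "\<And>b. \<exists>w\<in>pw m b. set w = UNIV" using all_letters by metis
  define \<epsilon> where "\<epsilon> = Lmin / (lam ^ m * Lmax)"
  have e0: "0 < \<epsilon>" unfolding \<epsilon>_def using Lmin_pos Lmax_pos lam_gt_1 by (intro divide_pos_pos mult_pos_pos) auto
  have "(\<lambda>n. mn n + \<epsilon> * (mx n - mn n)) \<longlonglongrightarrow> Y + \<epsilon> * (X - Y)" by (intro tendsto_intros Y mxX)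
  moreover have "(\<lambda>n. mn (m + n)) \<longlonglongrightarrow> Y" using LIMSEQ_ignore_initial_segment[OF Y, of m] by (simp add: add.commute)
  \<comment> \<open>In the limit the contraction of \<open>mn_mono_spread\<close> leaves no gap
    between minimum and maximum.\<close>
  ultimately have "Y + \<epsilon> * (X - Y) \<le> Y"
    by (rule LIMSEQ_le) (use mn_mono_spread[OF m] in \<open>auto simp: \<epsilon>_def\<close>)
  then have "X \<le> Y" using e0 by (simp add: mult_le_0_iff)
  moreover have "Y \<le> X"
    by (rule LIMSEQ_le[OF Y mxX]) (use order_trans[OF mn_le mx_ge] in blast)
  ultimately have "X = Y" by simp
  moreover have "Y = hlim" using limI[OF Y] by (simp add: hlim_def)
  ultimately show "mn \<longlonglongrightarrow> hlim" "mx \<longlonglongrightarrow> hlim" using Y mxX by auto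
qed

lemma growth_lower: "0 < e \<Longrightarrow> \<exists>M0. \<forall>M\<ge>M0. \<forall>a. hlim - e \<le> growth M a"
proof -
  assume e: "0 < e"
  have "eventually (\<lambda>n. hlim - e < mn n) sequentially" by (rule order_tendstoD(1)[OF growth_limit(1)]) (use e in simp)
  then show ?thesis unfolding eventually_sequentially using mn_le by (meson less_imp_le order_trans)
qed

section \<open>Coding weights and their gain over uniform weights\<close>

definition subprob :: "nat \<Rightarrow> ('a \<times> 'a list \<Rightarrow> real) \<Rightarrow> bool" where
  "subprob N p \<longleftrightarrow> (\<forall>c\<in>cells N. 0 < p c) \<and> (\<forall>a. (\<Sum>w\<in>pw N a. p (a, w)) \<le> 1)"

text \<open>The expected logarithm of \<open>p\<close> against the uniform weights
  \<open>1 / K N a\<close>; divided by \<open>ell\<close> it is a rate per unit of time.\<close>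

definition gain :: "(int \<Rightarrow> 'a) measure \<Rightarrow> nat \<Rightarrow> ('a \<times> 'a list \<Rightarrow> real) \<Rightarrow> real" where
  "gain \<mu> N p = (\<Sum>c\<in>cells N. dens \<mu> N c * (ln (K N (fst c)) + ln (p c)))"

text \<open>Compares the code with the one that uses uniform weights, whose cost in a cell is
  \<open>growth\<close> times its length. Naming the letter costs \<open>ln CARD('a)\<close> per
  cell, a rate that vanishes with the level.\<close>

lemma ks_le_gain:
  assumes s: "siv \<mu>" and p: "subprob N p"
  shows "ks_entropy (lifted \<mu>) (flow L 1) \<le> ereal (mx N + ln (real CARD('a)) / Lmin / lam ^ N - gain \<mu> N p / ell \<mu>)"
proof -
  have p': "\<And>c. c \<in> cells N \<Longrightarrow> 0 < p c" "\<And>a. (\<Sum>w\<in>pw N a. p (a, w)) \<le> 1" using p by (auto simp: subprob_def)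
  have l0: "0 < ell \<mu>" by (rule ell_pos[OF s])
  have c0: "0 \<le> ln (real CARD('a))" using Suc_leI[OF zero_less_card_finite[where 'a = 'a]] by simp
  define U where "U = mx N + ln (real CARD('a)) / Lmin / lam ^ N"
  have "dens \<mu> N c * gc p c / ell \<mu> \<le> tile \<mu> N c * U - dens \<mu> N c * (ln (K N (fst c)) + ln (p c)) / ell \<mu>"
    if c: "c \<in> cells N" for c
  proof -
    let ?T = "lam ^ N * L (fst c)"
    have T: "0 < ?T" "Lword L (snd c) = ?T" using lamL_pos Lword_cell[OF c] by auto
    have "gc p c + (ln (K N (fst c)) + ln (p c)) = ln (real CARD('a)) + growth N (fst c) * ?T"
      by (simp add: gc_def[OF s p'] lnK)
    also have "\<dots> \<le> U * ?T"
    proof -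
      have "growth N (fst c) * ?T \<le> mx N * ?T" using T by (intro mult_right_mono mx_ge) auto
      moreover have "ln (real CARD('a)) * 1 \<le> ln (real CARD('a)) * (L (fst c) / Lmin)"
        using c0 Lmin_pos Lmin_le[of "fst c"] by (intro mult_left_mono) auto
      moreover have "ln (real CARD('a)) * (L (fst c) / Lmin) = ln (real CARD('a)) / Lmin / lam ^ N * ?T"
        using lam_gt_1 by simp
      ultimately show ?thesis unfolding U_def distrib_right by linarith
    qed
    finally have "dens \<mu> N c * (gc p c + (ln (K N (fst c)) + ln (p c))) / ell \<mu> \<le> dens \<mu> N c * (U * ?T) / ell \<mu>"
      using l0 by (intro divide_right_mono mult_left_mono) auto
    then show ?thesis by (simp add: tile_def T(2) distrib_left add_divide_distrib mult_ac)
  qed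
  then have "Vp \<mu> N p \<le> (\<Sum>c\<in>cells N. tile \<mu> N c * U - dens \<mu> N c * (ln (K N (fst c)) + ln (p c)) / ell \<mu>)"
    using Vp_def[OF s p'] by (simp add: sum_divide_distrib sum_mono)
  also have "\<dots> = U - gain \<mu> N p / ell \<mu>"
    using tile_total[OF s, of N] by (simp add: sum_subtractf sum_distrib_right[symmetric] sum_divide_distrib[symmetric] gain_def)
  finally have "ereal (Vp \<mu> N p) \<le> ereal (U - gain \<mu> N p / ell \<mu>)" by simp
  with ks_upper[OF s p'] show ?thesis unfolding U_def by (rule order_trans)
qed

text \<open>The gain stays constant if the first substitution step is drawn from the productivity distribution.\<close>
lemma subprob_Suc:
  assumes s: "siv \<mu>" and p: "subprob N p"
  shows "\<exists>p'. subprob (Suc N) p' \<and> gain \<mu> (Suc N) p' = gain \<mu> N p"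
proof -
  define p' where "p' C = real (card (LS N (map fst (kids N C)))) / K (Suc N) (fst C) * (\<Prod>c\<leftarrow>kids N C. p c)" for C
  have p0: "\<And>c. c \<in> cells N \<Longrightarrow> 0 < p c" and p1: "\<And>a. (\<Sum>w\<in>pw N a. p (a, w)) \<le> 1" using p by (auto simp: subprob_def)
  have pr: "0 < (\<Prod>c\<leftarrow>cs. p c) \<and> ln (\<Prod>c\<leftarrow>cs. p c) = (\<Sum>c\<leftarrow>cs. ln (p c))" if "set cs \<subseteq> cells N" for cs
    using that by (induction cs) (auto simp: ln_mult_pos p0)
  have pos: "0 < real (card (LS N u)) / K (Suc N) b" for u b using card_LS_pos K_pos by simp
  have "subprob (Suc N) p'"
    unfolding subprob_def
  proof (intro conjI ballI allI)
    fix C assume "C \<in> cells (Suc N)"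
    then show "0 < p' C" unfolding p'_def using pr[OF kids_cells] pos by (intro mult_pos_pos) auto
  next
    fix b
    have "(\<Sum>W\<in>pw (Suc N) b. p' (b, W)) = (\<Sum>u\<in>\<sigma> b. \<Sum>ws\<in>LS N u. real (card (LS N (map fst (zip u ws)))) / K (Suc N) b * (\<Prod>c\<leftarrow>zip u ws. p c))"
      unfolding p'_def fst_conv by (rule sum_pw_Suc)
    also have "\<dots> = (\<Sum>u\<in>\<sigma> b. real (card (LS N u)) / K (Suc N) b * (\<Sum>ws\<in>LS N u. \<Prod>c\<leftarrow>zip u ws. p c))"
      unfolding sum_distrib_left
    proof (intro sum.cong refl)
      fix u ws assume "ws \<in> LS N u"
      then have "map fst (zip u ws) = u" by (simp add: LS_def list_all2_lengthD)
      then show "real (card (LS N (map fst (zip u ws)))) / K (Suc N) b * (\<Prod>c\<leftarrow>zip u ws. p c)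
        = real (card (LS N u)) / K (Suc N) b * (\<Prod>c\<leftarrow>zip u ws. p c)" by simp
    qed
    also have "\<dots> \<le> (\<Sum>u\<in>\<sigma> b. real (card (LS N u)) / K (Suc N) b * 1)"
    proof (intro sum_mono mult_left_mono)
      fix u
      have nn: "0 \<le> (\<Sum>w\<in>pw N a. p (a, w))" for a
        using p0 by (intro sum_nonneg less_imp_le) (auto simp: cells_def)
      have "0 \<le> (\<Prod>a\<leftarrow>u. \<Sum>w\<in>pw N a. p (a, w)) \<and> (\<Prod>a\<leftarrow>u. \<Sum>w\<in>pw N a. p (a, w)) \<le> 1"
        by (induction u) (auto intro!: mult_le_one p1 nn mult_nonneg_nonneg)
      then show "(\<Sum>ws\<in>LS N u. \<Prod>c\<leftarrow>zip u ws. p c) \<le> 1" unfolding prod_LS by blast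
    qed (rule less_imp_le[OF pos])
    also have "\<dots> = 1" using K_pos[of "Suc N" b] by (simp add: sum_divide_distrib[symmetric] K_Suc_LS[symmetric])
    finally show "(\<Sum>W\<in>pw (Suc N) b. p' (b, W)) \<le> 1" .
  qed
  moreover have "gain \<mu> (Suc N) p' = gain \<mu> N p"
  proof -
    \<comment> \<open>The count of \<open>C\<close> cancels against the productivity factor and
      leaves the product of the counts of its subcells. The integrand is thus additive under
      subdivision, and consistency carries it between levels.\<close>
    have "ln (K (Suc N) (fst C)) + ln (p' C) = (\<Sum>c\<leftarrow>kids N C. ln (K N (fst c)) + ln (p c))" if C: "C \<in> cells (Suc N)" for C
    proof -
      have "ln (p' C) = ln (real (card (LS N (map fst (kids N C))))) - ln (K (Suc N) (fst C)) + (\<Sum>c\<leftarrow>kids N C. ln (p c))"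
        unfolding p'_def using pr[OF kids_cells[OF C]] pos[of "map fst (kids N C)" "fst C"] K_pos[of "Suc N" "fst C"] card_LS_pos
        by (simp add: ln_mult_pos ln_div del: card_LS)
      then show ?thesis by (simp add: ln_card_LS sum_list_addf o_def)
    qed
    then show ?thesis unfolding gain_def using consistent_sum[OF dens_consistent[OF s], of N "\<lambda>c. ln (K N (fst c)) + ln (p c)"]
      by simp
  qed
  ultimately show ?thesis by blast
qed

text \<open>The gain is carried to higher and higher levels, where the maximal rate tends to
  \<open>hlim\<close> and the cost of the letters disappears.\<close>

lemma ks_le_limit:
  assumes s: "siv \<mu>" and p: "subprob N p"
  shows "ks_entropy (lifted \<mu>) (flow L 1) \<le> ereal (hlim - gain \<mu> N p / ell \<mu>)"
proof -
  have ex: "\<exists>p'. subprob (k + N) p' \<and> gain \<mu> (k + N) p' = gain \<mu> N p" for k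
  proof (induction k)
    case 0
    then show ?case using p by auto
  next
    case (Suc k)
    then obtain p' where "subprob (k + N) p'" "gain \<mu> (k + N) p' = gain \<mu> N p" by blast
    then show ?case using subprob_Suc[OF s, of "k + N" p'] by simp
  qed
  have le: "ks_entropy (lifted \<mu>) (flow L 1) \<le> ereal (mx (k + N) + ln (real CARD('a)) / Lmin / lam ^ (k + N) - gain \<mu> N p / ell \<mu>)" for k
    using ex[of k] ks_le_gain[OF s] by metis
  have "(\<lambda>n. mx n + ln (real CARD('a)) / Lmin / lam ^ n - gain \<mu> N p / ell \<mu>) \<longlonglongrightarrow> hlim + 0 - gain \<mu> N p / ell \<mu>"
    by (intro tendsto_intros growth_limit LIMSEQ_divide_realpow_zero lam_gt_1)
  from LIMSEQ_ignore_initial_segment[OF this, of N]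
  have "(\<lambda>k. ereal (mx (k + N) + ln (real CARD('a)) / Lmin / lam ^ (k + N) - gain \<mu> N p / ell \<mu>)) \<longlonglongrightarrow> ereal (hlim - gain \<mu> N p / ell \<mu>)"
    by simp
  then show ?thesis by (rule LIMSEQ_le_const) (use le in blast)
qed

lemma ks_le_hlim:
  assumes s: "siv \<mu>"
  shows "ks_entropy (lifted \<mu>) (flow L 1) \<le> ereal hlim"
proof -
  have "subprob 0 (\<lambda>c. 1 / K 0 (fst c))" using K_pos by (auto simp: subprob_def K_def)
  moreover have "gain \<mu> 0 (\<lambda>c. 1 / K 0 (fst c)) = 0" using K_pos by (simp add: gain_def ln_div)
  ultimately show ?thesis using ks_le_limit[OF s] by fastforce
qed

text \<open>Uses \<open>ln x \<ge> 1 - 1 / x\<close> at \<open>x = (t + 1) / 2\<close>, where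
  \<open>t\<close> is the density relative to its mean \<open>D / \<kappa>\<close> over the words of
  the type. The linear term sums to 0 over a type, and the quadratic one is positive unless
  \<open>t = 1\<close>.\<close>

lemma ln_gain_bound:
  fixes d D \<kappa> :: real
  assumes "0 \<le> d" "0 < D" "0 < \<kappa>"
  defines "t \<equiv> \<kappa> * d / D"
  shows "(d - D / \<kappa>) / 2 + D / \<kappa> * ((t - 1)\<^sup>2 / (2 * (t + 1))) \<le> d * ln ((t + 1) / 2)"
proof -
  have t: "0 \<le> t" using assms by (simp add: t_def)
  have d: "d = D / \<kappa> * t" using assms by (simp add: t_def)
  have "ln (2 / (t + 1)) \<le> 2 / (t + 1) - 1" using t by (intro ln_le_minus_one) simp
  moreover have "ln (2 / (t + 1)) = - ln ((t + 1) / 2)" using t by (simp add: ln_div)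
  ultimately have "1 - 2 / (t + 1) \<le> ln ((t + 1) / 2)" by linarith
  then have "d * (1 - 2 / (t + 1)) \<le> d * ln ((t + 1) / 2)" using assms(1) by (rule mult_left_mono)
  moreover have "(t - 1) / 2 + (t - 1)\<^sup>2 / (2 * (t + 1)) = t * (1 - 2 / (t + 1))"
    using t by (simp add: field_simps power2_eq_square)
  then have "D / \<kappa> * ((t - 1) / 2 + (t - 1)\<^sup>2 / (2 * (t + 1))) = D / \<kappa> * (t * (1 - 2 / (t + 1)))" by simp
  moreover have "(d - D / \<kappa>) / 2 = D / \<kappa> * ((t - 1) / 2)" unfolding d by (simp add: algebra_simps diff_divide_distrib)
  moreover have "D / \<kappa> * (t * (1 - 2 / (t + 1))) = d * (1 - 2 / (t + 1))" by (simp add: d)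
  ultimately show ?thesis by (simp only: distrib_left)
qed

text \<open>Take for p the mean of the conditional law of the cells of given type and of the uniform law.\<close>
lemma ks_less_hlim:
  assumes s: "siv \<mu>" and nu: "\<not> uniform (dens \<mu>)"
  shows "ks_entropy (lifted \<mu>) (flow L 1) < ereal hlim"
proof -
  obtain N a v w where vw: "v \<in> pw N a" "w \<in> pw N a" "dens \<mu> N (a, v) \<noteq> dens \<mu> N (a, w)"
    using nu unfolding uniform_def by blast
  define D where "D b = (\<Sum>w\<in>pw N b. dens \<mu> N (b, w))" for b
  define p where "p c = (dens \<mu> N c / D (fst c) + 1 / K N (fst c)) / 2" for c
  define t where "t c = K N (fst c) * dens \<mu> N c / D (fst c)" for c
  define E where "E c = D (fst c) / K N (fst c) * ((t c - 1)\<^sup>2 / (2 * (t c + 1)))" for c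
  have D0: "0 \<le> D b" for b unfolding D_def by (intro sum_nonneg) simp
  have t0: "0 \<le> t c" for c using D0 K_pos[of N "fst c"] by (simp add: t_def)
  have E0: "0 \<le> E c" for c using D0 K_pos[of N "fst c"] t0[of c] by (simp add: E_def)
  have sp: "subprob N p" unfolding subprob_def
  proof (intro conjI ballI allI)
    show "0 < p c" for c using D0[of "fst c"] K_pos[of N "fst c"] by (auto simp: p_def intro!: add_nonneg_pos)
    fix b
    have "(\<Sum>w\<in>pw N b. p (b, w)) = (D b / D b + 1) / 2"
      using K_pos[of N b] by (simp add: p_def sum_divide_distrib[symmetric] sum.distrib D_def[symmetric]) (simp add: K_def)
    also have "\<dots> \<le> 1" by (cases "D b = 0") auto
    finally show "(\<Sum>w\<in>pw N b. p (b, w)) \<le> 1" .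
  qed
  have g: "0 < gain \<mu> N p"
  proof -
    have tm: "(dens \<mu> N c - D (fst c) / K N (fst c)) / 2 + E c \<le> dens \<mu> N c * (ln (K N (fst c)) + ln (p c))" if c: "c \<in> cells N" for c
    proof (cases "D (fst c) = 0")
      case True
      have "(\<Sum>w\<in>pw N (fst c). dens \<mu> N (fst c, w)) = 0" using True by (simp add: D_def)
      moreover have "snd c \<in> pw N (fst c)" using c by (auto simp: cells_def)
      ultimately have "dens \<mu> N (fst c, snd c) = 0"
        using sum_nonneg_eq_0_iff[OF pw_valid(1)[of N "fst c"], of "\<lambda>w. dens \<mu> N (fst c, w)"] by auto
      then show ?thesis using True by (simp add: E_def)
    next
      case False
      then have Dp: "0 < D (fst c)" using D0[of "fst c"] by simp
      have "K N (fst c) * p c = (t c + 1) / 2" using K_pos[of N "fst c"] by (simp add: p_def t_def distrib_left)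
      moreover have "0 < p c" using sp c by (simp add: subprob_def)
      ultimately have "ln (K N (fst c)) + ln (p c) = ln ((t c + 1) / 2)"
        using ln_mult_pos[of "K N (fst c)" "p c"] K_pos[of N "fst c"] by presburger
      then show ?thesis
        using ln_gain_bound[of "dens \<mu> N c" "D (fst c)" "K N (fst c)"] Dp K_pos[of N "fst c"] by (simp add: E_def t_def)
    qed
    \<comment> \<open>For each letter, \<open>D\<close> is the sum of the densities and also
      \<open>K\<close> times the mean, so the linear terms cancel.\<close>
    have "(\<Sum>c\<in>cells N. (dens \<mu> N c - D (fst c) / K N (fst c)) / 2) = 0"
      unfolding sum_cells sum_divide_distrib[symmetric] sum_subtractf
      by (simp add: D_def[symmetric]) (simp add: K_def[symmetric])
    moreover have "0 < (\<Sum>c\<in>cells N. E c)"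
    proof -
      have "\<exists>w'\<in>pw N a. dens \<mu> N (a, w') \<noteq> D a / K N a" using vw by metis
      then obtain w' where w': "w' \<in> pw N a" "dens \<mu> N (a, w') \<noteq> D a / K N a" by blast
      \<comment> \<open>Two different densities cannot both vanish; this excludes the degenerate
        type with \<open>D a = 0\<close>.\<close>
      have "0 < dens \<mu> N (a, v) + dens \<mu> N (a, w)" using vw(3) dens_nonneg[of \<mu> N "(a, v)"] dens_nonneg[of \<mu> N "(a, w)"] by linarith
      then have "0 < dens \<mu> N (a, v) \<or> 0 < dens \<mu> N (a, w)" by linarith
      moreover have "dens \<mu> N (a, v) \<le> D a" "dens \<mu> N (a, w) \<le> D a"
        unfolding D_def using vw pw_valid(1) by (auto intro: member_le_sum)
      ultimately have Dp: "0 < D a" by linarith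
      have "t (a, w') \<noteq> 1" using w'(2) Dp K_pos[of N a] by (auto simp: t_def field_simps)
      then have "0 < E (a, w')" using Dp K_pos[of N a] t0[of "(a, w')"]
        unfolding E_def by (intro mult_pos_pos divide_pos_pos) auto
      moreover have "(a, w') \<in> cells N" using w' by (simp add: cells_def)
      ultimately show ?thesis using E0 by (intro sum_pos2[of _ "(a, w')"]) auto
    qed
    moreover have "(\<Sum>c\<in>cells N. (dens \<mu> N c - D (fst c) / K N (fst c)) / 2 + E c) \<le> gain \<mu> N p"
      unfolding gain_def by (rule sum_mono[OF tm])
    ultimately show ?thesis by (simp add: sum.distrib)
  qed
  note ks_le_limit[OF s sp]
  also have "ereal (hlim - gain \<mu> N p / ell \<mu>) < ereal hlim" using g ell_pos[OF s] by simp
  finally show ?thesis .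
qed

lemma ks_uniform:
  assumes "siv \<mu>" "uniform (dens \<mu>)"
  shows "ks_entropy (lifted \<mu>) (flow L 1) = ereal hlim"
  using ks_le_hlim[OF assms(1)] ks_lower[OF assms, of hlim] growth_lower unfolding growth_def by (intro antisym) blast+

theorem unique_uniform_max_entropy:
  assumes u: "uniformity_measure \<sigma> L \<mu>u" and unique: "\<And>\<mu>. uniformity_measure \<sigma> L \<mu> \<Longrightarrow> \<mu> = \<mu>u"
  shows "intrinsically_ergodic \<sigma> L \<and> max_entropy_measure \<sigma> L (lifted \<mu>u)"
proof -
  have su: "siv \<mu>u" "uniform (dens \<mu>u)" using u by (simp_all add: uniformity_measure_iff)
  have m: "max_entropy_measure \<sigma> L (lifted \<mu>u)"
    unfolding max_entropy_measure_def ks_uniform[OF su]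
  proof (intro conjI allI impI)
    show "finv (lifted \<mu>u)" by (rule lift_flow_inv[OF su(1)])
    fix \<nu> assume "finv \<nu>"
    then obtain \<mu> where "siv \<mu>" "\<nu> = lifted \<mu>" by (rule finv_is_lift)
    then show "ks_entropy \<nu> (flow L 1) \<le> ereal hlim" using ks_le_hlim by simp
  qed
  moreover have "\<nu> = lifted \<mu>u" if \<nu>: "max_entropy_measure \<sigma> L \<nu>" for \<nu>
  proof -
    have f: "finv \<nu>" using \<nu> by (simp add: max_entropy_measure_def)
    obtain \<mu> where \<mu>: "siv \<mu>" "\<nu> = lifted \<mu>" by (rule finv_is_lift[OF f])
    have "ereal hlim \<le> ks_entropy \<nu> (flow L 1)"
      using \<nu> lift_flow_inv[OF su(1)] ks_uniform[OF su] unfolding max_entropy_measure_def by metis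
    then have "uniform (dens \<mu>)" using ks_less_hlim[OF \<mu>(1)] \<mu>(2) by (metis not_le)
    then show ?thesis using unique[of \<mu>] \<mu> by (simp add: uniformity_measure_iff)
  qed
  ultimately show ?thesis unfolding intrinsically_ergodic_def by blast
qed

end

theorem theoremC:
  fixes \<sigma> :: "('a::finite) rsubst" and lam :: real and L :: "'a \<Rightarrow> real"
  assumes "valid_rsubst \<sigma>"
    and "primitive_rs \<sigma>"
    and "geom_compatible \<sigma> lam L"
    and "recognisable \<sigma>"
  defines "Q \<equiv> (\<lambda>n. Q_of \<sigma> lam L (productivity_dist \<sigma> n))"
  shows "((\<exists>!\<mu>. uniformity_measure \<sigma> L \<mu>) \<longleftrightarrow> ergodic_inverse_time Q)
    \<and> (\<forall>\<mu>u. uniformity_measure \<sigma> L \<mu>u \<and> (\<forall>\<mu>. uniformity_measure \<sigma> L \<mu> \<longrightarrow> \<mu> = \<mu>u)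
          \<longrightarrow> intrinsically_ergodic \<sigma> L \<and> max_entropy_measure \<sigma> L (lift \<sigma> L \<mu>u))"
proof -
  interpret recog_subst \<sigma> lam L using assms(1-4) by unfold_locales
  have "Q = Qn" unfolding Q_def Qn_def ..
  moreover have "(\<exists>!\<mu>. uniformity_measure \<sigma> L \<mu>) \<longleftrightarrow> ergodic_inverse_time Qn"
    unfolding uniformity_measure_iff by (rule unique_uniform_iff_ergodic)
  ultimately show ?thesis using unique_uniform_max_entropy by blast
qed

end
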